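(* Let $\mu\in\{0,1\}$. Let $S$ be a degenerate generating subset of an abelian group $G$ with $0\in S$ and let $H$ be a hyper-atom of $S$. Let $\phi:G\to G/H$ denote the canonical morphism. Let $T$ be a finite subset of $G$ such that $3-\mu\le |S|\le \max(4-2\mu,|S|)\le |T|$, $S+T$ is aperiodic and $|S+T|=|S|+|T|-\mu\le \frac{2|G|+2\mu}{3}$. Then one of the following conditions holds: (i) $\mu=0$ and $|G|=3|S|=3|T|=4\kappa_2(T^* )=12$. (ii) $|\phi(S+T)|=|\phi(S)|+|\phi(T)|-1$ and moreover $\phi(S)$ and $\phi(T)$ are (arithmetic) progressions with the same difference.
   Context: Groups are abelian, written additively. A set $X$ is periodic if $X+Q=X$ for some nonzero subgroup $Q$, and aperiodic otherwise. $X^*$ denotes an arbitrary translate of the nonempty set $X$ containing $0$. Let $S$ be a finite generating subset of $G$ with $0\in S$. For $X\subset G$ put $\partial_S(X)=(X+S)\setminus X$ and $X^S=G\setminus (X+S)$. For $|G|\ge 2k-1$, $\kappa_k(S)=\min\{|\partial_S(X)| : \infty>|X|\ge k \text{ and } |X^S|\ge k\}$, where $\min\emptyset=|G|-2k+1$ ($\kappa_2(T^* )$ is given by the same formula with $T^*$ in place of $S$). A $k$-fragment of $S$ is a finite $X\subset G$ with $|X|\ge k$, $|X^S|\ge k$ and $|\partial_S(X)|=\kappa_k(S)$. $S$ is degenerate if some subgroup of $G$ is a $2$-fragment of $S$; a maximal subgroup which is a $2$-fragment of a degenerate $S$ is called a hyper-atom of $S$. A set of cardinality $1$ is considered a progression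 with every difference. *)

theory Defs
  imports Complex_Main "HOL-Algebra.Generated_Groups"
begin

text \<open>
  The ambient abelian group \<open>G\<close> is a (multiplicatively written) \<open>comm_group\<close>, not necessarily
  finite. The sumset \<open>X + Y\<close> is \<open>X <#>\<^bsub>G\<^esub> Y\<close>, and the image of \<open>X\<close> in the quotient group
  \<open>G Mod H\<close> under the canonical morphism is \<open>(\<lambda>x. H #>\<^bsub>G\<^esub> x) ` X\<close>.
\<close>

definition periodic :: "('a, 'b) monoid_scheme \<Rightarrow> 'a set \<Rightarrow> bool" where
  "periodic G X \<longleftrightarrow> (\<exists>Q. subgroup Q G \<and> Q \<noteq> {\<one>\<^bsub>G\<^esub>} \<and> X <#>\<^bsub>G\<^esub> Q = X)"

definition bdry :: "('a, 'b) monoid_scheme \<Rightarrow> 'a set \<Rightarrow> 'a set \<Rightarrow> 'a set" where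
  "bdry G S X = (X <#>\<^bsub>G\<^esub> S) - X"

definition exterior :: "('a, 'b) monoid_scheme \<Rightarrow> 'a set \<Rightarrow> 'a set \<Rightarrow> 'a set" where
  "exterior G S X = carrier G - (X <#>\<^bsub>G\<^esub> S)"

definition separable :: "('a, 'b) monoid_scheme \<Rightarrow> nat \<Rightarrow> 'a set \<Rightarrow> 'a set \<Rightarrow> bool" where
  "separable G k S X \<longleftrightarrow> X \<subseteq> carrier G \<and> finite X \<and> k \<le> card X \<and>
     (infinite (exterior G S X) \<or> k \<le> card (exterior G S X))"

text \<open>
  The value for an empty family is \<open>|G| - 2k + 1\<close>, written so that truncated subtraction on
  \<open>nat\<close> is exact whenever \<open>|G| \<ge> 2k - 1\<close>, which is the range where the invariant is meaningful.
  For infinite \<open>G\<close> and finite \<open>S\<close> the family is nonempty, so that the convention that \<open>order G = 0\<close>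
  is never used.
\<close>

definition kappa :: "('a, 'b) monoid_scheme \<Rightarrow> nat \<Rightarrow> 'a set \<Rightarrow> nat" where
  "kappa G k S =
     (if \<exists>X. separable G k S X
      then (LEAST m. \<exists>X. separable G k S X \<and> m = card (bdry G S X))
      else order G + 1 - 2 * k)"

definition fragment :: "('a, 'b) monoid_scheme \<Rightarrow> nat \<Rightarrow> 'a set \<Rightarrow> 'a set \<Rightarrow> bool" where
  "fragment G k S X \<longleftrightarrow> separable G k S X \<and> card (bdry G S X) = kappa G k S"

definition degenerate :: "('a, 'b) monoid_scheme \<Rightarrow> 'a set \<Rightarrow> bool" where
  "degenerate G S \<longleftrightarrow> (\<exists>H. subgroup H G \<and> fragment G 2 S H)"

text \<open>Maximality of a hyper-atom is with respect to inclusion.\<close>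

definition hyper_atom :: "('a, 'b) monoid_scheme \<Rightarrow> 'a set \<Rightarrow> 'a set \<Rightarrow> bool" where
  "hyper_atom G S H \<longleftrightarrow> subgroup H G \<and> fragment G 2 S H \<and>
     (\<forall>K. subgroup K G \<and> fragment G 2 S K \<and> H \<subseteq> K \<longrightarrow> K = H)"

text \<open>
  Finite nonempty progressions with difference \<open>d\<close>; taking \<open>n = 1\<close>, a singleton is a progression
  with every difference. The listed elements need not be distinct, but this admits no further sets:
  if they repeat, the set is a coset of the finite cyclic group generated by \<open>d\<close>, which is already
  listed without repetition by taking \<open>n\<close> to be the order of \<open>d\<close>.
\<close>

definition progression :: "('a, 'b) monoid_scheme \<Rightarrow> 'a \<Rightarrow> 'a set \<Rightarrow> bool" where
  "progression G d X \<longleftrightarrow> d \<in> carrier G \<and>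
     (\<exists>a \<in> carrier G. \<exists>n::nat. n \<ge> 1 \<and> X = {a \<otimes>\<^bsub>G\<^esub> d [^]\<^bsub>G\<^esub> i | i. i < n})"

end

theory Submission
  imports Defs
begin

text \<open>
  Let \<open>Q = G / H\<close> and weight the images of \<open>S\<close>, \<open>T\<close>, \<open>S + T\<close> in \<open>Q\<close> by the sizes of their fibres.
  Since \<open>H\<close> is a 2-fragment, the image of \<open>S\<close> satisfies a Cauchy-Davenport inequality in \<open>Q\<close>, and maximality
  of \<open>H\<close> makes this inequality strict for nonzero subgroups of \<open>Q\<close>. Comparing the level sets of the weights shows that
  the image of \<open>S + T\<close> is at most one smaller than the sum of the sizes of the images: otherwise the fibres
  force a period of \<open>S + T\<close>. If the image of \<open>S + T\<close> is not all of \<open>Q\<close>, equality holds in the Cauchy-Davenport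
  inequality, and a 2-atom of the image of \<open>S\<close> cannot be a coset of a subgroup or a Sidon set with three or more points;
  so it is a pair, which makes both images progressions. The case of a single missing coset is excluded by counting,
  and so is the case where \<open>S + T\<close> meets every coset, thanks to \<open>|S + T| \<le> (2|G| + 2\<mu>) / 3\<close>, unless \<open>S\<close> meets only two cosets.
  If moreover \<open>T\<close> meets every coset then \<open>|Q| = 3\<close>, and the fibres of \<open>T\<close> are paired with the complements of those of
  \<open>S + T\<close>; Mann's theorem inside \<open>H\<close> leaves only the exceptional configuration \<open>|H| = 4\<close>, in which \<open>T\<close> is a
  progression with four terms.
\<close>

section \<open>Products of sets and stabilizers\<close>

text \<open>Aperiodicity enters through one mechanism. If a fibre of S + T is no larger than a fibre
  of S contributing to it, it is a translate of that fibre, and the differences within the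
  contributing fibre of T are periods of it. Extremal cases are pushed to such equalities until a
  nonzero element is a period of every fibre of S + T, or T + w lies in T for some w \<noteq> 0. The
  obstacle is that the 2-fragment inequality for H speaks only of sets with at least two elements
  and is silent on one-point fibres of T; this is where the group of order 3 * 4 = 12 survives. The
  constant 2/3 enters twice. With |S| \<le> |T| it bounds the image of S by about a third of the
  quotient; this defeats the subgroups P of the quotient whose sum with the image of S is
  everything, about which the strict inequality says nothing. It also bounds the total weight of S +
  T from above when S + T meets all cosets or all but one, against lower bounds that count
  translates of T.\<close>

definition stab :: "('a, 'b) monoid_scheme \<Rightarrow> 'a set \<Rightarrow> 'a set" where
  "stab G X = {g \<in> carrier G. X #>\<^bsub>G\<^esub> g = X}"

context comm_group
begin

lemma set_mult_iff: "x \<in> A <#> B \<longleftrightarrow> (\<exists>a\<in>A. \<exists>b\<in>B. x = a \<otimes> b)"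
  by (auto simp: set_mult_def)

lemma r_coset_iff: "x \<in> A #> g \<longleftrightarrow> (\<exists>a\<in>A. x = a \<otimes> g)"
  by (auto simp: r_coset_def)

lemma r_coset_image: "A #> g = (\<lambda>a. a \<otimes> g) ` A"
  by (auto simp: r_coset_def)

lemma set_mult_image: "A <#> B = (\<lambda>(a, b). a \<otimes> b) ` (A \<times> B)"
  by (auto simp: set_mult_def)

lemma set_multI: "a \<in> A \<Longrightarrow> b \<in> B \<Longrightarrow> a \<otimes> b \<in> A <#> B"
  by (auto simp: set_mult_def)

lemma mult_inv_cancel:
  assumes "x \<in> carrier G" "y \<in> carrier G"
  shows "x \<otimes> (y \<otimes> inv x) = y" "(y \<otimes> inv x) \<otimes> x = y" "(y \<otimes> x) \<otimes> inv x = y"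
  using assms by (metis m_assoc m_comm inv_closed r_inv r_one l_inv)+

lemma finite_set_mult: "finite A \<Longrightarrow> finite B \<Longrightarrow> finite (A <#> B)"
  by (simp add: set_mult_image)

lemma finite_r_coset: "finite A \<Longrightarrow> finite (A #> g)"
  by (simp add: r_coset_image)

lemma card_r_coset:
  assumes "A \<subseteq> carrier G" "g \<in> carrier G"
  shows "card (A #> g) = card A"
  unfolding r_coset_image
  by (rule card_image, rule inj_onI) (use assms in \<open>auto simp: subset_iff\<close>)

lemma r_coset_subset_set_mult: "b \<in> B \<Longrightarrow> A #> b \<subseteq> A <#> B"
  by (auto simp: r_coset_def set_mult_def)

lemma card_le_set_mult:
  assumes "A \<subseteq> carrier G" "B \<subseteq> carrier G" "finite A" "finite B" "B \<noteq> {}"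
  shows "card A \<le> card (A <#> B)"
proof -
  obtain b where "b \<in> B" using assms by blast
  then have "card (A #> b) \<le> card (A <#> B)"
    using assms by (intro card_mono finite_set_mult r_coset_subset_set_mult) auto
  then show ?thesis using card_r_coset assms \<open>b \<in> B\<close> by (metis subsetD)
qed

lemma set_mult_comm: "A \<subseteq> carrier G \<Longrightarrow> B \<subseteq> carrier G \<Longrightarrow> A <#> B = B <#> A"
  by (auto simp: set_mult_iff subset_iff) (metis m_comm)+

lemma r_coset_set_mult:
  assumes "A \<subseteq> carrier G" "B \<subseteq> carrier G" "g \<in> carrier G"
  shows "(A #> g) <#> B = (A <#> B) #> g"
  using assms by (simp add: r_coset_eq_set_mult set_mult_assoc set_mult_comm[of "{g}" B])

lemma set_mult_r_coset:
  assumes "A \<subseteq> carrier G" "B \<subseteq> carrier G" "g \<in> carrier G"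
  shows "A <#> (B #> g) = (A <#> B) #> g"
  using assms by (simp add: r_coset_eq_set_mult set_mult_assoc)

lemma Un_set_mult: "(A \<union> B) <#> S = (A <#> S) \<union> (B <#> S)"
  by (auto simp: set_mult_def)

lemma set_mult_Un: "S <#> (A \<union> B) = (S <#> A) \<union> (S <#> B)"
  by (auto simp: set_mult_def)

lemma r_coset_Int:
  assumes "A \<subseteq> carrier G" "B \<subseteq> carrier G" "g \<in> carrier G"
  shows "(A \<inter> B) #> g = (A #> g) \<inter> (B #> g)"
  using assms by (auto simp: r_coset_iff subset_iff)

lemma r_coset_mult_inv:
  assumes "A \<subseteq> carrier G" "g \<in> carrier G"
  shows "(A #> g) #> inv g = A" "(A #> inv g) #> g = A"
  using assms by (simp_all add: coset_mult_assoc)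

lemma r_coset_eq_iff:
  assumes "A \<subseteq> carrier G" "B \<subseteq> carrier G" "g \<in> carrier G"
  shows "A #> g = B #> g \<longleftrightarrow> A = B"
  by (metis assms r_coset_mult_inv(1))

lemma r_coset_subset_iff:
  assumes "A \<subseteq> carrier G" "B \<subseteq> carrier G" "g \<in> carrier G"
  shows "A #> g \<subseteq> B #> g \<longleftrightarrow> A \<subseteq> B"
  using assms r_coset_Int[of A B g] r_coset_eq_iff[of "A \<inter> B" A g] by (metis inf.absorb_iff1 inf.coboundedI1)

lemma mem_r_coset_iff:
  assumes "A \<subseteq> carrier G" "g \<in> carrier G" "x \<in> carrier G"
  shows "x \<in> A #> g \<longleftrightarrow> x \<otimes> inv g \<in> A"
proof
  assume "x \<in> A #> g"
  then obtain a where "a \<in> A" "x = a \<otimes> g" by (auto simp: r_coset_iff)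
  then show "x \<otimes> inv g \<in> A" using assms by (auto simp: m_assoc subset_iff)
next
  assume "x \<otimes> inv g \<in> A"
  moreover have "x = (x \<otimes> inv g) \<otimes> g" using assms by (simp add: m_assoc)
  ultimately show "x \<in> A #> g" by (auto simp: r_coset_iff)
qed

lemma set_mult_singleton: "A <#> {g} = A #> g"
  by (simp add: r_coset_eq_set_mult)

lemma singleton_r_coset: "{x} #> g = {x \<otimes> g}"
  by (auto simp: r_coset_def)

lemma r_coset_commute:
  assumes "A \<subseteq> carrier G" "g \<in> carrier G" "k \<in> carrier G"
  shows "(A #> g) #> k = (A #> k) #> g"
  using assms by (simp add: coset_mult_assoc m_comm)

lemma r_coset_pair: "S <#> {g, k} = (S #> g) \<union> (S #> k)"
  by (auto simp: set_mult_def r_coset_def)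

lemma card_mult_pair:
  assumes "A \<subseteq> carrier G" "finite A" "g \<in> carrier G"
  shows "card (A <#> {\<one>, g}) + card (A \<inter> (A #> g)) = 2 * card A"
  using assms card_Un_Int[of A "A #> g"] by (simp add: r_coset_pair card_r_coset finite_r_coset)

subsection \<open>Stabilizers\<close>

lemma stab_carrier: "stab G X \<subseteq> carrier G"
  by (auto simp: stab_def)

lemma one_stab: "X \<subseteq> carrier G \<Longrightarrow> \<one> \<in> stab G X"
  by (simp add: stab_def)

lemma subgroup_stab:
  assumes "X \<subseteq> carrier G"
  shows "subgroup (stab G X) G"
proof (rule subgroupI)
  show "stab G X \<noteq> {}" using one_stab assms by blast
next
  fix a assume "a \<in> stab G X"
  then show "inv a \<in> stab G X"
    using assms r_coset_mult_inv[of X a] by (auto simp: stab_def)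
next
  fix a b assume "a \<in> stab G X" "b \<in> stab G X"
  then show "a \<otimes> b \<in> stab G X"
    using assms coset_mult_assoc[of X a b] by (auto simp: stab_def)
qed (rule stab_carrier)

lemma set_mult_stab:
  assumes "X \<subseteq> carrier G"
  shows "X <#> stab G X = X"
proof
  show "X <#> stab G X \<subseteq> X" by (auto simp: stab_def set_mult_def r_coset_def)
  show "X \<subseteq> X <#> stab G X" using one_stab[OF assms] assms
    by (simp add: set_mult_iff subset_iff) (metis r_one)
qed

lemma stab_mult_mem: "x \<in> X \<Longrightarrow> g \<in> stab G X \<Longrightarrow> x \<otimes> g \<in> X"
  by (auto simp: stab_def r_coset_def)

lemma periodicI_stab:
  assumes "X \<subseteq> carrier G" "g \<in> stab G X" "g \<noteq> \<one>"
  shows "periodic G X"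
  unfolding periodic_def
  using assms subgroup_stab set_mult_stab by (intro exI[of _ "stab G X"]) auto

lemma in_stabI:
  assumes "X \<subseteq> carrier G" "finite X" "g \<in> carrier G" "X #> g \<subseteq> X"
  shows "g \<in> stab G X"
  using assms card_subset_eq[of X "X #> g"] card_r_coset[of X g] by (auto simp: stab_def)

lemma stab_subset_r_coset:
  assumes "X \<subseteq> carrier G" "x \<in> X"
  shows "stab G X #> x \<subseteq> X"
  using assms stab_mult_mem[of x X] stab_carrier[of X]
  by (auto simp: r_coset_iff subset_iff m_comm)

lemma card_stab_le:
  assumes "X \<subseteq> carrier G" "finite X" "X \<noteq> {}"
  shows "finite (stab G X)" "card (stab G X) \<le> card X"
proof -
  obtain x where x: "x \<in> X" using assms by blast
  have s: "stab G X #> x \<subseteq> X" using stab_subset_r_coset assms x by blast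
  have "stab G X = (stab G X #> x) #> inv x"
    using r_coset_mult_inv[of "stab G X" x] stab_carrier assms x by auto
  then show "finite (stab G X)" by (metis s assms(2) finite_r_coset finite_subset)
  show "card (stab G X) \<le> card X"
    using s assms x card_r_coset[OF stab_carrier, of x X] by (metis card_mono subsetD)
qed

lemma stab_set_mult:
  assumes "X \<subseteq> carrier G" "B \<subseteq> carrier G"
  shows "stab G X \<subseteq> stab G (X <#> B)"
proof
  fix g assume "g \<in> stab G X"
  then show "g \<in> stab G (X <#> B)"
    using r_coset_set_mult[of X B g] assms by (simp add: stab_def)
qed

lemma stab_r_coset:
  assumes "X \<subseteq> carrier G" "g \<in> carrier G"
  shows "stab G (X #> g) = stab G X"
  using assms r_coset_commute[of X g] r_coset_eq_iff[of _ X g]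
  by (auto simp: stab_def r_coset_subset_G)

text \<open>Each translate of \<open>A\<close> by an element of \<open>B\<close> lies in
  \<open>Y\<close> and has at least as many elements as \<open>Y\<close>, hence equals
  \<open>Y\<close>; two elements of \<open>B\<close> then differ by a period of
  \<open>A\<close>.\<close>

lemma set_mult_eq_r_coset:
  assumes "A \<subseteq> carrier G" "finite A" "B \<subseteq> carrier G" "b \<in> B" "A <#> B \<subseteq> Y" "finite Y" "card Y \<le> card A"
  shows "Y = A #> b" "b' \<in> B \<Longrightarrow> b' \<otimes> inv b \<in> stab G A"
proof -
  have *: "A #> b' = Y" if "b' \<in> B" for b'
    using that assms r_coset_subset_set_mult[OF that, of A] card_r_coset[of A b']
    by (intro card_seteq) auto
  then show "Y = A #> b" using assms by blast
  assume "b' \<in> B"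
  then have "A #> b' = A #> b" using * assms(4) by blast
  then have "A #> (b' \<otimes> inv b) = A"
    using assms \<open>b' \<in> B\<close> by (metis coset_mult_assoc inv_closed r_coset_mult_inv(1) subsetD)
  then show "b' \<otimes> inv b \<in> stab G A" using assms \<open>b' \<in> B\<close> by (auto simp: stab_def subset_iff)
qed

subsection \<open>Inverse sets\<close>

lemma set_inv_image: "set_inv A = (\<lambda>x. inv x) ` A"
  by (auto simp: SET_INV_def)

lemma set_inv_closed: "A \<subseteq> carrier G \<Longrightarrow> set_inv A \<subseteq> carrier G"
  by (auto simp: set_inv_image)

lemma card_set_inv: "A \<subseteq> carrier G \<Longrightarrow> card (set_inv A) = card A"
  unfolding set_inv_image by (rule card_image, rule inj_onI) (metis inv_inv subsetD)

lemma set_inv_inv: "A \<subseteq> carrier G \<Longrightarrow> set_inv (set_inv A) = A"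
  unfolding set_inv_image image_image by (force simp: subset_iff)

lemma set_inv_set_mult:
  assumes "A \<subseteq> carrier G" "B \<subseteq> carrier G"
  shows "set_inv (A <#> B) = set_inv A <#> set_inv B"
  unfolding set_inv_image set_mult_image image_image
  using assms by (force simp: inv_mult subset_iff image_iff)

end

section \<open>Atoms\<close>

text \<open>Separability relative to a subgroup \<open>K\<close>, since connectivity is also studied
  inside \<open>H\<close> and inside generated subgroups. For infinite \<open>K\<close> and finite
  \<open>S\<close> the complement of the sumset is infinite, so only finite \<open>K\<close> carries
  a condition on it. The quantity to be minimized is the excess
  \<open>card (X <#> S) - card X\<close>, which does not require 0 in \<open>S\<close>.\<close>

definition sep_in :: "('a, 'b) monoid_scheme \<Rightarrow> 'a set \<Rightarrow> nat \<Rightarrow> 'a set \<Rightarrow> 'a set \<Rightarrow> bool" where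
  "sep_in G K k S X \<longleftrightarrow> X \<subseteq> K \<and> finite X \<and> k \<le> card X \<and> (infinite K \<or> k \<le> card (K - (X <#>\<^bsub>G\<^esub> S)))"

context comm_group
begin

lemma set_mult_subgroup:
  assumes "subgroup K G" "A \<subseteq> K" "B \<subseteq> K"
  shows "A <#> B \<subseteq> K"
  using assms by (auto simp: set_mult_def subset_iff subgroup.m_closed)

lemma r_coset_subgroup:
  assumes "subgroup K G" "A \<subseteq> K" "g \<in> K"
  shows "A #> g \<subseteq> K"
  using assms by (auto simp: r_coset_def subset_iff subgroup.m_closed)

lemma set_inv_subgroup:
  assumes "subgroup K G" "A \<subseteq> K"
  shows "set_inv A \<subseteq> K"
  using assms by (auto simp: set_inv_image subset_iff subgroup.m_inv_closed)

lemma dual_disjoint: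
  assumes "S \<subseteq> carrier G" "X \<subseteq> carrier G" "Z \<subseteq> carrier G" "Z \<inter> (X <#> S) = {}"
  shows "(Z <#> set_inv S) \<inter> X = {}"
proof -
  have "False" if "z \<in> Z" "s \<in> S" "z \<otimes> inv s \<in> X" for z s
  proof -
    have "z = (z \<otimes> inv s) \<otimes> s" using that assms mult_inv_cancel(2)[of s z] by (simp add: subset_iff)
    then have "z \<in> X <#> S" using that by (metis set_multI)
    then show False using that assms by blast
  qed
  then show ?thesis by (auto simp: set_mult_def set_inv_image)
qed

text \<open>Z - S misses X, so |Z - S| \<le> |K| - |X|, while |Z| = |K| - |X + S|. Hence passing to
  the complement does not increase the excess.\<close>

lemma sep_in_dual:
  assumes K: "subgroup K G" "finite K" and S: "S \<subseteq> K" "S \<noteq> {}" and X: "sep_in G K k S X"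
  defines "Z \<equiv> K - (X <#> S)"
  shows "sep_in G K k (set_inv S) Z"
    and "card (Z <#> set_inv S) - card Z \<le> card (X <#> S) - card X"
proof -
  have Kc: "K \<subseteq> carrier G" using K by (simp add: subgroup.subset)
  have fin: "finite S" "finite X" using K S X finite_subset by (auto simp: sep_in_def)
  have XK: "X \<subseteq> K" using X by (simp add: sep_in_def)
  have ZK: "Z \<subseteq> K" "finite Z" using K by (auto simp: Z_def)
  have "(Z <#> set_inv S) \<inter> X = {}"
    by (rule dual_disjoint) (use Kc S XK ZK in \<open>auto simp: Z_def\<close>)
  then have sub: "Z <#> set_inv S \<subseteq> K - X"
    using set_mult_subgroup[OF K(1) ZK(1) set_inv_subgroup[OF K(1) S(1)]] by blast
  then have XZ: "X \<subseteq> K - (Z <#> set_inv S)" using XK by blast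
  have "k \<le> card (K - (Z <#> set_inv S))"
    using X card_mono[OF _ XZ] K by (auto simp: sep_in_def)
  then show "sep_in G K k (set_inv S) Z" using X K ZK by (simp add: sep_in_def Z_def)
  have XS: "X <#> S \<subseteq> K" using set_mult_subgroup K XK S by blast
  have "card (Z <#> set_inv S) \<le> card K - card X"
    using card_mono[OF _ sub] K XK fin by (simp add: card_Diff_subset)
  moreover have "card Z = card K - card (X <#> S)"
    unfolding Z_def using XS K finite_subset by (intro card_Diff_subset) auto
  moreover have "card X \<le> card (X <#> S)"
    using card_le_set_mult[of X S] fin S XK Kc by auto
  moreover have "card (X <#> S) \<le> card K" using XS K card_mono by blast
  ultimately show "card (Z <#> set_inv S) - card Z \<le> card (X <#> S) - card X" by linarith
qed

text \<open>
  The minimum runs over both \<open>S\<close> and \<open>- S\<close>: for finite \<open>K\<close> the complement of \<open>A + S\<close> then competes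
  with the minimizer \<open>A\<close>, which gives the room needed for the submodularity argument.
\<close>

lemma atom_exists:
  assumes K: "subgroup K G" and S: "S \<subseteq> K" "finite S" "S \<noteq> {}" and X0: "sep_in G K k S X0" and k: "k \<ge> 1"
  obtains S' A where "S' = S \<or> S' = set_inv S" "sep_in G K k S' A"
    "\<And>X. sep_in G K k S X \<Longrightarrow> card (A <#> S') - card A \<le> card (X <#> S) - card X"
    "\<And>g. g \<in> K \<Longrightarrow> k \<le> card (A \<inter> (A #> g)) \<Longrightarrow> A #> g = A"
proof -
  have Kc: "K \<subseteq> carrier G" using K by (simp add: subgroup.subset)
  define P where "P = (\<lambda>(S', X). (S' = S \<or> S' = set_inv S) \<and> sep_in G K k S' X)"
  define ex where "ex = (\<lambda>(S', X). card (X <#> S') - card X)"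
  have "P (S, X0)" using X0 by (simp add: P_def)
  then obtain p where p: "P p" "\<And>q. P q \<Longrightarrow> ex p \<le> ex q"
    using ex_has_least_nat[of P _ ex] by blast
  then obtain r where r: "P r \<and> ex r = ex p" "\<And>q. P q \<and> ex q = ex p \<Longrightarrow> card (snd r) \<le> card (snd q)"
    using ex_has_least_nat[of "\<lambda>q. P q \<and> ex q = ex p" p "\<lambda>q. card (snd q)"] by blast
  obtain S' A where SA: "r = (S', A)" by (cases r)
  have S': "S' = S \<or> S' = set_inv S" and sA: "sep_in G K k S' A" using r(1) by (auto simp: P_def SA)
  define \<kappa> where "\<kappa> = card (A <#> S') - card A"
  have mn: "\<kappa> \<le> card (X <#> T) - card X" if "T = S \<or> T = set_inv S" "sep_in G K k T X" for T X
    using p(2)[of "(T, X)"] r(1) that by (auto simp: P_def ex_def SA \<kappa>_def)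
  have at: "card A \<le> card X" if "T = S \<or> T = set_inv S" "sep_in G K k T X" "card (X <#> T) - card X \<le> \<kappa>" for T X
    using r(2)[of "(T, X)"] r(1) that mn[OF that(1,2)] by (auto simp: P_def ex_def SA \<kappa>_def)
  have Sc: "S \<subseteq> carrier G" using S Kc by blast
  have S'p: "S' \<subseteq> K" "finite S'" "S' \<noteq> {}"
    using S' S set_inv_subgroup[OF K S(1)] by (auto simp: set_inv_image)
  have S'c: "S' \<subseteq> carrier G" using S'p Kc by blast
  have A: "A \<subseteq> K" "finite A" "k \<le> card A" using sA by (auto simp: sep_in_def)
  have Ac: "A \<subseteq> carrier G" using A Kc by blast
  have cardA: "card (A <#> S') = card A + \<kappa>"
    using card_le_set_mult[OF Ac S'c] A S'p by (auto simp: \<kappa>_def)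
  \<comment> \<open>The complement has excess at most \<open>\<kappa>\<close> for the inverse of
    \<open>S'\<close>, so it cannot be smaller than \<open>A\<close>, a smallest minimizer over both
    sets.\<close>
  have ext: "card A \<le> card (K - (A <#> S'))" if "finite K"
  proof -
    note d = sep_in_dual[OF K that S'p(1,3) sA]
    have "set_inv S' = S \<or> set_inv S' = set_inv S" using S' set_inv_inv[OF Sc] by auto
    from at[OF this d(1)] d(2) show ?thesis by (simp add: \<kappa>_def)
  qed
  have tr: "A #> g = A" if g: "g \<in> K" and kI: "k \<le> card (A \<inter> (A #> g))" for g
  proof (rule ccontr)
    assume ne: "A #> g \<noteq> A"
    have gc: "g \<in> carrier G" using g Kc by blast
    define B where "B = A #> g"
    define I where "I = A \<inter> B"
    define U where "U = A \<union> B"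
    have B: "B \<subseteq> K" "finite B" "card B = card A"
      using r_coset_subgroup[OF K A(1) g] finite_r_coset A card_r_coset[OF Ac gc] by (auto simp: B_def)
    have "card (B <#> S') = card (A <#> S')"
      using r_coset_set_mult[OF Ac S'c gc] card_r_coset[of "A <#> S'" g] set_mult_closed[OF Ac S'c] gc
      by (simp add: B_def)
    then have cB: "card (B <#> S') = card A + \<kappa>" using cardA by simp
    have "I \<noteq> A" using ne B A card_subset_eq[of B A] by (auto simp: I_def B_def)
    then have Ilt: "card I < card A" using A by (auto simp: I_def intro!: psubset_card_mono)
    have IS: "I <#> S' \<subseteq> (A <#> S') \<inter> (B <#> S')" unfolding I_def set_mult_def by blast
    have fAS: "finite (A <#> S')" "finite (B <#> S')" using finite_set_mult A B S'p by auto
    have "sep_in G K k S' I"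
    proof -
      have "k \<le> card (K - (I <#> S'))" if "finite K"
      proof -
        have "card (K - (A <#> S')) \<le> card (K - (I <#> S'))" using IS that by (intro card_mono) auto
        then show ?thesis using sA that by (auto simp: sep_in_def)
      qed
      then show ?thesis using A kI by (auto simp: sep_in_def I_def B_def)
    qed
    \<comment> \<open>The intersection is separable and smaller than the smallest minimizer, so its
      excess exceeds \<open>\<kappa>\<close>. Submodularity then pushes the excess of the union
      below \<open>\<kappa>\<close>; it remains to see that the union is separable.\<close>
    then have "\<not> card (I <#> S') - card I \<le> \<kappa>" using at S' Ilt by force
    then have cI: "card I + \<kappa> < card (I <#> S')" by simp
    have cU: "card U + card I = 2 * card A"
      using card_Un_Int[of A B] A B by (simp add: U_def I_def)
    have "card (U <#> S') + card (I <#> S') \<le> card ((A <#> S') \<union> (B <#> S')) + card ((A <#> S') \<inter> (B <#> S'))"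
      unfolding U_def Un_set_mult using IS fAS by (intro add_left_mono card_mono) auto
    also have "\<dots> = 2 * card A + 2 * \<kappa>" using card_Un_Int[OF fAS] cardA cB by simp
    finally have sub: "card (U <#> S') + card (I <#> S') \<le> 2 * card A + 2 * \<kappa>" .
    have Uf: "U \<subseteq> K" "finite U" using A B by (auto simp: U_def)
    have "sep_in G K k S' U"
    proof -
      have "k \<le> card (K - (U <#> S'))" if fK: "finite K"
      proof -
        have US: "U <#> S' \<subseteq> K" using set_mult_subgroup K Uf S'p by blast
        have AS: "A <#> S' \<subseteq> K" using set_mult_subgroup K A S'p by blast
        have 1: "card (K - (U <#> S')) + card (U <#> S') = card K"
          using US fK by (metis card_Diff_subset card_mono finite_subset le_add_diff_inverse2)
        have 2: "card (K - (A <#> S')) + card (A <#> S') = card K"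
          using AS fK by (metis card_Diff_subset card_mono finite_subset le_add_diff_inverse2)
        \<comment> \<open>By \<open>ext\<close>, 2|A| + \<kappa> is at most |K|; so the strict gain
          at \<open>I\<close> leaves at least |I| + 1 elements outside U + S'.\<close>
        have "k \<le> card I" using kI by (simp add: I_def B_def)
        moreover have "card (U <#> S') + card I + 1 \<le> 2 * card A + \<kappa>" using sub cI by simp
        moreover have "2 * card A + \<kappa> \<le> card (K - (U <#> S')) + card (U <#> S')" using 1 2 ext[OF fK] cardA by simp
        ultimately show ?thesis by simp
      qed
      moreover have "k \<le> card U" using A B card_mono[of U A] Uf by (auto simp: U_def)
      ultimately show ?thesis using Uf by (auto simp: sep_in_def)
    qed
    then have "\<kappa> \<le> card (U <#> S') - card U" using mn S' by blast
    moreover have "card U \<le> card (U <#> S')"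
      using card_le_set_mult[of U S'] Uf S'p S'c Kc by auto
    ultimately show False using sub cI cU by linarith
  qed
  show ?thesis
    by (rule that[OF S' sA _ tr]) (use mn in \<open>auto simp: \<kappa>_def\<close>)
qed

text \<open>For y in \<open>A\<close>, both y and y + g lie in \<open>A\<close> and in its translate
  by y - x. Two common points make the translate equal to \<open>A\<close>, so every difference y -
  x is a period.\<close>

lemma periodic_atom_is_coset:
  assumes A: "A \<subseteq> carrier G" "finite A" "x \<in> A" and g: "g \<in> stab G A" "g \<noteq> \<one>"
    and tr: "\<And>y. y \<in> A \<Longrightarrow> 2 \<le> card (A \<inter> (A #> (y \<otimes> inv x))) \<Longrightarrow> A #> (y \<otimes> inv x) = A"
  shows "A = stab G A #> x"
proof
  show "stab G A #> x \<subseteq> A" using stab_subset_r_coset A by blast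
  show "A \<subseteq> stab G A #> x"
  proof
    fix y assume y: "y \<in> A"
    then have yc: "y \<in> carrier G" "x \<in> carrier G" using A by auto
    define w where "w = y \<otimes> inv x"
    have w: "w \<in> carrier G" using yc by (simp add: w_def)
    have "y = x \<otimes> w" using yc mult_inv_cancel by (simp add: w_def)
    then have "y \<in> A #> w" using A by (auto simp: r_coset_iff)
    moreover have "y \<otimes> g \<in> A #> w"
    proof -
      have "g \<in> stab G (A #> w)" using stab_r_coset A w g by simp
      then show ?thesis using stab_mult_mem \<open>y \<in> A #> w\<close> by blast
    qed
    moreover have "y \<otimes> g \<in> A" using stab_mult_mem y g by blast
    ultimately have "{y, y \<otimes> g} \<subseteq> A \<inter> (A #> w)" using y by auto
    moreover have "y \<otimes> g \<noteq> y" using g yc by (auto simp: stab_def)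
    ultimately have "2 \<le> card (A \<inter> (A #> w))"
      using card_mono[of "A \<inter> (A #> w)" "{y, y \<otimes> g}"] A by auto
    then have "A #> w = A" using tr y by (simp add: w_def)
    then have "w \<in> stab G A" using w by (simp add: stab_def)
    moreover have "y = w \<otimes> x" using yc mult_inv_cancel by (simp add: w_def)
    ultimately show "y \<in> stab G A #> x" by (auto simp: r_coset_iff)
  qed
qed

lemma set_inv_subgroup_eq:
  assumes "subgroup P G"
  shows "set_inv P = P"
proof
  show "set_inv P \<subseteq> P" using set_inv_subgroup[OF assms] by blast
  then show "P \<subseteq> set_inv P"
    using set_inv_inv[of P] subgroup.subset[OF assms] unfolding set_inv_image by blast
qed

text \<open>Mann's theorem: a subgroup attains the least excess. With k = 1 the overlap property
  makes translates of an atom equal or disjoint, so the atom is a coset of its stabilizer. A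
  subgroup is symmetric, so it also serves \<open>S\<close> when the atom was found for the inverse
  of \<open>S\<close>.\<close>

lemma mann:
  assumes K: "subgroup K G" and S: "S \<subseteq> K" "finite S" "S \<noteq> {}" "S \<noteq> K"
  obtains P where "subgroup P G" "P \<subseteq> K" "finite P" "P <#> S \<noteq> K"
    "\<And>X. X \<subseteq> K \<Longrightarrow> finite X \<Longrightarrow> X \<noteq> {} \<Longrightarrow> X <#> S \<noteq> K \<Longrightarrow>
        card (P <#> S) - card P \<le> card (X <#> S) - card X"
proof -
  have Kc: "K \<subseteq> carrier G" using K by (simp add: subgroup.subset)
  have Sc: "S \<subseteq> carrier G" using S Kc by blast
  have sep: "sep_in G K 1 S X" if "X \<subseteq> K" "finite X" "X \<noteq> {}" "X <#> S \<noteq> K" for X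
  proof -
    have "X <#> S \<subseteq> K" using set_mult_subgroup K that S by blast
    then have "finite K \<Longrightarrow> 1 \<le> card (K - (X <#> S))"
      using that by (metis Diff_eq_empty_iff One_nat_def Suc_leI card_gt_0_iff finite_Diff subset_antisym)
    then show ?thesis using that by (auto simp: sep_in_def Suc_le_eq card_gt_0_iff)
  qed
  have one: "\<one> \<in> K" using K subgroup.one_closed by blast
  have "{\<one>} <#> S = S" using Sc by (auto simp: set_mult_def subset_iff)
  then have "sep_in G K 1 S {\<one>}" using sep[of "{\<one>}"] S one by auto
  then obtain S' A where S': "S' = S \<or> S' = set_inv S" and A: "sep_in G K 1 S' A"
    and mn: "\<And>X. sep_in G K 1 S X \<Longrightarrow> card (A <#> S') - card A \<le> card (X <#> S) - card X"
    and tr: "\<And>g. g \<in> K \<Longrightarrow> 1 \<le> card (A \<inter> (A #> g)) \<Longrightarrow> A #> g = A"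
    using atom_exists[OF K S(1-3)] by (metis order_refl)
  have AK: "A \<subseteq> K" "finite A" "A \<noteq> {}" using A by (auto simp: sep_in_def)
  then have Ac: "A \<subseteq> carrier G" using Kc by blast
  have S'p: "S' \<subseteq> K" "S' \<subseteq> carrier G" "finite S'" "S' \<noteq> {}"
    using S' S set_inv_subgroup[OF K S(1)] Kc by (auto simp: set_inv_image)
  obtain x where x: "x \<in> A" using AK by blast
  have xc: "x \<in> carrier G" using x Ac by blast
  define P where "P = stab G A"
  have sP: "subgroup P G" and Pc: "P \<subseteq> carrier G" and Pf: "finite P"
    using subgroup_stab[OF Ac] stab_carrier card_stab_le[OF Ac] AK by (auto simp: P_def)
  have "A \<subseteq> P #> x"
  proof
    fix y assume y: "y \<in> A"
    then have yc: "y \<in> carrier G" using Ac by blast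
    have w: "y \<otimes> inv x \<in> K" using y x AK K by (meson subgroup.m_closed subgroup.m_inv_closed subsetD)
    have "y = x \<otimes> (y \<otimes> inv x)" using xc yc mult_inv_cancel by simp
    then have "y \<in> A \<inter> (A #> (y \<otimes> inv x))" using x y by (auto simp: r_coset_iff)
    then have "A #> (y \<otimes> inv x) = A" using tr[OF w] AK by (auto simp: Suc_le_eq card_gt_0_iff)
    then have "y \<otimes> inv x \<in> P" using xc yc by (simp add: P_def stab_def)
    moreover have "y = (y \<otimes> inv x) \<otimes> x" using xc yc mult_inv_cancel by simp
    ultimately show "y \<in> P #> x" by (auto simp: r_coset_iff)
  qed
  then have AP: "A = P #> x" using stab_subset_r_coset[OF Ac x] by (auto simp: P_def)
  have "P = A #> inv x" using AP r_coset_mult_inv Pc xc by simp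
  then have PK: "P \<subseteq> K" using r_coset_subgroup[OF K AK(1), of "inv x"] K x AK by (metis subgroup.m_inv_closed subsetD)
  have cP: "card A = card P" using AP card_r_coset Pc xc by simp
  have "card (A <#> S') = card (P <#> S')"
    using AP r_coset_set_mult[OF Pc S'p(2) xc] card_r_coset[of "P <#> S'" x] set_mult_closed[OF Pc S'p(2)] xc by simp
  moreover have "card (P <#> S') = card (P <#> S)"
    using S' set_inv_set_mult[OF Pc Sc] set_inv_subgroup_eq[OF sP] card_set_inv[OF set_mult_closed[OF Pc Sc]] by auto
  ultimately have c: "card (A <#> S') = card (P <#> S)" by simp
  have "P <#> S \<noteq> K"
  proof
    assume eq: "P <#> S = K"
    then have fK: "finite K" using finite_set_mult Pf S by metis
    have "A <#> S' \<subseteq> K" using set_mult_subgroup K AK S'p by blast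
    then have "A <#> S' = K" using c eq fK card_subset_eq by metis
    then show False using A fK by (simp add: sep_in_def)
  qed
  then show ?thesis
    using that[OF sP PK Pf] mn sep c cP by metis
qed

end

section \<open>Sets of small connectivity\<close>

context comm_group
begin

definition sidon :: "'a set \<Rightarrow> bool" where
  "sidon A \<longleftrightarrow> A \<subseteq> carrier G \<and> finite A \<and> (\<forall>g\<in>carrier G. g \<noteq> \<one> \<longrightarrow> card (A \<inter> (A #> g)) \<le> 1)"

lemma sidon_r_coset_Int:
  assumes "sidon A" "b \<in> carrier G" "c \<in> carrier G" "b \<noteq> c"
  shows "card ((A #> b) \<inter> (A #> c)) \<le> 1"
proof -
  have A: "A \<subseteq> carrier G" using assms by (simp add: sidon_def)
  have "(A #> (c \<otimes> inv b)) #> b = A #> c" using A assms by (simp add: coset_mult_assoc m_assoc)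
  then have "(A #> b) \<inter> (A #> c) = (A \<inter> (A #> (c \<otimes> inv b))) #> b"
    using A assms by (simp add: r_coset_Int r_coset_subset_G)
  moreover have "c \<otimes> inv b \<noteq> \<one>" using assms by (metis inv_closed inv_equality inv_inv)
  ultimately show ?thesis
    using assms A card_r_coset[of "A \<inter> (A #> (c \<otimes> inv b))" b] by (simp add: sidon_def le_infI1)
qed

lemma sidon_set_mult_2:
  assumes "sidon A" "B \<subseteq> carrier G" "finite B" "2 \<le> card B"
  shows "2 * card A \<le> card (A <#> B) + 1"
proof -
  have A: "A \<subseteq> carrier G" "finite A" using assms by (auto simp: sidon_def)
  obtain b c where bc: "b \<in> B" "c \<in> B" "b \<noteq> c"
    using assms by (metis One_nat_def card_le_Suc0_iff_eq not_less_eq_eq numeral_2_eq_2)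
  have "card ((A #> b) \<union> (A #> c)) \<le> card (A <#> B)"
    using bc assms A by (intro card_mono finite_set_mult Un_least r_coset_subset_set_mult) auto
  moreover have "card ((A #> b) \<union> (A #> c)) + card ((A #> b) \<inter> (A #> c)) = 2 * card A"
    using card_Un_Int[of "A #> b" "A #> c"] A bc assms card_r_coset[of A] finite_r_coset by (auto simp: subset_iff)
  moreover have "card ((A #> b) \<inter> (A #> c)) \<le> 1" using sidon_r_coset_Int assms bc by auto
  ultimately show ?thesis by linarith
qed

text \<open>Three distinct translates of \<open>A\<close> lose at most one point for each of their
  three pairs.\<close>

lemma sidon_set_mult_3:
  assumes "sidon A" "B \<subseteq> carrier G" "finite B" "3 \<le> card B"
  shows "3 * card A \<le> card (A <#> B) + 3"
proof -
  have A: "A \<subseteq> carrier G" "finite A" using assms by (auto simp: sidon_def)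
  obtain T where T: "T \<subseteq> B" "card T = 3" using assms(4) by (meson obtain_subset_with_card_n)
  then obtain b c d where bcd: "b \<in> B" "c \<in> B" "d \<in> B" "b \<noteq> c" "b \<noteq> d" "c \<noteq> d"
    by (auto simp: card_3_iff)
  let ?X = "A #> b" and ?Y = "A #> c" and ?Z = "A #> d"
  have f: "finite ?X" "finite ?Y" "finite ?Z" using A finite_r_coset by auto
  have c: "card ?X = card A" "card ?Y = card A" "card ?Z = card A"
    using A bcd assms card_r_coset by (auto simp: subset_iff)
  have "card (?X \<union> ?Y \<union> ?Z) \<le> card (A <#> B)"
    using bcd assms A by (intro card_mono finite_set_mult Un_least r_coset_subset_set_mult) auto
  moreover have "card (?X \<union> ?Y) + card (?X \<inter> ?Y) = 2 * card A" using card_Un_Int[OF f(1,2)] c by simp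
  moreover have "card (?X \<union> ?Y \<union> ?Z) + card ((?X \<union> ?Y) \<inter> ?Z) = card (?X \<union> ?Y) + card A"
    using card_Un_Int[of "?X \<union> ?Y" ?Z] f c by simp
  moreover have "card ((?X \<union> ?Y) \<inter> ?Z) \<le> card (?X \<inter> ?Z) + card (?Y \<inter> ?Z)"
    by (metis Int_Un_distrib2 card_Un_le)
  moreover have "card (?X \<inter> ?Z) \<le> 1" "card (?Y \<inter> ?Z) \<le> 1" "card (?X \<inter> ?Y) \<le> 1"
    using sidon_r_coset_Int assms bcd by auto
  ultimately show ?thesis by linarith
qed

lemma sidon_set_inv:
  assumes "sidon A"
  shows "sidon (set_inv A)"
  unfolding sidon_def
proof (intro conjI ballI impI)
  have A: "A \<subseteq> carrier G" "finite A" using assms by (auto simp: sidon_def)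
  show "set_inv A \<subseteq> carrier G" "finite (set_inv A)" using A set_inv_closed by (auto simp: set_inv_image)
  fix g assume g: "g \<in> carrier G" "g \<noteq> \<one>"
  have "set_inv A \<inter> (set_inv A #> g) \<subseteq> (\<lambda>x. inv x) ` (A \<inter> (A #> inv g))"
  proof
    fix y assume "y \<in> set_inv A \<inter> (set_inv A #> g)"
    then obtain a b where ab: "a \<in> A" "b \<in> A" "y = inv a" "y = inv b \<otimes> g"
      by (auto simp: set_inv_image r_coset_iff)
    then have "a = inv (inv b \<otimes> g)" using A by (metis inv_inv subsetD)
    then have "a = b \<otimes> inv g" using A ab g by (metis inv_closed inv_inv inv_mult subsetD)
    then have "a \<in> A #> inv g" using ab by (auto simp: r_coset_iff)
    then show "y \<in> (\<lambda>x. inv x) ` (A \<inter> (A #> inv g))" using ab by blast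
  qed
  then have "card (set_inv A \<inter> (set_inv A #> g)) \<le> card (A \<inter> (A #> inv g))"
    using A by (meson card_image_le card_mono finite_Int finite_imageI order_trans)
  also have "\<dots> \<le> 1" using assms g by (simp add: sidon_def)
  finally show "card (set_inv A \<inter> (set_inv A #> g)) \<le> 1" .
qed

text \<open>Two common points with a translate force a period, so without nonzero periods the set is
  Sidon; with one, \<open>periodic_atom_is_coset\<close> applies.\<close>

lemma atom_dichotomy:
  assumes K: "subgroup K G" and A: "A \<subseteq> K" "finite A" "A \<noteq> {}"
    and tr: "\<And>g. g \<in> K \<Longrightarrow> 2 \<le> card (A \<inter> (A #> g)) \<Longrightarrow> A #> g = A"
  obtains "sidon A" | P x where "subgroup P G" "P \<subseteq> K" "P \<noteq> {\<one>}" "finite P" "x \<in> A" "A = P #> x"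
proof (cases "\<exists>g\<in>stab G A. g \<noteq> \<one>")
  case True
  then obtain g where g: "g \<in> stab G A" "g \<noteq> \<one>" by blast
  have Kc: "K \<subseteq> carrier G" using K by (simp add: subgroup.subset)
  have Ac: "A \<subseteq> carrier G" using A Kc by blast
  obtain x where x: "x \<in> A" using A by blast
  have xy: "y \<otimes> inv x \<in> K" if "y \<in> A" for y
    using that x A K by (meson subgroup.m_closed subgroup.m_inv_closed subsetD)
  have eq: "A = stab G A #> x"
    using periodic_atom_is_coset[OF Ac A(2) x g] tr xy by blast
  have "stab G A = A #> inv x" using r_coset_mult_inv[OF stab_carrier, of x A] eq x Ac by auto
  then have "stab G A \<subseteq> K" using r_coset_subgroup[OF K A(1), of "inv x"] K x A by (metis subgroup.m_inv_closed subsetD)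
  then show ?thesis
    using that(2)[OF subgroup_stab[OF Ac] _ _ card_stab_le(1)[OF Ac A(2,3)] x eq] g by blast
next
  case False
  have Kc: "K \<subseteq> carrier G" using K by (simp add: subgroup.subset)
  have Ac: "A \<subseteq> carrier G" using A Kc by blast
  have "card (A \<inter> (A #> g)) \<le> 1" if g: "g \<in> carrier G" "g \<noteq> \<one>" for g
  proof (rule ccontr)
    assume "\<not> ?thesis"
    then have 2: "2 \<le> card (A \<inter> (A #> g))" by simp
    then have "A \<inter> (A #> g) \<noteq> {}" by auto
    then obtain a where "a \<in> A" "a \<in> A #> g" by blast
    then obtain b where ab: "a \<in> A" "b \<in> A" "a = b \<otimes> g" by (auto simp: r_coset_iff)
    then have "g = inv b \<otimes> a" using Ac g by (metis inv_solve_left subsetD)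
    then have "g \<in> K" using ab A K by (metis subgroup.m_closed subgroup.m_inv_closed subsetD)
    then have "A #> g = A" using tr 2 by blast
    then show False using False g by (auto simp: stab_def)
  qed
  then show ?thesis using that(1) Ac A by (auto simp: sidon_def)
qed

lemma card_coset_set_mult:
  assumes P: "subgroup P G" "finite P" and A: "A \<subseteq> carrier G" "finite A" "a \<in> A" "b \<in> A" "a \<otimes> inv b \<notin> P"
  shows "2 * card P \<le> card (A <#> P)"
proof -
  have Pc: "P \<subseteq> carrier G" using P by (simp add: subgroup.subset)
  have ab: "a \<in> carrier G" "b \<in> carrier G" using A by auto
  have "(P #> a) \<inter> (P #> b) = {}"
  proof (rule ccontr)
    assume "\<not> ?thesis"
    then obtain p q where pq: "p \<in> P" "q \<in> P" "p \<otimes> a = q \<otimes> b" by (auto simp: r_coset_iff)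
    then have "a = inv p \<otimes> (q \<otimes> b)" using ab Pc by (metis inv_solve_left subsetD m_closed)
    then have "a \<otimes> inv b = inv p \<otimes> q" using pq ab Pc by (simp add: m_assoc subset_iff)
    then show False using A pq P by (simp add: subgroup.m_closed subgroup.m_inv_closed)
  qed
  then have "card ((P #> a) \<union> (P #> b)) = 2 * card P"
    using card_Un_disjoint[of "P #> a" "P #> b"] finite_r_coset P card_r_coset[OF Pc] ab by simp
  moreover have "card ((P #> a) \<union> (P #> b)) \<le> card (A <#> P)"
    using A P Pc set_mult_comm[of A P]
    by (intro card_mono finite_set_mult) (auto intro!: r_coset_subset_set_mult Un_least)
  ultimately show ?thesis by simp
qed

text \<open>A 2-atom \<open>B\<close> of \<open>A\<close> would again be a Sidon set, and counting \<open>A + B\<close> from both sides is impossible.\<close>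

lemma sidon_connectivity:
  assumes A: "sidon A" "3 \<le> card A" "\<one> \<in> A" and K: "K = generate G A"
    and X: "sep_in G K 2 A X"
  shows "card X + card A \<le> card (X <#> A)"
proof (rule ccontr)
  assume neg: "\<not> ?thesis"
  have Ac: "A \<subseteq> carrier G" "finite A" using A by (auto simp: sidon_def)
  have sK: "subgroup K G" using K Ac generate_is_subgroup by blast
  then have Kc: "K \<subseteq> carrier G" by (simp add: subgroup.subset)
  have AK: "A \<subseteq> K" using K by (auto intro: generate.incl)
  have "A \<noteq> {}" using A by auto
  then obtain A' B where A': "A' = A \<or> A' = set_inv A" and B: "sep_in G K 2 A' B"
    and mn: "\<And>X. sep_in G K 2 A X \<Longrightarrow> card (B <#> A') - card B \<le> card (X <#> A) - card X"
    and tr: "\<And>g. g \<in> K \<Longrightarrow> 2 \<le> card (B \<inter> (B #> g)) \<Longrightarrow> B #> g = B"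
    using atom_exists[OF sK AK Ac(2) _ X] by (metis one_le_numeral)
  have Bp: "B \<subseteq> K" "finite B" "2 \<le> card B" "B \<noteq> {}" using B by (auto simp: sep_in_def)
  then have Bc: "B \<subseteq> carrier G" using Kc by blast
  have sA': "sidon A'" using A' A sidon_set_inv by auto
  then have A'c: "A' \<subseteq> carrier G" "finite A'" by (auto simp: sidon_def)
  have cA': "card A' = card A" using A' card_set_inv Ac by auto
  have oneA': "\<one> \<in> A'" using A' A(3) by (auto simp: set_inv_image image_iff intro!: bexI[of _ \<one>])
  have "A' \<noteq> {}" using oneA' by auto
  have comm: "A' <#> B = B <#> A'" using set_mult_comm A'c Bc by blast
  have "card (B <#> A') < card B + card A"
    using mn[OF X] neg card_le_set_mult[OF Bc A'c(1) Bp(2) A'c(2) \<open>A' \<noteq> {}\<close>] A(2) by linarith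
  then have small: "card (A' <#> B) < card B + card A" using comm by simp
  have two: "2 * card A \<le> card (A' <#> B) + 1" using sidon_set_mult_2[OF sA' Bc Bp(2,3)] cA' by simp
  consider "sidon B" | P x where "subgroup P G" "P \<subseteq> K" "P \<noteq> {\<one>}" "finite P" "x \<in> B" "B = P #> x"
    using atom_dichotomy[OF sK Bp(1,2,4) tr] by metis
  then show False
  proof cases
    \<comment> \<open>\<open>two\<close> and \<open>small\<close> give |A| \<le> |B|, so both sets
      have at least three elements. Adding the two three-translate bounds gives 3(|A| + |B|) \<le>
      2|A + B| + 6 < 2(|A| + |B|) + 6, which contradicts |A| + |B| \<ge> 6.\<close>
    case 1
    have "3 * card B \<le> card (A' <#> B) + 3"
      using sidon_set_mult_3[OF 1 A'c] cA' A(2) comm by simp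
    moreover have "card B \<ge> 3"
      using two small A(2) Bp(3) by linarith
    moreover from this have "3 * card A \<le> card (A' <#> B) + 3"
      using sidon_set_mult_3[OF sA' Bc Bp(2)] cA' by simp
    ultimately show False using small A(2) by linarith
  next
    case (2 P x)
    have Pc: "P \<subseteq> carrier G" using 2 Kc by blast
    have xc: "x \<in> carrier G" using 2 Bc by blast
    have cB: "card B = card P" using 2 card_r_coset Pc xc by simp
    have "card (A' <#> B) = card (A' <#> P)"
      using 2(6) set_mult_r_coset[OF A'c(1) Pc xc] card_r_coset[OF set_mult_closed[OF A'c(1) Pc] xc] by simp
    then have s: "card (A' <#> P) < card P + card A" "2 * card A \<le> card (A' <#> P) + 1"
      using small two cB by auto
    \<comment> \<open>If \<open>A'\<close> met two cosets of \<open>P\<close>, one bound would give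
      |P| < |A| and the other |A| \<le> |P|.\<close>
    have "A' \<subseteq> P"
    proof
      fix a assume a: "a \<in> A'"
      show "a \<in> P"
      proof (rule ccontr)
        assume "a \<notin> P"
        then have "a \<otimes> inv \<one> \<notin> P" using a A'c by auto
        then have "2 * card P \<le> card (A' <#> P)"
          using card_coset_set_mult[OF 2(1,4) A'c a oneA'] by blast
        then show False using s by linarith
      qed
    qed
    then have "A \<subseteq> P" using A' set_inv_subgroup[OF 2(1), of A'] set_inv_inv[OF Ac(1)] by auto
    then have "K \<subseteq> P" using K generate_subgroup_incl 2(1) by blast
    then have PK: "P = K" using 2 by blast
    have "B = K" using 2(5,6) Bp(1) PK
      by (metis (no_types, lifting) cB card_seteq 2(4) order_refl)
    moreover have "B #> \<one> \<subseteq> B <#> A'" using r_coset_subset_set_mult[OF oneA'] .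
    ultimately have "K - (B <#> A') = {}" using Bc by auto
    moreover have "finite K" using PK 2 by simp
    ultimately show False using B unfolding sep_in_def by (metis card.empty not_numeral_le_zero)
  qed
qed

end

section \<open>Counting along cosets\<close>

context comm_group
begin

lemma coset_disjoint:
  assumes "subgroup K G" "x \<in> carrier G" "y \<in> carrier G" "K #> x \<noteq> K #> y"
  shows "(K #> x) \<inter> (K #> y) = {}"
  using rcos_disjoint[OF assms(1)] assms rcosetsI[OF subgroup.subset[OF assms(1)]]
  by (auto simp: pairwise_def disjnt_def)

lemma card_coset_sum:
  assumes K: "subgroup K G" and X: "X \<subseteq> carrier G" "finite X"
    and \<C>: "(\<lambda>x. K #> x) ` X \<subseteq> \<C>" "\<C> \<subseteq> (\<lambda>x. K #> x) ` carrier G" "finite \<C>"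
  shows "card X = (\<Sum>C\<in>\<C>. card (X \<inter> C))"
proof -
  have "X = (\<Union>C\<in>\<C>. X \<inter> C)"
    using \<C>(1) X rcos_self[OF _ K] by blast
  moreover have "card (\<Union>C\<in>\<C>. X \<inter> C) = (\<Sum>C\<in>\<C>. card (X \<inter> C))"
  proof (rule card_UN_disjoint)
    show "\<forall>C\<in>\<C>. \<forall>D\<in>\<C>. C \<noteq> D \<longrightarrow> X \<inter> C \<inter> (X \<inter> D) = {}"
    proof (intro ballI impI)
      fix C D assume "C \<in> \<C>" "D \<in> \<C>" "C \<noteq> D"
      then obtain x y where "C = K #> x" "D = K #> y" "x \<in> carrier G" "y \<in> carrier G" using \<C>(2) by blast
      then have "C \<inter> D = {}" using coset_disjoint[OF K, of x y] \<open>C \<noteq> D\<close> by blast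
      then show "X \<inter> C \<inter> (X \<inter> D) = {}" by blast
    qed
  qed (use \<C> X in auto)
  ultimately show ?thesis by simp
qed

subsection \<open>Arithmetic progressions\<close>

text \<open>Following a, a + d, ... until the chain leaves \<open>X\<close> uses up the only element
  without a predecessor. Every remaining element has a predecessor among the remaining ones, so
  adding \<open>d\<close> permutes them.\<close>

lemma progression_structure:
  assumes X: "X \<subseteq> carrier G" "finite X" and d: "d \<in> carrier G" and a: "X - (X #> d) = {a}"
  obtains l R where "l \<ge> 1" "X = (\<lambda>i::nat. a \<otimes> d [^] i) ` {..<l} \<union> R" "R \<subseteq> X" "R #> d = R" "a \<notin> R"
proof -
  have aX: "a \<in> X" "a \<notin> X #> d" using a by auto
  have ac: "a \<in> carrier G" using aX X by auto
  have "\<exists>i::nat. a \<otimes> d [^] i \<notin> X"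
  proof (rule ccontr)
    assume "\<not> ?thesis"
    \<comment> \<open>An endless chain in the finite set \<open>X\<close> would return to
      \<open>a\<close> and give it a predecessor.\<close>
    then have all: "a \<otimes> d [^] (i::nat) \<in> X" for i by blast
    then have "\<not> inj (\<lambda>i::nat. a \<otimes> d [^] i)"
      using X(2) by (meson finite_subset image_subsetI finite_imageD infinite_UNIV_nat)
    then obtain i j :: nat where "i < j" "a \<otimes> d [^] i = a \<otimes> d [^] j"
      by (metis injI linorder_neqE_nat)
    then have "d [^] i = d [^] (i + (j - i))" using ac d by simp
    then have "d [^] i = d [^] i \<otimes> d [^] (j - i)" using d nat_pow_mult[OF d, of i "j - i"] by simp
    then have "d [^] (j - i) = \<one>" using d l_cancel_one' by (metis nat_pow_closed)
    then have "d [^] (j - i - 1) \<otimes> d = \<one>"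
      using \<open>i < j\<close> by (metis Suc_diff_1 nat_pow_Suc zero_less_diff)
    then have "a = (a \<otimes> d [^] (j - i - 1)) \<otimes> d" using ac d by (simp add: m_assoc)
    then show False using all aX by (metis r_coset_iff)
  qed
  then obtain l :: nat where l: "a \<otimes> d [^] l \<notin> X" "\<And>i. i < l \<Longrightarrow> a \<otimes> d [^] i \<in> X"
    using exists_least_iff[of "\<lambda>i::nat. a \<otimes> d [^] i \<notin> X"] by metis
  have l1: "l \<ge> 1" using l(1) aX ac by (cases l) auto
  define P where "P = (\<lambda>i::nat. a \<otimes> d [^] i) ` {..<l}"
  define R where "R = X - P"
  have aP: "a \<in> P" unfolding P_def using l1 ac by (intro image_eqI[of _ _ 0]) auto
  have "R \<subseteq> R #> d"
  proof
    fix r assume r: "r \<in> R"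
    have "r \<noteq> a" using r aP by (auto simp: R_def)
    then have "r \<in> X #> d" using r a by (auto simp: R_def)
    then obtain x where x: "x \<in> X" "r = x \<otimes> d" by (auto simp: r_coset_iff)
    have "x \<notin> P"
    proof
      assume "x \<in> P"
      then obtain i where i: "i < l" "x = a \<otimes> d [^] i" by (auto simp: P_def)
      then have ri: "r = a \<otimes> d [^] Suc i" using x ac d by (simp add: m_assoc)
      show False
      proof (cases "Suc i < l")
        case True
        then have "r \<in> P" unfolding P_def ri by (intro imageI) simp
        then show False using r by (simp add: R_def)
      next
        case False
        then have "Suc i = l" using i by simp
        then show False using ri l(1) r by (auto simp: R_def)
      qed
    qed
    then show "r \<in> R #> d" using x by (auto simp: R_def r_coset_iff)
  qed
  moreover have "card (R #> d) = card R" "finite R" "R \<subseteq> carrier G"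
    using X d card_r_coset[of R d] unfolding R_def by auto
  ultimately have "R #> d = R" using card_subset_eq[of "R #> d" R] finite_r_coset by simp
  moreover have "X = P \<union> R" using l(2) by (auto simp: P_def R_def)
  moreover have "a \<notin> R" using aP by (simp add: R_def)
  moreover have "R \<subseteq> X" by (auto simp: R_def)
  ultimately show ?thesis using that[OF l1, of R] unfolding P_def by blast
qed

lemma pair_growth_cases:
  assumes X: "X \<subseteq> carrier G" "finite X" and d: "d \<in> carrier G" and c: "card (X <#> {\<one>, d}) \<le> card X + 1"
  obtains "X #> d = X" | a where "X - (X #> d) = {a}"
proof -
  have "card (X <#> {\<one>, d}) + card (X \<inter> (X #> d)) = 2 * card X" using card_mult_pair X d by blast
  moreover have "card X = card (X \<inter> (X #> d)) + card (X - (X #> d))"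
    using card_Int_Diff[OF X(2)] by simp
  ultimately have "card (X - (X #> d)) \<le> 1" using c by linarith
  then consider "card (X - (X #> d)) = 0" | "card (X - (X #> d)) = 1" by linarith
  then show ?thesis
  proof cases
    case 1
    then have "X \<subseteq> X #> d" using X by auto
    then have "X #> d = X" using card_subset_eq[of "X #> d" X] finite_r_coset X d card_r_coset[of X d] by simp
    then show ?thesis using that by blast
  next
    case 2
    then show ?thesis using that by (auto simp: card_1_singleton_iff)
  qed
qed

lemma progressionI:
  "a \<in> carrier G \<Longrightarrow> d \<in> carrier G \<Longrightarrow> l \<ge> 1 \<Longrightarrow> X = (\<lambda>i::nat. a \<otimes> d [^] i) ` {..<l} \<Longrightarrow> progression G d X"
  unfolding progression_def by (intro conjI bexI[of _ a] exI[of _ l]) auto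

end

text \<open>What the image of S in the quotient by the hyper-atom satisfies: \<open>cauchy\<close>
  stems from the minimal boundary of H, \<open>nosub\<close> from its maximality, and
  \<open>size\<close> from the upper bound on |S + T|.\<close>

locale cauchy_set = comm_group G for G (structure) +
  fixes S :: "'a set"
  assumes S: "S \<subseteq> carrier G" "finite S" "\<one> \<in> S" "generate G S = carrier G" "2 \<le> card S"
    and cauchy: "\<And>X. X \<subseteq> carrier G \<Longrightarrow> finite X \<Longrightarrow> X \<noteq> {} \<Longrightarrow> X <#> S \<noteq> carrier G \<Longrightarrow>
        card X + card S \<le> card (X <#> S) + 1"
    and nosub: "\<And>P. subgroup P G \<Longrightarrow> finite P \<Longrightarrow> P \<noteq> {\<one>} \<Longrightarrow> P <#> S \<noteq> carrier G \<Longrightarrow>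
        card P + card S \<le> card (P <#> S)"
    and size: "finite (carrier G) \<Longrightarrow> 3 * card S \<le> card (carrier G) + 3"
begin

text \<open>\<open>S\<close> is a progression plus a d-periodic part R. If R is nonempty, its
  stabilizer P satisfies |P + S| \<le> |R| + |P| < |S| + |P|, so \<open>nosub\<close> makes P + S
  everything, and then |P| \<le> |R| < |S| violates \<open>size\<close>.\<close>

lemma progression_of_pair:
  assumes d: "d \<in> carrier G" "d \<noteq> \<one>" and c: "card (S <#> {\<one>, d}) \<le> card S + 1"
  shows "progression G d S"
  using pair_growth_cases[OF S(1,2) d(1) c]
proof cases
  case 1
  then have dS: "d \<in> stab G S" using d by (simp add: stab_def)
  have f: "finite (stab G S)" using card_stab_le S by auto
  have "stab G S <#> S = S" using set_mult_stab S stab_carrier set_mult_comm by metis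
  moreover have "S \<noteq> carrier G" using size S by auto
  moreover have "card (stab G S) > 0" using f dS card_gt_0_iff by blast
  ultimately have False using nosub[OF subgroup_stab f] S dS d by auto
  then show ?thesis ..
next
  case (2 a)
  obtain l R where l: "l \<ge> 1" "S = (\<lambda>i::nat. a \<otimes> d [^] i) ` {..<l} \<union> R" "R \<subseteq> S" "R #> d = R" "a \<notin> R"
    using progression_structure[OF S(1,2) d(1) 2] by metis
  have a: "a \<in> S" "a \<in> carrier G" using 2 S by auto
  show ?thesis
  proof (cases "R = {}")
    case True
    then show ?thesis using progressionI[OF a(2) d(1) l(1)] l(2) by simp
  next
    case False
    have R: "R \<subseteq> carrier G" "finite R" using l S finite_subset by auto
    define P where "P = stab G R"
    have P: "subgroup P G" "finite P" "d \<in> P" "P \<subseteq> carrier G" "card P \<le> card R"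
      using subgroup_stab[OF R(1)] card_stab_le[OF R False] stab_carrier l(4) d by (auto simp: P_def stab_def)
    have "d [^] (i::nat) \<in> P" for i
      using P by (induction i) (auto simp: subgroup.one_closed subgroup.m_closed)
    then have pw: "a \<otimes> d [^] (i::nat) \<in> P #> a" for i using a d by (auto simp: r_coset_iff m_comm[of a])
    then have S_sub: "S \<subseteq> R \<union> (P #> a)" unfolding l(2) by blast
    have "P <#> S \<subseteq> R \<union> (P #> a)"
    proof -
      have "P <#> S \<subseteq> P <#> (R \<union> (P #> a))" using S_sub by (auto simp: set_mult_def)
      also have "\<dots> = (P <#> R) \<union> (P <#> (P #> a))" by (rule set_mult_Un)
      also have "P <#> R = R" using set_mult_stab R set_mult_comm P by (metis P_def)
      also have "P <#> (P #> a) = P #> a"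
        using set_mult_r_coset P a subgroup_mult_id[OF P(1)] by simp
      finally show ?thesis .
    qed
    then have "card (P <#> S) \<le> card (R \<union> (P #> a))" using R P finite_r_coset by (intro card_mono) auto
    also have "\<dots> \<le> card R + card P" using card_Un_le card_r_coset P a by metis
    finally have PS: "card (P <#> S) \<le> card R + card P" .
    have "card R < card S" using l a S by (intro psubset_card_mono) auto
    moreover have "P \<noteq> {\<one>}" using P d by auto
    ultimately have eq: "P <#> S = carrier G" using nosub[OF P(1,2)] PS by fastforce
    then have "finite (carrier G)" using finite_set_mult[OF P(2) S(2)] by simp
    then have "3 * card S \<le> card R + card P + 3" using size PS eq by simp
    moreover have "card R > 0" using R False by (simp add: card_gt_0_iff)
    ultimately have False using \<open>card R < card S\<close> P(5) by linarith
    then show ?thesis ..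
  qed
qed

text \<open>Sumsets with a progression grow by at least one element at each step of the progression.\<close>

lemma progression_partner:
  assumes d: "progression G d S" and T: "T \<subseteq> carrier G" "finite T" "T \<noteq> {}"
    and TS: "T <#> S \<noteq> carrier G" "card (T <#> S) + 1 \<le> card T + card S"
  shows "progression G d T"
proof -
  obtain b n where b: "b \<in> carrier G" and n: "n \<ge> 1" and Sn: "S = (\<lambda>i::nat. b \<otimes> d [^] i) ` {..<n}"
    and dc: "d \<in> carrier G"
    using d unfolding progression_def by (auto simp: image_def)
  \<comment> \<open>As 0 lies in \<open>S\<close>, the first term \<open>b\<close> is an inverse
    multiple of \<open>d\<close>; hence \<open>d\<close> alone generates the group.\<close>
  have stab_all: "stab G X = carrier G" if X: "X \<subseteq> carrier G" "d \<in> stab G X" for X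
  proof -
    have sg: "subgroup (stab G X) G" using subgroup_stab X by blast
    have pw: "d [^] (i::nat) \<in> stab G X" for i
      using sg X by (induction i) (auto simp: subgroup.one_closed subgroup.m_closed)
    obtain j :: nat where "\<one> = b \<otimes> d [^] j" using S(3) Sn by auto
    then have "b = inv (d [^] j)" using b dc by (metis inv_equality nat_pow_closed)
    then have "b \<in> stab G X" using pw sg by (simp add: subgroup.m_inv_closed)
    then have "S \<subseteq> stab G X" using Sn pw sg by (auto simp: subgroup.m_closed)
    then have "generate G S \<subseteq> stab G X" using generate_subgroup_incl sg by blast
    then show ?thesis using S(4) stab_carrier by blast
  qed
  have full: "X = carrier G" if X: "X \<subseteq> carrier G" "X \<noteq> {}" "d \<in> stab G X" for X
  proof -
    obtain x where x: "x \<in> X" using X by blast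
    have "carrier G #> x \<subseteq> X" using stab_subset_r_coset[OF X(1) x] stab_all[OF X(1,3)] by simp
    moreover have "carrier G #> x = carrier G"
      using x X coset_join2[of x "carrier G"] subgroup_self by auto
    ultimately show ?thesis using X by blast
  qed
  define D where "D = (\<lambda>j. (\<lambda>i::nat. d [^] i) ` {..<j})"
  have Dc: "D j \<subseteq> carrier G" "finite (D j)" for j using dc by (auto simp: D_def)
  have D1: "D (Suc j) = D j \<union> {d [^] j}" for j by (auto simp: D_def lessThan_Suc)
  have Dstep: "D (Suc (Suc j)) = D (Suc j) <#> {\<one>, d}" for j
  proof (induction j)
    case 0
    then show ?case using dc by (auto simp: D_def lessThan_Suc set_mult_def)
  next
    case (Suc j)
    have "D (Suc (Suc j)) <#> {\<one>, d} = (D (Suc j) <#> {\<one>, d}) \<union> ({d [^] Suc j} <#> {\<one>, d})"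
      by (simp only: D1[of "Suc j"] Un_set_mult)
    also have "\<dots> = D (Suc (Suc j)) \<union> {d [^] Suc j, d [^] Suc (Suc j)}"
      using Suc.IH dc by (auto simp: set_mult_def)
    also have "\<dots> = D (Suc (Suc (Suc j)))" using D1[of "Suc j"] D1[of "Suc (Suc j)"] by auto
    finally show ?case by simp
  qed
  have SD: "S = D n #> b" using Sn b dc by (auto simp: D_def r_coset_def m_comm)
  have cS: "card S \<le> n" using Sn card_image_le[of "{..<n}"] by simp
  have TSD: "T <#> S = (T <#> D n) #> b" using SD set_mult_r_coset T Dc b by simp
  then have cTD: "card (T <#> D n) = card (T <#> S)" using card_r_coset set_mult_closed T Dc b by metis
  have nfull: "T <#> D n \<noteq> carrier G"
  proof
    assume "T <#> D n = carrier G"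
    then have "T <#> S = carrier G" using TSD b coset_join2[of b "carrier G"] subgroup_self by auto
    then show False using TS by blast
  qed
  have Tc: "T <#> D j \<subseteq> carrier G" for j using set_mult_closed T Dc by blast
  have nfull': "T <#> D j \<noteq> carrier G" if "j \<le> n" for j
  proof -
    have "D j \<subseteq> D n" using that by (auto simp: D_def)
    then have "T <#> D j \<subseteq> T <#> D n" by (auto simp: set_mult_def)
    then show ?thesis using nfull Tc by blast
  qed
  have step: "card (T <#> D (Suc j)) < card (T <#> D (Suc (Suc j)))" if "Suc (Suc j) \<le> n" for j
  proof -
    let ?X = "T <#> D (Suc j)"
    have fX: "finite ?X" "?X \<subseteq> carrier G" "?X \<noteq> {}"
      using finite_set_mult T Dc Tc by (auto simp: D_def set_mult_def)
    have eq: "T <#> D (Suc (Suc j)) = ?X <#> {\<one>, d}"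
      using Dstep set_mult_assoc[of T "D (Suc j)" "{\<one>, d}"] T Dc dc by simp
    have "?X #> d \<noteq> ?X" using full[OF fX(2,3)] nfull'[of "Suc j"] that dc by (auto simp: stab_def)
    then have "?X \<inter> (?X #> d) \<noteq> ?X"
      using card_subset_eq[of "?X #> d" ?X] card_r_coset[of ?X d] fX dc finite_r_coset by auto
    then have "card (?X \<inter> (?X #> d)) < card ?X" using fX by (intro psubset_card_mono) auto
    then show ?thesis using card_mult_pair[OF fX(2,1) dc] unfolding eq by linarith
  qed
  have n2: "2 \<le> n" using S(5) cS by linarith
  have "card (T <#> D 2) + j \<le> card (T <#> D (2 + j))" if "2 + j \<le> n" for j
    using that
  proof (induction j)
    case (Suc j)
    then show ?case using step[of "Suc j"] by simp
  qed simp
  moreover obtain j where j: "n = 2 + j" using n2 le_Suc_ex by blast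
  ultimately have "card (T <#> D 2) + j \<le> card (T <#> D n)" by blast
  \<comment> \<open>Each of the \<open>n\<close> - 2 later steps costs at least one element, so at
    most one is left for the first step.\<close>
  then have "card (T <#> D 2) \<le> card T + 1" using cTD TS(2) cS j by linarith
  moreover have "D 2 = {\<one>, d}" using dc by (auto simp: D_def lessThan_Suc numeral_2_eq_2)
  ultimately have c2: "card (T <#> {\<one>, d}) \<le> card T + 1" by simp
  have Tn: "T \<noteq> carrier G" using nfull'[of 1] T n by (auto simp: D_def lessThan_Suc set_mult_singleton)
  from pair_growth_cases[OF T(1,2) dc c2] show ?thesis
  proof cases
    case 1
    then show ?thesis using full T Tn dc by (auto simp: stab_def)
  next
    case (2 a)
    obtain l R where l: "l \<ge> 1" "T = (\<lambda>i::nat. a \<otimes> d [^] i) ` {..<l} \<union> R" "R \<subseteq> T" "R #> d = R" "a \<notin> R"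
      using progression_structure[OF T(1,2) dc 2] by metis
    have "a \<in> carrier G" using 2 T by auto
    have "R = {}"
    proof (rule ccontr)
      assume "R \<noteq> {}"
      then have "R = carrier G" using full[of R] l T dc by (auto simp: stab_def)
      then show False using l \<open>a \<in> carrier G\<close> by blast
    qed
    then show ?thesis using progressionI[OF \<open>a \<in> carrier G\<close> dc l(1)] l(2) by simp
  qed
qed

end

section \<open>Growth inside a coset under a Sidon set\<close>

context comm_group
begin

text \<open>After translation into \<open>K\<close>, a piece with at least two elements whose sumset
  misses at least two is covered by \<open>sidon_connectivity\<close>. A single point is immediate,
  and if exactly one element p is missed, then p - A is disjoint from the piece, which gives the
  bound.\<close>

lemma coset_piece_growth:
  assumes A: "sidon A" "3 \<le> card A" "\<one> \<in> A" and K: "K = generate G A"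
    and s: "s \<in> carrier G" and X: "X \<subseteq> K #> s" "finite X" "X \<noteq> {}"
  obtains "finite K" "A <#> X = K #> s" | "card X + card A \<le> card (A <#> X) + 1"
proof -
  have Ac: "A \<subseteq> carrier G" "finite A" using A by (auto simp: sidon_def)
  have sK: "subgroup K G" using K Ac generate_is_subgroup by blast
  then have Kc: "K \<subseteq> carrier G" by (simp add: subgroup.subset)
  have AK: "A \<subseteq> K" using K by (auto intro: generate.incl)
  define Z where "Z = X #> inv s"
  have Xc: "X \<subseteq> carrier G" using X Kc s r_coset_subset_G by blast
  have XZ: "X = Z #> s" using Xc s by (simp add: Z_def r_coset_mult_inv)
  have ZK: "Z \<subseteq> K" using X(1) r_coset_mult_inv(1)[OF Kc s] unfolding Z_def r_coset_def by blast
  have Zf: "finite Z" "Z \<noteq> {}" "card Z = card X"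
    using X Xc s finite_r_coset card_r_coset[of X "inv s"] by (auto simp: Z_def r_coset_def)
  have Zc: "Z \<subseteq> carrier G" using ZK Kc by blast
  have AX: "A <#> X = (Z <#> A) #> s" using XZ set_mult_r_coset[OF Ac(1) Zc s] set_mult_comm[OF Ac(1) Zc] by simp
  have cAX: "card (A <#> X) = card (Z <#> A)" using AX card_r_coset set_mult_closed Zc Ac s by metis
  have ZAK: "Z <#> A \<subseteq> K" using set_mult_subgroup sK ZK AK by blast
  show ?thesis
  proof (cases "finite K \<and> Z <#> A = K")
    case True
    then show ?thesis using that(1) AX by simp
  next
    case False
    have "card Z + card A \<le> card (Z <#> A) + 1"
    proof (cases "sep_in G K 2 A Z")
      case True
      then show ?thesis using sidon_connectivity[OF A K True] by simp
    next
      case ns: False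
      show ?thesis
      proof (cases "2 \<le> card Z")
        case False
        then have "card Z = 1" using Zf card_gt_0_iff[of Z] by linarith
        moreover have "card A \<le> card (Z <#> A)"
          using card_le_set_mult[OF Ac(1) Zc Ac(2) Zf(1,2)] set_mult_comm[OF Ac(1) Zc] by simp
        ultimately show ?thesis by simp
      next
        case True
        then have fK: "finite K" and "\<not> 2 \<le> card (K - (Z <#> A))" using ns ZK Zf by (auto simp: sep_in_def)
        moreover have "K - (Z <#> A) \<noteq> {}" using False fK ZAK by blast
        ultimately have c1: "card (K - (Z <#> A)) = 1"
          using card_gt_0_iff[of "K - (Z <#> A)"] by auto
        then obtain p where p: "K - (Z <#> A) = {p}" by (auto simp: card_1_singleton_iff)
        have "({p} <#> set_inv A) \<inter> Z = {}"
          by (rule dual_disjoint) (use p Ac Zc Kc in auto)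
        moreover have "{p} <#> set_inv A \<subseteq> K" using set_mult_subgroup sK set_inv_subgroup[OF sK AK] p by blast
        ultimately have "{p} <#> set_inv A \<subseteq> K - Z" by blast
        then have "card ({p} <#> set_inv A) \<le> card K - card Z"
          using card_mono[of "K - Z"] fK ZK Zf by (simp add: card_Diff_subset)
        moreover have "card (set_inv A) \<le> card ({p} <#> set_inv A)"
          using card_le_set_mult[of "set_inv A" "{p}"] set_mult_comm[of "{p}" "set_inv A"] p Kc set_inv_closed[OF Ac(1)] Ac
          by (auto simp: set_inv_image)
        moreover have "card Z \<le> card K" using ZK fK card_mono by blast
        moreover have "card (Z <#> A) + 1 = card K"
          using c1 ZAK fK card_Diff_subset[of "Z <#> A" K] finite_subset[OF ZAK fK] card_mono[OF fK ZAK] by simp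
        ultimately show ?thesis using card_set_inv[OF Ac(1)] by linarith
      qed
    qed
    then show ?thesis using that(2) cAX Zf by simp
  qed
qed

end

text \<open>A set of about a third of the group cannot contain all but one of c \<ge> 2 cosets and a
  further element: this would need 3(c - 1)k \<le> ck.\<close>

lemma coset_count_arith:
  fixes c k s n :: nat
  assumes "2 \<le> c" "(c - 1) * k + 1 \<le> s" "3 * s \<le> n + 3" "n = c * k" "k > 0"
  shows False
proof -
  obtain m where c: "c = m + 2" using assms(1) by (metis add.commute le_Suc_ex)
  have e: "c - 1 = m + 1" using c by linarith
  have d: "(m + 1) * k = m * k + k" "(m + 2) * k = m * k + 2 * k"
    by (simp_all only: add_mult_distrib mult_1)
  have "(m * k + k) + 1 \<le> s" using assms(2) unfolding e d .
  moreover have "n = m * k + 2 * k" using assms c by (simp only: d)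
  ultimately show False using assms(3,5) by linarith
qed

context cauchy_set
begin

text \<open>
  The pair is a 2-atom of \<open>S\<close>: a larger 2-atom \<open>A\<close> would be a Sidon set, and comparing \<open>A + S\<close> with \<open>K + S\<close> for the subgroup \<open>K\<close> generated by \<open>A\<close> is impossible.
\<close>

lemma pair_of_fragment:
  assumes X0: "sep_in G (carrier G) 2 S X0" "card (X0 <#> S) + 1 \<le> card X0 + card S"
  obtains d where "d \<in> carrier G" "d \<noteq> \<one>" "card (S <#> {\<one>, d}) \<le> card S + 1"
proof -
  have "S \<noteq> {}" using S by auto
  then obtain S' A0 where S': "S' = S \<or> S' = set_inv S" and A0: "sep_in G (carrier G) 2 S' A0"
    and mn: "\<And>X. sep_in G (carrier G) 2 S X \<Longrightarrow> card (A0 <#> S') - card A0 \<le> card (X <#> S) - card X"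
    and tr: "\<And>g. g \<in> carrier G \<Longrightarrow> 2 \<le> card (A0 \<inter> (A0 #> g)) \<Longrightarrow> A0 #> g = A0"
    using atom_exists[OF subgroup_self S(1,2) _ X0(1)] by (metis one_le_numeral)
  have S'p: "S' \<subseteq> carrier G" "finite S'" "\<one> \<in> S'" "card S' = card S" "S' \<noteq> {}"
    using S' S set_inv_closed card_set_inv \<open>S \<noteq> {}\<close> inv_one by (auto simp: set_inv_image image_iff) force
  have genS': "K = carrier G" if "subgroup K G" "S' \<subseteq> K" for K
  proof -
    have "S \<subseteq> K" using S' that set_inv_subgroup[OF that] set_inv_inv[OF S(1)] by auto
    then show ?thesis using generate_subgroup_incl[OF _ that(1)] S(4) subgroup.subset[OF that(1)] by blast
  qed
  have nosub': "P <#> S' = carrier G" if P: "subgroup P G" "finite P" "P \<noteq> {\<one>}" "card (P <#> S') < card P + card S" for P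
  proof -
    have Pc: "P \<subseteq> carrier G" using P by (simp add: subgroup.subset)
    have i: "set_inv (P <#> S) = P <#> set_inv S"
      using set_inv_set_mult[OF Pc S(1)] set_inv_subgroup_eq[OF P(1)] by simp
    have ci: "card (P <#> set_inv S) = card (P <#> S)"
      using i card_set_inv[OF set_mult_closed[OF Pc S(1)]] by simp
    then have "\<not> card P + card S \<le> card (P <#> S)" using S' P(4) by auto
    then have "P <#> S = carrier G" using nosub P by blast
    moreover have "set_inv (carrier G) = carrier G" using set_inv_subgroup_eq subgroup_self by blast
    ultimately show ?thesis using S' i by auto
  qed
  have A0p: "A0 \<subseteq> carrier G" "finite A0" "2 \<le> card A0" "A0 \<noteq> {}" using A0 by (auto simp: sep_in_def)
  have cA0: "card (A0 <#> S') + 1 \<le> card A0 + card S"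
    using mn[OF X0(1)] X0(2) card_le_set_mult[OF A0p(1) S'p(1) A0p(2) S'p(2,5)] S(5)
      card_le_set_mult[of X0 S] X0(1) S \<open>S \<noteq> {}\<close> unfolding sep_in_def by linarith
  have ext: "2 \<le> card (carrier G - (A0 <#> S'))" if "finite (carrier G)" using A0 that by (simp add: sep_in_def)
  consider "sidon A0" | P x where "subgroup P G" "P \<noteq> {\<one>}" "finite P" "x \<in> A0" "A0 = P #> x"
    using atom_dichotomy[OF subgroup_self A0p(1,2,4) tr] by metis
  then show ?thesis
  proof cases
    case (2 P x)
    have Pc: "P \<subseteq> carrier G" "x \<in> carrier G" using 2 A0p by (auto simp: subgroup.subset)
    have eq: "A0 <#> S' = (P <#> S') #> x" using 2 r_coset_set_mult[OF Pc(1) S'p(1) Pc(2)] by simp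
    have "card (P <#> S') < card P + card S"
      using cA0 eq card_r_coset[OF set_mult_closed[OF Pc(1) S'p(1)] Pc(2)] 2 card_r_coset[OF Pc] by simp
    then have PS: "P <#> S' = carrier G" using nosub' 2 by blast
    then have "A0 <#> S' = carrier G" using eq coset_join2[OF Pc(2) subgroup_self Pc(2)] by simp
    moreover have "finite (carrier G)" using PS finite_set_mult[OF 2(3) S'p(2)] by simp
    ultimately show ?thesis using ext by simp
  next
    case 1
    obtain x where x: "x \<in> A0" using A0p by blast
    have xc: "x \<in> carrier G" using x A0p by blast
    define A where "A = A0 #> inv x"
    have Ac: "A \<subseteq> carrier G" "finite A" "card A = card A0"
      using A0p xc card_r_coset finite_r_coset r_coset_subset_G by (auto simp: A_def)
    have oneA: "\<one> \<in> A" using x xc by (auto simp: A_def r_coset_iff intro!: bexI[of _ x])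
    have AS: "A <#> S' = (A0 <#> S') #> inv x" using r_coset_set_mult[OF A0p(1) S'p(1)] xc by (simp add: A_def)
    have cAS: "card (A <#> S') = card (A0 <#> S')" using AS card_r_coset set_mult_closed A0p S'p xc by simp
    have sA: "sidon A"
      unfolding sidon_def
    proof (intro conjI ballI impI)
      fix g assume g: "g \<in> carrier G" "g \<noteq> \<one>"
      have "A \<inter> (A #> g) = (A0 \<inter> (A0 #> g)) #> inv x"
        using r_coset_commute[of A0 "inv x" g] r_coset_Int[of A0 "A0 #> g" "inv x"] A0p xc g r_coset_subset_G
        by (simp add: A_def)
      then show "card (A \<inter> (A #> g)) \<le> 1"
        using 1 g card_r_coset[of "A0 \<inter> (A0 #> g)" "inv x"] A0p xc by (simp add: sidon_def le_infI1)
    qed (use Ac in auto)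
    show ?thesis
    proof (cases "card A = 2")
      case True
      then obtain z where z: "A = {\<one>, z}" "z \<noteq> \<one>" using oneA by (auto simp: card_2_iff)
      then have zc: "z \<in> carrier G" using Ac by auto
      have "A <#> S' = S' <#> {\<one>, z}" using z set_mult_comm Ac S'p by simp
      then have c: "card (S' <#> {\<one>, z}) \<le> card S + 1" using cA0 cAS Ac True by simp
      show ?thesis
      proof (cases "S' = S")
        case True
        then show ?thesis using that[OF zc z(2)] c by simp
      next
        case False
        then have "set_inv (S' <#> {\<one>, z}) = S <#> {\<one>, inv z}"
          using S' set_inv_set_mult[OF S'p(1), of "{\<one>, z}"] set_inv_inv[OF S(1)] zc by (auto simp: set_inv_image)
        then have "card (S <#> {\<one>, inv z}) \<le> card S + 1"
          using c card_set_inv[of "S' <#> {\<one>, z}"] set_mult_closed[OF S'p(1), of "{\<one>, z}"] zc by simp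
        then show ?thesis using that[of "inv z"] zc z(2) by (metis inv_closed inv_eq_1_iff)
      qed
    next
      case False
      then have A3: "3 \<le> card A" using Ac A0p by simp
      define K where "K = generate G A"
      have sK: "subgroup K G" using generate_is_subgroup Ac by (simp add: K_def)
      have Kc: "K \<subseteq> carrier G" using sK by (simp add: subgroup.subset)
      have AK: "A \<subseteq> K" by (auto simp: K_def intro: generate.incl)
      have oneK: "\<one> \<in> K" using sK subgroup.one_closed by blast
      have KA: "card A \<le> card K" if "finite K" using card_mono[OF that AK] .
      define \<C> where "\<C> = (\<lambda>s. K #> s) ` S'"
      have \<C>: "finite \<C>" "\<C> \<subseteq> (\<lambda>x. K #> x) ` carrier G" using S'p by (auto simp: \<C>_def)
      have sumS: "card S = (\<Sum>C\<in>\<C>. card (S' \<inter> C))"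
        using card_coset_sum[OF sK S'p(1,2) _ \<C>(2,1)] S'p(4) by (simp add: \<C>_def)
      have cosetA: "K #> (a \<otimes> s) = K #> s" if "a \<in> K" "s \<in> carrier G" for a s
      proof -
        have "a \<otimes> s \<in> K #> s" using that by (auto simp: r_coset_iff)
        then show ?thesis by (rule repr_independence[OF _ that(2) sK, symmetric])
      qed
      \<comment> \<open>\<open>A\<close> lies in \<open>K\<close>, so its sumset with
        \<open>S'\<close> can be computed coset by coset.\<close>
      have piece: "(A <#> S') \<inter> C = A <#> (S' \<inter> C)" if CC: "C \<in> \<C>" for C
      proof -
        obtain s0 where s0: "s0 \<in> carrier G" "C = K #> s0" using CC S'p(1) unfolding \<C>_def by auto
        have "a \<otimes> s \<in> C \<longleftrightarrow> s \<in> C" if "a \<in> A" "s \<in> S'" for a s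
        proof -
          have sc: "s \<in> carrier G" "a \<otimes> s \<in> carrier G" "a \<in> K" using that S'p Ac AK by auto
          have mem: "x \<in> C \<longleftrightarrow> K #> x = C" if "x \<in> carrier G" for x
          proof
            show "x \<in> C \<Longrightarrow> K #> x = C" unfolding s0(2) by (rule repr_independence[OF _ s0(1) sK, symmetric])
            show "K #> x = C \<Longrightarrow> x \<in> C" using rcos_self[OF that sK] by blast
          qed
          show ?thesis using mem[OF sc(1)] mem[OF sc(2)] cosetA[OF sc(3,1)] by simp
        qed
        then show ?thesis unfolding set_mult_def by auto
      qed
      have "(\<lambda>x. K #> x) ` (A <#> S') \<subseteq> \<C>"
        using cosetA AK S'p by (auto simp: \<C>_def set_mult_iff subset_iff)
      then have sumAS: "card (A <#> S') = (\<Sum>C\<in>\<C>. card (A <#> (S' \<inter> C)))"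
        using card_coset_sum[OF sK set_mult_closed[OF Ac(1) S'p(1)] finite_set_mult[OF Ac(2) S'p(2)] _ \<C>(2,1)] piece by simp
      have grow: "card (S' \<inter> C) \<le> card (A <#> (S' \<inter> C))" for C
        using card_le_set_mult[of "S' \<inter> C" A] set_mult_comm[of "S' \<inter> C" A] S'p Ac oneA by auto
      have dich: "(finite K \<and> A <#> (S' \<inter> C) = C) \<or> card (S' \<inter> C) + card A \<le> card (A <#> (S' \<inter> C)) + 1"
        if C: "C \<in> \<C>" for C
      proof -
        obtain s0 where s0: "s0 \<in> S'" "C = K #> s0" using C by (auto simp: \<C>_def)
        then have "s0 \<in> S' \<inter> C" using rcos_self[OF _ sK] S'p by auto
        then show ?thesis
          using coset_piece_growth[OF sA A3 oneA K_def, of s0 "S' \<inter> C"] s0 S'p by blast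
      qed
      have total: "(\<Sum>C\<in>\<C>. card (A <#> (S' \<inter> C))) + 1 \<le> card A + (\<Sum>C\<in>\<C>. card (S' \<inter> C))"
        using cA0 cAS sumAS sumS Ac by simp
      have KS: "K <#> S' = \<Union>\<C>" by (auto simp: \<C>_def set_mult_def r_coset_def)
      have cardC: "card C = card K" if "C \<in> \<C>" for C using that \<C> card_r_coset Kc by blast
      have cKS: "card (K <#> S') = card \<C> * card K" if fK: "finite K"
      proof -
        have "card (\<Union>\<C>) = sum card \<C>"
        proof (rule card_Union_disjoint)
          show "pairwise disjnt \<C>"
            unfolding pairwise_def disjnt_def using \<C>(2) coset_disjoint[OF sK] by blast
          show "finite C" if "C \<in> \<C>" for C using that fK finite_r_coset by (auto simp: \<C>_def)
        qed
        then show ?thesis using KS cardC by simp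
      qed
      have K1: "K \<noteq> {\<one>}" using A3 AK card_mono[of "{\<one>}" A] by auto
      \<comment> \<open>Here the roles are exchanged: \<open>S'\<close> would be a separable set for
        the Sidon set \<open>A\<close>.\<close>
      have Kne: "K \<noteq> carrier G"
      proof
        assume Kall: "K = carrier G"
        have "sep_in G K 2 A S'"
          using S'p S(5) ext AS cAS set_mult_comm[OF Ac(1) S'p(1)] Kall
            card_Diff_subset[of "A <#> S'" "carrier G"] card_Diff_subset[of "A0 <#> S'" "carrier G"]
            set_mult_closed[OF Ac(1) S'p(1)] set_mult_closed[OF A0p(1) S'p(1)] finite_set_mult[OF Ac(2) S'p(2)]
            finite_set_mult[OF A0p(2) S'p(2)]
          by (auto simp: sep_in_def)
        from sidon_connectivity[OF sA A3 oneA K_def this] show False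
          using cA0 cAS set_mult_comm[OF Ac(1) S'p(1)] S'p(4) Ac by simp
      qed
      have c2: "2 \<le> card \<C>"
      proof (rule ccontr)
        assume "\<not> ?thesis"
        moreover have "K #> \<one> \<in> \<C>" using S'p by (auto simp: \<C>_def)
        ultimately have "\<C> = {K #> \<one>}" using \<C>(1) card_le_Suc0_iff_eq[of \<C>] by auto
        then have "K #> s = K" if "s \<in> S'" for s using that Kc unfolding \<C>_def by (metis coset_mult_one image_eqI singletonD)
        then have "S' \<subseteq> K" using rcos_self[OF _ sK] S'p by blast
        then show False using genS' sK Kne by blast
      qed
      have fin: "finite K \<and> card (K <#> S') + 1 \<le> card K + card S \<and> (\<exists>C0\<in>\<C>. (card \<C> - 1) * card K + 1 \<le> card S) \<or>
        finite K \<and> card (K <#> S') + 1 \<le> card K + card S \<and> K <#> S' = A <#> S'"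
      proof (cases "\<forall>C\<in>\<C>. finite K \<and> A <#> (S' \<inter> C) = C")
        case True
        moreover have "\<C> \<noteq> {}" using c2 by auto
        ultimately have "finite K" by blast
        from True have True: "\<forall>C\<in>\<C>. A <#> (S' \<inter> C) = C" by blast
        have "(\<Sum>C\<in>\<C>. card (A <#> (S' \<inter> C))) = card \<C> * card K" using True cardC by simp
        then have "card (A <#> S') = card (K <#> S')" using cKS \<open>finite K\<close> sumAS by simp
        moreover have "A <#> S' \<subseteq> K <#> S'" using AK by (rule mono_set_mult) auto
        ultimately have "A <#> S' = K <#> S'"
          using card_subset_eq finite_set_mult \<open>finite K\<close> S'p by metis
        then show ?thesis using cA0 cAS KA Ac \<open>finite K\<close> by auto
      next
        case False
        \<comment> \<open>The total growth is at most |A| - 1, and the unfilled coset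
          \<open>C0\<close> takes all of it. So no other coset grows, and by \<open>dich\<close>
          those are already filled by \<open>S'\<close>.\<close>
        then obtain C0 where C0: "C0 \<in> \<C>" "\<not> (finite K \<and> A <#> (S' \<inter> C0) = C0)" by blast
        have b0: "card (S' \<inter> C0) + card A \<le> card (A <#> (S' \<inter> C0)) + 1" using dich C0 by blast
        have sp: "(\<Sum>C\<in>\<C>. f C) = f C0 + (\<Sum>C\<in>\<C>-{C0}. f C)" for f :: "_ \<Rightarrow> nat"
          using \<C>(1) C0 by (simp add: sum.remove)
        have le: "(\<Sum>C\<in>\<C>-{C0}. card (S' \<inter> C)) \<le> (\<Sum>C\<in>\<C>-{C0}. card (A <#> (S' \<inter> C)))"
          using grow by (intro sum_mono) auto
        have eqs: "(\<Sum>C\<in>\<C>-{C0}. card (S' \<inter> C)) = (\<Sum>C\<in>\<C>-{C0}. card (A <#> (S' \<inter> C)))"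
          using total b0 le unfolding sp[of "\<lambda>C. card (S' \<inter> C)"] sp[of "\<lambda>C. card (A <#> (S' \<inter> C))"] by linarith
        have eachC: "card (S' \<inter> C) = card (A <#> (S' \<inter> C))" if "C \<in> \<C> - {C0}" for C
          using sum_mono_inv[OF eqs _ that] grow \<C>(1) by simp
        have full: "finite K \<and> card (S' \<inter> C) = card K" if "C \<in> \<C> - {C0}" for C
          using dich[of C] eachC[OF that] that A3 cardC by fastforce
        have "\<C> - {C0} \<noteq> {}" using c2 card_mono[of "{C0}" \<C>] by auto
        then have fK: "finite K" using full by blast
        have "(\<Sum>C\<in>\<C>-{C0}. card (S' \<inter> C)) = (card \<C> - 1) * card K" using full \<C>(1) C0 by (simp add: card_Diff_singleton)
        moreover have "1 \<le> card (S' \<inter> C0)"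
          using C0(1) rcos_self[OF _ sK] S'p by (auto simp: \<C>_def Suc_le_eq card_gt_0_iff)
        ultimately have g: "(card \<C> - 1) * card K + 1 \<le> card S" using sumS sp[of "\<lambda>C. card (S' \<inter> C)"] by simp
        have "card \<C> * card K = (card \<C> - 1) * card K + card K"
          using c2 by (cases "card \<C>") auto
        then show ?thesis using g fK cKS C0(1) by auto
      qed
      \<comment> \<open>In both cases \<open>nosub'\<close> makes K + S' everything. If A + S' = K +
        S', this contradicts the two elements missed by the atom; otherwise \<open>S'\<close> fills
        all cosets but one, which is too much for \<open>size\<close>.\<close>
      then have fK: "finite K" and le: "card (K <#> S') + 1 \<le> card K + card S" by auto
      then have KSall: "K <#> S' = carrier G" using nosub'[OF sK fK K1] by simp
      then have fG: "finite (carrier G)" using finite_set_mult fK S'p by metis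
      have "K <#> S' \<noteq> A <#> S'"
      proof
        assume "K <#> S' = A <#> S'"
        then have "card (A0 <#> S') = card (carrier G)" using KSall cAS by simp
        then have "A0 <#> S' = carrier G" using card_subset_eq[OF fG set_mult_closed[OF A0p(1) S'p(1)]] by simp
        then show False using ext[OF fG] by simp
      qed
      then have g: "(card \<C> - 1) * card K + 1 \<le> card S" using fin by blast
      have n: "card (carrier G) = card \<C> * card K" using cKS fK KSall by simp
      have "card K > 0" using fK oneK card_gt_0_iff by blast
      from coset_count_arith[OF c2 g size[OF fG] n this] show ?thesis ..
    qed
  qed
qed

end

section \<open>Weights on the quotient\<close>

text \<open>Layer-cake summation; it reduces weighted sumset inequalities to unweighted ones for
  level sets.\<close>

lemma sum_eq_sum_levels:
  fixes f :: "'b \<Rightarrow> nat"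
  assumes "finite A" "\<And>a. a \<in> A \<Longrightarrow> f a \<le> h"
  shows "sum f A = (\<Sum>j=1..h. card {a \<in> A. j \<le> f a})"
proof -
  have "f a = (\<Sum>j=1..h. of_bool (j \<le> f a))" if "a \<in> A" for a
  proof -
    have "{1..h} \<inter> {j. j \<le> f a} = {1..f a}" using assms(2)[OF that] by auto
    then show ?thesis by (simp add: sum.If_cases of_bool_def)
  qed
  then have "sum f A = (\<Sum>a\<in>A. \<Sum>j=1..h. of_bool (j \<le> f a))" by (rule sum.cong[OF refl])
  also have "\<dots> = (\<Sum>j=1..h. \<Sum>a\<in>A. of_bool (j \<le> f a))" by (rule sum.swap)
  also have "\<dots> = (\<Sum>j=1..h. card {a \<in> A. j \<le> f a})"
  proof (rule sum.cong[OF refl])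
    fix j :: nat
    have "(\<Sum>a\<in>A. (of_bool (j \<le> f a) :: nat)) = card (A \<inter> {a. j \<le> f a})"
      using assms(1) by (simp add: sum.If_cases of_bool_def)
    also have "A \<inter> {a. j \<le> f a} = {a \<in> A. j \<le> f a}" by blast
    finally show "(\<Sum>a\<in>A. (of_bool (j \<le> f a) :: nat)) = card {a \<in> A. j \<le> f a}" .
  qed
  finally show ?thesis .
qed

text \<open>
  The images of \<open>S\<close>, \<open>T\<close> in the quotient by \<open>H\<close>, weighted by the sizes \<open>\<sigma>\<close>, \<open>\<tau>\<close>, \<open>\<eta>\<close> of the fibres of
  \<open>S\<close>, \<open>T\<close>, \<open>S + T\<close>; here \<open>h\<close> is the order of \<open>H\<close>.
\<close>

locale weighted = cauchy_set +
  fixes T :: "'a set" and \<sigma> \<tau> \<eta> :: "'a \<Rightarrow> nat" and h \<mu> :: nat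
  assumes T: "T \<subseteq> carrier G" "finite T" "T \<noteq> {}"
    and sig: "\<And>s. s \<in> S \<Longrightarrow> 1 \<le> \<sigma> s \<and> \<sigma> s \<le> h"
    and tau: "\<And>a. a \<in> T \<Longrightarrow> 1 \<le> \<tau> a \<and> \<tau> a \<le> h"
    and eta_le: "\<And>y. \<eta> y \<le> h"
    and eta_sig: "\<And>s a. s \<in> S \<Longrightarrow> a \<in> T \<Longrightarrow> \<sigma> s \<le> \<eta> (s \<otimes> a)"
    and eta_tau: "\<And>s a. s \<in> S \<Longrightarrow> a \<in> T \<Longrightarrow> \<tau> a \<le> \<eta> (s \<otimes> a)"
    and full: "\<And>s a. s \<in> S \<Longrightarrow> a \<in> T \<Longrightarrow> h < \<sigma> s + \<tau> a \<Longrightarrow> \<eta> (s \<otimes> a) = h"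
    and total: "sum \<eta> (S <#> T) + \<mu> = sum \<sigma> S + sum \<tau> T"
    and mu: "\<mu> \<le> 1"
    and holes: "card S * h + \<mu> \<le> sum \<sigma> S + h"
    and S_le_T: "sum \<sigma> S \<le> sum \<tau> T"
    and nonfull: "\<exists>y\<in>S <#> T. \<eta> y < h"
    and upper: "finite (carrier G) \<Longrightarrow> 3 * sum \<eta> (S <#> T) \<le> 2 * card (carrier G) * h + 2 * \<mu>"
    and h2: "2 \<le> h"
begin

abbreviation "Y \<equiv> S <#> T"
definition "Sl j = {s \<in> S. j \<le> \<sigma> s}"
definition "Tl j = {a \<in> T. j \<le> \<tau> a}"
definition "Yl j = {y \<in> Y. j \<le> \<eta> y}"

lemma Y: "Y \<subseteq> carrier G" "finite Y" "Y \<noteq> {}"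
  using set_mult_closed S T finite_set_mult nonfull by auto

lemma S_ne: "S \<noteq> {}" using S by auto

lemma levels_finite: "finite (Sl j)" "finite (Tl j)" "finite (Yl j)" "Sl j \<subseteq> S" "Tl j \<subseteq> T" "Yl j \<subseteq> Y"
  using S T Y by (auto simp: Sl_def Tl_def Yl_def)

lemma levels_card: "card (Sl j) \<le> card S" "card (Tl j) \<le> card T" "card (Yl j) \<le> card Y"
  using card_mono[OF S(2) levels_finite(4)[of j]] card_mono[OF T(2) levels_finite(5)[of j]]
    card_mono[OF Y(2) levels_finite(6)[of j]] by auto

lemma Sl_T: "Sl j <#> T \<subseteq> Yl j"
proof -
  have "s \<otimes> a \<in> Yl j" if "s \<in> S" "j \<le> \<sigma> s" "a \<in> T" for s a
    using that eta_sig[of s a] set_multI[of s S a T] by (auto simp: Yl_def)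
  then show ?thesis by (auto simp: set_mult_def Sl_def)
qed

lemma Tl_S: "Tl j <#> S \<subseteq> Yl j"
proof -
  have "a \<otimes> s \<in> Yl j" if "s \<in> S" "j \<le> \<tau> a" "a \<in> T" for s a
  proof -
    have "a \<otimes> s = s \<otimes> a" using that S T by (auto intro: m_comm)
    then show ?thesis using that eta_tau[of s a] set_multI[of s S a T] by (auto simp: Yl_def)
  qed
  then show ?thesis by (auto simp: set_mult_def Tl_def)
qed

lemma levels_1: "Sl 1 = S" "Tl 1 = T" "Yl 1 = Y"
proof -
  show "Sl 1 = S" "Tl 1 = T" using sig tau by (auto simp: Sl_def Tl_def)
  then show "Yl 1 = Y" using Sl_T[of 1] levels_finite(6)[of 1] by (simp add: subset_antisym)
qed

lemma cauchy_Tl: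
  assumes "Tl j \<noteq> {}" "card (Yl j) < card Y"
  shows "card (Tl j) + card S \<le> card (Yl j) + 1"
proof -
  have 1: "card (Tl j <#> S) \<le> card (Yl j)" using Tl_S levels_finite by (simp add: card_mono)
  have "Tl j <#> S \<noteq> carrier G"
  proof
    assume "Tl j <#> S = carrier G"
    then have "card Y \<le> card (Tl j <#> S)" using Y finite_set_mult[OF levels_finite(2) S(2)] by (metis card_mono)
    then show False using 1 assms by linarith
  qed
  moreover have "Tl j \<subseteq> carrier G" using levels_finite(5)[of j] T by blast
  ultimately have "card (Tl j) + card S \<le> card (Tl j <#> S) + 1" using cauchy levels_finite assms by blast
  then show ?thesis using 1 by linarith
qed

text \<open>A proper level of \<open>S\<close> lacks an element, which pays for the 1 in the
  Cauchy-Davenport bound; if the level of \<open>S\<close> is all of \<open>S\<close>, that of the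
  sumset is all of \<open>Y\<close>. Summed over the levels, this meets \<open>total\<close>, whence
  the equalities of \<open>level_eq\<close>.\<close>

lemma level_ge:
  assumes big: "card S + card T \<le> card Y"
  shows "card (Sl j) + card (Tl j) \<le> card (Yl j)"
proof (cases "Tl j = {} \<or> Sl j = S")
  case True
  then show ?thesis
  proof
    assume t: "Tl j = {}"
    have "Sl j \<subseteq> carrier G" using levels_finite(4) S by blast
    then have "card (Sl j) \<le> card (Sl j <#> T)"
      using card_le_set_mult[of "Sl j" T] levels_finite T by blast
    also have "\<dots> \<le> card (Yl j)" using Sl_T levels_finite by (simp add: card_mono)
    finally show ?thesis using t by simp
  next
    assume s: "Sl j = S"
    then have "Yl j = Y" using Sl_T[of j] levels_finite(6) by auto
    then show ?thesis using s levels_card(2)[of j] big by simp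
  qed
next
  case False
  then have "card (Sl j) < card S" using levels_finite(4) S by (intro psubset_card_mono) auto
  then show ?thesis
    using cauchy_Tl[of j] False levels_card[of j] big by (cases "card (Yl j) < card Y") auto
qed

lemma sum_levels:
  "sum \<sigma> S = (\<Sum>j=1..h. card (Sl j))" "sum \<tau> T = (\<Sum>j=1..h. card (Tl j))" "sum \<eta> Y = (\<Sum>j=1..h. card (Yl j))"
  unfolding Sl_def Tl_def Yl_def
  by (rule sum_eq_sum_levels; use S T Y sig tau eta_le in blast)+

lemma level_eq:
  assumes big: "card S + card T \<le> card Y"
  shows "\<mu> = 0" "1 \<le> j \<Longrightarrow> j \<le> h \<Longrightarrow> card (Yl j) = card (Sl j) + card (Tl j)"
proof -
  have le: "(\<Sum>j=1..h. card (Sl j) + card (Tl j)) \<le> (\<Sum>j=1..h. card (Yl j))"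
    using level_ge[OF big] by (intro sum_mono) auto
  have t: "(\<Sum>j=1..h. card (Yl j)) + \<mu> = (\<Sum>j=1..h. card (Sl j) + card (Tl j))"
    using total sum_levels by (simp add: sum.distrib)
  then show "\<mu> = 0" using le by linarith
  then have eq: "(\<Sum>j=1..h. card (Sl j) + card (Tl j)) = (\<Sum>j=1..h. card (Yl j))" using t by simp
  show "card (Yl j) = card (Sl j) + card (Tl j)" if "1 \<le> j" "j \<le> h"
    using sum_mono_inv[OF eq] level_ge[OF big] that by auto
qed

text \<open>If \<open>s0\<close> alone lies below level j, all elements of \<open>Y\<close> below
  that level lie in s0 + (T - T_j). There are at most |T| - |T_j| of them, whereas
  \<open>level_eq\<close> requires one more.\<close>

lemma no_single_gap:
  assumes big: "card S + card T \<le> card Y" and j: "1 \<le> j" "j \<le> h"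
  shows "card (Sl j) + 1 \<noteq> card S"
proof
  assume c: "card (Sl j) + 1 = card S"
  have "card (S - Sl j) = 1" using c levels_finite[of j] S card_Diff_subset[of "Sl j" S] by simp
  then obtain s0 where s0: "S - Sl j = {s0}" by (auto simp: card_1_singleton_iff)
  have "Y - Yl j \<subseteq> (\<lambda>a. s0 \<otimes> a) ` (T - Tl j)"
  proof
    fix y assume y: "y \<in> Y - Yl j"
    then obtain s a where sa: "s \<in> S" "a \<in> T" "y = s \<otimes> a" by (auto simp: set_mult_iff)
    have "\<eta> y < j" using y by (auto simp: Yl_def)
    then have "s \<notin> Sl j" "a \<notin> Tl j" using eta_sig[OF sa(1,2)] eta_tau[OF sa(1,2)] sa(3) by (auto simp: Sl_def Tl_def)
    then have "s = s0" "a \<in> T - Tl j" using sa s0 by auto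
    then show "y \<in> (\<lambda>a. s0 \<otimes> a) ` (T - Tl j)" using sa(3) by blast
  qed
  then have "card (Y - Yl j) \<le> card (T - Tl j)" using T by (meson card_image_le card_mono finite_Diff finite_imageI order_trans)
  moreover have "card (Y - Yl j) = card Y - card (Yl j)" "card (T - Tl j) = card T - card (Tl j)"
    using levels_finite[of j] by (simp_all add: card_Diff_subset)
  moreover have "card Y = card S + card T" using level_eq(2)[OF big, of 1] levels_1 h2 by simp
  moreover have "card (Yl j) = card (Sl j) + card (Tl j)" using level_eq(2)[OF big j] .
  ultimately show False using c levels_card(2)[of j] by linarith
qed

text \<open>Let \<open>q\<close> be the least weight on \<open>S\<close>. Level equality at
  \<open>q\<close> makes all weights on \<open>T\<close> at least \<open>q\<close>; above
  \<open>q\<close> at least two elements of \<open>S\<close> are lost, and a nonempty level of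
  \<open>T\<close> would contradict Cauchy-Davenport. A non-full element of \<open>Y\<close> gives
  2q \<le> h, so two elements of weight \<open>q\<close> already exhaust the total deficit
  \<open>h\<close> allowed by \<open>holes\<close>.\<close>

lemma large_structure:
  assumes big: "card S + card T \<le> card Y"
  obtains s0 s1 q where "s0 \<in> S" "s1 \<in> S" "s0 \<noteq> s1" "h = 2 * q" "\<sigma> s0 = q" "\<sigma> s1 = q"
    "\<And>s. s \<in> S \<Longrightarrow> s \<noteq> s0 \<Longrightarrow> s \<noteq> s1 \<Longrightarrow> \<sigma> s = h" "\<And>a. a \<in> T \<Longrightarrow> \<tau> a = q"
    "\<And>y. y \<in> Y \<Longrightarrow> \<eta> y = q \<or> \<eta> y = h" "card {y \<in> Y. \<eta> y = q} = card T + 2"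
    "\<mu> = 0" "card Y = card S + card T"
proof -
  note leq = level_eq[OF big]
  have cY: "card Y = card S + card T" using leq(2)[of 1] levels_1 h2 by simp
  define q where "q = Min (\<sigma> ` S)"
  have q_le: "q \<le> \<sigma> s" if "s \<in> S" for s using that S by (simp add: q_def)
  have "q \<in> \<sigma> ` S" unfolding q_def using S S_ne by (intro Min_in) auto
  then obtain sm where sm: "sm \<in> S" "\<sigma> sm = q" by auto
  have q1: "1 \<le> q" "q \<le> h" using sig[OF sm(1)] sm by auto
  have "Sl q = S" using q_le by (auto simp: Sl_def)
  moreover from this have "Yl q = Y" using Sl_T[of q] levels_finite(6) by auto
  ultimately have "card (Tl q) = card T" using leq(2)[OF q1] cY by simp
  then have "Tl q = T" using card_subset_eq[OF T(2) levels_finite(5)] by simp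
  then have tau_ge: "q \<le> \<tau> a" if "a \<in> T" for a using that by (auto simp: Tl_def)
  obtain y0 where y0: "y0 \<in> Y" "\<eta> y0 < h" using nonfull by blast
  then obtain s' a' where sa: "s' \<in> S" "a' \<in> T" "y0 = s' \<otimes> a'" by (auto simp: set_mult_iff)
  have "\<sigma> s' + \<tau> a' \<le> h" using full[OF sa(1,2)] y0 sa(3) by force
  then have qq: "2 * q \<le> h" using q_le[OF sa(1)] tau_ge[OF sa(2)] by linarith
  have qh: "q < h" using qq q1 by linarith
  have small: "card (Sl j) + 2 \<le> card S" if "q < j" "j \<le> h" for j
  proof -
    have "sm \<notin> Sl j" using sm that by (auto simp: Sl_def)
    then have "card (Sl j) < card S" using levels_finite(4)[of j] sm S by (intro psubset_card_mono) auto
    moreover have "card (Sl j) + 1 \<noteq> card S" using no_single_gap[OF big] that q1 by auto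
    ultimately show ?thesis by linarith
  qed
  have empty: "Tl j = {}" if j: "q < j" "j \<le> h" for j
  proof (rule ccontr)
    assume ne: "Tl j \<noteq> {}"
    have e: "card (Yl j) = card (Sl j) + card (Tl j)" using leq(2)[of j] j q1 by simp
    then have "card (Yl j) < card Y" using small[OF j] cY levels_card(2)[of j] by linarith
    then show False using cauchy_Tl[OF ne] e small[OF j] by linarith
  qed
  have tau_eq: "\<tau> a = q" if "a \<in> T" for a
  proof (rule ccontr)
    assume "\<tau> a \<noteq> q"
    then have "a \<in> Tl (q + 1)" using tau_ge[OF that] that by (auto simp: Tl_def)
    then show False using empty[of "q + 1"] qh by simp
  qed
  define B where "B = S - Sl (q + 1)"
  have B: "B \<subseteq> S" "finite B" using S by (auto simp: B_def)
  have Bq: "\<sigma> s = q" if "s \<in> B" for s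
    using q_le[of s] that by (auto simp: B_def Sl_def)
  have cB: "card B + card (Sl (q + 1)) = card S"
    using card_Diff_subset[of "Sl (q+1)" S] levels_finite[of "q+1"] levels_card(1)[of "q+1"] by (simp add: B_def)
  have B2: "2 \<le> card B" using small[of "q + 1"] cB qh by linarith
  have split: "sum \<sigma> S = card B * q + sum \<sigma> (Sl (q + 1))"
  proof -
    have "sum \<sigma> S = sum \<sigma> (Sl (q + 1)) + sum \<sigma> B"
      using sum.subset_diff[of "Sl (q+1)" S \<sigma>] levels_finite[of "q+1"] S by (simp add: B_def add.commute)
    moreover have "sum \<sigma> B = card B * q" using Bq by simp
    ultimately show ?thesis by simp
  qed
  have rest_le: "sum \<sigma> (Sl (q + 1)) \<le> card (Sl (q + 1)) * h"
    using sum_bounded_above[of "Sl (q+1)" \<sigma> h] sig levels_finite(4)[of "q+1"] by auto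
  have Sh: "card S * h = card B * h + card (Sl (q + 1)) * h" using cB by (metis add_mult_distrib)
  have a1: "card B * h \<le> card B * q + h" using holes split rest_le Sh by linarith
  have "2 * (card B * q) \<le> card B * h" using mult_le_mono2[OF qq, of "card B"] by (simp add: mult.left_commute)
  then have a2: "card B * h \<le> 2 * h" using a1 by linarith
  then have cB2: "card B = 2" using B2 qh by simp
  then have hq: "h = 2 * q" using a1 qq by simp
  have "card (Sl (q + 1)) * h \<le> sum \<sigma> (Sl (q + 1))" using holes split Sh cB2 hq by simp
  then have "sum \<sigma> (Sl (q + 1)) = (\<Sum>s\<in>Sl (q + 1). h)" using rest_le by simp
  then have rest: "\<sigma> s = h" if "s \<in> Sl (q + 1)" for s
    using sum_mono_inv[of \<sigma> "Sl (q+1)" "\<lambda>_. h" s] that sig levels_finite[of "q+1"] by auto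
  obtain s0 s1 where s01: "B = {s0, s1}" "s0 \<noteq> s1" using cB2 by (auto simp: card_2_iff)
  have Sother: "\<sigma> s = h" if "s \<in> S" "s \<noteq> s0" "s \<noteq> s1" for s
    using rest[of s] that s01 by (auto simp: B_def)
  \<comment> \<open>No weight on \<open>S\<close> lies strictly between \<open>q\<close> and
    \<open>h\<close>, so level equality excludes such weights on \<open>Y\<close> as well.\<close>
  have "Sl h = Sl (q + 1)" using rest qh by (auto simp: Sl_def)
  then have "card (Yl h) = card (Yl (q + 1))"
    using leq(2)[of h] leq(2)[of "q+1"] empty[of h] empty[of "q+1"] qh q1 by simp
  moreover have "Yl h \<subseteq> Yl (q + 1)" using qh by (auto simp: Yl_def)
  ultimately have "Yl h = Yl (q + 1)" using card_subset_eq levels_finite by metis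
  have Yge: "Yl q = Y" using \<open>Yl q = Y\<close> .
  have ye: "\<eta> y = q \<or> \<eta> y = h" if "y \<in> Y" for y
  proof (cases "y \<in> Yl h")
    case True
    then show ?thesis using eta_le[of y] by (auto simp: Yl_def)
  next
    case False
    then have "y \<notin> Yl (q + 1)" "y \<in> Yl q" using \<open>Yl h = Yl (q + 1)\<close> Yge that by auto
    then show ?thesis by (auto simp: Yl_def)
  qed
  have "{y \<in> Y. \<eta> y = q} = Y - Yl h" using ye qh by (auto simp: Yl_def)
  then have "card {y \<in> Y. \<eta> y = q} = card Y - card (Yl h)" using levels_finite[of h] card_Diff_subset by simp
  moreover have "card (Yl h) + 2 = card S"
    using leq(2)[of h] empty[of h] qh q1 cB cB2 \<open>Sl h = Sl (q + 1)\<close> by simp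
  ultimately have "card {y \<in> Y. \<eta> y = q} = card T + 2" using cY by simp
  then show ?thesis
    using that[of s0 s1 q] s01 B Bq Sother tau_eq ye leq(1) cY hq by blast
qed

end

text \<open>\<open>n\<close> is the order of the quotient, \<open>v\<close> is |S| - 1, and h - e
  and h - e - d are the largest and the smallest weight on S; \<open>ed\<close> comes from
  \<open>holes\<close> and \<open>ub\<close> from the upper bound on the sumset. Eliminating
  \<open>d\<close> leaves an inequality quadratic in \<open>v\<close>, whose term 2v - v * v is at
  most -3 for v \<ge> 3, too small for the left side.\<close>

lemma covering_arith:
  fixes n t v h e d w \<mu> :: int
  assumes n: "n = 3 * v + w" "w \<ge> 0" and v: "v \<ge> 2" and mu: "0 \<le> \<mu>" and h: "h \<ge> 2" and e: "e \<ge> 1"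
    and d: "d \<ge> 0" and ed: "(v + 1) * e + d + \<mu> \<le> h"
    and ub: "n * h \<le> 3 * n * e + 3 * v * d + 2 * \<mu>"
  shows "v = 2" "\<mu> = 0" "w * (h - 3 * e) = 0" "3 * e + d = h"
proof -
  have "3 * v * d \<le> 3 * v * (h - \<mu> - (v + 1) * e)" using ed v by (intro mult_left_mono) auto
  then have "n * h \<le> 3 * n * e + 3 * v * (h - \<mu> - (v + 1) * e) + 2 * \<mu>" using ub by linarith
  then have key: "w * h + (3 * v - 2) * \<mu> \<le> 3 * e * (w + 2 * v - v * v)"
    unfolding n by (simp add: algebra_simps)
  have nn: "0 \<le> (3 * v - 2) * \<mu>" using v mu by simp
  show v2: "v = 2"
  proof (rule ccontr)
    assume "v \<noteq> 2"
    then have v3: "v \<ge> 3" using v by simp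
    have "(v - 3) * (v + 1) \<ge> 0" using v3 by simp
    then have "2 * v - v * v \<le> -3" by (simp add: algebra_simps)
    then have "3 * e * (w + 2 * v - v * v) \<le> 3 * e * (w - 3)" using e by (intro mult_left_mono) auto
    then have k2: "w * h \<le> 3 * e * (w - 3)" using key nn by linarith
    show False
    proof (cases "w \<ge> 3")
      case True
      have "4 * e \<le> (v + 1) * e" using v3 e by (intro mult_right_mono) auto
      then have "4 * e \<le> h" using ed d mu by linarith
      then have "4 * e * (w - 3) \<le> h * (w - 3)" using True by (intro mult_right_mono) auto
      moreover have "3 * e * (w - 3) \<le> 4 * e * (w - 3)" using True e by (intro mult_right_mono) auto
      ultimately have "w * h \<le> h * (w - 3)" using k2 by linarith
      then show False using h by (simp add: algebra_simps)
    next
      case False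
      then have "3 * e * (w - 3) < 0" using e by (simp add: mult_pos_neg)
      moreover have "0 \<le> w * h" using n h by simp
      ultimately show False using k2 by linarith
    qed
  qed
  have k: "w * (h - 3 * e) + 4 * \<mu> \<le> 0" using key unfolding v2 by (simp add: algebra_simps)
  have e3: "3 * e + d + \<mu> \<le> h" using ed unfolding v2 by simp
  have "0 \<le> w * (h - 3 * e)" using e3 d mu n by simp
  then show "\<mu> = 0" "w * (h - 3 * e) = 0" using k mu by linarith+
  then have "w * h = 3 * (w * e)" by (simp only: right_diff_distrib)
  moreover have "n * h = 6 * h + w * h" "3 * n * e = 18 * e + 3 * (w * e)" "3 * v * d = 6 * d"
    unfolding n v2 by (simp_all add: algebra_simps)
  ultimately have "6 * h \<le> 18 * e + 6 * d" using ub \<open>\<mu> = 0\<close> by linarith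
  then show "3 * e + d = h" using e3 mu by linarith
qed

context weighted
begin

text \<open>The translate of \<open>T\<close> by a heaviest element of \<open>S\<close> consists of
  elements of weight at least \<open>M\<close>, and all others have weight at least
  \<open>m\<close>. Against the upper bound and \<open>holes\<close> this is possible only for |S| =
  3 and a group of order 6, with constant weights on \<open>S\<close> and \<open>Y\<close>;
  \<open>constant_weights\<close> later rules this out.\<close>

lemma covering:
  assumes cov: "Y = carrier G" and small: "card Y + 1 \<le> card S + card T" and u: "3 \<le> card S"
  obtains s0 s1 c where "s0 \<in> S" "s1 \<in> S" "s0 \<noteq> s1" "\<sigma> s0 = c" "\<sigma> s1 = c"
    "\<And>y. y \<in> carrier G \<Longrightarrow> \<eta> y = c" "T = carrier G"
proof -
  define n t v where "n = card (carrier G)" and "t = card T" and "v = card S - 1"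
  have fG: "finite (carrier G)" using cov Y by simp
  have tn: "t \<le> n" using card_mono[OF fG T(1)] by (simp add: t_def n_def)
  have v: "card S = v + 1" "2 \<le> v" using u by (auto simp: v_def)
  have nv: "3 * v \<le> n" using size[OF fG] v by (simp add: n_def)
  have nt: "n \<le> v + t" using small cov v by (simp add: n_def t_def)
  define M m where "M = Max (\<sigma> ` S)" and "m = Min (\<sigma> ` S)"
  have le: "\<sigma> s \<le> M" "m \<le> \<sigma> s" if "s \<in> S" for s using that S by (auto simp: M_def m_def)
  have "M \<in> \<sigma> ` S" "m \<in> \<sigma> ` S" unfolding M_def m_def using S S_ne by (auto intro!: Max_in Min_in)
  then obtain sM sm where sM: "sM \<in> S" "\<sigma> sM = M" and sm: "sm \<in> S" "\<sigma> sm = m" by auto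
  have m1: "1 \<le> m" "m \<le> M" "M \<le> h" using sig sM sm le by auto
  define A where "A = (\<lambda>a. sM \<otimes> a) ` T"
  have sMc: "sM \<in> carrier G" using sM S by blast
  have A: "A \<subseteq> carrier G" "card A = t" "finite A"
    using T sMc unfolding A_def t_def by (auto intro!: card_image inj_onI simp: subset_iff)
  have etaA: "M \<le> \<eta> y" if "y \<in> A" for y using that eta_sig[OF sM(1)] sM(2) by (auto simp: A_def)
  have etam: "m \<le> \<eta> y" if y: "y \<in> carrier G" for y
  proof -
    obtain s a where "s \<in> S" "a \<in> T" "y = s \<otimes> a" using y unfolding cov[symmetric] set_mult_iff by blast
    then show ?thesis using eta_sig[of s a] le(2)[of s] by simp
  qed
  have splitY: "sum \<eta> Y = sum \<eta> A + sum \<eta> (carrier G - A)"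
    using sum.subset_diff[OF A(1) fG, of \<eta>] cov by simp
  have cD: "card (carrier G - A) = n - t" using card_Diff_subset[OF A(3,1)] A(2) by (simp add: n_def)
  have sA: "t * M \<le> sum \<eta> A" using sum_bounded_below[of A M \<eta>] etaA A by simp
  have sD: "(n - t) * m \<le> sum \<eta> (carrier G - A)"
    using sum_bounded_below[of "carrier G - A" m \<eta>] etam cD by simp
  have up: "3 * sum \<eta> Y \<le> 2 * (n * h) + 2 * \<mu>" using upper[OF fG] by (simp add: n_def)
  have low: "t * M + (n - t) * m \<le> sum \<eta> Y" using sA sD splitY by linarith
  have sumS: "sum \<sigma> S \<le> m + v * M"
  proof -
    have "sum \<sigma> S = \<sigma> sm + sum \<sigma> (S - {sm})" using sum.remove[OF S(2) sm(1), of \<sigma>] by simp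
    also have "sum \<sigma> (S - {sm}) \<le> card (S - {sm}) * M" using sum_bounded_above[of "S - {sm}" \<sigma> M] le(1) by simp
    also have "card (S - {sm}) = v" using sm S by (simp add: v_def)
    finally show ?thesis using sm by simp
  qed
  have hol: "v * h + \<mu> \<le> m + v * M" using holes sumS unfolding v(1) by (simp add: algebra_simps)
  \<comment> \<open>A full element of \<open>S\<close> makes at least |T| \<ge> 2n / 3 elements of
    the sumset full, which nearly exhausts the upper bound; what remains exceeds it.\<close>
  have Mh: "M < h"
  proof (rule ccontr)
    assume "\<not> M < h"
    then have Meq: "M = h" using m1 by simp
    have "3 * (t * h) + 3 * ((n - t) * m) \<le> 2 * (n * h) + 2 * \<mu>" using low up unfolding Meq by linarith
    moreover have "2 * n \<le> 3 * t" using nt nv by linarith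
    then have "2 * (n * h) \<le> 3 * (t * h)" by (metis mult.assoc mult_le_mono1)
    ultimately have a: "3 * ((n - t) * m) \<le> 2 * \<mu>" "3 * (t * h) \<le> 2 * (n * h) + 2 * \<mu>" by linarith+
    show False
    proof (cases "t = n")
      case True
      then have "n * h \<le> 2 * \<mu>" using a(2) by (simp add: mult.commute)
      moreover have "n \<ge> 6" using nv v by linarith
      then have "6 * h \<le> n * h" by (rule mult_le_mono1)
      ultimately show False using mu h2 by linarith
    next
      case False
      then have "1 \<le> (n - t) * m" using tn m1 by (simp add: Suc_le_eq)
      then show False using a(1) mu by linarith
    qed
  qed
  define e d where "e = int h - int M" and "d = int M - int m"
  have e1: "e \<ge> 1" and d0: "d \<ge> 0" using Mh m1 by (auto simp: e_def d_def)
  have Mi: "int M = int h - e" "int m = int h - e - d" by (auto simp: e_def d_def)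
  have ed: "(int v + 1) * e + d + int \<mu> \<le> int h"
  proof -
    have "int v * int h + int \<mu> \<le> int m + int v * int M" using hol by (metis of_nat_add of_nat_le_iff of_nat_mult)
    then show ?thesis unfolding Mi by (simp add: algebra_simps)
  qed
  have nti: "int (n - t) = int n - int t" using tn by simp
  have lowi: "int t * int M + (int n - int t) * int m \<le> int (sum \<eta> Y)"
    using low nti by (metis of_nat_add of_nat_le_iff of_nat_mult)
  have upi: "3 * int (sum \<eta> Y) \<le> 2 * (int n * int h) + 2 * int \<mu>"
  proof -
    have "int (3 * sum \<eta> Y) \<le> int (2 * (n * h) + 2 * \<mu>)" using up by (simp only: of_nat_le_iff)
    then show ?thesis by simp
  qed
  have ntd: "(int n - int t) * d \<le> int v * d" using nt d0 by (intro mult_right_mono) auto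
  have ub: "int n * int h \<le> 3 * int n * e + 3 * int v * d + 2 * int \<mu>"
  proof -
    have "int t * int M + (int n - int t) * int m = int n * int h - int n * e - (int n - int t) * d"
      unfolding Mi by (simp add: algebra_simps)
    then show ?thesis using lowi upi ntd by linarith
  qed
  define w where "w = int n - 3 * int v"
  have w: "int n = 3 * int v + w" "w \<ge> 0" using nv by (auto simp: w_def)
  note ca = covering_arith[OF w _ _ _ e1 d0 ed ub]
  have v2: "int v = 2" and mu0: "int \<mu> = 0" and we: "w * (int h - 3 * e) = 0" and h3: "3 * e + d = int h"
    using ca v h2 by auto
  have n6: "int n = 6 + w" using w v2 by simp
  text \<open>All the inequalities used above are now equalities.\<close>
  have wh: "w * int h = 3 * (w * e)" using we by (simp add: algebra_simps)
  have "int t * int M + (int n - int t) * int m = int n * int h - int n * e - (int n - int t) * d"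
    unfolding Mi by (simp add: algebra_simps)
  moreover have "int n * e = 6 * e + w * e" "int n * int h = 6 * int h + w * int h"
    unfolding n6 by (simp_all add: algebra_simps)
  ultimately have ge: "2 * (int n * int h) \<le> 3 * (int t * int M + (int n - int t) * int m)"
    using ntd v2 h3 wh by simp
  then have sumY: "3 * int (sum \<eta> Y) = 2 * (int n * int h)"
    and low_eq: "int (sum \<eta> Y) = int t * int M + (int n - int t) * int m"
  proof -
    have "3 * E = 2 * N \<and> E = P" if "2 * N \<le> 3 * P" "P \<le> E" "3 * E \<le> 2 * N" for P E N :: int
      using that by linarith
    from this[OF ge lowi] show "3 * int (sum \<eta> Y) = 2 * (int n * int h)"
      and "int (sum \<eta> Y) = int t * int M + (int n - int t) * int m" using upi mu0 by simp_all
  qed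
  have "sum \<eta> Y = t * M + (n - t) * m"
  proof -
    have "int (sum \<eta> Y) = int (t * M + (n - t) * m)" using low_eq nti by simp
    then show ?thesis by (simp only: of_nat_eq_iff)
  qed
  then have "sum \<eta> A = t * M" using sA sD splitY by linarith
  then have eqA: "(\<Sum>y\<in>A. M) = sum \<eta> A" using A by simp
  have etaM: "\<eta> y = M" if "y \<in> A" for y
    using sum_mono_inv[OF eqA _ that A(3)] etaA by simp
  have tau_le: "int (\<tau> a) \<le> e" if "a \<in> T" for a
  proof -
    have "\<eta> (sM \<otimes> a) = M" using etaM that by (auto simp: A_def)
    then have "\<sigma> sM + \<tau> a \<le> h" using full[OF sM(1) that] Mh by force
    then show ?thesis using sM by (simp add: e_def)
  qed
  have sumT: "int (sum \<tau> T) \<le> int t * e"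
  proof -
    have "int (sum \<tau> T) = (\<Sum>a\<in>T. int (\<tau> a))" by simp
    also have "\<dots> \<le> of_nat (card T) * e" using tau_le by (intro sum_bounded_above)
    finally show ?thesis by (simp add: t_def)
  qed
  have S2: "int (sum \<sigma> S) = 2 * int h"
  proof -
    have "2 * h \<le> sum \<sigma> S" using holes v v2 by simp
    moreover have "int (sum \<sigma> S) \<le> int m + int v * int M" using sumS by (metis of_nat_add of_nat_le_iff of_nat_mult)
    then have "int (sum \<sigma> S) \<le> 2 * int h" unfolding v2 Mi using h3 by simp
    ultimately show ?thesis by linarith
  qed
  have tot: "int (sum \<eta> Y) = int (sum \<sigma> S) + int (sum \<tau> T)" using total mu0 by simp
  have nth: "3 * (int t * e) \<le> int n * int h"
  proof -
    have "int t * (3 * e) \<le> int n * int h" using tn h3 d0 e1 by (intro mult_mono) auto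
    then show ?thesis by (simp add: algebra_simps)
  qed
  have "int n * int h \<le> 6 * int h" using sumY tot S2 sumT nth by linarith
  then have "int n \<le> 6" using h2 by simp
  then have n: "int n = 6" "w = 0" using n6 w by auto
  have te: "6 * e \<ge> 2 * int h \<and> int t = 6 \<and> 3 * e = int h"
  proof -
    have a: "2 * int h \<le> int t * e" using S_le_T S2 sumT by linarith
    have b: "int t * e \<le> 6 * e" using tn n e1 by (intro mult_right_mono) auto
    have c: "3 * e \<le> int h" using h3 d0 by simp
    have d: "6 * e = 2 * int h" using a b c by linarith
    then have "6 * e \<le> int t * e" using a by simp
    then have "6 \<le> int t" using e1 by simp
    then show ?thesis using d tn n by simp
  qed
  then have d0': "d = 0" using h3 by simp
  then have Mm: "M = m" by (simp add: d_def)
  have Tall: "T = carrier G" using card_subset_eq[OF fG T(1)] te n by (simp add: t_def n_def)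
  have "A = carrier G" using card_subset_eq[OF fG A(1)] A(2) te n by (simp add: n_def)
  then have all: "\<eta> y = M" if "y \<in> carrier G" for y using etaM that by simp
  have sg: "\<sigma> s = M" if "s \<in> S" for s using le[OF that] Mm by simp
  obtain s0 s1 where "s0 \<in> S" "s1 \<in> S" "s0 \<noteq> s1"
    using S(5) by (metis One_nat_def S(2) card_le_Suc0_iff_eq not_less_eq_eq numeral_2_eq_2)
  then show ?thesis using that sg all Tall by blast
qed

end

section \<open>Sumsets that miss one element of the quotient\<close>

lemma (in group) mult_inv_eq_iff:
  assumes "c \<in> carrier G" "s \<in> carrier G" "t \<in> carrier G"
  shows "c \<otimes> inv s = c \<otimes> inv t \<longleftrightarrow> s = t"
  using assms by (metis inv_closed inv_inv Units_l_cancel Units_eq)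

text \<open>All quantities are deficits from \<open>h\<close>: \<open>e0\<close> \<ge>
  \<open>e1\<close> \<ge> \<open>em\<close> on S, and the sums \<open>Es\<close>, \<open>Fs\<close>,
  \<open>Gs\<close> over S, T, S + T. \<open>k\<close> counts the non-full elements represented
  through the element of deficit \<open>em\<close>; each of them costs T a deficit of h - em. This
  yields 2k \<le> v, hence 2 Gs \<le> v h, which is too little for the lower bound on
  \<open>Gs\<close>.\<close>

lemma near_covering_arith_large:
  fixes k v h em e1 e0 Gs Fs Es \<mu> n :: int
  assumes "Gs \<le> k * em + v * e1" "k * (h - em) \<le> Fs" "Fs = h + Gs - Es - \<mu>"
    "e0 + e1 + (v - 1) * em \<le> Es" "Es \<le> h - \<mu>" "0 \<le> em" "em \<le> e1" "e1 \<le> e0"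
    "(n - 3) * h - 2 * \<mu> \<le> 3 * Gs" "3 * v \<le> n" "v \<ge> 3" "0 \<le> k" "2 \<le> h" "0 \<le> \<mu>" "\<mu> \<le> 1"
  shows False
proof -
  have e1: "2 * e1 + (v - 1) * em \<le> h - \<mu>" using assms by linarith
  have "4 * em \<le> (v + 1) * em" using assms by (intro mult_right_mono) auto
  also have "\<dots> = (v - 1) * em + 2 * em" by (simp add: algebra_simps)
  finally have em4: "4 * em \<le> h" using e1 assms by linarith
  have "2 * em \<le> (v - 1) * em" using assms by (intro mult_right_mono) auto
  then have b: "h - \<mu> - (v - 1) * em \<le> h - 2 * em" using assms by linarith
  have vb: "v * (h - \<mu> - (v - 1) * em) \<le> v * (h - 2 * em)" using b assms by (intro mult_left_mono) auto
  have "(v - 2) * (2 * e1) \<le> (v - 2) * (h - \<mu> - (v - 1) * em)" using e1 assms by (intro mult_left_mono) auto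
  then have ve: "2 * (v * e1) \<le> 4 * e1 + v * (h - \<mu> - (v - 1) * em) - (2 * h - 2 * \<mu> - 2 * ((v - 1) * em))"
    by (simp add: algebra_simps)
  have "k * (h - em) = k * (h - 2 * em) + k * em" by (simp add: algebra_simps)
  then have kk: "k * (h - 2 * em) \<le> h + v * e1 - Es - \<mu>" using assms by linarith
  have "2 * (k * (h - 2 * em)) \<le> v * (h - \<mu> - (v - 1) * em)"
  proof -
    have "2 * a \<le> vX" if "a \<le> h + b - Es - \<mu>" "2 * b \<le> 4 * e1 + vX - (2 * h - 2 * \<mu> - 2 * P)" "e0 + e1 + P \<le> Es"
      for a b vX P using that assms(8) by linarith
    from this[OF kk ve assms(4)] show ?thesis .
  qed
  then have "(2 * k) * (h - 2 * em) \<le> v * (h - 2 * em)" using vb by linarith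
  moreover have "h - 2 * em > 0" using em4 assms by linarith
  ultimately have "2 * k \<le> v" by simp
  then have "2 * k * em \<le> v * em" using assms by (intro mult_right_mono) auto
  moreover have "v * (2 * e1) \<le> v * (h - (v - 1) * em)" using e1 assms by (intro mult_left_mono) auto
  moreover have "v * (h - (v - 1) * em) \<le> v * (h - em)"
  proof -
    have "1 * em \<le> (v - 1) * em" using assms by (intro mult_right_mono) auto
    then show ?thesis using assms by (intro mult_left_mono) auto
  qed
  moreover have "v * (h - em) = v * h - v * em" by (simp add: algebra_simps)
  ultimately have "2 * Gs \<le> v * h" using assms(1) by linarith
  moreover have "(3 * v - 3) * h \<le> (n - 3) * h" using assms by (intro mult_right_mono) auto
  moreover have "(3 * v - 3) * h = 3 * (v * h) - 3 * h" by (simp add: algebra_simps)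
  moreover have "3 * h \<le> v * h" using assms by (intro mult_right_mono) auto
  ultimately show False using assms by linarith
qed

text \<open>The case v = 2, where that estimate is too weak. The additional input \<open>alt\<close>
  concerns the at most two non-full elements not represented through the element of deficit
  \<open>em\<close>.\<close>

lemma near_covering_arith_3:
  fixes k h em e1 e0 Gs Fs Es \<mu> n :: int
  assumes "k * (h - em) \<le> Fs" "Fs = h + Gs - Es - \<mu>"
    "e0 + e1 + em \<le> Es" "Es \<le> h - \<mu>" "0 \<le> em" "em \<le> e1" "e1 \<le> e0"
    "(n - 3) * h - 2 * \<mu> \<le> 3 * Gs" "6 \<le> n" "0 \<le> k" "2 \<le> h" "0 \<le> \<mu>" "\<mu> \<le> 1"
    and alt: "Gs \<le> k * em + e1 \<or> Gs \<le> k * em + 2 * e1 \<and> 3 * h - e0 - 2 * e1 \<le> Fs"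
  shows False
proof -
  have em3: "3 * em \<le> h - \<mu>" using assms by linarith
  have "k * (h - em) = k * (h - 2 * em) + k * em" by (simp add: algebra_simps)
  then have kk: "k * (h - 2 * em) + k * em \<le> h + Gs - Es - \<mu>" using assms by linarith
  have k2: "2 * h - 4 * em \<le> k * (h - 2 * em)" if "2 \<le> k"
    using mult_right_mono[OF that, of "h - 2 * em"] em3 assms by simp
  have k3: "3 * h - 6 * em \<le> k * (h - 2 * em)" if "3 \<le> k"
    using mult_right_mono[OF that, of "h - 2 * em"] em3 assms by simp
  have "3 * h \<le> (n - 3) * h" using assms by (intro mult_right_mono) auto
  then have G: "3 * h - 2 * \<mu> \<le> 3 * Gs" using assms by linarith
  have kem1: "k * em \<le> em" if "k \<le> 1" using mult_right_mono[OF that, of em] assms by simp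
  from alt show False
  proof
    assume a: "Gs \<le> k * em + e1"
    have "k \<le> 1"
    proof (rule ccontr)
      assume "\<not> k \<le> 1"
      then have "2 \<le> k" by simp
      moreover from this have "2 * em \<le> k * em" using assms by (intro mult_right_mono) auto
      ultimately show False using k2 kk a em3 assms by linarith
    qed
    then show False using kem1 a G em3 assms by linarith
  next
    assume a: "Gs \<le> k * em + 2 * e1 \<and> 3 * h - e0 - 2 * e1 \<le> Fs"
    have "k \<le> 2"
    proof (rule ccontr)
      assume "\<not> k \<le> 2"
      then have "3 \<le> k" by simp
      then show False using k3 kk a em3 assms by linarith
    qed
    then have "k * em \<le> 2 * em" using assms by (intro mult_right_mono) auto
    then show False using a em3 assms by linarith
  qed
qed

context weighted
begin

text \<open>
  If \<open>S + T\<close> misses exactly one coset, then \<open>T\<close> is the complement of a reflection of \<open>S\<close>, so that every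
  other coset is represented at least twice when \<open>S\<close> is not a progression.
\<close>

lemma near_covering:
  assumes fG: "finite (carrier G)" and miss: "card Y + 1 = card (carrier G)" and cY: "card Y + 1 = card S + card T"
    and u: "3 \<le> card S" and ov: "\<And>z. z \<in> carrier G \<Longrightarrow> z \<noteq> \<one> \<Longrightarrow> card (S \<inter> (S #> z)) + 2 \<le> card S"
  shows False
proof -
  have Sc: "s \<in> carrier G" if "s \<in> S" for s using that S by blast
  have Tc: "a \<in> carrier G" if "a \<in> T" for a using that T by blast
  have "card (carrier G - Y) = 1" using miss card_Diff_subset[OF Y(2,1)] by simp
  then obtain c where c: "carrier G - Y = {c}" by (auto simp: card_1_singleton_iff)
  then have cc: "c \<in> carrier G" and cY': "c \<notin> Y" by auto
  define R where "R = (\<lambda>s. c \<otimes> inv s) ` S"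
  have Rc: "R \<subseteq> carrier G" "finite R" using cc Sc S by (auto simp: R_def)
  have cR: "card R = card S"
    unfolding R_def using cc Sc mult_inv_eq_iff by (intro card_image inj_onI) blast
  have disj: "a \<notin> R" if a: "a \<in> T" for a
  proof
    assume "a \<in> R"
    then obtain s where s: "s \<in> S" "a = c \<otimes> inv s" by (auto simp: R_def)
    then have "s \<otimes> a = c" using cc Sc mult_inv_cancel by simp
    then show False using set_multI[OF s(1) a] cY' by simp
  qed
  have "card (carrier G - R) = card T" using card_Diff_subset[OF Rc(2,1)] cR miss cY by simp
  moreover have "T \<subseteq> carrier G - R" using disj T(1) by auto
  ultimately have Teq: "T = carrier G - R"
    using card_subset_eq[of "carrier G - R" T] fG by simp
  have solve: "s \<otimes> (y \<otimes> inv s) = y" if "s \<in> S" "y \<in> carrier G" for s y using that Sc mult_inv_cancel by simp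
  have notT: "\<exists>s'\<in>S. y \<otimes> inv s = c \<otimes> inv s'" if "y \<in> carrier G" "s \<in> S" "y \<otimes> inv s \<notin> T" for y s
    using that Sc unfolding Teq R_def by auto
  \<comment> \<open>If y - s is not in T, it equals c - s' for some s' in S, so s also lies in the
    translate of S by y - c. By \<open>ov\<close> at least two elements of S are not of this
    kind.\<close>
  have two: "2 \<le> card {s \<in> S. y \<otimes> inv s \<in> T}" if y: "y \<in> carrier G" "y \<noteq> c" for y
  proof -
    let ?z = "y \<otimes> inv c"
    have z: "?z \<in> carrier G" "?z \<noteq> \<one>" using y cc by (auto simp: inv_equality[symmetric]) (metis inv_closed inv_equality inv_inv)
    have "{s \<in> S. y \<otimes> inv s \<notin> T} \<subseteq> S \<inter> (S #> ?z)"
    proof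
      fix s assume "s \<in> {s \<in> S. y \<otimes> inv s \<notin> T}"
      then obtain s' where s: "s \<in> S" "s' \<in> S" "y \<otimes> inv s = c \<otimes> inv s'" using notT y by blast
      have sc: "s \<in> carrier G" "s' \<in> carrier G" using s Sc by auto
      have ys: "y = s \<otimes> (c \<otimes> inv s')" using solve[OF s(1) y(1)] unfolding s(3) by simp
      have "y = (s \<otimes> inv s') \<otimes> c" unfolding ys using sc cc by (simp add: m_ac)
      then have "?z = s \<otimes> inv s'" using sc cc mult_inv_cancel(3) by simp
      then have "s' \<otimes> ?z = s" using sc mult_inv_cancel(1) by simp
      then show "s \<in> S \<inter> (S #> ?z)" using s(1,2) by (metis Int_iff r_coset_iff)
    qed
    then have "card {s \<in> S. y \<otimes> inv s \<notin> T} \<le> card (S \<inter> (S #> ?z))" using S by (intro card_mono) auto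
    then have "card {s \<in> S. y \<otimes> inv s \<notin> T} + 2 \<le> card S" using ov[OF z] by linarith
    moreover have "card S = card {s \<in> S. y \<otimes> inv s \<in> T} + card {s \<in> S. y \<otimes> inv s \<notin> T}"
      using S by (subst card_Un_disjoint[symmetric]) (auto intro!: arg_cong[of _ _ card])
    ultimately show ?thesis by linarith
  qed
  text \<open>\<open>s0\<close> has the smallest weight, \<open>sm\<close> the largest weight among the others, \<open>s1\<close> the smallest among the rest.\<close>
  obtain s0 where s0: "s0 \<in> S" "\<And>s. s \<in> S \<Longrightarrow> \<sigma> s0 \<le> \<sigma> s"
    using ex_has_least_nat[of "\<lambda>s. s \<in> S" _ \<sigma>] S_ne by blast
  have "card (S - {s0}) \<ge> 2" using s0 S u by simp
  then have "S - {s0} \<noteq> {}" by (metis card.empty not_numeral_le_zero)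
  then have "Max (\<sigma> ` (S - {s0})) \<in> \<sigma> ` (S - {s0})" using S by (intro Max_in) auto
  then obtain sm where "Max (\<sigma> ` (S - {s0})) = \<sigma> sm" "sm \<in> S - {s0}" by (rule imageE)
  then have sm: "sm \<in> S" "sm \<noteq> s0" "\<sigma> sm = Max (\<sigma> ` (S - {s0}))" by auto
  have sm3: "\<sigma> s \<le> \<sigma> sm" if "s \<in> S" "s \<noteq> s0" for s
    unfolding sm(3) using S that by (intro Max_ge) auto
  have c2: "card (S - {s0, sm}) + 2 = card S"
    using card_Diff_subset[of "{s0, sm}" S] s0 sm u by simp
  then have "S - {s0, sm} \<noteq> {}" using u by force
  then obtain s1 where s1: "s1 \<in> S" "s1 \<noteq> s0" "s1 \<noteq> sm" "\<And>s. s \<in> S \<Longrightarrow> s \<noteq> s0 \<Longrightarrow> s \<noteq> sm \<Longrightarrow> \<sigma> s1 \<le> \<sigma> s"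
    using ex_has_least_nat[of "\<lambda>s. s \<in> S - {s0, sm}" _ \<sigma>] by blast
  have s1le: "\<sigma> s1 \<le> \<sigma> s" if "s \<in> S" "s \<noteq> s0" for s
  proof (cases "s = sm")
    case True
    then show ?thesis using sm3 s1 by simp
  next
    case False
    then show ?thesis using s1(4) that by simp
  qed
  define e g f where "e = (\<lambda>s. int h - int (\<sigma> s))" and "g = (\<lambda>y. int h - int (\<eta> y))" and "f = (\<lambda>a. int h - int (\<tau> a))"
  have enn: "0 \<le> e s" if "s \<in> S" for s using sig that by (simp add: e_def)
  have fnn: "0 \<le> f a" if "a \<in> T" for a using tau that by (simp add: f_def)
  have gnn: "0 \<le> g y" for y using eta_le by (simp add: g_def)
  have eord: "0 \<le> e sm" "e sm \<le> e s1" "e s1 \<le> e s0" using enn[OF sm(1)] sm3[OF s1(1,2)] s0(2)[OF s1(1)] by (auto simp: e_def)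
  have repr: "g y \<le> e s" "\<eta> y < h \<Longrightarrow> int h - e s \<le> f (y \<otimes> inv s)"
    if "s \<in> S" "y \<in> carrier G" "y \<otimes> inv s \<in> T" for s y
  proof -
    have y: "s \<otimes> (y \<otimes> inv s) = y" using solve that by blast
    show "g y \<le> e s" using eta_sig[OF that(1,3)] y by (simp add: g_def e_def)
    assume "\<eta> y < h"
    then have "\<sigma> s + \<tau> (y \<otimes> inv s) \<le> h" using full[OF that(1,3)] y by force
    then show "int h - e s \<le> f (y \<otimes> inv s)" by (simp add: e_def f_def)
  qed
  define v where "v = int (card S) - 1"
  define n where "n = int (card (carrier G))"
  have yc: "y \<in> carrier G" "y \<noteq> c" if "y \<in> Y" for y using that Y cY' by auto
  define N where "N = {y \<in> Y. \<eta> y < h}"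
  \<comment> \<open>A non-full element represented through \<open>sm\<close> has deficit at most
    \<open>e sm\<close> and forces a deficit of at least h - \<open>e sm\<close> on T. The remaining
    ones, \<open>NB\<close>, have deficit at most \<open>e s1\<close> and number at most |S| -
    1.\<close>
  define NA where "NA = {y \<in> N. y \<otimes> inv sm \<in> T}"
  define NB where "NB = N - NA"
  have Nf: "finite N" "finite NA" "finite NB" "NA \<subseteq> N" using Y by (auto simp: N_def NA_def NB_def)
  define k where "k = int (card NA)"
  have sumg: "sum g Y = sum g NA + sum g NB"
  proof -
    have "sum g Y = sum g N"
      by (rule sum.mono_neutral_right) (use Y eta_le in \<open>auto simp: N_def g_def not_less intro: le_antisym\<close>)
    also have "\<dots> = sum g NB + sum g NA" unfolding NB_def using sum.subset_diff[OF Nf(4,1)] by simp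
    finally show ?thesis by (simp only: add.commute)
  qed
  have gNA: "sum g NA \<le> k * e sm"
  proof -
    have "g y \<le> e sm" if "y \<in> NA" for y
    proof -
      have "y \<in> Y" "y \<otimes> inv sm \<in> T" using that unfolding NA_def N_def by blast+
      then show ?thesis using repr(1)[OF sm(1)] yc(1) by blast
    qed
    then show ?thesis unfolding k_def by (intro sum_bounded_above) auto
  qed
  have gNB1: "g y \<le> e s1" if "y \<in> NB" for y
  proof -
    have y: "y \<in> carrier G" "y \<noteq> c" using that yc by (auto simp: NB_def N_def)
    have "\<not> {s \<in> S. y \<otimes> inv s \<in> T} \<subseteq> {s0}"
    proof
      assume "{s \<in> S. y \<otimes> inv s \<in> T} \<subseteq> {s0}"
      then have "card {s \<in> S. y \<otimes> inv s \<in> T} \<le> card {s0}" by (intro card_mono) auto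
      then show False using two[OF y] by simp
    qed
    then obtain s where s: "s \<in> S" "y \<otimes> inv s \<in> T" "s \<noteq> s0" by blast
    then have "g y \<le> e s" using repr(1) y by blast
    also have "e s \<le> e s1" using s1le s by (simp add: e_def)
    finally show ?thesis .
  qed
  have gNB: "sum g NB \<le> int (card NB) * e s1" using gNB1 by (intro sum_bounded_above) auto
  have NBsub: "NB \<subseteq> (\<lambda>s. c \<otimes> sm \<otimes> inv s) ` (S - {sm})"
  proof
    fix y assume y: "y \<in> NB"
    then have y': "y \<in> carrier G" "y \<noteq> c" "y \<otimes> inv sm \<notin> T" using yc by (auto simp: NB_def N_def NA_def)
    then obtain s' where s': "s' \<in> S" "y \<otimes> inv sm = c \<otimes> inv s'" using notT sm by blast
    have "y = sm \<otimes> (y \<otimes> inv sm)" using solve[OF sm(1) y'(1)] by simp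
    also have "\<dots> = c \<otimes> sm \<otimes> inv s'" using s' sm Sc cc by (simp add: m_ac)
    finally have yeq: "y = c \<otimes> sm \<otimes> inv s'" .
    have "s' \<noteq> sm" using yeq y' sm Sc cc by (auto simp: m_assoc)
    then show "y \<in> (\<lambda>s. c \<otimes> sm \<otimes> inv s) ` (S - {sm})" using yeq s' by blast
  qed
  have cNB: "int (card NB) \<le> v"
  proof -
    have "card NB \<le> card (S - {sm})"
      using NBsub S by (meson card_image_le card_mono finite_Diff finite_imageI order_trans)
    then show ?thesis using sm S u by (simp add: v_def)
  qed
  have sumf: "k * (int h - e sm) \<le> sum f T"
  proof -
    have inj: "inj_on (\<lambda>y. y \<otimes> inv sm) NA"
      using yc sm Sc by (intro inj_onI) (auto simp: NA_def N_def)
    have "k * (int h - e sm) \<le> (\<Sum>y\<in>NA. f (y \<otimes> inv sm))"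
      unfolding k_def
    proof (rule sum_bounded_below)
      fix y assume "y \<in> NA"
      then show "int h - e sm \<le> f (y \<otimes> inv sm)" using repr(2)[OF sm(1)] yc by (auto simp: NA_def N_def)
    qed
    also have "\<dots> = sum f ((\<lambda>y. y \<otimes> inv sm) ` NA)" using sum.reindex[OF inj, of f] by (simp add: o_def)
    also have "\<dots> \<le> sum f T" using T fnn by (intro sum_mono2) (auto simp: NA_def)
    finally show ?thesis .
  qed
  have sS: "sum e S = int (card S) * int h - int (sum \<sigma> S)" by (simp add: e_def sum_subtractf)
  have sT: "sum f T = int (card T) * int h - int (sum \<tau> T)" by (simp add: f_def sum_subtractf)
  have sY: "sum g Y = int (card Y) * int h - int (sum \<eta> Y)" by (simp add: g_def sum_subtractf)
  have cards: "int (card Y) = n - 1" "int (card T) = n - int (card S)" using miss cY by (auto simp: n_def)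
  have tot: "int (sum \<eta> Y) + int \<mu> = int (sum \<sigma> S) + int (sum \<tau> T)" using total by linarith
  have Feq: "sum f T = int h + sum g Y - sum e S - int \<mu>"
    using tot unfolding sS sT sY cards by (simp add: algebra_simps)
  have Eup: "sum e S \<le> int h - int \<mu>"
  proof -
    have "int (card S * h + \<mu>) \<le> int (sum \<sigma> S + h)" using holes by (simp only: of_nat_le_iff)
    then show ?thesis unfolding sS by simp
  qed
  have Elow: "e s0 + e s1 + (v - 1) * e sm \<le> sum e S"
  proof -
    have "sum e S = e s0 + sum e (S - {s0})" using sum.remove[OF S(2) s0(1), of e] by simp
    also have "sum e (S - {s0}) = e s1 + sum e (S - {s0} - {s1})" using sum.remove[of "S - {s0}" s1 e] S s1 by simp
    also have "sum e (S - {s0} - {s1}) \<ge> of_nat (card (S - {s0} - {s1})) * e sm"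
      using sm3 by (intro sum_bounded_below) (simp add: e_def)
    moreover have "int (card (S - {s0} - {s1})) = v - 1" using S s0 s1 u by (simp add: v_def)
    ultimately show ?thesis by simp
  qed
  have Glow: "(n - 3) * int h - 2 * int \<mu> \<le> 3 * sum g Y"
  proof -
    have "int (3 * sum \<eta> Y) \<le> int (2 * card (carrier G) * h + 2 * \<mu>)" using upper[OF fG] by (simp only: of_nat_le_iff)
    then have "3 * int (sum \<eta> Y) \<le> 2 * (n * int h) + 2 * int \<mu>" by (simp add: n_def)
    then show ?thesis unfolding sY cards by (simp add: algebra_simps)
  qed
  have nv: "3 * v \<le> n" using size[OF fG] by (simp add: v_def n_def)
  have "int (card NB) * e s1 \<le> v * e s1" using cNB eord by (intro mult_right_mono) auto
  then have Gup: "sum g Y \<le> k * e sm + v * e s1" using sumg gNA gNB by linarith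
  have base: "0 \<le> k" "2 \<le> int h" "0 \<le> int \<mu>" "int \<mu> \<le> 1" using h2 mu by (auto simp: k_def)
  show False
  proof (cases "v \<ge> 3")
    case True
    show False by (rule near_covering_arith_large[OF Gup sumf Feq Elow Eup eord Glow nv True base])
  next
    case False
    then have v2: "v = 2" "card S = 3" using u by (auto simp: v_def)
    have "S = {s0, s1, sm}"
      using card_subset_eq[of S "{s0, s1, sm}"] S v2 s0 s1 sm by auto
    have Seq: "S - {sm} = {s0, s1}" using \<open>S = {s0, s1, sm}\<close> s1 sm by auto
    have NBsub2: "NB \<subseteq> {c \<otimes> sm \<otimes> inv s0, c \<otimes> sm \<otimes> inv s1}" using NBsub Seq by auto
    \<comment> \<open>If \<open>NB\<close> has two elements, both are represented through
      \<open>s0\<close> and through \<open>s1\<close>, and this exhibits three distinct elements of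
      \<open>T\<close> with large deficit.\<close>
    have alt: "sum g Y \<le> k * e sm + e s1 \<or> sum g Y \<le> k * e sm + 2 * e s1 \<and> 3 * int h - e s0 - 2 * e s1 \<le> sum f T"
    proof (cases "card NB \<le> 1")
      case True
      then have "int (card NB) * e s1 \<le> 1 * e s1" using eord by (intro mult_right_mono) auto
      then show ?thesis using sumg gNA gNB by linarith
    next
      case False
      let ?y0 = "c \<otimes> sm \<otimes> inv s0" and ?y1 = "c \<otimes> sm \<otimes> inv s1"
      have "NB = {?y0, ?y1}"
        using False by (intro card_seteq NBsub2) (simp_all add: card_insert_if)
      then have y01: "?y0 \<in> NB" "?y1 \<in> NB" by auto
      have both: "y \<otimes> inv s0 \<in> T \<and> y \<otimes> inv s1 \<in> T" if "y \<in> NB" for y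
      proof -
        have y: "y \<in> carrier G" "y \<noteq> c" "y \<otimes> inv sm \<notin> T" using that yc by (auto simp: NB_def N_def NA_def)
        let ?A = "{s \<in> S. y \<otimes> inv s \<in> T}"
        have "?A \<subseteq> {s0, s1}" using Seq y by blast
        then have "?A = {s0, s1}" using card_seteq[of "{s0, s1}" ?A] two[OF y(1,2)] s1 by auto
        then show ?thesis by blast
      qed
      have Nc: "y \<in> carrier G" "\<eta> y < h" if "y \<in> NB" for y using that yc by (auto simp: NB_def N_def)
      let ?a = "?y0 \<otimes> inv s0" and ?b = "?y0 \<otimes> inv s1" and ?d = "?y1 \<otimes> inv s1"
      have inT: "?a \<in> T" "?b \<in> T" "?d \<in> T" using both y01 by auto
      have fv: "int h - e s0 \<le> f ?a" "int h - e s1 \<le> f ?b" "int h - e s1 \<le> f ?d"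
        using repr(2) s0(1) s1(1) inT Nc y01 by blast+
      have cs: "s0 \<in> carrier G" "s1 \<in> carrier G" "sm \<in> carrier G" using s0 s1 sm Sc by auto
      have bd: "?b = ?y1 \<otimes> inv s0" using cs cc by (simp add: m_ac)
      have y1c: "?y0 \<in> carrier G" "?y1 \<in> carrier G" using cs cc by auto
      have ab: "?a \<noteq> ?b" using y1c cs s1(2) by (auto simp: mult_inv_eq_iff simp del: Units_l_cancel)
      have bd': "?b \<noteq> ?d" unfolding bd using y1c cs s1(2) by (auto simp: mult_inv_eq_iff simp del: Units_l_cancel)
      \<comment> \<open>Otherwise s0 - s1 would have order two and interchange \<open>s0\<close> and
        \<open>s1\<close>, an overlap of two points which \<open>ov\<close> forbids for a set of
        three.\<close>
      have ad: "?a \<noteq> ?d"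
      proof
        assume "?a = ?d"
        then have "inv s0 \<otimes> inv s0 = inv s1 \<otimes> inv s1"
          using cs cc by (simp add: m_assoc)
        then have sq: "s0 \<otimes> s0 = s1 \<otimes> s1" using cs by (metis inv_closed inv_inv inv_mult m_closed)
        let ?w = "s0 \<otimes> inv s1"
        have w: "?w \<in> carrier G" "?w \<noteq> \<one>" using cs s1(2) by (auto, metis inv_equality inv_inv inv_closed)
        have "s1 \<otimes> ?w = s0" using cs mult_inv_cancel by simp
        moreover have "s0 \<otimes> ?w = s1"
          using cs sq by (metis m_assoc inv_closed mult_inv_cancel(3))
        ultimately have "{s0, s1} \<subseteq> S \<inter> (S #> ?w)" using s0 s1 by (auto simp: r_coset_iff) metis+
        then have "2 \<le> card (S \<inter> (S #> ?w))" using card_mono[of "S \<inter> (S #> ?w)" "{s0, s1}"] S s1 by auto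
        then show False using ov[OF w] v2 by linarith
      qed
      have "f ?a + f ?b + f ?d = sum f {?a, ?b, ?d}" using ab bd' ad by simp
      also have "\<dots> \<le> sum f T" using T fnn inT by (intro sum_mono2) auto
      finally have "3 * int h - e s0 - 2 * e s1 \<le> sum f T" using fv by linarith
      moreover have "sum g Y \<le> k * e sm + 2 * e s1" using Gup v2 by simp
      ultimately show ?thesis by blast
    qed
    have n6: "6 \<le> n" using nv v2 by simp
    have Elow3: "e s0 + e s1 + e sm \<le> sum e S" using Elow v2 by simp
    show False by (rule near_covering_arith_3[OF sumf Feq Elow3 Eup eord Glow n6 base alt])
  qed
qed

end

section \<open>S meets two cosets and T meets all\<close>

lemma two_coset_arith_1:
  fixes n h D E P s0 s1 :: int
  assumes n: "3 \<le> n" and h: "2 \<le> h" and a: "P + n * h \<le> 2 * E" "E + 1 = D + P" "D \<le> P" "3 * E \<le> 2 * (n * h) + 2"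
    "D = s0 + s1" "s0 \<le> s1" "n * s1 \<le> E" "h + 1 \<le> D"
  shows False
proof -
  have "n \<noteq> 3" using a h by auto
  then have n4: "4 \<le> n" using n by simp
  have nD: "n * D \<le> 2 * E"
  proof -
    have "n * D \<le> n * (2 * s1)" using a n by (intro mult_left_mono) auto
    then show ?thesis using a(7) by simp
  qed
  have i1: "n * h + 1 \<le> E + D" using a by linarith
  have "n * (n * h + 1) \<le> n * (E + D)" using i1 n by (intro mult_left_mono) auto
  also have "\<dots> = n * E + n * D" by (simp add: algebra_simps)
  finally have i2: "n * (n * h) + n \<le> n * E + 2 * E" using nD by (simp add: algebra_simps)
  have "(n + 2) * (3 * E) \<le> (n + 2) * (2 * (n * h) + 2)" using a(4) n by (intro mult_left_mono) auto
  then have i3: "3 * (n * E) + 6 * E \<le> 2 * (n * (n * h)) + 2 * n + 4 * (n * h) + 4" by (simp add: algebra_simps)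
  have i4: "n * (n * h) + n \<le> 4 * (n * h) + 4" using i2 i3 by linarith
  have n4': "n = 4"
  proof (rule ccontr)
    assume "n \<noteq> 4"
    then have "5 \<le> n" using n4 by simp
    then have "5 * (n * h) \<le> n * (n * h)" using n h by (intro mult_right_mono) auto
    moreover have "0 \<le> n * h" using n h by simp
    ultimately show False using i4 \<open>5 \<le> n\<close> by linarith
  qed
  have "4 * h + 1 \<le> E + D" "3 * E \<le> 8 * h + 2" "4 * D \<le> 2 * E" "2 * D \<le> E + 1" "4 * s1 \<le> E"
    using i1 a nD unfolding n4' by linarith+
  \<comment> \<open>For \<mu> = 1 the estimates survive only at n = 4, where parity refutes
    them.\<close>
  then have "6 * s1 = 4 * h + 1" using a(5,6) by linarith
  then have "(4 * h + 1) mod 2 = (6 * s1) mod 2" by simp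
  then show False by presburger
qed

text \<open>\<open>D\<close>, \<open>P\<close>, \<open>E\<close> are the total weights of S, T and S
  + T. For \<mu> = 0 the bounds collapse to E = 2D = 2P and 3D = nh; then n \<le> 4, and n = 3 would
  give D = h.\<close>

lemma two_coset_arith_2:
  fixes n h D E P s0 s1 :: int
  assumes n: "3 \<le> n" and h: "2 \<le> h" and a: "P + n * h \<le> 2 * E" "E = D + P" "D \<le> P" "3 * E \<le> 2 * (n * h)"
    "D = s0 + s1" "s0 \<le> s1" "n * s1 \<le> E" "h + 1 \<le> D"
  shows "s0 = s1" "E = n * s1"
proof -
  have e: "E = 2 * D" "P = D" "3 * D = n * h" using a by linarith+
  have nD: "n * D \<le> 2 * (n * s1)"
    using mult_left_mono[of D "2 * s1" n] a n by simp
  then have "n * D \<le> 4 * D" using a(7) e by linarith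
  moreover have "0 < D" using a h by linarith
  ultimately have n4: "n \<le> 4" using mult_le_cancel_right_pos by blast
  have "n \<noteq> 3" using e a by auto
  then have n4': "n = 4" using n n4 by simp
  have "2 * D \<le> 4 * s1" "4 * s1 \<le> 2 * D" using nD a(7) e unfolding n4' by linarith+
  then show "s0 = s1" "E = n * s1" using a(5,6) e n4' by auto
qed

text \<open>\<open>frag\<close> is the 2-fragment inequality for a single fibre of T, hence
  restricted to fibres with at least two elements; \<open>bigS\<close> and \<open>bigT\<close> are
  the lower bounds on |S| and |T|.\<close>

locale two_coset = weighted +
  fixes s0 s1 :: 'a
  assumes S2: "S = {s0, s1}" "s0 \<noteq> s1" "\<sigma> s0 \<le> \<sigma> s1"
    and Tall: "T = carrier G"
    and frag: "\<And>a. a \<in> carrier G \<Longrightarrow> 2 \<le> \<tau> a \<Longrightarrow> \<tau> a + h \<le> \<eta> (s0 \<otimes> a) + \<eta> (s1 \<otimes> a)"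
    and bigS: "3 \<le> sum \<sigma> S + \<mu>" and bigT: "4 \<le> sum \<tau> T + 2 * \<mu>"
begin

lemma fin: "finite (carrier G)" using T Tall by simp

lemma s_car: "s0 \<in> carrier G" "s1 \<in> carrier G" using S S2 by auto

definition "d = s1 \<otimes> inv s0"

lemma d: "d \<in> carrier G" "s0 \<otimes> d = s1" using s_car mult_inv_cancel by (auto simp: d_def)

lemma shift: "a \<in> carrier G \<Longrightarrow> s0 \<otimes> (a \<otimes> d) = s1 \<otimes> a"
  using d s_car by (metis m_assoc m_comm)

text \<open>One of \<open>s0\<close>, \<open>s1\<close> is 0, so the other one is \<open>d\<close>
  or its inverse. Hence \<open>d\<close> generates the group, and a nonempty finite set closed under
  adding \<open>d\<close> is everything.\<close>

lemma d_closed: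
  assumes B: "B \<subseteq> carrier G" "B \<noteq> {}" "\<And>b. b \<in> B \<Longrightarrow> b \<otimes> d \<in> B"
  shows "B = carrier G"
proof -
  have fB: "finite B" using B fin finite_subset by blast
  have "B #> d \<subseteq> B" using B(3) by (auto simp: r_coset_def)
  then have ds: "d \<in> stab G B" using in_stabI B fB d by blast
  have sg: "subgroup (stab G B) G" using subgroup_stab B by blast
  have "s0 = \<one> \<or> s1 = \<one>" using S(3) S2 by auto
  then have "s0 \<in> stab G B \<and> s1 \<in> stab G B"
  proof
    assume e: "s0 = \<one>"
    have "x = s1" if "x \<in> carrier G" "s0 \<otimes> x = s1" for x using that by (simp add: e)
    then show ?thesis using ds one_stab[OF B(1)] d e by metis
  next
    assume e: "s1 = \<one>"
    have "inv x = s0" if "x \<in> carrier G" "s0 \<otimes> x = s1" for x using that s_car by (simp add: e inv_equality)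
    then have "inv d = s0" using d by blast
    then show ?thesis using ds one_stab[OF B(1)] e subgroup.m_inv_closed[OF sg ds] by metis
  qed
  then have "S \<subseteq> stab G B" unfolding S2(1) by blast
  then have "generate G S \<subseteq> stab G B" using generate_subgroup_incl sg by blast
  then have st: "stab G B = carrier G" using S(4) stab_carrier by blast
  obtain b where b: "b \<in> B" using B by blast
  then have bc: "b \<in> carrier G" using B by blast
  have "x \<in> B" if "x \<in> carrier G" for x
  proof -
    have "inv b \<otimes> x \<in> stab G B" using st bc that by simp
    then have "b \<otimes> (inv b \<otimes> x) \<in> B" using stab_mult_mem b by blast
    then show ?thesis using bc that by (simp add: m_assoc[symmetric])
  qed
  then show ?thesis using B by blast
qed

lemma Yall: "Y = carrier G"
proof -
  have "y \<in> Y" if "y \<in> carrier G" for y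
    using set_multI[of s0 S "y \<otimes> inv s0" T] that s_car S2 Tall mult_inv_cancel by simp
  then show ?thesis using Y by blast
qed

definition "E0 a = \<eta> (s0 \<otimes> a)"
definition "E1 a = \<eta> (s1 \<otimes> a)"

lemma E1_E0: "a \<in> carrier G \<Longrightarrow> E1 a = E0 (a \<otimes> d)"
  using shift by (simp add: E0_def E1_def)

lemma bij_shift: "s \<in> carrier G \<Longrightarrow> bij_betw (\<lambda>a. s \<otimes> a) (carrier G) (carrier G)"
  by (rule bij_betw_byWitness[of _ "\<lambda>a. inv s \<otimes> a"]) (auto simp: m_assoc[symmetric])

lemma sum_E: "sum E0 (carrier G) = sum \<eta> Y" "sum E1 (carrier G) = sum \<eta> Y"
  unfolding Yall E0_def E1_def using sum.reindex_bij_betw[OF bij_shift[OF s_car(1)], of \<eta>]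
    sum.reindex_bij_betw[OF bij_shift[OF s_car(2)], of \<eta>] by auto

lemma E_bounds:
  assumes "a \<in> carrier G"
  shows "\<sigma> s0 \<le> E0 a" "\<sigma> s1 \<le> E1 a" "\<tau> a \<le> E0 a" "\<tau> a \<le> E1 a" "E0 a \<le> h" "E1 a \<le> h" "\<sigma> s1 \<le> E0 a"
proof -
  show "\<sigma> s0 \<le> E0 a" "\<sigma> s1 \<le> E1 a" "\<tau> a \<le> E0 a" "\<tau> a \<le> E1 a" "E0 a \<le> h" "E1 a \<le> h"
    using assms eta_sig eta_tau eta_le S2 Tall by (auto simp: E0_def E1_def)
  have m: "inv s1 \<otimes> (s0 \<otimes> a) \<in> carrier G" using s_car assms by simp
  have "s1 \<otimes> (inv s1 \<otimes> (s0 \<otimes> a)) = s0 \<otimes> a" using s_car assms by (simp add: m_assoc[symmetric])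
  then show "\<sigma> s1 \<le> E0 a" using eta_sig[of s1 "inv s1 \<otimes> (s0 \<otimes> a)"] m S2 Tall by (simp add: E0_def)
qed

lemma eta_ge: "y \<in> carrier G \<Longrightarrow> \<sigma> s1 \<le> \<eta> y"
  using E_bounds(7)[of "inv s0 \<otimes> y"] s_car by (simp add: E0_def m_assoc[symmetric])

abbreviation "n \<equiv> card (carrier G)"
abbreviation "D \<equiv> sum \<sigma> S"
abbreviation "P \<equiv> sum \<tau> T"

lemma D_eq: "D = \<sigma> s0 + \<sigma> s1" using S2 by simp

lemma D_ge: "h + \<mu> \<le> D" using holes S2 by simp

lemma n3: "3 \<le> n" using size[OF fin] S2 by simp

text \<open>One-point fibres escape \<open>frag\<close>. For them E0 + E1 \<ge> D \<ge> h falls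
  short of the same inequality by one exactly on \<open>J\<close>.\<close>

definition "J = {a \<in> carrier G. \<tau> a = 1 \<and> E0 a + E1 a = h}"

lemma J_bound: "P + n * h \<le> 2 * sum \<eta> Y + card J"
proof -
  have le: "\<tau> a + h \<le> E0 a + E1 a + of_bool (a \<in> J)" if "a \<in> carrier G" for a
  proof (cases "2 \<le> \<tau> a")
    case True
    then show ?thesis using frag[OF that] by (simp add: E0_def E1_def)
  next
    case False
    then have "\<tau> a = 1" using tau[of a] Tall that by fastforce
    then show ?thesis using E_bounds[OF that] D_ge D_eq that by (auto simp: J_def)
  qed
  have "(\<Sum>a\<in>carrier G. \<tau> a + h) \<le> (\<Sum>a\<in>carrier G. E0 a + E1 a + of_bool (a \<in> J))"
    using le by (intro sum_mono) blast
  moreover have "(\<Sum>a\<in>carrier G. (of_bool (a \<in> J) :: nat)) = card J"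
  proof -
    have "carrier G \<inter> {a. a \<in> J} = J" by (auto simp: J_def)
    then show ?thesis using fin by (simp add: sum.If_cases of_bool_def)
  qed
  ultimately show ?thesis using Tall sum_E by (simp add: sum.distrib)
qed

lemma low: "n * \<sigma> s1 \<le> sum \<eta> Y"
  using sum_bounded_below[of "carrier G" "\<sigma> s1" \<eta>] eta_ge Yall by simp

lemma J_sigma:
  assumes "a \<in> J"
  shows "D = h" "\<mu> = 0" "\<sigma> s0 = \<sigma> s1" "h = 2 * \<sigma> s1" "E0 a = \<sigma> s1" "E1 a = \<sigma> s1"
  using assms E_bounds[of a] D_ge D_eq S2(3) by (auto simp: J_def)

text \<open>Here \<open>J\<close> is empty, so the inequality of \<open>frag\<close> can be summed
  over all positions. The arithmetic turns the lower bound \<open>\<sigma> s1\<close> on every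
  weight of \<open>Y\<close> into an equality in the sum, hence everywhere.\<close>

lemma cases_large:
  assumes "h + 1 \<le> D"
  shows "\<sigma> s0 = \<sigma> s1" "\<And>y. y \<in> carrier G \<Longrightarrow> \<eta> y = \<sigma> s1"
proof -
  have "J = {}" using J_sigma(1) assms by fastforce
  then have jb: "P + n * h \<le> 2 * sum \<eta> Y" using J_bound by simp
  define E where "E = sum \<eta> Y"
  have i: "int P + int n * int h \<le> 2 * int E" "int E + int \<mu> = int D + int P" "int D \<le> int P"
    "3 * int E \<le> 2 * (int n * int h) + 2 * int \<mu>" "int D = int (\<sigma> s0) + int (\<sigma> s1)" "int (\<sigma> s0) \<le> int (\<sigma> s1)"
    "int n * int (\<sigma> s1) \<le> int E" "int h + 1 \<le> int D" "3 \<le> int n" "2 \<le> int h"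
  proof -
    have "int (P + n * h) \<le> int (2 * E)" using jb by (simp only: of_nat_le_iff E_def)
    then show "int P + int n * int h \<le> 2 * int E" by simp
    have "int (E + \<mu>) = int (D + P)" using total by (simp only: E_def)
    then show "int E + int \<mu> = int D + int P" by (simp only: of_nat_add)
    show "int D \<le> int P" using S_le_T by (simp only: of_nat_le_iff)
    have "int (3 * E) \<le> int (2 * n * h + 2 * \<mu>)" using upper[OF fin] by (simp only: of_nat_le_iff E_def)
    then show "3 * int E \<le> 2 * (int n * int h) + 2 * int \<mu>" by simp
    show "int D = int (\<sigma> s0) + int (\<sigma> s1)" using D_eq by (simp only: of_nat_add)
    show "int (\<sigma> s0) \<le> int (\<sigma> s1)" using S2 by simp
    have "int (n * \<sigma> s1) \<le> int E" using low by (simp only: of_nat_le_iff E_def)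
    then show "int n * int (\<sigma> s1) \<le> int E" by simp
    show "int h + 1 \<le> int D" using assms by linarith
    show "3 \<le> int n" "2 \<le> int h" using n3 h2 by auto
  qed
  have "\<mu> = 0"
  proof (rule ccontr)
    assume "\<mu> \<noteq> 0"
    then have m: "\<mu> = 1" using mu by simp
    show False
      using two_coset_arith_1[OF i(9,10,1) _ i(3) _ i(5,6,7,8)] i(2,4) unfolding m by simp
  qed
  then have "int (\<sigma> s0) = int (\<sigma> s1)" "int E = int n * int (\<sigma> s1)"
    using two_coset_arith_2[OF i(9,10,1) _ i(3) _ i(5,6,7,8)] i(2,4) by simp_all
  then show "\<sigma> s0 = \<sigma> s1" by simp
  have "int E = int (n * \<sigma> s1)" using \<open>int E = int n * int (\<sigma> s1)\<close> by simp
  then have "E = n * \<sigma> s1" by (simp only: of_nat_eq_iff)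
  then have "(\<Sum>y\<in>carrier G. \<sigma> s1) = sum \<eta> (carrier G)" using Yall by (simp add: E_def)
  from sum_mono_inv[OF this _ _ fin] show "\<eta> y = \<sigma> s1" if "y \<in> carrier G" for y
    using eta_ge that by simp
qed

text \<open>With h = 2s, the quantities \<open>w\<close> sum to 4s and are at least s wherever
  \<open>\<tau>\<close> is at most s, so there are at most four such positions. By the upper bound
  at least two thirds of the elements are non-full, and those translate into these positions. This
  leaves a quotient of order 4 with w = s throughout.\<close>

lemma cases_tight:
  assumes D: "D = h" and n4: "4 \<le> n"
  shows "\<sigma> s0 = \<sigma> s1" "(\<forall>y\<in>carrier G. \<eta> y = \<sigma> s1) \<or>
     \<sigma> s1 = 2 \<and> h = 4 \<and> (\<forall>y\<in>carrier G. \<eta> y = 2 \<or> \<eta> y = 4) \<and> (\<exists>a\<in>carrier G. \<tau> a = 2 \<and> E1 a = 2)"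
proof -
  have m0: "\<mu> = 0" using D D_ge by simp
  define E where "E = sum \<eta> Y"
  have EP: "E = h + P" using total D m0 by (simp add: E_def)
  have jb: "P + n * h \<le> 2 * E + card J" using J_bound by (simp add: E_def)
  have up: "3 * E \<le> 2 * (n * h)" using upper[OF fin] m0 by (simp add: E_def)
  have fJ: "finite J" using fin by (simp add: J_def)
  have "J \<noteq> {}"
  proof
    assume "J = {}"
    then have "n * h \<le> P + 2 * h" using jb EP by simp
    then have "n * h \<le> 3 * h" using up EP by linarith
    then show False using n4 h2 by simp
  qed
  then obtain j where j: "j \<in> J" by blast
  define s where "s = \<sigma> s1"
  have s: "\<sigma> s0 = s" "h = 2 * s" using J_sigma[OF j] by (auto simp: s_def)
  then show "\<sigma> s0 = \<sigma> s1" by (simp add: s_def)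
  have s2: "2 \<le> s" using bigS D s m0 by simp
  have hole: "\<tau> a \<le> s" if "a \<in> carrier G" "E0 a < h \<or> E1 a < h" for a
    using full[of s0 a] full[of s1 a] that S2 Tall s by (force simp: E0_def E1_def s_def)
  define w where "w = (\<lambda>a. int (E0 a) + int (E1 a) - 2 * int (\<tau> a))"
  define B where "B = {a \<in> carrier G. \<tau> a \<le> s}"
  have fB: "finite B" "B \<subseteq> carrier G" using fin by (auto simp: B_def)
  have w0: "0 \<le> w a" if "a \<in> carrier G" for a using E_bounds[OF that] by (simp add: w_def)
  have tau1: "1 \<le> \<tau> a" if "a \<in> carrier G" for a using tau that Tall by simp
  have wB: "int s \<le> w a" if a: "a \<in> B" for a
  proof (cases "2 \<le> \<tau> a")
    case True
    then show ?thesis using frag[of a] a s by (simp add: w_def E0_def E1_def B_def)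
  next
    case False
    then show ?thesis using E_bounds[of a] a s s2 tau1[of a] by (simp add: w_def B_def s_def)
  qed
  have sw: "sum w (carrier G) = 4 * int s"
  proof -
    have "sum w (carrier G) = int (sum E0 (carrier G)) + int (sum E1 (carrier G)) - 2 * int P"
      by (simp add: w_def sum.distrib sum_subtractf sum_distrib_left Tall)
    moreover have "sum \<eta> Y = 2 * s + P" using EP s(2) by (simp only: E_def)
    then have "int (sum \<eta> Y) = 2 * int s + int P" by (simp only: of_nat_add of_nat_mult of_nat_numeral)
    ultimately show ?thesis unfolding sum_E by linarith
  qed
  have "int (card B) * int s \<le> sum w B" using wB by (intro sum_bounded_below) auto
  also have "\<dots> \<le> sum w (carrier G)" using w0 fin fB by (intro sum_mono2) auto
  finally have cB: "card B \<le> 4" using sw s2 by simp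
  define N where "N = {y \<in> carrier G. \<eta> y < h}"
  have fN: "finite N" "N \<subseteq> carrier G" using fin by (auto simp: N_def)
  have "n * h \<le> E + card N * s"
  proof -
    have "h \<le> \<eta> y + (if y \<in> N then s else 0)" if "y \<in> carrier G" for y
      using eta_ge[OF that] s that by (auto simp: N_def s_def)
    then have "(\<Sum>y\<in>carrier G. h) \<le> (\<Sum>y\<in>carrier G. \<eta> y + (if y \<in> N then s else 0))" by (rule sum_mono)
    also have "\<dots> = E + card (carrier G \<inter> N) * s"
      using fin Yall by (simp add: sum.distrib E_def sum.If_cases)
    finally show ?thesis using fN by (simp add: Int_absorb1)
  qed
  then have "3 * (n * h) \<le> 2 * (n * h) + 3 * (card N * s)" using up by linarith
  then have "(2 * n) * s \<le> (3 * card N) * s" unfolding s(2) by (simp add: algebra_simps)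
  then have cN: "2 * n \<le> 3 * card N" using s2 by simp
  have NB: "y \<otimes> inv s0 \<in> B" "y \<otimes> inv s1 \<in> B" if "y \<in> N" for y
  proof -
    have y: "y \<in> carrier G" "\<eta> y < h" using that by (auto simp: N_def)
    show "y \<otimes> inv s0 \<in> B" "y \<otimes> inv s1 \<in> B"
      using hole[of "y \<otimes> inv s0"] hole[of "y \<otimes> inv s1"] y s_car mult_inv_cancel by (auto simp: B_def E0_def E1_def)
  qed
  define N0 where "N0 = N #> inv s0"
  have N0B: "N0 \<subseteq> B" using NB by (auto simp: N0_def r_coset_def)
  have cN0: "card N0 = card N" using card_r_coset fN s_car by (simp add: N0_def)
  \<comment> \<open>If \<open>B\<close> is no larger than \<open>N\<close>, two translates of
    \<open>N\<close> coincide with \<open>B\<close>, which is then closed under adding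
    \<open>d\<close>. Otherwise |N| \<le> 3, and the two-thirds bound gives n \<le> 4.\<close>
  have Ball: "B = carrier G"
  proof (cases "card B = card N")
    case True
    then have B0: "B = N0" using card_subset_eq[OF fB(1) N0B] cN0 by simp
    show ?thesis
    proof (rule d_closed[OF fB(2)])
      have "card N > 0" using cN n4 by linarith
      then show "B \<noteq> {}" using True by auto
      have N1: "N #> inv s1 \<subseteq> B" using NB by (auto simp: r_coset_def)
      have "card (N #> inv s1) = card B" using True card_r_coset fN s_car by simp
      then have B1: "B = N #> inv s1" using card_subset_eq[OF fB(1) N1] by simp
      fix b assume "b \<in> B"
      then obtain y where y: "y \<in> N" "b = y \<otimes> inv s1" using B1 by (auto simp: r_coset_def)
      have yc: "y \<in> carrier G" using y fN by blast
      have "b \<otimes> d = y \<otimes> inv s0"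
      proof -
        have "b \<otimes> d = (y \<otimes> inv s1) \<otimes> (s1 \<otimes> inv s0)" using y by (simp add: d_def)
        also have "\<dots> = ((y \<otimes> inv s1) \<otimes> s1) \<otimes> inv s0" using yc s_car by (simp add: m_assoc[symmetric])
        finally show ?thesis using yc s_car mult_inv_cancel(2) by simp
      qed
      then show "b \<otimes> d \<in> B" using NB y by simp
    qed
  next
    case False
    then have "card N + 1 \<le> card B" using card_mono[OF fB(1) N0B] cN0 by linarith
    then have "4 \<le> card B" "n \<le> 4" using cN cB n4 by linarith+
    then show ?thesis using card_subset_eq[OF fin fB(2)] n4 cB by simp
  qed
  have n4': "n = 4" using cB n4 Ball by simp
  have wall: "w a = int s" if "a \<in> carrier G" for a
  proof -
    have "(\<Sum>a\<in>carrier G. int s) = sum w (carrier G)" using sw n4' by simp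
    from sum_mono_inv[OF this _ that fin] show ?thesis using wB Ball by simp
  qed
  have tcase: "\<tau> a = 1 \<or> \<tau> a = s" if a: "a \<in> carrier G" for a
  proof (cases "2 \<le> \<tau> a")
    case True
    have "a \<in> B" using Ball a by simp
    then have "\<tau> a \<le> s" unfolding B_def by simp
    moreover have "\<tau> a + h \<le> E0 a + E1 a" using frag[OF a True] by (simp add: E0_def E1_def)
    ultimately show ?thesis using wall[OF a] s(2) unfolding w_def by linarith
  next
    case False
    then show ?thesis using tau1[OF a] by simp
  qed
  have jj: "j \<in> carrier G" "\<tau> j = 1" "E0 j = s" "E1 j = s"
    using j unfolding J_def s_def J_sigma(5,6)[OF j] by (blast | rule J_sigma[OF j])+
  have s2': "s = 2" using wall[OF jj(1)] jj by (simp add: w_def)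
  have h4: "h = 4" using s s2' by simp
  have v1: "E0 a = 2" "E1 a = 2" if "a \<in> carrier G" "\<tau> a = 1" for a
    using wall[OF that(1)] that(2) E_bounds[OF that(1)] s2' by (auto simp: w_def s_def)
  have v2: "E0 a + E1 a = 6" if "a \<in> carrier G" "\<tau> a = 2" for a
    using wall[OF that(1)] that(2) s2' by (simp add: w_def)
  have toE0: "\<eta> y = E0 (y \<otimes> inv s0)" "y \<otimes> inv s0 \<in> carrier G" if "y \<in> carrier G" for y
    using that s_car mult_inv_cancel by (auto simp: E0_def)
  show "(\<forall>y\<in>carrier G. \<eta> y = \<sigma> s1) \<or>
     \<sigma> s1 = 2 \<and> h = 4 \<and> (\<forall>y\<in>carrier G. \<eta> y = 2 \<or> \<eta> y = 4) \<and> (\<exists>a\<in>carrier G. \<tau> a = 2 \<and> E1 a = 2)"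
  proof (cases "\<forall>a\<in>carrier G. \<tau> a = 1")
    case True
    then show ?thesis using v1 toE0 s2' by (metis s_def)
  next
    case False
    define B2 where "B2 = {a \<in> carrier G. \<tau> a = 2}"
    have B2: "B2 \<subseteq> carrier G" "B2 \<noteq> {}" using False tcase s2' by (auto simp: B2_def)
    have "\<exists>a\<in>B2. a \<otimes> d \<notin> B2"
    proof (rule ccontr)
      assume "\<not> ?thesis"
      then have "B2 = carrier G" using d_closed[OF B2] by blast
      then have "j \<in> B2" using jj(1) by simp
      then show False using jj(2) unfolding B2_def by simp
    qed
    then obtain a where a: "a \<in> carrier G" "\<tau> a = 2" "a \<otimes> d \<notin> B2" by (auto simp: B2_def)
    have ad: "a \<otimes> d \<in> carrier G" using a d by simp
    then have "\<tau> (a \<otimes> d) = 1" using a(3) tcase[OF ad] s2' by (auto simp: B2_def)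
    then have "E1 a = 2" using v1(1)[OF ad] E1_E0 a by simp
    then have ex: "\<exists>a\<in>carrier G. \<tau> a = 2 \<and> E1 a = 2" using a by blast
    define V where "V = {a \<in> carrier G. E0 a = 3}"
    \<comment> \<open>The value 3 would propagate: it forces \<open>\<tau>\<close> = 2 and E1 = 3,
      which is E0 one step further on. It would then also be the value at \<open>j\<close>.\<close>
    have "V = {}"
    proof (rule ccontr)
      assume ne: "V \<noteq> {}"
      have "b \<otimes> d \<in> V" if "b \<in> V" for b
      proof -
        have b: "b \<in> carrier G" "E0 b = 3" using that by (auto simp: V_def)
        then have "\<tau> b = 2" using v1(1) tcase[OF b(1)] s2' by force
        then have "E1 b = 3" using v2[OF b(1)] b by simp
        then show ?thesis using E1_E0 b d by (simp add: V_def)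
      qed
      then have "V = carrier G" using d_closed[of V] ne by (auto simp: V_def)
      then have "j \<in> V" using jj(1) by simp
      then show False using jj(3) s2' unfolding V_def by simp
    qed
    then have nv: "E0 a \<noteq> 3" if "a \<in> carrier G" for a using that by (auto simp: V_def)
    have "\<eta> y = 2 \<or> \<eta> y = 4" if "y \<in> carrier G" for y
    proof -
      note t = toE0[OF that]
      have "2 \<le> \<eta> y" "\<eta> y \<le> 4" using eta_ge[OF that] eta_le[of y] s2' h4 by (auto simp: s_def)
      then show ?thesis using nv[OF t(2)] t(1) by linarith
    qed
    then show ?thesis using ex s2' h4 by (simp add: s_def)
  qed
qed

text \<open>For n = 3 the upper bound reads h + P \<le> 2h, while P \<ge> D = h; hence P = h. If
  \<open>J\<close> is empty, the inequality of \<open>frag\<close> holds at all three positions and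
  is an equality in the sum.\<close>

lemma cases_three:
  assumes D: "D = h" and n: "n = 3"
  shows "P = h" "\<mu> = 0" "4 \<le> h"
    "a \<in> carrier G \<Longrightarrow> \<tau> a + \<tau> (a \<otimes> d) + \<tau> (a \<otimes> d \<otimes> d) = h"
    "a \<in> carrier G \<Longrightarrow> E0 a + E0 (a \<otimes> d) + E0 (a \<otimes> d \<otimes> d) = 2 * h"
    "a \<in> carrier G \<Longrightarrow> a \<otimes> d \<otimes> d \<otimes> d = a"
    "a \<in> carrier G \<Longrightarrow> y \<in> carrier G \<Longrightarrow> y = s0 \<otimes> a \<or> y = s1 \<otimes> a \<or> y = s1 \<otimes> (a \<otimes> d)"
    "J = {} \<Longrightarrow> a \<in> carrier G \<Longrightarrow> E0 a + E1 a = \<tau> a + h"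
proof -
  show m0: "\<mu> = 0" using D D_ge by simp
  have EP: "sum \<eta> Y = h + P" using total D m0 by simp
  then have "P \<le> h" using upper[OF fin] m0 n by simp
  then show Ph: "P = h" using S_le_T D by simp
  then show "4 \<le> h" using bigT m0 by simp
  have three: "carrier G = {a, a \<otimes> d, a \<otimes> d \<otimes> d} \<and> a \<noteq> a \<otimes> d \<and> a \<otimes> d \<noteq> a \<otimes> d \<otimes> d \<and> a \<noteq> a \<otimes> d \<otimes> d \<and> a \<otimes> d \<otimes> d \<otimes> d = a"
    if a: "a \<in> carrier G" for a
  proof -
    have c: "a \<otimes> d \<in> carrier G" "a \<otimes> d \<otimes> d \<in> carrier G" using a d by auto
    have d1: "d \<noteq> \<one>" using S2(2) d s_car by (metis r_one)
    have n1: "a \<noteq> a \<otimes> d" "a \<otimes> d \<noteq> a \<otimes> d \<otimes> d" using a c d d1 by auto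
    have n2: "a \<noteq> a \<otimes> d \<otimes> d"
    proof
      assume e: "a = a \<otimes> d \<otimes> d"
      have "{a, a \<otimes> d} = carrier G"
        by (rule d_closed) (use a c e in auto)
      then have "n \<le> 2" using n1(1) by (metis card_2_iff order_refl)
      then show False using n by simp
    qed
    have eq: "carrier G = {a, a \<otimes> d, a \<otimes> d \<otimes> d}"
      using card_subset_eq[OF fin, of "{a, a \<otimes> d, a \<otimes> d \<otimes> d}"] a c n1 n2 n by simp
    have "a \<otimes> d \<otimes> d \<otimes> d \<in> carrier G" using c d by simp
    moreover have "a \<otimes> d \<otimes> d \<otimes> d \<noteq> a \<otimes> d \<otimes> d" using c d d1 by simp
    moreover have "a \<otimes> d \<otimes> d \<otimes> d \<noteq> a \<otimes> d" using n2 c d a by (metis right_cancel m_closed)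
    ultimately show ?thesis using eq n1 n2 by blast
  qed
  show t3: "\<tau> a + \<tau> (a \<otimes> d) + \<tau> (a \<otimes> d \<otimes> d) = h" if a: "a \<in> carrier G" for a
  proof -
    have "sum \<tau> {a, a \<otimes> d, a \<otimes> d \<otimes> d} = h" using three[OF a] Ph Tall by metis
    then show ?thesis using three[OF a] by simp
  qed
  show e3: "E0 a + E0 (a \<otimes> d) + E0 (a \<otimes> d \<otimes> d) = 2 * h" if a: "a \<in> carrier G" for a
  proof -
    have "sum E0 {a, a \<otimes> d, a \<otimes> d \<otimes> d} = 2 * h" using three[OF a] sum_E(1) EP Ph by (metis mult_2)
    then show ?thesis using three[OF a] by simp
  qed
  show "a \<otimes> d \<otimes> d \<otimes> d = a" if "a \<in> carrier G" for a using three[OF that] by blast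
  show "y = s0 \<otimes> a \<or> y = s1 \<otimes> a \<or> y = s1 \<otimes> (a \<otimes> d)" if a: "a \<in> carrier G" and y: "y \<in> carrier G" for a y
  proof -
    have yc: "y \<otimes> inv s0 \<in> carrier G" "y = s0 \<otimes> (y \<otimes> inv s0)" using y s_car mult_inv_cancel by auto
    then have "y \<otimes> inv s0 = a \<or> y \<otimes> inv s0 = a \<otimes> d \<or> y \<otimes> inv s0 = a \<otimes> d \<otimes> d" using three[OF a] by blast
    then show ?thesis using yc(2) shift a d by auto
  qed
  assume J0: "J = {}"
  have le: "\<tau> a + h \<le> E0 a + E1 a" if "a \<in> carrier G" for a
  proof (cases "2 \<le> \<tau> a")
    case True
    then show ?thesis using frag[OF that] by (simp add: E0_def E1_def)
  next
    case False
    then have "\<tau> a = 1" using tau[of a] Tall that by fastforce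
    then show ?thesis using E_bounds[OF that] D_ge D_eq that J0 by (fastforce simp: J_def)
  qed
  have "(\<Sum>a\<in>carrier G. \<tau> a + h) = (\<Sum>a\<in>carrier G. E0 a + E1 a)"
    using sum_E EP Ph Tall n by (simp add: sum.distrib)
  from sum_mono_inv[OF this le _ fin] show "E0 a + E1 a = \<tau> a + h" if "a \<in> carrier G" for a using that by simp
qed

end

section \<open>Passing to the quotient by a hyper-atom\<close>

text \<open>\<open>frag\<close> and \<open>maxH\<close> express the minimal boundary and the
  maximality of the hyper-atom by sizes of sumsets, without \<open>kappa\<close> and without
  subtraction.\<close>

locale hyper = comm_group G for G (structure) +
  fixes S T H :: "'a set" and \<mu> :: nat
  assumes S: "S \<subseteq> carrier G" "finite S" "\<one> \<in> S" "generate G S = carrier G"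
    and T: "T \<subseteq> carrier G" "finite T" "T \<noteq> {}"
    and H: "subgroup H G" "finite H" "2 \<le> card H" "H <#> S \<noteq> carrier G"
    and frag: "\<And>X. X \<subseteq> carrier G \<Longrightarrow> finite X \<Longrightarrow> 2 \<le> card X \<Longrightarrow>
        infinite (carrier G) \<or> 2 \<le> card (carrier G - (X <#> S)) \<Longrightarrow>
        card X + card (H <#> S) \<le> card (X <#> S) + card H"
    and maxH: "\<And>K. subgroup K G \<Longrightarrow> finite K \<Longrightarrow> H \<subseteq> K \<Longrightarrow>
        infinite (carrier G) \<or> 2 \<le> card (carrier G - (K <#> S)) \<Longrightarrow>
        card (K <#> S) + card H \<le> card K + card (H <#> S) \<Longrightarrow> K = H"
    and mu: "\<mu> \<le> 1"
    and sizes: "3 \<le> card S + \<mu>" "4 \<le> card T + 2 * \<mu>" "card S \<le> card T"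
    and aper: "\<not> periodic G (S <#> T)"
    and tot: "card (S <#> T) + \<mu> = card S + card T"
    and ub: "finite (carrier G) \<Longrightarrow> 3 * card (S <#> T) \<le> 2 * card (carrier G) + 2 * \<mu>"
begin

definition "\<phi> x = H #> x"
abbreviation "Q \<equiv> G Mod H"
abbreviation "h \<equiv> card H"
abbreviation "ST \<equiv> S <#> T"

lemma Hc: "H \<subseteq> carrier G" using H by (simp add: subgroup.subset)

lemma norm: "H \<lhd> G" using subgroup_imp_normal H by blast

lemma Qgrp: "comm_group Q" using abelian_FactGroup H by blast

lemma carrierQ: "carrier Q = \<phi> ` carrier G" by (simp add: carrier_FactGroup \<phi>_def[abs_def])

lemma carE:
  assumes "C \<in> carrier Q"
  obtains x where "x \<in> carrier G" "C = \<phi> x"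
  using assms unfolding carrierQ by (rule imageE)

lemma phi_mult: "x \<in> carrier G \<Longrightarrow> y \<in> carrier G \<Longrightarrow> \<phi> (x \<otimes> y) = \<phi> x <#> \<phi> y"
  using normal.rcos_sum[OF norm] by (simp add: \<phi>_def)

lemma phi_car: "x \<in> carrier G \<Longrightarrow> \<phi> x \<in> carrier Q" by (simp add: carrierQ)

lemma phi_mem:
  assumes "x \<in> carrier G" "y \<in> carrier G"
  shows "x \<in> \<phi> y \<longleftrightarrow> \<phi> x = \<phi> y"
proof
  show "x \<in> \<phi> y \<Longrightarrow> \<phi> x = \<phi> y" unfolding \<phi>_def by (rule repr_independence[OF _ assms(2) H(1), symmetric])
  show "\<phi> x = \<phi> y \<Longrightarrow> x \<in> \<phi> y" using rcos_self[OF assms(1) H(1)] by (simp add: \<phi>_def)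
qed

lemma phi_self: "x \<in> carrier G \<Longrightarrow> x \<in> \<phi> x" using phi_mem by blast

lemma car_mem: "C \<in> carrier Q \<Longrightarrow> x \<in> C \<longleftrightarrow> x \<in> carrier G \<and> \<phi> x = C"
proof -
  assume "C \<in> carrier Q"
  then obtain y where y: "y \<in> carrier G" "C = \<phi> y" by (auto simp: carrierQ)
  have "\<phi> y \<subseteq> carrier G" using r_coset_subset_G[OF Hc y(1)] by (simp add: \<phi>_def)
  then show ?thesis using phi_mem[of x y] y by blast
qed

lemma car_card: "C \<in> carrier Q \<Longrightarrow> card C = h" "C \<in> carrier Q \<Longrightarrow> finite C" "C \<in> carrier Q \<Longrightarrow> C \<subseteq> carrier G"
  using card_r_coset[OF Hc] finite_r_coset[OF H(2)] r_coset_subset_G[OF Hc] by (auto simp: carrierQ \<phi>_def)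

lemma Qmult: "C \<in> carrier Q \<Longrightarrow> D \<in> carrier Q \<Longrightarrow> C <#> D \<in> carrier Q"
  using monoid.m_closed[OF comm_monoid.axioms(1)[OF comm_group.axioms(1)[OF Qgrp]]] by simp

lemma phi_H: "x \<in> H \<Longrightarrow> \<phi> x = H" "\<phi> \<one> = H"
  using coset_join2[OF _ H(1)] Hc by (auto simp: \<phi>_def)

lemma phi_set_mult:
  assumes "A \<subseteq> carrier G" "B \<subseteq> carrier G"
  shows "\<phi> ` A <#>\<^bsub>Q\<^esub> \<phi> ` B = \<phi> ` (A <#> B)"
proof -
  have "\<phi> a <#> \<phi> b = \<phi> (a \<otimes> b)" if "a \<in> A" "b \<in> B" for a b using phi_mult that assms by (metis subsetD)
  then show ?thesis unfolding set_mult_def[of Q] set_mult_def[of G A B] by auto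
qed

lemma card_phi_sum:
  assumes "X \<subseteq> carrier G" "finite X"
  shows "card X = (\<Sum>C\<in>\<phi> ` X. card (X \<inter> C))"
  using card_coset_sum[OF H(1) assms, of "\<phi> ` X"] assms by (auto simp: \<phi>_def)

text \<open>Elements of the quotient are cosets, so the union of a family of them is its preimage
  under \<open>\<phi>\<close>.\<close>

lemma pre_mem:
  assumes "\<X> \<subseteq> carrier Q"
  shows "x \<in> \<Union>\<X> \<longleftrightarrow> x \<in> carrier G \<and> \<phi> x \<in> \<X>"
proof
  assume "x \<in> \<Union>\<X>"
  then obtain C where C: "C \<in> \<X>" "x \<in> C" by (rule UnionE)
  then show "x \<in> carrier G \<and> \<phi> x \<in> \<X>" using car_mem[of C x] assms by auto
next
  assume "x \<in> carrier G \<and> \<phi> x \<in> \<X>"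
  then show "x \<in> \<Union>\<X>" using phi_self[of x] by (intro UnionI) auto
qed

lemma pre_card:
  assumes "\<X> \<subseteq> carrier Q" "finite \<X>"
  shows "card (\<Union>\<X>) = h * card \<X>" "finite (\<Union>\<X>)" "\<Union>\<X> \<subseteq> carrier G"
proof -
  have C: "C \<subseteq> carrier G" "finite C" if "C \<in> \<X>" for C using car_card(2,3)[of C] that assms(1) by auto
  show f: "finite (\<Union>\<X>)" using assms(2) C(2) by auto
  show f': "\<Union>\<X> \<subseteq> carrier G" by (rule Union_least) (rule C(1))
  have "\<phi> ` \<Union>\<X> = \<X>"
  proof
    show "\<phi> ` \<Union>\<X> \<subseteq> \<X>" using pre_mem[OF assms(1)] by blast
    show "\<X> \<subseteq> \<phi> ` \<Union>\<X>"
    proof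
      fix C assume C: "C \<in> \<X>"
      then obtain x where "x \<in> carrier G" "C = \<phi> x" using assms(1) carE by (metis subsetD)
      then show "C \<in> \<phi> ` \<Union>\<X>" using C phi_self by blast
    qed
  qed
  then have "card (\<Union>\<X>) = (\<Sum>C\<in>\<X>. card (\<Union>\<X> \<inter> C))" using card_phi_sum[OF f' f] by simp
  also have "\<dots> = (\<Sum>C\<in>\<X>. h)"
  proof (rule sum.cong[OF refl])
    fix C assume C: "C \<in> \<X>"
    then have "\<Union>\<X> \<inter> C = C" by blast
    then show "card (\<Union>\<X> \<inter> C) = h" using car_card(1) C assms(1) by (metis subsetD)
  qed
  finally show "card (\<Union>\<X>) = h * card \<X>" by (simp add: mult.commute)
qed

lemma QS_sub:
  assumes "\<X> \<subseteq> carrier Q"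
  shows "\<X> <#>\<^bsub>Q\<^esub> \<phi> ` S \<subseteq> carrier Q"
proof
  fix z assume "z \<in> \<X> <#>\<^bsub>Q\<^esub> \<phi> ` S"
  then obtain C s where z: "C \<in> \<X>" "s \<in> S" "z = C <#> \<phi> s" unfolding set_mult_def[of Q] by auto
  then have "C \<in> carrier Q" "\<phi> s \<in> carrier Q" using assms phi_car S(1) by auto
  then show "z \<in> carrier Q" using Qmult z by simp
qed

lemma QS_fin: "finite \<X> \<Longrightarrow> finite (\<X> <#>\<^bsub>Q\<^esub> \<phi> ` S)"
  using S(2) unfolding set_mult_def[of Q] by auto

lemma pre_mult:
  assumes "\<X> \<subseteq> carrier Q"
  shows "\<Union>\<X> <#> S = \<Union>(\<X> <#>\<^bsub>Q\<^esub> \<phi> ` S)"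
proof -
  note sub = QS_sub[OF assms]
  show ?thesis
  proof
    show "\<Union>\<X> <#> S \<subseteq> \<Union>(\<X> <#>\<^bsub>Q\<^esub> \<phi> ` S)"
    proof
      fix z assume "z \<in> \<Union>\<X> <#> S"
      then obtain x s where xs: "x \<in> \<Union>\<X>" "s \<in> S" "z = x \<otimes> s" by (auto simp: set_mult_iff)
      then have c: "x \<in> carrier G" "\<phi> x \<in> \<X>" "s \<in> carrier G" using pre_mem[OF assms] S by auto
      then have "\<phi> z \<in> \<X> <#>\<^bsub>Q\<^esub> \<phi> ` S" unfolding set_mult_def[of Q] using phi_mult xs by auto
      moreover have "z \<in> \<phi> z" using phi_self c xs by simp
      ultimately show "z \<in> \<Union>(\<X> <#>\<^bsub>Q\<^esub> \<phi> ` S)" by blast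
    qed
    show "\<Union>(\<X> <#>\<^bsub>Q\<^esub> \<phi> ` S) \<subseteq> \<Union>\<X> <#> S"
    proof
      fix z assume "z \<in> \<Union>(\<X> <#>\<^bsub>Q\<^esub> \<phi> ` S)"
      then have z: "z \<in> carrier G" "\<phi> z \<in> \<X> <#>\<^bsub>Q\<^esub> \<phi> ` S" using pre_mem[OF sub] by auto
      then obtain C s where Cs: "C \<in> \<X>" "s \<in> S" "\<phi> z = C <#> \<phi> s" unfolding set_mult_def[of Q] by auto
      have sc: "s \<in> carrier G" using Cs S by blast
      obtain x where x: "x \<in> carrier G" "C = \<phi> x" using carE[OF subsetD[OF assms Cs(1)]] .
      have "\<phi> z = \<phi> (x \<otimes> s)" using Cs x sc phi_mult by simp
      then have "\<phi> (z \<otimes> inv s) = \<phi> (x \<otimes> s \<otimes> inv s)" using phi_mult z x sc by simp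
      then have "\<phi> (z \<otimes> inv s) = C" using x sc mult_inv_cancel(3) by simp
      then have "z \<otimes> inv s \<in> \<Union>\<X>" using pre_mem[OF assms] Cs z sc by simp
      then have "z \<otimes> inv s \<otimes> s \<in> \<Union>\<X> <#> S" by (rule set_multI[OF _ Cs(2)])
      then show "z \<in> \<Union>\<X> <#> S" using z sc mult_inv_cancel(2) by simp
    qed
  qed
qed

lemma HS_card: "card (H <#> S) = h * card (\<phi> ` S)"
proof -
  have "{H} \<subseteq> carrier Q" using phi_car[of \<one>] phi_H by simp
  then have "H <#> S = \<Union>({H} <#>\<^bsub>Q\<^esub> \<phi> ` S)" using pre_mult[of "{H}"] by simp
  also have "{H} <#>\<^bsub>Q\<^esub> \<phi> ` S = \<phi> ` S"
  proof -
    have "H <#> \<phi> s = \<phi> s" if "s \<in> S" for s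
      using phi_mult[of \<one> s] phi_H that S by (metis l_one one_closed subsetD)
    then show ?thesis unfolding set_mult_def[of Q] by auto
  qed
  finally show ?thesis using pre_card(1)[of "\<phi> ` S"] phi_car S by (auto simp: mult.commute)
qed

lemma phiS: "\<phi> ` S \<subseteq> carrier Q" "finite (\<phi> ` S)" "\<one>\<^bsub>Q\<^esub> \<in> \<phi> ` S"
proof -
  show "\<phi> ` S \<subseteq> carrier Q" "finite (\<phi> ` S)" using phi_car S by auto
  have "\<phi> \<one> \<in> \<phi> ` S" using S(3) by blast
  then show "\<one>\<^bsub>Q\<^esub> \<in> \<phi> ` S" using phi_H by simp
qed

lemma phiT: "\<phi> ` T \<subseteq> carrier Q" "finite (\<phi> ` T)" "\<phi> ` T \<noteq> {}"
  using phi_car T by auto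

lemma genQ: "generate Q (\<phi> ` S) = carrier Q"
proof -
  have "group_hom G Q \<phi>"
    unfolding group_hom_def group_hom_axioms_def
    using normal.factorgroup_is_group[OF norm] normal.r_coset_hom_Mod[OF norm] is_group
    by (simp add: \<phi>_def[abs_def])
  then have "\<phi> ` generate G S = generate Q (\<phi> ` S)" using group_hom.generate_img S(1) by blast
  then show ?thesis using S(4) carrierQ by simp
qed

lemma finQ: "finite (carrier Q) \<longleftrightarrow> finite (carrier G)"
proof
  assume f: "finite (carrier Q)"
  have "carrier G \<subseteq> \<Union>(carrier Q)" using phi_self phi_car by blast
  then show "finite (carrier G)" using pre_card(2)[OF order_refl f] finite_subset by blast
qed (simp add: carrierQ)

lemma UnionQ: "\<Union>(carrier Q) = carrier G"
  using car_card(3) phi_self phi_car by blast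

lemma ordQ: "finite (carrier G) \<Longrightarrow> card (carrier G) = h * card (carrier Q)"
  using pre_card(1)[OF order_refl] finQ UnionQ by simp

lemma pre_ext:
  assumes X: "\<X> \<subseteq> carrier Q" "\<X> <#>\<^bsub>Q\<^esub> \<phi> ` S \<noteq> carrier Q"
  shows "infinite (carrier G) \<or> 2 \<le> card (carrier G - (\<Union>\<X> <#> S))"
proof (cases "finite (carrier G)")
  case True
  let ?Z = "carrier Q - (\<X> <#>\<^bsub>Q\<^esub> \<phi> ` S)"
  note sub = QS_sub[OF X(1)]
  have f: "finite ?Z" using True finQ by simp
  have "?Z \<noteq> {}" using X sub by blast
  then have "1 \<le> card ?Z" using f by (simp add: Suc_le_eq card_gt_0_iff)
  then have "2 * 1 \<le> h * card ?Z" using H(3) by (rule mult_le_mono[rotated])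
  moreover have "\<Union>?Z \<subseteq> carrier G - (\<Union>\<X> <#> S)"
    unfolding pre_mult[OF X(1)] using pre_mem[of ?Z] pre_mem[OF sub] by blast
  then have "card (\<Union>?Z) \<le> card (carrier G - (\<Union>\<X> <#> S))" using True by (intro card_mono) auto
  ultimately show ?thesis using pre_card(1)[of ?Z] f by simp
qed simp

lemma u2: "2 \<le> card (\<phi> ` S)"
proof (rule ccontr)
  assume "\<not> ?thesis"
  then have "card (\<phi> ` S) \<le> Suc 0" by simp
  then have one: "\<phi> s = H" if "s \<in> S" for s
    using card_le_Suc0_iff_eq[OF phiS(2)] that S(3) phi_H(2) by (metis image_eqI)
  have "S \<subseteq> H"
  proof
    fix s assume s: "s \<in> S"
    then show "s \<in> H" using phi_self[of s] one[OF s] S by auto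
  qed
  then have "H = carrier G" using generate_subgroup_incl[OF _ H(1)] S(4) Hc by blast
  moreover have "H <#> S = H" using \<open>S \<subseteq> H\<close> set_mult_subgroup[OF H(1) order_refl, of S] S(3)
    by (auto simp: set_mult_iff) (metis Hc r_one subsetD)
  ultimately show False using H(4) by simp
qed

text \<open>This is the 2-fragment inequality for the preimage of \<open>\<X>\<close>, divided by
  \<open>h\<close>. As h \<ge> 2, a nonempty preimage has two elements and one missing coset leaves
  two elements outside.\<close>

lemma cauchyQ:
  assumes X: "\<X> \<subseteq> carrier Q" "finite \<X>" "\<X> \<noteq> {}" "\<X> <#>\<^bsub>Q\<^esub> \<phi> ` S \<noteq> carrier Q"
  shows "card \<X> + card (\<phi> ` S) \<le> card (\<X> <#>\<^bsub>Q\<^esub> \<phi> ` S) + 1"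
proof -
  note sub = QS_sub[OF X(1)] QS_fin[OF X(2)]
  have "1 \<le> card \<X>" using X by (simp add: Suc_le_eq card_gt_0_iff)
  then have "2 * 1 \<le> h * card \<X>" using H(3) by (rule mult_le_mono[rotated])
  then have "2 \<le> card (\<Union>\<X>)" using pre_card(1)[OF X(1,2)] by simp
  then have "card (\<Union>\<X>) + card (H <#> S) \<le> card (\<Union>\<X> <#> S) + h"
    using frag[OF pre_card(3,2)[OF X(1,2)] _ pre_ext[OF X(1,4)]] by blast
  then have "h * (card \<X> + card (\<phi> ` S)) \<le> h * (card (\<X> <#>\<^bsub>Q\<^esub> \<phi> ` S) + 1)"
    unfolding pre_mult[OF X(1)] pre_card(1)[OF X(1,2)] pre_card(1)[OF sub] HS_card by (simp add: algebra_simps)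
  from iffD1[OF mult_le_cancel1 this] show ?thesis using H(3) by simp
qed

text \<open>Otherwise the preimage of \<open>P\<close> would be a 2-fragment and a subgroup strictly
  larger than H.\<close>

lemma nosubQ:
  assumes P: "subgroup P Q" "finite P" "P \<noteq> {\<one>\<^bsub>Q\<^esub>}" "P <#>\<^bsub>Q\<^esub> \<phi> ` S \<noteq> carrier Q"
  shows "card P + card (\<phi> ` S) \<le> card (P <#>\<^bsub>Q\<^esub> \<phi> ` S)"
proof (rule ccontr)
  assume neg: "\<not> ?thesis"
  have PQ: "P \<subseteq> carrier Q" using P(1) subgroup.subset by blast
  note sub = QS_sub[OF PQ] QS_fin[OF P(2)]
  have oneP: "H \<in> P" using subgroup.one_closed[OF P(1)] by simp
  note pm = pre_mem[OF PQ]
  have inv_phi: "inv\<^bsub>Q\<^esub> (\<phi> x) = \<phi> (inv x)" if "x \<in> carrier G" for x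
  proof -
    have "\<phi> (inv x) \<otimes>\<^bsub>Q\<^esub> \<phi> x = \<one>\<^bsub>Q\<^esub>" using phi_mult[of "inv x" x] that phi_H by simp
    then show ?thesis using group.inv_equality[OF comm_group.axioms(2)[OF Qgrp]] phi_car that by simp
  qed
  have K: "subgroup (\<Union>P) G"
  proof (rule subgroupI)
    show "\<Union>P \<subseteq> carrier G" using pre_card(3)[OF PQ P(2)] .
    show "\<Union>P \<noteq> {}" using oneP subgroup.one_closed[OF H(1)] by blast
    fix x assume x: "x \<in> \<Union>P"
    then show "inv x \<in> \<Union>P" using pm inv_phi subgroup.m_inv_closed[OF P(1)] by (metis inv_closed)
    fix y assume "y \<in> \<Union>P"
    then show "x \<otimes> y \<in> \<Union>P" using x pm phi_mult subgroup.m_closed[OF P(1)] by (metis m_closed mult_FactGroup)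
  qed
  have "card (P <#>\<^bsub>Q\<^esub> \<phi> ` S) + 1 \<le> card P + card (\<phi> ` S)" using neg by simp
  then have "h * (card (P <#>\<^bsub>Q\<^esub> \<phi> ` S) + 1) \<le> h * (card P + card (\<phi> ` S))" by (rule mult_le_mono2)
  then have "card (\<Union>P <#> S) + h \<le> card (\<Union>P) + card (H <#> S)"
    unfolding pre_mult[OF PQ] pre_card(1)[OF PQ P(2)] pre_card(1)[OF sub] HS_card by (simp add: algebra_simps)
  then have KH: "\<Union>P = H"
    using maxH[OF K pre_card(2)[OF PQ P(2)] _ pre_ext[OF PQ P(4)]] oneP by blast
  have "C = H" if C: "C \<in> P" for C
  proof -
    obtain x where x: "x \<in> carrier G" "C = \<phi> x" using carE[OF subsetD[OF PQ C]] .
    then have "x \<in> H" using KH C phi_self by blast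
    then show ?thesis using x phi_H by simp
  qed
  then have "P = {H}" using oneP by blast
  then show False using P(3) by simp
qed

lemma ST: "ST \<subseteq> carrier G" "finite ST"
  using set_mult_closed S T finite_set_mult by auto

lemma aperD: "g \<in> carrier G \<Longrightarrow> g \<noteq> \<one> \<Longrightarrow> \<exists>x\<in>ST. x \<otimes> g \<notin> ST"
proof (rule ccontr)
  assume g: "g \<in> carrier G" "g \<noteq> \<one>" and "\<not> (\<exists>x\<in>ST. x \<otimes> g \<notin> ST)"
  then have "ST #> g \<subseteq> ST" by (auto simp: r_coset_def)
  then have "g \<in> stab G ST" using in_stabI[OF ST g(1)] by blast
  then show False using periodicI_stab[OF ST(1)] g aper by blast
qed

lemma n'3: "finite (carrier G) \<Longrightarrow> 3 \<le> card (carrier Q)"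
proof -
  assume f: "finite (carrier G)"
  have "\<phi> ` S \<noteq> carrier Q"
  proof
    assume e: "\<phi> ` S = carrier Q"
    have "card (H <#> S) = card (carrier G)" using HS_card e ordQ[OF f] by simp
    then have "H <#> S = carrier G" using card_subset_eq[OF f set_mult_closed[OF Hc S(1)]] by simp
    then show False using H(4) by simp
  qed
  then have "\<phi> ` S \<subset> carrier Q" using phiS by blast
  then have "card (\<phi> ` S) < card (carrier Q)" using f finQ by (intro psubset_card_mono) auto
  then show ?thesis using u2 by linarith
qed

text \<open>The order of G is at least 2 * 3, so the upper bound leaves at least (|G| - 2) / 3 > 1
  elements uncovered.\<close>

lemma ext_ST: "infinite (carrier G) \<or> 2 \<le> card (carrier G - ST)"
proof (cases "finite (carrier G)")
  case True
  have "2 * 3 \<le> h * card (carrier Q)" using H(3) n'3[OF True] by (rule mult_le_mono)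
  then have "6 \<le> card (carrier G)" using ordQ[OF True] by simp
  then have "card ST + 2 \<le> card (carrier G)" using ub[OF True] mu by linarith
  then have "2 \<le> card (carrier G - ST)" using card_Diff_subset[OF ST(2,1)] by linarith
  then show ?thesis by simp
qed simp

text \<open>Take X = T in the 2-fragment inequality: S misses at most h - \<mu> elements of the
  cosets of H that it meets. All deficit estimates rest on this.\<close>

lemma holesG: "card (\<phi> ` S) * h + \<mu> \<le> card S + h"
proof -
  have TS: "T <#> S = ST" using set_mult_comm S T by blast
  have "2 \<le> card T" using sizes mu by linarith
  then have "card T + card (H <#> S) \<le> card (T <#> S) + h"
    using frag[OF T(1,2)] ext_ST TS by simp
  then show ?thesis using tot TS HS_card by (simp add: mult.commute)
qed

definition "\<sigma> C = card (S \<inter> C)"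
definition "\<tau> C = card (T \<inter> C)"
text \<open>The value 0 outside the quotient makes the bound \<open>h\<close> valid for every
  argument, as \<open>weighted\<close> demands.\<close>

definition "\<eta> C = (if C \<in> carrier Q then card (ST \<inter> C) else 0)"

lemma eta_eq: "C \<in> carrier Q \<Longrightarrow> \<eta> C = card (ST \<inter> C)"
  by (simp add: \<eta>_def)

lemma fibre_mult:
  assumes "C \<in> carrier Q" "D \<in> carrier Q"
  shows "(S \<inter> C) <#> (T \<inter> D) \<subseteq> ST \<inter> (C <#> D)"
  unfolding set_mult_def by blast

text \<open>For the last claim, y - (S \<inter> C) and T \<inter> D are subsets of D with more than
  |D| = h elements together, so they meet.\<close>

lemma eta_bounds:
  assumes "C \<in> \<phi> ` S" "D \<in> \<phi> ` T"
  shows "\<sigma> C \<le> \<eta> (C <#> D)" "\<tau> D \<le> \<eta> (C <#> D)" "h < \<sigma> C + \<tau> D \<Longrightarrow> \<eta> (C <#> D) = h"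
proof -
  have CD: "C \<in> carrier Q" "D \<in> carrier Q" using assms phiS phiT by blast+
  obtain s t where st: "s \<in> S" "t \<in> T" "C = \<phi> s" "D = \<phi> t" using assms by blast
  have stc: "s \<in> carrier G" "t \<in> carrier G" using st S T by blast+
  have m: "s \<in> S \<inter> C" "t \<in> T \<inter> D" using st stc phi_self by auto
  have f: "finite (ST \<inter> (C <#> D))" using ST by simp
  have "card ((S \<inter> C) #> t) \<le> \<eta> (C <#> D)"
    unfolding eta_eq[OF Qmult[OF CD]] using fibre_mult[OF CD] r_coset_subset_set_mult[OF m(2), of "S \<inter> C"] f by (meson card_mono order_trans)
  then show "\<sigma> C \<le> \<eta> (C <#> D)" using card_r_coset[of "S \<inter> C" t] S(1) stc by (simp add: \<sigma>_def le_infI1)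
  have "card ((T \<inter> D) #> s) \<le> \<eta> (C <#> D)"
    unfolding eta_eq[OF Qmult[OF CD]] using fibre_mult[OF CD] r_coset_subset_set_mult[OF m(1), of "T \<inter> D"] f
      set_mult_comm[of "T \<inter> D" "S \<inter> C"] S T by (metis card_mono inf.coboundedI1 order_trans)
  then show "\<tau> D \<le> \<eta> (C <#> D)" using card_r_coset[of "T \<inter> D" s] T(1) stc by (simp add: \<tau>_def le_infI1)
  assume big: "h < \<sigma> C + \<tau> D"
  have "C <#> D \<subseteq> ST"
  proof
    fix y assume y: "y \<in> C <#> D"
    have yc: "y \<in> carrier G" "\<phi> y = C <#> D" using y car_mem[OF Qmult[OF CD]] by blast+
    define A where "A = (\<lambda>x. y \<otimes> inv x) ` (S \<inter> C)"
    have AD: "A \<subseteq> D"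
    proof
      fix a assume "a \<in> A"
      then obtain x where x: "x \<in> S" "x \<in> C" "a = y \<otimes> inv x" by (auto simp: A_def)
      have xc: "x \<in> carrier G" "\<phi> x = C" using x car_mem[OF CD(1)] by auto
      have "\<phi> y = \<phi> (t \<otimes> x)" using yc(2) phi_mult[of x t] phi_mult[of t x] xc stc st m_comm[of x t] by simp
      then have "\<phi> a = \<phi> (t \<otimes> x \<otimes> inv x)" using phi_mult x xc yc stc by simp
      then have "\<phi> a = D" using xc stc st mult_inv_cancel(3) by simp
      then show "a \<in> D" using car_mem[OF CD(2)] x xc yc by simp
    qed
    have "card A = \<sigma> C"
      unfolding A_def \<sigma>_def using yc S mult_inv_eq_iff by (intro card_image inj_onI) blast
    moreover have "card (A \<union> (T \<inter> D)) \<le> h" using card_mono[OF car_card(2)[OF CD(2)], of "A \<union> (T \<inter> D)"] AD car_card(1)[OF CD(2)] by auto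
    moreover have "finite A" "finite (T \<inter> D)" using S T by (auto simp: A_def)
    ultimately have "A \<inter> (T \<inter> D) \<noteq> {}"
      using big card_Un_disjoint[of A "T \<inter> D"] by (auto simp: \<tau>_def)
    then obtain x where x: "x \<in> S" "y \<otimes> inv x \<in> T" by (auto simp: A_def)
    then have "x \<otimes> (y \<otimes> inv x) \<in> ST" by (rule set_multI)
    then show "y \<in> ST" using mult_inv_cancel(1)[of x y] x S yc by auto
  qed
  then have "ST \<inter> (C <#> D) = C <#> D" by blast
  then show "\<eta> (C <#> D) = h" using car_card(1)[OF Qmult[OF CD]] by (simp add: eta_eq[OF Qmult[OF CD]])
qed

lemma phi_ST: "\<phi> ` S <#>\<^bsub>Q\<^esub> \<phi> ` T = \<phi> ` ST"
  using phi_set_mult S T by blast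

text \<open>If all fibres were full, every element of H would be a period of S + T.\<close>

lemma nonfullG: "\<exists>C\<in>\<phi> ` ST. \<eta> C < h"
proof (rule ccontr)
  assume "\<not> ?thesis"
  then have full: "h \<le> \<eta> C" if "C \<in> \<phi> ` ST" for C using that by force
  obtain g where g: "g \<in> H" "g \<noteq> \<one>"
    using H(3) by (metis card_le_Suc0_iff_eq H(2) not_less_eq_eq numeral_2_eq_2)
  have gc: "g \<in> carrier G" using g Hc by blast
  obtain x where x: "x \<in> ST" "x \<otimes> g \<notin> ST" using aperD[OF gc g(2)] by blast
  have xc: "x \<in> carrier G" using x ST by blast
  have CQ: "\<phi> x \<in> carrier Q" using phi_car xc by blast
  have "ST \<inter> \<phi> x = \<phi> x"
    using card_seteq[OF car_card(2)[OF CQ], of "ST \<inter> \<phi> x"] full[of "\<phi> x"] x car_card(1)[OF CQ] eta_eq[OF CQ] by auto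
  moreover have "x \<otimes> g \<in> \<phi> x" using g gc xc m_comm[of x g] by (auto simp: \<phi>_def r_coset_iff)
  ultimately show False using x by blast
qed

lemma weightedQ: "weighted Q (\<phi> ` S) (\<phi> ` T) \<sigma> \<tau> \<eta> h \<mu>"
proof -
  interpret Q: comm_group Q by (rule Qgrp)
  have cs: "cauchy_set Q (\<phi> ` S)"
  proof (unfold_locales)
    show "\<phi> ` S \<subseteq> carrier Q" "finite (\<phi> ` S)" "\<one>\<^bsub>Q\<^esub> \<in> \<phi> ` S" by (rule phiS)+
    show "generate Q (\<phi> ` S) = carrier Q" by (rule genQ)
    show "2 \<le> card (\<phi> ` S)" by (rule u2)
    show "card X + card (\<phi> ` S) \<le> card (X <#>\<^bsub>Q\<^esub> \<phi> ` S) + 1"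
      if "X \<subseteq> carrier Q" "finite X" "X \<noteq> {}" "X <#>\<^bsub>Q\<^esub> \<phi> ` S \<noteq> carrier Q" for X
      using cauchyQ that by blast
    show "card P + card (\<phi> ` S) \<le> card (P <#>\<^bsub>Q\<^esub> \<phi> ` S)"
      if "subgroup P Q" "finite P" "P \<noteq> {\<one>\<^bsub>Q\<^esub>}" "P <#>\<^bsub>Q\<^esub> \<phi> ` S \<noteq> carrier Q" for P
      using nosubQ that by blast
    assume "finite (carrier Q)"
    then have f: "finite (carrier G)" using finQ by blast
    \<comment> \<open>From |S| \<le> |T| one has 2|S| \<le> |S + T| + \<mu>, so 6|S| \<le> 2|G| +
      5\<mu>; six times \<open>holesG\<close> absorbs the 5\<mu>.\<close>
    have "6 * (card (\<phi> ` S) * h) \<le> 2 * (h * card (carrier Q)) + 6 * h"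
      using holesG ub[OF f] sizes tot ordQ[OF f] mu by linarith
    then have "(2 * h) * (3 * card (\<phi> ` S)) \<le> (2 * h) * (card (carrier Q) + 3)" by (simp add: algebra_simps)
    from iffD1[OF mult_le_cancel1 this] show "3 * card (\<phi> ` S) \<le> card (carrier Q) + 3" using H(3) by simp
  qed
  have sumS: "sum \<sigma> (\<phi> ` S) = card S" using card_phi_sum[OF S(1,2)] by (simp add: \<sigma>_def)
  have sumT: "sum \<tau> (\<phi> ` T) = card T" using card_phi_sum[OF T(1,2)] by (simp add: \<tau>_def)
  have sumST: "sum \<eta> (\<phi> ` S <#>\<^bsub>Q\<^esub> \<phi> ` T) = card ST"
  proof -
    have "sum \<eta> (\<phi> ` ST) = (\<Sum>C\<in>\<phi> ` ST. card (ST \<inter> C))"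
      using phi_car ST by (intro sum.cong refl eta_eq) blast
    then show ?thesis using card_phi_sum[OF ST] phi_ST by simp
  qed
  have inter: "1 \<le> card (X \<inter> C) \<and> card (X \<inter> C) \<le> h" if X: "X \<subseteq> carrier G" "finite X" "C \<in> \<phi> ` X" for X C
  proof -
    obtain x where x: "x \<in> X" "C = \<phi> x" using X by blast
    then have "x \<in> X \<inter> C" using phi_self X by blast
    moreover have "C \<in> carrier Q" using x X phi_car by blast
    ultimately show ?thesis
      using car_card[of C] card_mono[of C "X \<inter> C"] X by (auto simp: Suc_le_eq card_gt_0_iff)
  qed
  show ?thesis
  proof (intro weighted.intro cs weighted_axioms.intro)
    show "\<phi> ` T \<subseteq> carrier Q" "finite (\<phi> ` T)" "\<phi> ` T \<noteq> {}" by (rule phiT)+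
    show "1 \<le> \<sigma> s \<and> \<sigma> s \<le> h" if "s \<in> \<phi> ` S" for s using inter[OF S(1,2) that] by (simp add: \<sigma>_def)
    show "1 \<le> \<tau> a \<and> \<tau> a \<le> h" if "a \<in> \<phi> ` T" for a using inter[OF T(1,2) that] by (simp add: \<tau>_def)
    show "\<eta> y \<le> h" for y
    proof (cases "y \<in> carrier Q")
      case True
      then show ?thesis using card_mono[of y "ST \<inter> y"] car_card[of y] by (simp add: eta_eq)
    qed (simp add: \<eta>_def)
    show "\<sigma> s \<le> \<eta> (s \<otimes>\<^bsub>Q\<^esub> a)" if "s \<in> \<phi> ` S" "a \<in> \<phi> ` T" for s a using eta_bounds(1)[OF that] by simp
    show "\<tau> a \<le> \<eta> (s \<otimes>\<^bsub>Q\<^esub> a)" if "s \<in> \<phi> ` S" "a \<in> \<phi> ` T" for s a using eta_bounds(2)[OF that] by simp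
    show "\<eta> (s \<otimes>\<^bsub>Q\<^esub> a) = h" if "s \<in> \<phi> ` S" "a \<in> \<phi> ` T" "h < \<sigma> s + \<tau> a" for s a
      using eta_bounds(3)[OF that] by simp
    show "sum \<eta> (\<phi> ` S <#>\<^bsub>Q\<^esub> \<phi> ` T) + \<mu> = sum \<sigma> (\<phi> ` S) + sum \<tau> (\<phi> ` T)"
      using sumS sumT sumST tot by simp
    show "\<mu> \<le> 1" by (rule mu)
    show "card (\<phi> ` S) * h + \<mu> \<le> sum \<sigma> (\<phi> ` S) + h" using holesG sumS by simp
    show "sum \<sigma> (\<phi> ` S) \<le> sum \<tau> (\<phi> ` T)" using sumS sumT sizes by simp
    show "\<exists>y\<in>\<phi> ` S <#>\<^bsub>Q\<^esub> \<phi> ` T. \<eta> y < h" using nonfullG phi_ST by simp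
    show "2 \<le> h" by (rule H)
    assume "finite (carrier Q)"
    then have f: "finite (carrier G)" using finQ by blast
    show "3 * sum \<eta> (\<phi> ` S <#>\<^bsub>Q\<^esub> \<phi> ` T) \<le> 2 * card (carrier Q) * h + 2 * \<mu>"
      using ub[OF f] sumST ordQ[OF f] by (simp add: algebra_simps)
  qed
qed

end

section \<open>Periods of the fibres of S + T\<close>

context hyper
begin

sublocale W: weighted Q "\<phi> ` S" "\<phi> ` T" \<sigma> \<tau> \<eta> h \<mu>
  by (rule weightedQ)

lemma phiS_car: "C \<in> \<phi> ` S \<Longrightarrow> C \<in> carrier Q" using phiS(1) by (rule subsetD)
lemma phiT_car: "C \<in> \<phi> ` T \<Longrightarrow> C \<in> carrier Q" using phiT(1) by (rule subsetD)

lemma fib_sub: "S \<inter> C \<subseteq> carrier G" "T \<inter> C \<subseteq> carrier G" "ST \<inter> C \<subseteq> carrier G"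
  "finite (S \<inter> C)" "finite (T \<inter> C)" "finite (ST \<inter> C)"
  using S T ST by auto

lemma T_fib: "D \<in> \<phi> ` T \<Longrightarrow> \<exists>t. t \<in> T \<inter> D"
  using phi_self T(1) by auto

lemma S_fib: "C \<in> \<phi> ` S \<Longrightarrow> \<exists>s. s \<in> S \<inter> C"
  using phi_self S(1) by auto

lemma sum_fibre:
  assumes "C \<in> \<phi> ` S" "D \<in> \<phi> ` T" "t \<in> T \<inter> D" "\<eta> (C <#> D) \<le> \<sigma> C"
  shows "ST \<inter> (C <#> D) = (S \<inter> C) #> t" "t' \<in> T \<inter> D \<Longrightarrow> t' \<otimes> inv t \<in> stab G (S \<inter> C)"
proof -
  note CD = phiS_car[OF assms(1)] phiT_car[OF assms(2)]
  have le: "card (ST \<inter> (C <#> D)) \<le> card (S \<inter> C)" using assms(4) eta_eq[OF Qmult[OF CD]] by (simp add: \<sigma>_def)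
  note e = set_mult_eq_r_coset[OF fib_sub(1) fib_sub(4) fib_sub(2) assms(3) fibre_mult[OF CD] fib_sub(6) le]
  show "ST \<inter> (C <#> D) = (S \<inter> C) #> t" by (rule e(1))
  show "t' \<in> T \<inter> D \<Longrightarrow> t' \<otimes> inv t \<in> stab G (S \<inter> C)" by (rule e(2))
qed

lemma stab_H:
  assumes C: "C \<in> carrier Q" and X: "X \<subseteq> C" "x \<in> X" and g: "g \<in> stab G X"
  shows "g \<in> H"
proof -
  have x: "x \<in> carrier G" "\<phi> x = C" using car_mem[OF C, of x] X by auto
  have gc: "g \<in> carrier G" using g by (simp add: stab_def)
  have "x \<otimes> g \<in> \<phi> x" using stab_mult_mem[OF X(2) g] X x by auto
  then obtain k where k: "k \<in> H" "x \<otimes> g = k \<otimes> x" by (auto simp: \<phi>_def r_coset_iff)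
  have kc: "k \<in> carrier G" using k Hc by auto
  have "x \<otimes> g = x \<otimes> k" using k kc x m_comm by simp
  then have "g = k" using x gc kc by simp
  then show ?thesis using k by simp
qed

lemma periodicD:
  assumes g: "g \<in> carrier G" "g \<noteq> \<one>" and st: "\<And>C. C \<in> carrier Q \<Longrightarrow> C \<in> \<phi> ` ST \<Longrightarrow> g \<in> stab G (ST \<inter> C)"
  shows False
proof -
  obtain x where x: "x \<in> ST" "x \<otimes> g \<notin> ST" using aperD[OF g] by auto
  have xc: "x \<in> carrier G" using x ST by auto
  have "g \<in> stab G (ST \<inter> \<phi> x)" using st[OF phi_car[OF xc]] x by auto
  moreover have "x \<in> ST \<inter> \<phi> x" using x phi_self[OF xc] by auto
  ultimately have "x \<otimes> g \<in> ST \<inter> \<phi> x" by (rule stab_mult_mem[rotated])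
  then show False using x by auto
qed

lemma full_stab:
  assumes C: "C \<in> carrier Q" "\<eta> C = h" and g: "g \<in> H"
  shows "g \<in> stab G (ST \<inter> C)"
proof -
  have e: "ST \<inter> C = C"
    using card_seteq[OF car_card(2)[OF C(1)], of "ST \<inter> C"] C car_card(1)[OF C(1)] eta_eq[OF C(1)] by simp
  have gc: "g \<in> carrier G" using g Hc by auto
  have "C #> g \<subseteq> C"
  proof
    fix z assume "z \<in> C #> g"
    then obtain x where x: "x \<in> C" "z = x \<otimes> g" by (auto simp: r_coset_iff)
    then have xc: "x \<in> carrier G" "\<phi> x = C" using car_mem[OF C(1), of x] by auto
    have "z = g \<otimes> x" using x xc gc m_comm by simp
    then have "z \<in> \<phi> x" using g by (auto simp: \<phi>_def r_coset_iff)
    then show "z \<in> C" using xc by simp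
  qed
  then show ?thesis unfolding e using in_stabI[OF car_card(3)[OF C(1)] car_card(2)[OF C(1)] gc] by simp
qed

text \<open>Two elements of T \<inter> D differ by a period of S \<inter> C; it lies in H because it
  keeps a nonempty subset of one coset in that coset.\<close>

lemma nontriv:
  assumes "C \<in> \<phi> ` S" "D \<in> \<phi> ` T" "\<eta> (C <#> D) \<le> \<sigma> C" "2 \<le> \<tau> D"
  obtains g where "g \<in> stab G (S \<inter> C)" "g \<noteq> \<one>" "g \<in> H" "g \<in> carrier G"
proof -
  have "\<not> card (T \<inter> D) \<le> Suc 0" using assms(4) by (simp add: \<tau>_def)
  then obtain t t' where t: "t \<in> T \<inter> D" "t' \<in> T \<inter> D" "t \<noteq> t'"
    using card_le_Suc0_iff_eq[OF fib_sub(5)] by metis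
  have tc: "t \<in> carrier G" "t' \<in> carrier G" using t T by auto
  have g: "t' \<otimes> inv t \<in> stab G (S \<inter> C)" by (rule sum_fibre(2)[OF assms(1,2) t(1) assms(3) t(2)])
  have "t' \<otimes> inv t \<noteq> \<one>"
  proof
    assume "t' \<otimes> inv t = \<one>"
    then have "(t' \<otimes> inv t) \<otimes> t = \<one> \<otimes> t" by simp
    then show False using t tc mult_inv_cancel(2)[of t t'] by simp
  qed
  moreover obtain s where "s \<in> S \<inter> C" using S_fib[OF assms(1)] by auto
  then have "t' \<otimes> inv t \<in> H" using stab_H[OF phiS_car[OF assms(1)] _ _ g] by auto
  ultimately show ?thesis using that[OF g] tc by auto
qed

lemma divQ:
  assumes "C \<in> carrier Q" "s \<in> carrier Q"
  obtains D where "D \<in> carrier Q" "s <#> D = C"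
proof -
  obtain x y where xy: "x \<in> carrier G" "C = \<phi> x" "y \<in> carrier G" "s = \<phi> y" using carE[OF assms(1)] carE[OF assms(2)] by metis
  have "s <#> \<phi> (inv y \<otimes> x) = \<phi> (y \<otimes> (inv y \<otimes> x))" using phi_mult[of y "inv y \<otimes> x"] xy by simp
  also have "y \<otimes> (inv y \<otimes> x) = x" using xy by (simp add: m_assoc[symmetric])
  finally have e: "s <#> \<phi> (inv y \<otimes> x) = C" using xy by simp
  have "\<phi> (inv y \<otimes> x) \<in> carrier Q" using phi_car xy by simp
  then show ?thesis using e by (rule that)
qed

lemma stab_of_rep:
  assumes "C \<in> \<phi> ` S" "D \<in> \<phi> ` T" "\<eta> (C <#> D) \<le> \<sigma> C" "g \<in> stab G (S \<inter> C)"
  shows "g \<in> stab G (ST \<inter> (C <#> D))"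
proof -
  obtain t where t: "t \<in> T \<inter> D" using T_fib[OF assms(2)] by auto
  have tc: "t \<in> carrier G" using t T by auto
  show ?thesis unfolding sum_fibre(1)[OF assms(1,2) t assms(3)] using stab_r_coset[OF fib_sub(1) tc] assms(4) by simp
qed

text \<open>As T meets every coset, each fibre of S + T is a translate of S \<inter> s0, so a
  nonzero period of S \<inter> s0 is a period of S + T. Without such periods the shift w taking S
  \<inter> s0 to S \<inter> s1 is unique, and comparing two representations of one fibre shows that
  T + w lies in T.\<close>

lemma constant_weights:
  assumes s: "s0 \<in> \<phi> ` S" "s1 \<in> \<phi> ` S" "s0 \<noteq> s1" "\<sigma> s0 = c" "\<sigma> s1 = c"
    and eta: "\<And>C. C \<in> carrier Q \<Longrightarrow> \<eta> C = c" and Tall: "\<phi> ` T = carrier Q"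
  shows False
proof (cases "\<exists>g\<in>stab G (S \<inter> s0). g \<noteq> \<one>")
  case True
  then obtain g where g: "g \<in> stab G (S \<inter> s0)" "g \<noteq> \<one>" by auto
  show False
  proof (rule periodicD[OF _ g(2)])
    show "g \<in> carrier G" using g by (simp add: stab_def)
    fix C assume C: "C \<in> carrier Q"
    obtain D where D: "D \<in> carrier Q" "s0 <#> D = C" by (rule divQ[OF C phiS_car[OF s(1)]])
    have "D \<in> \<phi> ` T" using D Tall by simp
    then show "g \<in> stab G (ST \<inter> C)" using stab_of_rep[OF s(1) _ _ g(1), of D] D(2) eta[OF C] s(4) by simp
  qed
next
  case False
  have ex: "\<exists>t'\<in>T. (S \<inter> s0) #> (t' \<otimes> inv t) = S \<inter> s1" if t: "t \<in> T" for t
  proof -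
    have tc: "t \<in> carrier G" using t T by auto
    have tD: "\<phi> t \<in> \<phi> ` T" "t \<in> T \<inter> \<phi> t" using t phi_self[OF tc] by auto
    have C: "s1 <#> \<phi> t \<in> carrier Q" using Qmult[OF phiS_car[OF s(2)] phi_car[OF tc]] .
    obtain D where D: "D \<in> carrier Q" "s0 <#> D = s1 <#> \<phi> t" by (rule divQ[OF C phiS_car[OF s(1)]])
    have DT: "D \<in> \<phi> ` T" using D Tall by simp
    obtain t' where t': "t' \<in> T \<inter> D" using T_fib[OF DT] by auto
    have t'c: "t' \<in> carrier G" using t' T by auto
    have "(S \<inter> s0) #> t' = (S \<inter> s1) #> t"
      using sum_fibre(1)[OF s(1) DT t'] sum_fibre(1)[OF s(2) tD] D(2) eta[OF C] s(4,5) by simp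
    then have "((S \<inter> s0) #> t') #> inv t = S \<inter> s1" using r_coset_mult_inv(1)[OF fib_sub(1) tc] by simp
    then have "(S \<inter> s0) #> (t' \<otimes> inv t) = S \<inter> s1" using coset_mult_assoc[OF fib_sub(1) t'c] tc by simp
    then show ?thesis using t' by auto
  qed
  obtain t0 where t0: "t0 \<in> T" using T by auto
  obtain t0' where t0': "t0' \<in> T" "(S \<inter> s0) #> (t0' \<otimes> inv t0) = S \<inter> s1" using ex[OF t0] by auto
  define w where "w = t0' \<otimes> inv t0"
  have "t0 \<in> carrier G" "t0' \<in> carrier G" using t0 t0'(1) T(1) by auto
  then have wc: "w \<in> carrier G" by (simp add: w_def)
  have w: "(S \<inter> s0) #> w = S \<inter> s1" using t0' by (simp add: w_def)
  have Tw: "t \<otimes> w \<in> T" if t: "t \<in> T" for t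
  proof -
    obtain t' where t': "t' \<in> T" "(S \<inter> s0) #> (t' \<otimes> inv t) = S \<inter> s1" using ex[OF t] by auto
    have c: "t \<in> carrier G" "t' \<in> carrier G" using t t' T by auto
    let ?v = "t' \<otimes> inv t"
    have vc: "?v \<in> carrier G" using c by simp
    have "(S \<inter> s1) #> inv w = S \<inter> s0" using r_coset_mult_inv(1)[OF fib_sub(1) wc, of s0] unfolding w .
    then have "((S \<inter> s0) #> ?v) #> inv w = S \<inter> s0" unfolding t'(2) .
    then have "(S \<inter> s0) #> (?v \<otimes> inv w) = S \<inter> s0" using coset_mult_assoc[OF fib_sub(1) vc, of "inv w" s0] wc by simp
    then have "?v \<otimes> inv w \<in> stab G (S \<inter> s0)" using vc wc by (simp add: stab_def)
    then have "?v \<otimes> inv w = \<one>" using False by auto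
    then have "?v \<otimes> inv w \<otimes> w = w" using wc by simp
    then have "?v = w" using mult_inv_cancel(2)[OF wc vc] by simp
    then have "t \<otimes> w = t'" using mult_inv_cancel(1)[OF c] by simp
    then show ?thesis using t' by simp
  qed
  have "w \<noteq> \<one>"
  proof
    assume "w = \<one>"
    then have "S \<inter> s0 = S \<inter> s1" using w coset_mult_one[OF fib_sub(1)] by simp
    moreover obtain x where "x \<in> S \<inter> s0" using S_fib[OF s(1)] by auto
    ultimately have "x \<in> s0" "x \<in> s1" by auto
    then show False using car_mem[OF phiS_car[OF s(1)], of x] car_mem[OF phiS_car[OF s(2)], of x] s(3) by auto
  qed
  then obtain x where x: "x \<in> ST" "x \<otimes> w \<notin> ST" using aperD[OF wc] by auto
  then obtain a b where ab: "a \<in> S" "b \<in> T" "x = a \<otimes> b" by (auto simp: set_mult_iff)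
  then have "x \<otimes> w = a \<otimes> (b \<otimes> w)" using wc S T by (auto simp: m_assoc subset_iff)
  then show False using set_multI[OF ab(1) Tw[OF ab(2)]] x by simp
qed

lemma sum_sigma: "sum \<sigma> (\<phi> ` S) = card S" using card_phi_sum[OF S(1,2)] by (simp add: \<sigma>_def)
lemma sum_tau: "sum \<tau> (\<phi> ` T) = card T" using card_phi_sum[OF T(1,2)] by (simp add: \<tau>_def)

text \<open>Every half-full fibre of S + T arises from \<open>s0\<close> or \<open>s1\<close>. There
  are two more of them than cosets in the image of T, so some coset \<open>a\<close> is used with
  both. There T \<inter> a is a coset of the stabilizers of S \<inter> s0 and of S \<inter> s1,
  which thus coincide; a nonzero element of them would be a period of S + T. Hence h = 2, and the
  rest is counting in the quotient.\<close>

lemma not_large: "\<not> card (\<phi> ` S) + card (\<phi> ` T) \<le> card W.Y"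
proof
  assume big: "card (\<phi> ` S) + card (\<phi> ` T) \<le> card W.Y"
  obtain s0 s1 q where s: "s0 \<in> \<phi> ` S" "s1 \<in> \<phi> ` S" "s0 \<noteq> s1" and hq: "h = 2 * q" and sq: "\<sigma> s0 = q" "\<sigma> s1 = q"
    and srest: "\<And>s. s \<in> \<phi> ` S \<Longrightarrow> s \<noteq> s0 \<Longrightarrow> s \<noteq> s1 \<Longrightarrow> \<sigma> s = h" and tq: "\<And>a. a \<in> \<phi> ` T \<Longrightarrow> \<tau> a = q"
    and eq: "\<And>y. y \<in> W.Y \<Longrightarrow> \<eta> y = q \<or> \<eta> y = h" and cN: "card {y \<in> W.Y. \<eta> y = q} = card (\<phi> ` T) + 2"
    and m0: "\<mu> = 0" and cY: "card W.Y = card (\<phi> ` S) + card (\<phi> ` T)"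
    by (rule W.large_structure[OF big], rule that)
  have q1: "1 \<le> q" using hq H(3) by simp
  define N where "N = {y \<in> W.Y. \<eta> y = q}"
  define A where "A = (\<lambda>s. {a \<in> \<phi> ` T. s <#> a \<in> N})"
  have AT: "A s \<subseteq> \<phi> ` T" "finite (A s)" for s using phiT by (auto simp: A_def)
  have Nrep: "\<exists>a. (a \<in> A s0 \<and> C = s0 <#> a) \<or> (a \<in> A s1 \<and> C = s1 <#> a)" if C: "C \<in> N" for C
  proof -
    have "C \<in> W.Y" using C by (simp add: N_def)
    then obtain s' a where sa: "s' \<in> \<phi> ` S" "a \<in> \<phi> ` T" "C = s' <#> a" unfolding set_mult_def[of Q] by auto
    have "\<sigma> s' \<le> q" using eta_bounds(1)[OF sa(1,2)] sa(3) C by (simp add: N_def)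
    then have "s' = s0 \<or> s' = s1" using srest[OF sa(1)] hq q1 by linarith
    then show ?thesis using sa C by (auto simp: A_def)
  qed
  have "N \<subseteq> (\<lambda>a. s0 <#> a) ` A s0 \<union> (\<lambda>a. s1 <#> a) ` A s1"
  proof
    fix C assume "C \<in> N"
    from Nrep[OF this] show "C \<in> (\<lambda>a. s0 <#> a) ` A s0 \<union> (\<lambda>a. s1 <#> a) ` A s1" by auto
  qed
  then have "card N \<le> card ((\<lambda>a. s0 <#> a) ` A s0 \<union> (\<lambda>a. s1 <#> a) ` A s1)" using AT by (intro card_mono) auto
  also have "\<dots> \<le> card ((\<lambda>a. s0 <#> a) ` A s0) + card ((\<lambda>a. s1 <#> a) ` A s1)" by (rule card_Un_le)
  also have "\<dots> \<le> card (A s0) + card (A s1)" using card_image_le[OF AT(2)] by (intro add_mono)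
  finally have le: "card (\<phi> ` T) + 2 \<le> card (A s0) + card (A s1)" using cN by (simp add: N_def)
  have "A s0 \<inter> A s1 \<noteq> {}"
  proof
    assume "A s0 \<inter> A s1 = {}"
    then have "card (A s0) + card (A s1) = card (A s0 \<union> A s1)" using card_Un_disjoint AT by metis
    also have "\<dots> \<le> card (\<phi> ` T)" using AT phiT by (intro card_mono) auto
    finally show False using le by simp
  qed
  then obtain a where a: "a \<in> A s0" "a \<in> A s1" by auto
  have aT: "a \<in> \<phi> ` T" using a by (simp add: A_def)
  obtain t where t: "t \<in> T \<inter> a" using T_fib[OF aT] by auto
  have tc: "t \<in> carrier G" using t T by auto
  have coset: "T \<inter> a = stab G (S \<inter> s) #> t \<and> card (stab G (S \<inter> s)) = q" if s': "s \<in> \<phi> ` S" "\<sigma> s = q" "a \<in> A s" for s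
  proof -
    have e: "\<eta> (s <#> a) \<le> \<sigma> s" using s' by (simp add: A_def N_def)
    obtain x where x: "x \<in> S \<inter> s" using S_fib[OF s'(1)] by auto
    have ne: "S \<inter> s \<noteq> {}" using x by auto
    have cs: "card (stab G (S \<inter> s)) \<le> q" "finite (stab G (S \<inter> s))"
      using card_stab_le[OF fib_sub(1) fib_sub(4) ne] s'(2) by (auto simp: \<sigma>_def)
    have sub: "T \<inter> a \<subseteq> stab G (S \<inter> s) #> t"
    proof
      fix t' assume t': "t' \<in> T \<inter> a"
      have t'c: "t' \<in> carrier G" using t' T by auto
      have "t' \<otimes> inv t \<in> stab G (S \<inter> s)" by (rule sum_fibre(2)[OF s'(1) aT t e t'])
      moreover have "t' = (t' \<otimes> inv t) \<otimes> t" using mult_inv_cancel(2)[OF tc t'c] by simp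
      ultimately show "t' \<in> stab G (S \<inter> s) #> t" unfolding r_coset_iff by (rule bexI[rotated])
    qed
    have cc: "card (stab G (S \<inter> s) #> t) = card (stab G (S \<inter> s))" by (rule card_r_coset[OF stab_carrier tc])
    have ct: "card (T \<inter> a) = q" using tq[OF aT] by (simp add: \<tau>_def)
    have "T \<inter> a = stab G (S \<inter> s) #> t"
      by (rule card_seteq[OF finite_r_coset[OF cs(2)] sub]) (use cc ct cs in simp)
    then show ?thesis using cc ct by simp
  qed
  have K01: "stab G (S \<inter> s0) = stab G (S \<inter> s1)"
    using coset[OF s(1) sq(1) a(1)] coset[OF s(2) sq(2) a(2)] r_coset_eq_iff[OF stab_carrier stab_carrier tc] by metis
  have trivial: "g = \<one>" if g: "g \<in> stab G (S \<inter> s0)" for g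
  proof (rule ccontr)
    assume g1: "g \<noteq> \<one>"
    obtain x where x: "x \<in> S \<inter> s0" using S_fib[OF s(1)] by auto
    have gH: "g \<in> H" using stab_H[OF phiS_car[OF s(1)] _ x g] by auto
    show False
    proof (rule periodicD[OF _ g1])
      show "g \<in> carrier G" using gH Hc by auto
      fix C assume C: "C \<in> carrier Q" "C \<in> \<phi> ` ST"
      then have CY: "C \<in> W.Y" using phi_ST by simp
      show "g \<in> stab G (ST \<inter> C)"
      proof (cases "\<eta> C = h")
        case True
        then show ?thesis using full_stab[OF C(1) _ gH] by simp
      next
        case False
        then have CN: "C \<in> N" using eq[OF CY] CY by (simp add: N_def)
        have e: "\<eta> C = q" using CN by (simp add: N_def)
        from Nrep[OF CN] obtain b where b: "(b \<in> A s0 \<and> C = s0 <#> b) \<or> (b \<in> A s1 \<and> C = s1 <#> b)" by auto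
        then show ?thesis
        proof
          assume b: "b \<in> A s0 \<and> C = s0 <#> b"
          then have "b \<in> \<phi> ` T" using AT by auto
          then show ?thesis using stab_of_rep[OF s(1) _ _ g, of b] b e sq by simp
        next
          assume b: "b \<in> A s1 \<and> C = s1 <#> b"
          then have "b \<in> \<phi> ` T" using AT by auto
          then show ?thesis using stab_of_rep[OF s(2) _ _, of b g] b e sq g K01 by simp
        qed
      qed
    qed
  qed
  have "stab G (S \<inter> s0) = {\<one>}" using trivial one_stab[OF fib_sub(1)] by auto
  then have qq: "q = 1" using coset[OF s(1) sq(1) a(1)] by simp
  then have hh: "h = 2" using hq by simp
  have t4: "4 \<le> card (\<phi> ` T)"
  proof -
    have "sum \<tau> (\<phi> ` T) = card (\<phi> ` T)" using tq qq by simp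
    then show ?thesis using sum_tau sizes(2) m0 by simp
  qed
  \<comment> \<open>The full cosets of S. The sum of \<open>F\<close> with the image of T has only
    |F| elements, so that image lies in one coset of the stabilizer \<open>P\<close> of
    \<open>F\<close>.\<close>
  define F where "F = \<phi> ` S - {s0, s1}"
  have F: "F \<subseteq> carrier Q" "finite F" "card F + 2 = card (\<phi> ` S)" "F \<subseteq> \<phi> ` S"
  proof -
    show "F \<subseteq> carrier Q" "finite F" "F \<subseteq> \<phi> ` S" using phiS by (auto simp: F_def)
    have "card F = card (\<phi> ` S) - 2" using s phiS unfolding F_def by (subst card_Diff_subset) auto
    then show "card F + 2 = card (\<phi> ` S)" using u2 by simp
  qed
  have "sum \<sigma> (\<phi> ` S) = sum \<sigma> F + sum \<sigma> {s0, s1}"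
    using sum.subset_diff[of "{s0, s1}" "\<phi> ` S" \<sigma>] s phiS by (simp add: F_def)
  moreover have "sum \<sigma> F = 2 * card F" using srest hh by (simp add: F_def)
  ultimately have "card S = 2 * card F + 2" using sum_sigma sq qq s(3) by simp
  then have Fne: "F \<noteq> {}" using sizes(1) m0 by auto
  have FT: "F <#>\<^bsub>Q\<^esub> \<phi> ` T \<subseteq> W.Y - N"
  proof
    fix C assume "C \<in> F <#>\<^bsub>Q\<^esub> \<phi> ` T"
    then obtain s' a where sa: "s' \<in> F" "a \<in> \<phi> ` T" "C = s' <#> a" unfolding set_mult_def[of Q] by auto
    have sS: "s' \<in> \<phi> ` S" using sa F by auto
    have "\<sigma> s' = h" using srest[OF sS] sa by (auto simp: F_def)
    then have "h \<le> \<eta> C" using eta_bounds(1)[OF sS sa(2)] sa(3) by simp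
    moreover have "C \<in> W.Y" unfolding set_mult_def[of Q] using sS sa by auto
    ultimately show "C \<in> W.Y - N" using hh qq by (auto simp: N_def)
  qed
  have NY: "N \<subseteq> W.Y" "finite N" using W.Y by (auto simp: N_def)
  have cYN: "card (W.Y - N) = card F"
    using card_Diff_subset[OF NY(2,1)] cN cY F(3) by (simp add: N_def)
  obtain a0 where a0: "a0 \<in> \<phi> ` T" using phiT by auto
  have a0c: "a0 \<in> carrier Q" using phiT_car[OF a0] .
  note eqF = W.set_mult_eq_r_coset[OF F(1,2) phiT(1) a0 FT _ eq_imp_le[OF cYN]]
  have YN: "W.Y - N = F #>\<^bsub>Q\<^esub> a0" using eqF(1) W.Y by auto
  define P where "P = stab Q F"
  have P: "subgroup P Q" "P \<subseteq> carrier Q" "finite P" "card P \<le> card F"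
    using W.subgroup_stab[OF F(1)] W.stab_carrier W.card_stab_le[OF F(1,2) Fne] by (auto simp: P_def)
  have TP: "\<phi> ` T \<subseteq> P #>\<^bsub>Q\<^esub> a0"
  proof
    fix b assume b: "b \<in> \<phi> ` T"
    have "b \<otimes>\<^bsub>Q\<^esub> inv\<^bsub>Q\<^esub> a0 \<in> P" unfolding P_def using eqF(2)[OF _ b] W.Y by auto
    moreover have "b = (b \<otimes>\<^bsub>Q\<^esub> inv\<^bsub>Q\<^esub> a0) \<otimes>\<^bsub>Q\<^esub> a0" using W.mult_inv_cancel(2)[OF a0c phiT_car[OF b]] by simp
    ultimately show "b \<in> P #>\<^bsub>Q\<^esub> a0" unfolding W.r_coset_iff by (rule bexI[rotated])
  qed
  have cTP: "card (\<phi> ` T) \<le> card P"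
    using card_mono[OF W.finite_r_coset[OF P(3)] TP] W.card_r_coset[OF P(2) a0c] by simp
  have sc: "s0 \<in> carrier Q" "s1 \<in> carrier Q" using s phiS_car by auto
  \<comment> \<open>If \<open>s0\<close> and \<open>s1\<close> lie in one coset of \<open>P\<close>,
    then |P + S| \<le> |F| + |P| contradicts \<open>nosubQ\<close> or \<open>size\<close>. Otherwise
    the translates of the image of T by \<open>s0\<close> and \<open>s1\<close> and the set F + a0
    are disjoint, and together exceed |F| + 2 + |T|, as the image of T has at least four
    elements.\<close>
  show False
  proof (cases "s1 \<in> P #>\<^bsub>Q\<^esub> s0")
    case True
    have s0P: "s0 \<in> P #>\<^bsub>Q\<^esub> s0" by (rule W.rcos_self[OF sc(1) P(1)])
    have "\<phi> ` S \<subseteq> F \<union> (P #>\<^bsub>Q\<^esub> s0)" using True s0P by (auto simp: F_def)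
    then have "P <#>\<^bsub>Q\<^esub> \<phi> ` S \<subseteq> P <#>\<^bsub>Q\<^esub> (F \<union> (P #>\<^bsub>Q\<^esub> s0))" by (rule mono_set_mult[OF order_refl])
    also have "\<dots> = (P <#>\<^bsub>Q\<^esub> F) \<union> (P <#>\<^bsub>Q\<^esub> (P #>\<^bsub>Q\<^esub> s0))" by (rule W.set_mult_Un)
    also have "P <#>\<^bsub>Q\<^esub> F = F" using W.set_mult_stab[OF F(1)] W.set_mult_comm[OF P(2) F(1)] by (simp add: P_def)
    also have "P <#>\<^bsub>Q\<^esub> (P #>\<^bsub>Q\<^esub> s0) = P #>\<^bsub>Q\<^esub> s0"
      using W.set_mult_r_coset[OF P(2,2) sc(1)] W.subgroup_mult_id[OF P(1)] by simp
    finally have "card (P <#>\<^bsub>Q\<^esub> \<phi> ` S) \<le> card (F \<union> (P #>\<^bsub>Q\<^esub> s0))"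
      using F(2) W.finite_r_coset[OF P(3)] by (intro card_mono) auto
    also have "\<dots> \<le> card F + card P" using card_Un_le[of F "P #>\<^bsub>Q\<^esub> s0"] W.card_r_coset[OF P(2) sc(1)] by simp
    finally have c: "card (P <#>\<^bsub>Q\<^esub> \<phi> ` S) \<le> card F + card P" .
    have P1: "P \<noteq> {\<one>\<^bsub>Q\<^esub>}" using cTP t4 by auto
    have all: "P <#>\<^bsub>Q\<^esub> \<phi> ` S = carrier Q"
    proof (rule ccontr)
      assume "P <#>\<^bsub>Q\<^esub> \<phi> ` S \<noteq> carrier Q"
      from nosubQ[OF P(1,3) P1 this] show False using c F(3) by linarith
    qed
    then have f: "finite (carrier Q)" using QS_fin[OF P(3)] by simp
    show False using W.size[OF f] c all F(3) P(4) by simp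
  next
    case False
    have dis: "(P #>\<^bsub>Q\<^esub> s0) \<inter> (P #>\<^bsub>Q\<^esub> s1) = {}"
    proof (rule W.coset_disjoint[OF P(1) sc])
      show "P #>\<^bsub>Q\<^esub> s0 \<noteq> P #>\<^bsub>Q\<^esub> s1" using False W.rcos_self[OF sc(2) P(1)] by auto
    qed
    have disF: "F \<inter> (P #>\<^bsub>Q\<^esub> s') = {}" if s': "s' \<in> carrier Q" "s' \<notin> F" for s'
    proof (rule ccontr)
      assume "F \<inter> (P #>\<^bsub>Q\<^esub> s') \<noteq> {}"
      then obtain p where p: "p \<in> P" "p \<otimes>\<^bsub>Q\<^esub> s' \<in> F" by (auto simp: W.r_coset_iff)
      have pc: "p \<in> carrier Q" using p P by auto
      have "inv\<^bsub>Q\<^esub> p \<in> stab Q F" using subgroup.m_inv_closed[OF P(1) p(1)] by (simp add: P_def)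
      then have "(p \<otimes>\<^bsub>Q\<^esub> s') \<otimes>\<^bsub>Q\<^esub> inv\<^bsub>Q\<^esub> p \<in> F" by (rule W.stab_mult_mem[OF p(2)])
      moreover have "(p \<otimes>\<^bsub>Q\<^esub> s') \<otimes>\<^bsub>Q\<^esub> inv\<^bsub>Q\<^esub> p = s'"
        using W.mult_inv_cancel(3)[OF pc s'(1)] W.m_comm[OF pc s'(1)] by simp
      ultimately show False using s' by simp
    qed
    have Pc: "P #>\<^bsub>Q\<^esub> s' \<subseteq> carrier Q" if "s' \<in> carrier Q" for s' by (rule W.r_coset_subset_G[OF P(2) that])
    define Z where "Z s' = \<phi> ` T #>\<^bsub>Q\<^esub> s'" for s'
    have Zsub: "Z s' \<subseteq> (P #>\<^bsub>Q\<^esub> s') #>\<^bsub>Q\<^esub> a0" if s': "s' \<in> carrier Q" for s'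
    proof -
      have "Z s' \<subseteq> (P #>\<^bsub>Q\<^esub> a0) #>\<^bsub>Q\<^esub> s'" unfolding Z_def using W.r_coset_subset_iff[OF phiT(1) Pc[OF a0c] s'] TP by simp
      then show ?thesis using W.r_coset_commute[OF P(2) a0c s'] by simp
    qed
    have ZY: "Z s' \<subseteq> W.Y" if "s' \<in> \<phi> ` S" for s'
      using W.r_coset_subset_set_mult[OF that, of "\<phi> ` T"] W.set_mult_comm[OF phiT(1) phiS(1)] by (simp add: Z_def)
    have cZ: "card (Z s') = card (\<phi> ` T)" "finite (Z s')" if "s' \<in> carrier Q" for s'
      using W.card_r_coset[OF phiT(1) that] W.finite_r_coset[OF phiT(2)] by (simp_all add: Z_def)
    have Z01: "Z s0 \<inter> Z s1 = {}"
    proof -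
      have "Z s0 \<inter> Z s1 \<subseteq> ((P #>\<^bsub>Q\<^esub> s0) \<inter> (P #>\<^bsub>Q\<^esub> s1)) #>\<^bsub>Q\<^esub> a0"
        unfolding W.r_coset_Int[OF Pc[OF sc(1)] Pc[OF sc(2)] a0c] using Zsub[OF sc(1)] Zsub[OF sc(2)] by auto
      then show ?thesis unfolding dis by (simp add: r_coset_def)
    qed
    have ZF: "(W.Y - N) \<inter> Z s' = {}" if s': "s' \<in> carrier Q" "s' \<notin> F" for s'
    proof -
      have "(W.Y - N) \<inter> Z s' \<subseteq> (F \<inter> (P #>\<^bsub>Q\<^esub> s')) #>\<^bsub>Q\<^esub> a0"
        unfolding W.r_coset_Int[OF F(1) Pc[OF s'(1)] a0c] YN using Zsub[OF s'(1)] by auto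
      then show ?thesis unfolding disF[OF s'] by (simp add: r_coset_def)
    qed
    have sF: "s0 \<notin> F" "s1 \<notin> F" by (auto simp: F_def)
    have "card ((W.Y - N) \<union> (Z s0 \<union> Z s1)) \<le> card W.Y"
      using ZY[OF s(1)] ZY[OF s(2)] W.Y(2) by (intro card_mono) auto
    moreover have "card ((W.Y - N) \<union> (Z s0 \<union> Z s1)) = card F + (card (\<phi> ` T) + card (\<phi> ` T))"
    proof -
      have "card (Z s0 \<union> Z s1) = card (\<phi> ` T) + card (\<phi> ` T)"
        using card_Un_disjoint[OF cZ(2)[OF sc(1)] cZ(2)[OF sc(2)] Z01] cZ(1)[OF sc(1)] cZ(1)[OF sc(2)] by simp
      moreover have "(W.Y - N) \<inter> (Z s0 \<union> Z s1) = {}" using ZF[OF sc(1) sF(1)] ZF[OF sc(2) sF(2)] by auto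
      ultimately show ?thesis
        using card_Un_disjoint[of "W.Y - N" "Z s0 \<union> Z s1"] cZ(2)[OF sc(1)] cZ(2)[OF sc(2)] W.Y(2) cYN by simp
    qed
    ultimately show False using cY F(3) t4 by linarith
  qed
qed

text \<open>Here |H + S| = 2h, and X + S is the union of the contributions of the two fibres of
  S.\<close>

lemma frag_two:
  assumes SS: "\<phi> ` S = {s0, s1}" "s0 \<noteq> s1" and X: "X \<subseteq> carrier G" "finite X" "2 \<le> card X" "X \<subseteq> T"
  shows "card X + h \<le> card (X <#> (S \<inter> s0)) + card (X <#> (S \<inter> s1))"
proof -
  have XS: "X <#> S \<subseteq> ST" using X(4) set_mult_comm[OF X(1) S(1)] by (auto simp: set_mult_def)
  have "infinite (carrier G) \<or> 2 \<le> card (carrier G - (X <#> S))"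
  proof (cases "finite (carrier G)")
    case True
    then have "card (carrier G - ST) \<le> card (carrier G - (X <#> S))" using XS by (intro card_mono) auto
    then show ?thesis using ext_ST True by auto
  qed simp
  from frag[OF X(1-3) this] have le: "card X + h \<le> card (X <#> S)" using HS_card SS by simp
  have "S \<subseteq> (S \<inter> s0) \<union> (S \<inter> s1)"
  proof
    fix x assume x: "x \<in> S"
    then have "\<phi> x \<in> {s0, s1}" using SS by auto
    moreover have "x \<in> \<phi> x" using x S phi_self by auto
    ultimately show "x \<in> (S \<inter> s0) \<union> (S \<inter> s1)" using x by auto
  qed
  then have "S = (S \<inter> s0) \<union> (S \<inter> s1)" by auto
  then have "X <#> S = (X <#> (S \<inter> s0)) \<union> (X <#> (S \<inter> s1))" using set_mult_Un by metis
  then have "card (X <#> S) \<le> card (X <#> (S \<inter> s0)) + card (X <#> (S \<inter> s1))" using card_Un_le by metis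
  then show ?thesis using le by simp
qed

end

section \<open>Two cosets in a quotient of order three\<close>

locale hyper_two = hyper +
  fixes s0 s1 :: "'a set"
  assumes SS: "\<phi> ` S = {s0, s1}" "s0 \<noteq> s1" "\<sigma> s0 \<le> \<sigma> s1" and Tall: "\<phi> ` T = carrier Q"
begin

lemma s01: "s0 \<in> \<phi> ` S" "s1 \<in> \<phi> ` S" using SS by auto
lemma s01c: "s0 \<in> carrier Q" "s1 \<in> carrier Q" using s01 phiS_car by auto
lemma aT: "a \<in> carrier Q \<Longrightarrow> a \<in> \<phi> ` T" using Tall by simp

lemma fibre_pair:
  assumes a: "a \<in> carrier Q" "2 \<le> \<tau> a"
  shows "\<tau> a + h \<le> card ((S \<inter> s0) <#> (T \<inter> a)) + card ((S \<inter> s1) <#> (T \<inter> a))"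
    "card ((S \<inter> s0) <#> (T \<inter> a)) \<le> \<eta> (s0 <#> a)" "card ((S \<inter> s1) <#> (T \<inter> a)) \<le> \<eta> (s1 <#> a)"
proof -
  have "card (T \<inter> a) + h \<le> card ((T \<inter> a) <#> (S \<inter> s0)) + card ((T \<inter> a) <#> (S \<inter> s1))"
    using a(2) by (intro frag_two[OF SS(1,2) fib_sub(2) fib_sub(5)]) (auto simp: \<tau>_def)
  then show "\<tau> a + h \<le> card ((S \<inter> s0) <#> (T \<inter> a)) + card ((S \<inter> s1) <#> (T \<inter> a))"
    using set_mult_comm[OF fib_sub(2) fib_sub(1)] by (simp add: \<tau>_def)
  show "card ((S \<inter> s0) <#> (T \<inter> a)) \<le> \<eta> (s0 <#> a)" "card ((S \<inter> s1) <#> (T \<inter> a)) \<le> \<eta> (s1 <#> a)"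
    unfolding eta_eq[OF Qmult[OF s01c(1) a(1)]] eta_eq[OF Qmult[OF s01c(2) a(1)]]
    using card_mono[OF fib_sub(6) fibre_mult[OF s01c(1) a(1)]] card_mono[OF fib_sub(6) fibre_mult[OF s01c(2) a(1)]] by auto
qed

lemma two_cosetQ: "two_coset Q (\<phi> ` S) (\<phi> ` T) \<sigma> \<tau> \<eta> h \<mu> s0 s1"
proof (unfold_locales)
  show "\<phi> ` S = {s0, s1}" "s0 \<noteq> s1" "\<sigma> s0 \<le> \<sigma> s1" by (rule SS)+
  show "\<phi> ` T = carrier Q" by (rule Tall)
  show "\<tau> a + h \<le> \<eta> (s0 \<otimes>\<^bsub>Q\<^esub> a) + \<eta> (s1 \<otimes>\<^bsub>Q\<^esub> a)" if "a \<in> carrier Q" "2 \<le> \<tau> a" for a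
    using fibre_pair[OF that] by simp
  show "3 \<le> sum \<sigma> (\<phi> ` S) + \<mu>" using sizes sum_sigma by simp
  show "4 \<le> sum \<tau> (\<phi> ` T) + 2 * \<mu>" using sizes sum_tau by simp
qed

sublocale V: two_coset Q "\<phi> ` S" "\<phi> ` T" \<sigma> \<tau> \<eta> h \<mu> s0 s1
  by (rule two_cosetQ)

lemma E0_eq: "V.E0 a = \<eta> (s0 <#> a)" by (simp add: V.E0_def)
lemma E1_eq: "V.E1 a = \<eta> (s1 <#> a)" by (simp add: V.E1_def)
lemma dQ: "a \<in> carrier Q \<Longrightarrow> a <#> V.d \<in> carrier Q" using Qmult V.d(1) by simp
lemma shiftQ: "a \<in> carrier Q \<Longrightarrow> s0 <#> (a <#> V.d) = s1 <#> a" using V.shift by simp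

lemma not_D_large: "\<not> h + 1 \<le> sum \<sigma> (\<phi> ` S)"
proof
  assume a: "h + 1 \<le> sum \<sigma> (\<phi> ` S)"
  show False
    by (rule constant_weights[OF s01 SS(2) V.cases_large(1)[OF a] refl V.cases_large(2)[OF a] Tall])
qed

lemma D_eq_h: "sum \<sigma> (\<phi> ` S) = h" using not_D_large V.D_ge by linarith

text \<open>In the second outcome of \<open>cases_tight\<close>, a two-element fibre of T over a
  sumset fibre of size \<open>\<sigma> s1\<close> gives a nonzero period of S \<inter> s1. All
  non-full fibres have this size and are translates of S \<inter> s1, so they share the
  period.\<close>

lemma n_three: "card (carrier Q) = 3"
proof (rule ccontr)
  assume "card (carrier Q) \<noteq> 3"
  then have n4: "4 \<le> card (carrier Q)" using V.n3 by linarith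
  note ct = V.cases_tight[OF D_eq_h n4]
  from ct(2) show False
  proof
    assume "\<forall>y\<in>carrier Q. \<eta> y = \<sigma> s1"
    then have e: "\<And>C. C \<in> carrier Q \<Longrightarrow> \<eta> C = \<sigma> s1" by simp
    show False by (rule constant_weights[OF s01 SS(2) ct(1) refl e Tall])
  next
    assume A: "\<sigma> s1 = 2 \<and> h = 4 \<and> (\<forall>y\<in>carrier Q. \<eta> y = 2 \<or> \<eta> y = 4) \<and> (\<exists>a\<in>carrier Q. \<tau> a = 2 \<and> V.E1 a = 2)"
    then obtain a where a: "a \<in> carrier Q" "\<tau> a = 2" "V.E1 a = 2" by auto
    have le: "\<eta> (s1 <#> a) \<le> \<sigma> s1" using a(3) A E1_eq by simp
    obtain g where g: "g \<in> stab G (S \<inter> s1)" "g \<noteq> \<one>" "g \<in> H" "g \<in> carrier G"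
      by (rule nontriv[OF s01(2) aT[OF a(1)] le]) (use a(2) in auto)
    show False
    proof (rule periodicD[OF g(4,2)])
      fix C assume C: "C \<in> carrier Q"
      show "g \<in> stab G (ST \<inter> C)"
      proof (cases "\<eta> C = h")
        case True
        show ?thesis by (rule full_stab[OF C True g(3)])
      next
        case False
        then have e: "\<eta> C \<le> \<sigma> s1" using A C by force
        obtain D where D: "D \<in> carrier Q" "s1 <#> D = C" by (rule divQ[OF C s01c(2)])
        show ?thesis using stab_of_rep[OF s01(2) aT[OF D(1)] _ g(1)] D(2) e by simp
      qed
    qed
  qed
qed

lemmas c3 = V.cases_three[OF D_eq_h n_three]

lemma h4: "4 \<le> h" by (rule c3(3))

lemma three_tau: "a \<in> carrier Q \<Longrightarrow> \<tau> a + \<tau> (a <#> V.d) + \<tau> (a <#> V.d <#> V.d) = h" using c3(4) by simp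
lemma three_back: "a \<in> carrier Q \<Longrightarrow> a <#> V.d <#> V.d <#> V.d = a" using c3(6) by simp
lemma three_eta:
  "a \<in> carrier Q \<Longrightarrow> \<eta> (s0 <#> a) + \<eta> (s1 <#> a) + \<eta> (s1 <#> (a <#> V.d)) = 2 * h"
  using c3(5)[of a] shiftQ[of a] shiftQ[of "a <#> V.d"] dQ[of a] by (simp add: E0_eq)

lemma three_stab:
  assumes a: "a \<in> carrier Q" and g: "g \<in> carrier G" "g \<noteq> \<one>"
    and st: "g \<in> stab G (ST \<inter> (s0 <#> a))" "g \<in> stab G (ST \<inter> (s1 <#> a))" "g \<in> stab G (ST \<inter> (s1 <#> (a <#> V.d)))"
  shows False
proof (rule periodicD[OF g])
  fix C assume C: "C \<in> carrier Q"
  have "C = s0 <#> a \<or> C = s1 <#> a \<or> C = s1 <#> (a <#> V.d)" using c3(7)[OF a C] by simp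
  then show "g \<in> stab G (ST \<inter> C)" using st by auto
qed

text \<open>At a position of \<open>J\<close> two of the three fibres of S + T have size h / 2, as
  do both fibres of S, and the third is full. One of the other two fibres of T has at least two
  elements, since they have h - 1 \<ge> 3 together; it yields a period common to all three
  fibres.\<close>

lemma J_empty: "V.J = {}"
proof (rule ccontr)
  assume "V.J \<noteq> {}"
  then obtain a where aJ: "a \<in> V.J" by auto
  have a: "a \<in> carrier Q" "\<tau> a = 1" using aJ unfolding V.J_def by auto
  note js = V.J_sigma[OF aJ]
  define b where "b = a <#> V.d"
  define c where "c = b <#> V.d"
  have bc: "b \<in> carrier Q" "c \<in> carrier Q" using dQ a by (auto simp: b_def c_def)
  have sb: "s0 <#> b = s1 <#> a" using shiftQ[OF a(1)] by (simp add: b_def)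
  have sc: "s1 <#> c = s0 <#> a"
    using shiftQ[OF bc(2)] three_back[OF a(1)] by (simp add: c_def b_def)
  have e0: "\<eta> (s0 <#> a) \<le> \<sigma> s0" "\<eta> (s0 <#> a) \<le> \<sigma> s1" "\<eta> (s1 <#> a) \<le> \<sigma> s0" "\<eta> (s1 <#> a) \<le> \<sigma> s1"
    using js(3,5,6) E0_eq[of a] E1_eq[of a] by auto
  have "\<eta> (s0 <#> a) + \<eta> (s1 <#> a) = h" using js(4,5,6) E0_eq[of a] E1_eq[of a] by simp
  then have e3: "\<eta> (s1 <#> b) = h" using three_eta[OF a(1)] by (simp add: b_def)
  have s1b: "s1 <#> b \<in> carrier Q" by (rule Qmult[OF s01c(2) bc(1)])
  have "\<tau> b + \<tau> c + 1 = h" using three_tau[OF a(1)] a(2) by (simp add: b_def c_def)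
  then consider "2 \<le> \<tau> b" | "2 \<le> \<tau> c" using h4 by linarith
  then show False
  proof cases
    case 1
    have le: "\<eta> (s0 <#> b) \<le> \<sigma> s0" using e0(3) sb by simp
    obtain g where g: "g \<in> stab G (S \<inter> s0)" "g \<noteq> \<one>" "g \<in> H" "g \<in> carrier G"
      by (rule nontriv[OF s01(1) aT[OF bc(1)] le 1])
    show False
      using three_stab[OF a(1) g(4,2)] stab_of_rep[OF s01(1) aT[OF a(1)] e0(1) g(1)]
        stab_of_rep[OF s01(1) aT[OF bc(1)] le g(1)] full_stab[OF s1b e3 g(3)] sb by (simp add: b_def)
  next
    case 2
    have le: "\<eta> (s1 <#> c) \<le> \<sigma> s1" using e0(2) sc by simp
    obtain g where g: "g \<in> stab G (S \<inter> s1)" "g \<noteq> \<one>" "g \<in> H" "g \<in> carrier G"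
      by (rule nontriv[OF s01(2) aT[OF bc(2)] le 2])
    show False
      using three_stab[OF a(1) g(4,2)] stab_of_rep[OF s01(2) aT[OF a(1)] e0(4) g(1)]
        stab_of_rep[OF s01(2) aT[OF bc(2)] le g(1)] full_stab[OF s1b e3 g(3)] sc by (simp add: b_def)
  qed
qed

lemma delta: "a \<in> carrier Q \<Longrightarrow> \<eta> (s0 <#> a) + \<eta> (s1 <#> a) = \<tau> a + h"
  using c3(8)[OF J_empty] by (simp add: E0_eq E1_eq)

text \<open>The three values of \<open>\<eta>\<close> sum to 2h, and \<open>delta\<close> at the
  next position evaluates two of them.\<close>

lemma eta_tau_compl:
  assumes "a \<in> carrier Q"
  shows "\<eta> (s0 <#> a) + \<tau> (a <#> V.d) = h" "\<eta> (s1 <#> a) + \<tau> (a <#> V.d <#> V.d) = h"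
proof -
  have *: "\<eta> (s0 <#> a) + \<tau> (a <#> V.d) = h" if a: "a \<in> carrier Q" for a
    using three_eta[OF a] delta[OF dQ[OF a]] shiftQ[OF a] by simp
  show "\<eta> (s0 <#> a) + \<tau> (a <#> V.d) = h" by (rule *[OF assms])
  show "\<eta> (s1 <#> a) + \<tau> (a <#> V.d <#> V.d) = h" using *[OF dQ[OF assms]] shiftQ[OF assms] by simp
qed

lemma tau_pos: "a \<in> carrier Q \<Longrightarrow> 1 \<le> \<tau> a" using W.tau aT by simp

lemma tau_le: "a \<in> carrier Q \<Longrightarrow> \<tau> a \<le> \<sigma> s0" "a \<in> carrier Q \<Longrightarrow> \<tau> a + \<sigma> s1 \<le> h"
proof -
  assume a: "a \<in> carrier Q"
  have "\<eta> (s1 <#> a) < h" using eta_tau_compl(2)[OF a] tau_pos[OF dQ[OF dQ[OF a]]] by linarith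
  then show "\<tau> a + \<sigma> s1 \<le> h" using eta_bounds(3)[OF s01(2) aT[OF a]] by (cases "h < \<sigma> s1 + \<tau> a") auto
  then show "\<tau> a \<le> \<sigma> s0" using V.D_eq D_eq_h by linarith
qed

text \<open>By \<open>delta\<close> there is no slack in \<open>fibre_pair\<close>, so both
  inclusions are equalities.\<close>

lemma fibre_eq:
  assumes a: "a \<in> carrier Q" "2 \<le> \<tau> a"
  shows "ST \<inter> (s0 <#> a) = (S \<inter> s0) <#> (T \<inter> a)" "ST \<inter> (s1 <#> a) = (S \<inter> s1) <#> (T \<inter> a)"
proof -
  note fp = fibre_pair[OF a]
  have c: "card ((S \<inter> s0) <#> (T \<inter> a)) = \<eta> (s0 <#> a)" "card ((S \<inter> s1) <#> (T \<inter> a)) = \<eta> (s1 <#> a)"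
    using fp delta[OF a(1)] by linarith+
  show "ST \<inter> (s0 <#> a) = (S \<inter> s0) <#> (T \<inter> a)"
    using card_subset_eq[OF fib_sub(6) fibre_mult[OF s01c(1) a(1)]] c(1) eta_eq[OF Qmult[OF s01c(1) a(1)]] by simp
  show "ST \<inter> (s1 <#> a) = (S \<inter> s1) <#> (T \<inter> a)"
    using card_subset_eq[OF fib_sub(6) fibre_mult[OF s01c(2) a(1)]] c(2) eta_eq[OF Qmult[OF s01c(2) a(1)]] by simp
qed

lemma fibre_eq_stab:
  assumes a: "a \<in> carrier Q" "2 \<le> \<tau> a"
  shows "g \<in> stab G (S \<inter> s0) \<Longrightarrow> g \<in> stab G (ST \<inter> (s0 <#> a))" "g \<in> stab G (S \<inter> s1) \<Longrightarrow> g \<in> stab G (ST \<inter> (s1 <#> a))"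
  unfolding fibre_eq[OF a] using stab_set_mult[OF fib_sub(1) fib_sub(2)] by auto

text \<open>The other two fibres of T have h - 1 elements together and at most
  \<open>\<sigma> s0\<close> \<le> h / 2 each, so one of them has exactly
  \<open>\<sigma> s0\<close>. By complementation a fibre of S + T is then as small as one of S, and
  it is also reached through the remaining fibre of T. Only for h = 4 is that fibre a single point
  which yields no period.\<close>

lemma singleton_fibre:
  assumes a: "a \<in> carrier Q" "\<tau> a = 1"
  shows "h = 4" "\<sigma> s0 = 2" "\<sigma> s1 = 2"
proof -
  define b where "b = a <#> V.d"
  define c where "c = b <#> V.d"
  have bc: "b \<in> carrier Q" "c \<in> carrier Q" using dQ a by (auto simp: b_def c_def)
  have sb: "s0 <#> b = s1 <#> a" using shiftQ[OF a(1)] by (simp add: b_def)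
  have sc: "s1 <#> c = s0 <#> a" "s0 <#> c = s1 <#> b"
    using shiftQ[OF bc(2)] shiftQ[OF bc(1)] three_back[OF a(1)] by (simp_all add: c_def b_def)
  have t: "\<tau> b + \<tau> c + 1 = h" using three_tau[OF a(1)] a(2) by (simp add: b_def c_def)
  have e: "\<eta> (s0 <#> a) + \<tau> b = h" "\<eta> (s1 <#> a) + \<tau> c = h"
    using eta_tau_compl[OF a(1)] by (simp_all add: b_def c_def)
  have D: "\<sigma> s0 + \<sigma> s1 = h" using V.D_eq D_eq_h by simp
  note le = tau_le(1)[OF bc(1)] tau_le(1)[OF bc(2)]
  note r = stab_of_rep[OF s01(1) aT[OF a(1)]] stab_of_rep[OF s01(2) aT[OF a(1)]]
  have main: "\<sigma> s0 = 2 \<and> \<sigma> s1 = 2"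
  proof (rule ccontr)
    assume neg: "\<not> ?thesis"
    show False
    proof (cases "\<sigma> s0 = \<sigma> s1")
      case False
      then have v: "\<tau> b = \<sigma> s0" "\<tau> c = \<sigma> s0" "\<sigma> s1 = \<sigma> s0 + 1" "2 \<le> \<tau> b" "2 \<le> \<tau> c"
        using t le D SS(3) h4 by linarith+
      have e1: "\<eta> (s0 <#> a) \<le> \<sigma> s1" "\<eta> (s1 <#> a) \<le> \<sigma> s1" using e v D by linarith+
      have l: "\<eta> (s1 <#> c) \<le> \<sigma> s1" using e1 sc by simp
      obtain g where g: "g \<in> stab G (S \<inter> s1)" "g \<noteq> \<one>" "g \<in> H" "g \<in> carrier G"
        by (rule nontriv[OF s01(2) aT[OF bc(2)] l v(5)])
      have "g \<in> stab G (ST \<inter> (s0 <#> a))" using stab_of_rep[OF s01(2) aT[OF bc(2)] l g(1)] sc by simp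
      moreover have "g \<in> stab G (ST \<inter> (s1 <#> b))" by (rule fibre_eq_stab(2)[OF bc(1) v(4) g(1)])
      ultimately show False
        using three_stab[OF a(1) g(4,2)] r(2)[OF e1(2) g(1)] by (simp add: b_def)
    next
      case True
      have h2s: "h = 2 * \<sigma> s0" using D True by simp
      have s3: "3 \<le> \<sigma> s0" using neg True h2s h4 by linarith
      have two: "2 \<le> \<tau> b" "2 \<le> \<tau> c" using t le h2s s3 by linarith+
      consider "\<tau> b = \<sigma> s0" | "\<tau> c = \<sigma> s0" using t le h2s by linarith
      then show False
      proof cases
        case 1
        have e1: "\<eta> (s0 <#> a) \<le> \<sigma> s0" "\<eta> (s0 <#> a) \<le> \<sigma> s1" using e(1) 1 h2s True by linarith+
        have l: "\<eta> (s1 <#> c) \<le> \<sigma> s1" using e1 sc by simp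
        obtain g where g: "g \<in> stab G (S \<inter> s1)" "g \<noteq> \<one>" "g \<in> H" "g \<in> carrier G"
          by (rule nontriv[OF s01(2) aT[OF bc(2)] l two(2)])
        have gs: "g \<in> stab G (ST \<inter> (s0 <#> a))" using stab_of_rep[OF s01(2) aT[OF bc(2)] l g(1)] sc by simp
        obtain t' where t': "t' \<in> T \<inter> a" using T_fib[OF aT[OF a(1)]] by auto
        have t'c: "t' \<in> carrier G" using t' T(1) by auto
        have "g \<in> stab G (S \<inter> s0)"
          using gs unfolding sum_fibre(1)[OF s01(1) aT[OF a(1)] t' e1(1)] stab_r_coset[OF fib_sub(1) t'c] .
        then have "g \<in> stab G (ST \<inter> (s0 <#> b))" by (rule fibre_eq_stab(1)[OF bc(1) two(1)])
        moreover have "g \<in> stab G (ST \<inter> (s1 <#> b))" by (rule fibre_eq_stab(2)[OF bc(1) two(1) g(1)])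
        ultimately show False using three_stab[OF a(1) g(4,2) gs] sb by (simp add: b_def)
      next
        case 2
        have e1: "\<eta> (s1 <#> a) \<le> \<sigma> s0" "\<eta> (s1 <#> a) \<le> \<sigma> s1" using e(2) 2 h2s True by linarith+
        have l: "\<eta> (s0 <#> b) \<le> \<sigma> s0" using e1 sb by simp
        obtain g where g: "g \<in> stab G (S \<inter> s0)" "g \<noteq> \<one>" "g \<in> H" "g \<in> carrier G"
          by (rule nontriv[OF s01(1) aT[OF bc(1)] l two(1)])
        have gs: "g \<in> stab G (ST \<inter> (s1 <#> a))" using stab_of_rep[OF s01(1) aT[OF bc(1)] l g(1)] sb by simp
        obtain t' where t': "t' \<in> T \<inter> a" using T_fib[OF aT[OF a(1)]] by auto
        have t'c: "t' \<in> carrier G" using t' T(1) by auto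
        have gs1: "g \<in> stab G (S \<inter> s1)"
          using gs unfolding sum_fibre(1)[OF s01(2) aT[OF a(1)] t' e1(2)] stab_r_coset[OF fib_sub(1) t'c] .
        have "g \<in> stab G (ST \<inter> (s1 <#> c))" by (rule fibre_eq_stab(2)[OF bc(2) two(2) gs1])
        moreover have "g \<in> stab G (ST \<inter> (s0 <#> c))" by (rule fibre_eq_stab(1)[OF bc(2) two(2) g(1)])
        ultimately show False using three_stab[OF a(1) g(4,2) _ gs] sc by (simp add: b_def)
      qed
    qed
  qed
  then show "\<sigma> s0 = 2" "\<sigma> s1 = 2" "h = 4" using D by auto
qed

end

section \<open>Progressions, small subgroups and pairs\<close>

context comm_group
begin

lemma cancel_left:
  assumes "x \<in> carrier G" "y \<in> carrier G" "z \<in> carrier G"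
  shows "x \<otimes> y = x \<otimes> z \<longleftrightarrow> y = z"
  using assms Units_l_cancel[of x y z] Units_eq by auto

lemma subgroup_of_closed:
  assumes F: "F \<subseteq> carrier G" "finite F" "\<one> \<in> F" and cl: "\<And>x y. x \<in> F \<Longrightarrow> y \<in> F \<Longrightarrow> x \<otimes> y \<in> F"
  shows "subgroup F G"
proof -
  have "F \<subseteq> stab G F"
  proof
    fix f assume f: "f \<in> F"
    have "F #> f \<subseteq> F" using cl f by (auto simp: r_coset_iff)
    then show "f \<in> stab G F" using in_stabI[OF F(1,2)] f F(1) by auto
  qed
  moreover have "stab G F \<subseteq> F"
  proof
    fix g assume g: "g \<in> stab G F"
    have "\<one> \<otimes> g \<in> F" by (rule stab_mult_mem[OF F(3) g])
    then show "g \<in> F" using g by (simp add: stab_def)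
  qed
  ultimately have "stab G F = F" by auto
  then show ?thesis using subgroup_stab[OF F(1)] by simp
qed

lemma card_dvd_of_stable:
  assumes P: "subgroup P G" and X: "X \<subseteq> carrier G" "finite X" and st: "\<And>x. x \<in> X \<Longrightarrow> P #> x \<subseteq> X"
  shows "card P dvd card X"
proof -
  let ?I = "(\<lambda>x. P #> x) ` X"
  have Pc: "P \<subseteq> carrier G" by (rule subgroup.subset[OF P])
  have fI: "finite ?I" using X by simp
  have sI: "?I \<subseteq> (\<lambda>x. P #> x) ` carrier G" using X(1) by auto
  have "card X = (\<Sum>C\<in>?I. card (X \<inter> C))" by (rule card_coset_sum[OF P X order_refl sI fI])
  also have "\<dots> = (\<Sum>C\<in>?I. card P)"
  proof (rule sum.cong[OF refl])
    fix C assume "C \<in> ?I"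
    then obtain x where x: "x \<in> X" "C = P #> x" by auto
    then have "X \<inter> C = C" using st by auto
    then show "card (X \<inter> C) = card P" using x card_r_coset[OF Pc, of x] X(1) by auto
  qed
  also have "\<dots> = card ?I * card P" by simp
  finally show ?thesis by simp
qed

lemma card_subgroup_dvd:
  assumes "subgroup P G" "subgroup K G" "finite K" "P \<subseteq> K"
  shows "card P dvd card K"
  using card_dvd_of_stable[OF assms(1) subgroup.subset[OF assms(2)] assms(3)] r_coset_subgroup[OF assms(2,4)] by simp

abbreviation ap :: "'a \<Rightarrow> 'a \<Rightarrow> nat \<Rightarrow> 'a set" where
  "ap x d n \<equiv> (\<lambda>i::nat. x \<otimes> d [^] i) ` {..<n}"

lemma ap_Suc: "ap x d (Suc n) = insert (x \<otimes> d [^] n) (ap x d n)"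
  by (simp add: lessThan_Suc)

lemma ap_two: "x \<in> carrier G \<Longrightarrow> d \<in> carrier G \<Longrightarrow> ap x d 2 = {x, x \<otimes> d}"
  by (auto simp: numeral_2_eq_2 ap_Suc)

lemma ap_inj:
  assumes c: "x \<in> carrier G" "d \<in> carrier G" and o: "\<And>k. 0 < k \<Longrightarrow> k \<le> n \<Longrightarrow> d [^] (k::nat) \<noteq> \<one>"
    and ij: "i \<le> n" "j \<le> n" "x \<otimes> d [^] (i::nat) = x \<otimes> d [^] (j::nat)"
  shows "i = j"
proof -
  have e: "d [^] i = d [^] j" using ij(3) cancel_left[OF c(1), of "d [^] i" "d [^] j"] c by simp
  have *: False if "a < b" "b \<le> n" "d [^] (a::nat) = d [^] (b::nat)" for a b
  proof -
    have "d [^] a \<otimes> d [^] (b - a) = d [^] a \<otimes> \<one>" using that(1,3) c nat_pow_mult[OF c(2), of a "b - a"] by simp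
    then have "d [^] (b - a) = \<one>" using cancel_left[of "d [^] a" "d [^] (b - a)" \<one>] c by simp
    then show False using o[of "b - a"] that by simp
  qed
  show ?thesis using *[of i j] *[of j i] ij e by (metis nat_neq_iff)
qed

lemma ap_mult: "x \<in> carrier G \<Longrightarrow> d \<in> carrier G \<Longrightarrow> (x \<otimes> d [^] (i::nat)) \<otimes> d [^] (j::nat) = x \<otimes> d [^] (i + j)"
  by (simp add: m_assoc nat_pow_mult)

lemma ap_shift: "x \<in> carrier G \<Longrightarrow> d \<in> carrier G \<Longrightarrow> (x \<otimes> d [^] (i::nat)) \<otimes> d = x \<otimes> d [^] (Suc i)"
  by (simp add: m_assoc)

lemma ap_r_coset: "x \<in> carrier G \<Longrightarrow> d \<in> carrier G \<Longrightarrow> t \<in> carrier G \<Longrightarrow> ap x d n #> t = ap (x \<otimes> t) d n"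
  by (auto simp: r_coset_image image_image m_ac intro!: image_cong)

lemma ap_pair:
  assumes c: "x \<in> carrier G" "d \<in> carrier G" "t \<in> carrier G" and n: "1 \<le> n"
  shows "ap x d n <#> {t, t \<otimes> d} = ap (x \<otimes> t) d (Suc n)"
proof -
  have td: "t \<otimes> d \<in> carrier G" using c by simp
  have "ap x d n <#> {t, t \<otimes> d} = ap (x \<otimes> t) d n \<union> ap (x \<otimes> (t \<otimes> d)) d n"
    unfolding r_coset_pair ap_r_coset[OF c(1,2,3)] ap_r_coset[OF c(1,2) td] ..
  also have "ap (x \<otimes> (t \<otimes> d)) d n = (\<lambda>i. (x \<otimes> t) \<otimes> d [^] (Suc i)) ` {..<n}"
    using c by (intro image_cong refl) (simp add: m_ac)
  also have "\<dots> = (\<lambda>i. (x \<otimes> t) \<otimes> d [^] i) ` (Suc ` {..<n})" by (simp only: image_image)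
  finally have e: "ap x d n <#> {t, t \<otimes> d} = (\<lambda>i. (x \<otimes> t) \<otimes> d [^] i) ` ({..<n} \<union> Suc ` {..<n})"
    by (simp only: image_Un)
  have "{..<n} \<union> Suc ` {..<n} = {..<Suc n}"
  proof (rule Set.set_eqI)
    fix i show "i \<in> {..<n} \<union> Suc ` {..<n} \<longleftrightarrow> i \<in> {..<Suc n}" using n by (cases i) auto
  qed
  then show ?thesis using e by simp
qed

text \<open>If z were a later term of the other progression, the term before z would belong to the
  first progression too, so z would recur after at most n steps.\<close>

lemma ap_start:
  assumes c: "z \<in> carrier G" "z' \<in> carrier G" "d \<in> carrier G" and o: "\<And>k. 0 < k \<Longrightarrow> k \<le> n \<Longrightarrow> d [^] (k::nat) \<noteq> \<one>"
    and n: "1 \<le> n" and e: "ap z d n = ap z' d n"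
  shows "z = z'"
proof -
  have "z \<otimes> d [^] (0::nat) \<in> ap z d n" by (rule imageI) (use n in simp)
  then have "z \<in> ap z' d n" unfolding e using c by simp
  then obtain i where i: "i < n" "z = z' \<otimes> d [^] i" by auto
  show ?thesis
  proof (cases i)
    case 0
    then show ?thesis using i c by simp
  next
    case (Suc k)
    have "z' \<otimes> d [^] k \<in> ap z' d n" by (rule imageI) (use i Suc in simp)
    then have "z' \<otimes> d [^] k \<in> ap z d n" unfolding e .
    then obtain j where j: "j < n" "z' \<otimes> d [^] k = z \<otimes> d [^] j" by auto
    have "z = (z' \<otimes> d [^] k) \<otimes> d" using i(2) Suc ap_shift[OF c(2,3)] by simp
    then have "z \<otimes> d [^] (0::nat) = z \<otimes> d [^] (Suc j)" using j(2) ap_shift[OF c(1,3)] c by simp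
    then have "0 = Suc j" by (intro ap_inj[OF c(1,3) o, where n = n]) (use j in auto)
    then show ?thesis by simp
  qed
qed

lemma ap_three_pair:
  assumes c: "z \<in> carrier G" "z' \<in> carrier G" "d \<in> carrier G" and o: "\<And>k. 0 < k \<Longrightarrow> k \<le> 3 \<Longrightarrow> d [^] (k::nat) \<noteq> \<one>"
    and e: "{z, z \<otimes> d} \<subseteq> ap z' d 3"
  shows "z = z' \<or> z = z' \<otimes> d"
proof -
  obtain i :: nat where i: "i < 3" "z = z' \<otimes> d [^] i" using e by auto
  obtain j :: nat where j: "j < 3" "z \<otimes> d = z' \<otimes> d [^] j" using e by auto
  have "z' \<otimes> d [^] (Suc i) = z' \<otimes> d [^] j" using j(2) i(2) ap_shift[OF c(2,3)] by simp
  then have "Suc i = j" by (intro ap_inj[OF c(2,3) o, where n = 3]) (use i j in auto)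
  then have "i = 0 \<or> i = 1" using j by linarith
  then show ?thesis using i(2) c by auto
qed

text \<open>The alternative \<open>d [^] k \<otimes> f = \<one>\<close> states that f is
  -kd.\<close>

lemma ap_quotient:
  assumes c: "x \<in> carrier G" "d \<in> carrier G" "f \<in> carrier G" and z: "z \<in> ap x d n" "z \<otimes> f \<in> ap x d n"
  obtains k where "k < n" "f = d [^] k \<or> d [^] k \<otimes> f = \<one>"
proof -
  obtain i where i: "i < n" "z = x \<otimes> d [^] i" using z by auto
  obtain j where j: "j < n" "z \<otimes> f = x \<otimes> d [^] j" using z by auto
  have "x \<otimes> (d [^] i \<otimes> f) = x \<otimes> d [^] j" using i j c by (simp add: m_assoc)
  then have e: "d [^] i \<otimes> f = d [^] j" using cancel_left[of x "d [^] i \<otimes> f" "d [^] j"] c by simp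
  show ?thesis
  proof (cases "i \<le> j")
    case True
    then have "d [^] i \<otimes> f = d [^] i \<otimes> d [^] (j - i)" using e c by (simp add: nat_pow_mult)
    then have "f = d [^] (j - i)" using cancel_left[of "d [^] i" f "d [^] (j - i)"] c by simp
    then show ?thesis using that[of "j - i"] j by simp
  next
    case False
    then have "d [^] j \<otimes> (d [^] (i - j) \<otimes> f) = d [^] j \<otimes> \<one>"
      using e c by (simp add: m_assoc[symmetric] nat_pow_mult)
    then have "d [^] (i - j) \<otimes> f = \<one>" using cancel_left[of "d [^] j" "d [^] (i - j) \<otimes> f" \<one>] c by simp
    then show ?thesis using that[of "i - j"] i by simp
  qed
qed

lemma ap_card: "card (ap x d n) \<le> n"
  using card_image_le[of "{..<n}"] by simp

text \<open>Exactly one element lacks a predecessor. The other two either continue a chain from it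
  or precede each other, and then 2d = 0.\<close>

lemma three_set_cases:
  assumes A: "A \<subseteq> carrier G" "card A = 3" and d: "d \<in> carrier G" "d \<noteq> \<one>" and ov: "card (A \<inter> (A #> d)) = 2"
  obtains "d [^] (2::nat) = \<one>" | x where "x \<in> carrier G" "A = ap x d 3"
proof -
  have fA: "finite A" using A(2) by (simp add: card_ge_0_finite)
  obtain b c where bc: "A \<inter> (A #> d) = {b, c}" "b \<noteq> c" using ov by (auto simp: card_2_iff)
  have "card (A - (A #> d)) = 1" using card_Diff_subset_Int[of A "A #> d"] fA A(2) ov by simp
  then obtain a where a: "A - (A #> d) = {a}" by (auto simp: card_1_singleton_iff)
  have Aabc: "A = {a, b, c}" using a bc by blast
  have cc: "a \<in> carrier G" "b \<in> carrier G" "c \<in> carrier G" using A(1) Aabc by auto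
  have "b \<in> A #> d" "c \<in> A #> d" using bc by auto
  then obtain b' c' where b': "b' \<in> A" "b = b' \<otimes> d" and c': "c' \<in> A" "c = c' \<otimes> d" by (auto simp: r_coset_iff)
  have nb: "b' \<noteq> b" "c' \<noteq> c" "b' \<noteq> c'" using b' c' d bc(2) cc by auto
  have ap3: "ap y d 3 = {y, y \<otimes> d, (y \<otimes> d) \<otimes> d}" if "y \<in> carrier G" for y
    using that d by (auto simp: numeral_3_eq_3 ap_Suc m_assoc)
  consider "b' = a" "c' = b" | "b' = c" "c' = a" | "b' = c" "c' = b" using nb b'(1) c'(1) Aabc by blast
  then show ?thesis
  proof cases
    case 1
    then have "A = ap a d 3" using Aabc b' c' ap3[OF cc(1)] by simp
    then show ?thesis by (rule that(2)[OF cc(1)])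
  next
    case 2
    then have "A = ap a d 3" using Aabc b' c' ap3[OF cc(1)] by auto
    then show ?thesis by (rule that(2)[OF cc(1)])
  next
    case 3
    then have "b \<otimes> (d \<otimes> d) = b \<otimes> \<one>" using b' c' cc d by (simp add: m_assoc)
    then have "d \<otimes> d = \<one>" using cancel_left[of b "d \<otimes> d" \<one>] cc d by simp
    then show ?thesis using that(1) d by (simp add: numeral_2_eq_2)
  qed
qed

lemma order_four:
  assumes K: "subgroup K G" "finite K" "d \<in> K" and d2: "d [^] (2::nat) \<noteq> \<one>" and d4: "d [^] (4::nat) = \<one>"
  shows "4 dvd card K"
proof -
  have dc: "d \<in> carrier G" by (rule subgroup.mem_carrier[OF K(1,3)])
  have d1: "d \<noteq> \<one>" using d2 by auto
  have d3: "d [^] (3::nat) \<noteq> \<one>"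
  proof
    assume "d [^] (3::nat) = \<one>"
    then have "d [^] (Suc 3) = d" unfolding nat_pow_Suc using dc by simp
    then show False using d4 d1 by simp
  qed
  have o: "d [^] k \<noteq> \<one>" if k: "0 < k" "k \<le> 3" for k :: nat
  proof -
    have "k = 1 \<or> k = 2 \<or> k = 3" using k by linarith
    then show ?thesis using d1 d2 d3 dc by auto
  qed
  have red: "d [^] i = d [^] (i mod 4)" for i :: nat
  proof -
    have "d [^] (4 * (i div 4)) = \<one>" using dc d4 nat_pow_pow[OF dc, of 4 "i div 4"] by simp
    then show ?thesis using nat_pow_mult[OF dc, of "4 * (i div 4)" "i mod 4"] dc by simp
  qed
  let ?F = "ap \<one> d 4"
  have Fc: "?F \<subseteq> carrier G" using dc by auto
  have cl: "x \<otimes> y \<in> ?F" if "x \<in> ?F" "y \<in> ?F" for x y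
  proof -
    obtain i j :: nat where ij: "x = d [^] i" "y = d [^] j" using \<open>x \<in> ?F\<close> \<open>y \<in> ?F\<close> dc by auto
    have "x \<otimes> y = \<one> \<otimes> d [^] ((i + j) mod 4)" using ij dc red[of "i + j"] by (simp add: nat_pow_mult)
    then show ?thesis by auto
  qed
  have one: "\<one> \<in> ?F" using dc by (auto intro!: image_eqI[of _ _ 0])
  have sF: "subgroup ?F G" by (rule subgroup_of_closed[OF Fc _ one cl]) auto
  have FK: "?F \<subseteq> K"
  proof -
    have "d [^] i \<in> K" for i :: nat
      by (induction i) (use K subgroup.one_closed subgroup.m_closed in auto)
    then show ?thesis using dc by auto
  qed
  have "inj_on (\<lambda>i::nat. \<one> \<otimes> d [^] i) {..<4}"
    by (rule inj_onI) (rule ap_inj[OF one_closed dc o, where n = 3], auto)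
  then have "card ?F = 4" by (simp add: card_image)
  then show ?thesis using card_subgroup_dvd[OF sF K(1,2) FK] by simp
qed

lemma order_three:
  assumes K: "subgroup K G" "finite K" "d \<in> K" and d1: "d \<noteq> \<one>" and d3: "d [^] (3::nat) = \<one>"
  shows "3 dvd card K"
proof -
  have dc: "d \<in> carrier G" by (rule subgroup.mem_carrier[OF K(1,3)])
  have d2: "d [^] (2::nat) \<noteq> \<one>"
  proof
    assume "d [^] (2::nat) = \<one>"
    then have "d [^] (Suc 2) = d" unfolding nat_pow_Suc using dc by simp
    then show False using d3 d1 by simp
  qed
  have o: "d [^] k \<noteq> \<one>" if k: "0 < k" "k \<le> 2" for k :: nat
  proof -
    have "k = 1 \<or> k = 2" using k by linarith
    then show ?thesis using d1 d2 dc by auto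
  qed
  have red: "d [^] i = d [^] (i mod 3)" for i :: nat
  proof -
    have "d [^] (3 * (i div 3)) = \<one>" using dc d3 nat_pow_pow[OF dc, of 3 "i div 3"] by simp
    then show ?thesis using nat_pow_mult[OF dc, of "3 * (i div 3)" "i mod 3"] dc by simp
  qed
  let ?F = "ap \<one> d 3"
  have Fc: "?F \<subseteq> carrier G" using dc by auto
  have cl: "x \<otimes> y \<in> ?F" if "x \<in> ?F" "y \<in> ?F" for x y
  proof -
    obtain i j :: nat where ij: "x = d [^] i" "y = d [^] j" using \<open>x \<in> ?F\<close> \<open>y \<in> ?F\<close> dc by auto
    have "x \<otimes> y = \<one> \<otimes> d [^] ((i + j) mod 3)" using ij dc red[of "i + j"] by (simp add: nat_pow_mult)
    then show ?thesis by auto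
  qed
  have one: "\<one> \<in> ?F" using dc by (auto intro!: image_eqI[of _ _ 0])
  have sF: "subgroup ?F G" by (rule subgroup_of_closed[OF Fc _ one cl]) auto
  have FK: "?F \<subseteq> K"
  proof -
    have "d [^] i \<in> K" for i :: nat
      by (induction i) (use K subgroup.one_closed subgroup.m_closed in auto)
    then show ?thesis using dc by auto
  qed
  have "inj_on (\<lambda>i::nat. \<one> \<otimes> d [^] i) {..<3}"
    by (rule inj_onI) (rule ap_inj[OF one_closed dc o, where n = 2], auto)
  then have "card ?F = 3" by (simp add: card_image)
  then show ?thesis using card_subgroup_dvd[OF sF K(1,2) FK] by simp
qed

lemma two_involutions:
  assumes K: "subgroup K G" "finite K" "d \<in> K" "e \<in> K" and d: "d \<noteq> \<one>" "d \<otimes> d = \<one>" "e \<noteq> \<one>" "e \<otimes> e = \<one>" "d \<noteq> e"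
  shows "4 dvd card K"
proof -
  have c: "d \<in> carrier G" "e \<in> carrier G" by (rule subgroup.mem_carrier[OF K(1,3)], rule subgroup.mem_carrier[OF K(1,4)])
  let ?F = "{\<one>, d, e, d \<otimes> e}"
  have cd1: "d \<otimes> (d \<otimes> e) = e" using m_assoc[OF c(1,1,2)] d c by simp
  have cd3: "(d \<otimes> e) \<otimes> e = d" using m_assoc[OF c(1,2,2)] d c by simp
  have ed: "e \<otimes> d = d \<otimes> e" by (rule m_comm[OF c(2,1)])
  have cd4: "e \<otimes> (d \<otimes> e) = d" using m_comm[OF c(2), of "d \<otimes> e"] cd3 c by simp
  have cd5: "(d \<otimes> e) \<otimes> d = e" using m_comm[of "d \<otimes> e" d] cd1 c by simp
  note cd = cd1 cd4 cd5 cd3 ed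
  have cd2: "(d \<otimes> e) \<otimes> (d \<otimes> e) = \<one>" using c cd d by (simp add: m_assoc)
  have sF: "subgroup ?F G"
  proof (rule subgroup_of_closed)
    show "?F \<subseteq> carrier G" using c by auto
    fix x y assume "x \<in> ?F" "y \<in> ?F"
    then show "x \<otimes> y \<in> ?F" using c d cd cd2 by auto
  qed auto
  have n1: "d \<otimes> e \<noteq> \<one>"
  proof
    assume "d \<otimes> e = \<one>"
    then have "d \<otimes> (d \<otimes> e) = d" using c by simp
    then show False using cd d by simp
  qed
  have n2: "d \<otimes> e \<noteq> d" "d \<otimes> e \<noteq> e" using c d by auto
  have "card ?F = 4" using d n1 n2 by auto
  moreover have "?F \<subseteq> K" using K subgroup.one_closed subgroup.m_closed by auto
  ultimately show ?thesis using card_subgroup_dvd[OF sF K(1,2)] by simp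
qed

lemma pairE:
  assumes "B \<subseteq> carrier G" "card B = 2"
  obtains t f where "t \<in> carrier G" "f \<in> carrier G" "f \<noteq> \<one>" "B = {t, t \<otimes> f}"
proof -
  obtain t t' where t: "B = {t, t'}" "t \<noteq> t'" using assms(2) by (auto simp: card_2_iff)
  have c: "t \<in> carrier G" "t' \<in> carrier G" using t assms by auto
  have e: "t \<otimes> (t' \<otimes> inv t) = t'" using c mult_inv_cancel(1) by simp
  have "t' \<otimes> inv t \<noteq> \<one>"
  proof
    assume "t' \<otimes> inv t = \<one>"
    then show False using e t c by simp
  qed
  then show ?thesis using that[of t "t' \<otimes> inv t"] c t e by simp
qed

lemma pair_overlap:
  assumes "A \<subseteq> carrier G" "finite A" "t \<in> carrier G" "f \<in> carrier G"
  shows "card (A <#> {t, t \<otimes> f}) + card (A \<inter> (A #> f)) = 2 * card A"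
proof -
  have "{t, t \<otimes> f} = {\<one>, f} #> t" using assms by (auto simp: r_coset_image m_comm)
  then have "A <#> {t, t \<otimes> f} = (A <#> {\<one>, f}) #> t" using set_mult_r_coset[of A "{\<one>, f}" t] assms by simp
  moreover have "A <#> {\<one>, f} \<subseteq> carrier G" using assms set_mult_closed[of A "{\<one>, f}"] by simp
  ultimately show ?thesis using card_mult_pair[OF assms(1,2,4)] card_r_coset assms(3) by simp
qed

lemma coset_quotient:
  assumes P: "subgroup P G" and c: "x \<in> carrier G" "y \<in> carrier G" and e: "P #> x = P #> y"
  shows "x \<otimes> inv y \<in> P"
proof -
  have "x \<in> P #> x" using P c by (simp add: rcos_self)
  then show ?thesis using e mem_r_coset_iff[of P y x] P c subgroup.subset by auto
qed

lemma three_cosets: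
  assumes P: "subgroup P G" "finite P" and A: "A \<subseteq> carrier G" "finite A" and x: "x \<in> A" "y \<in> A" "z \<in> A"
    and n: "x \<otimes> inv y \<notin> P" "y \<otimes> inv z \<notin> P" "x \<otimes> inv z \<notin> P"
  shows "3 * card P \<le> card (P <#> A)"
proof -
  have Pc: "P \<subseteq> carrier G" using P subgroup.subset by blast
  have c: "x \<in> carrier G" "y \<in> carrier G" "z \<in> carrier G" using A x by auto
  have d: "(P #> x) \<inter> (P #> y) = {}" "(P #> y) \<inter> (P #> z) = {}" "(P #> x) \<inter> (P #> z) = {}"
    using coset_disjoint[OF P(1) c(1,2)] coset_quotient[OF P(1) c(1,2)] n(1)
      coset_disjoint[OF P(1) c(2,3)] coset_quotient[OF P(1) c(2,3)] n(2)
      coset_disjoint[OF P(1) c(1,3)] coset_quotient[OF P(1) c(1,3)] n(3) by argo+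
  have sub: "(P #> x) \<union> ((P #> y) \<union> (P #> z)) \<subseteq> P <#> A" using r_coset_subset_set_mult x by blast
  have f: "finite (P #> x)" "finite (P #> y)" "finite (P #> z)" using finite_r_coset P by auto
  have "card ((P #> y) \<union> (P #> z)) = 2 * card P" using card_Un_disjoint[OF f(2,3) d(2)] card_r_coset[OF Pc] c by simp
  moreover have "card ((P #> x) \<union> ((P #> y) \<union> (P #> z))) = card (P #> x) + card ((P #> y) \<union> (P #> z))"
    by (rule card_Un_disjoint) (use f d in auto)
  ultimately have "card ((P #> x) \<union> ((P #> y) \<union> (P #> z))) = 3 * card P" using card_r_coset[OF Pc c(1)] by simp
  then show ?thesis using card_mono[OF finite_set_mult[OF P(2) A(2)] sub] by simp
qed

end

section \<open>T has a one-point fibre\<close>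

context hyper
begin

lemma T_not_shift_closed:
  assumes w: "w \<in> carrier G" "w \<noteq> \<one>" and Tw: "\<And>t. t \<in> T \<Longrightarrow> t \<otimes> w \<in> T"
  shows False
proof -
  obtain x where x: "x \<in> ST" "x \<otimes> w \<notin> ST" using aperD[OF w] by auto
  then obtain a b where ab: "a \<in> S" "b \<in> T" "x = a \<otimes> b" by (auto simp: set_mult_iff)
  have "x \<otimes> w = a \<otimes> (b \<otimes> w)" using ab w(1) S(1) T(1) by (simp add: m_assoc subset_iff)
  then show False using set_multI[OF ab(1) Tw[OF ab(2)]] x by simp
qed

lemma coset_quotient_H:
  assumes C: "C \<in> carrier Q" "t \<in> C" "t \<otimes> f \<in> C" and f: "f \<in> carrier G"
  shows "f \<in> H"
proof -
  have t: "t \<in> carrier G" "\<phi> t = C" using C car_mem by auto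
  have "t \<otimes> f \<in> H #> t" using t(2) C(3) by (simp add: \<phi>_def)
  then obtain k where k: "k \<in> H" "t \<otimes> f = k \<otimes> t" by (auto simp: r_coset_iff)
  have kc: "k \<in> carrier G" using k Hc by auto
  have "t \<otimes> f = t \<otimes> k" using k(2) m_comm[OF kc t(1)] by simp
  then show ?thesis using cancel_left[OF t(1) f kc] k(1) by simp
qed

end

context hyper_two
begin

text \<open>If all fibres of T have two elements, \<open>fibre_eq\<close> writes every fibre of S +
  T as (S \<inter> s1) + (T \<inter> D), which inherits the periods of each summand.\<close>

lemma T_fibres_aperiodic:
  assumes two: "\<And>a. a \<in> carrier Q \<Longrightarrow> 2 \<le> \<tau> a" and g: "g \<in> carrier G" "g \<noteq> \<one>"
    and st: "\<And>a. a \<in> carrier Q \<Longrightarrow> g \<in> stab G (S \<inter> s1) \<or> g \<in> stab G (T \<inter> a)"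
  shows False
proof (rule periodicD[OF g])
  fix C assume C: "C \<in> carrier Q"
  obtain D where D: "D \<in> carrier Q" "s1 <#> D = C" by (rule divQ[OF C s01c(2)])
  have e: "ST \<inter> C = (S \<inter> s1) <#> (T \<inter> D)" using fibre_eq(2)[OF D(1) two[OF D(1)]] D(2) by simp
  from st[OF D(1)] show "g \<in> stab G (ST \<inter> C)"
  proof
    assume "g \<in> stab G (S \<inter> s1)"
    then show ?thesis unfolding e using stab_set_mult[OF fib_sub(1) fib_sub(2)] by (rule rev_subsetD)
  next
    assume "g \<in> stab G (T \<inter> D)"
    then show ?thesis unfolding e set_mult_comm[OF fib_sub(1) fib_sub(2)]
      using stab_set_mult[OF fib_sub(2) fib_sub(1)] by (rule rev_subsetD)
  qed
qed

text \<open>The sumset of a triple S \<inter> s0 or S \<inter> s1 with a pair T \<inter> a has four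
  elements, so the triple meets its translate by the difference of the pair in two points. As 4 does
  not divide 6, a difference of order two is shared by all pairs and becomes a period. Otherwise the
  triples are progressions with a common difference, which is also that of the pairs, and comparing
  four-term progressions in one coset shows that T + w lies in T.\<close>

lemma no_six:
  assumes h6: "h = 6" and t2: "\<And>a. a \<in> carrier Q \<Longrightarrow> \<tau> a = 2" and s3: "\<sigma> s0 = 3" "\<sigma> s1 = 3"
  shows False
proof -
  have two: "2 \<le> \<tau> a" if "a \<in> carrier Q" for a using t2[OF that] by simp
  have n4: "\<not> 4 dvd h" using h6 by simp
  have c4: "card ((S \<inter> s0) <#> (T \<inter> a)) = 4" "card ((S \<inter> s1) <#> (T \<inter> a)) = 4" if a: "a \<in> carrier Q" for a
  proof -
    have "\<eta> (s0 <#> a) = 4" "\<eta> (s1 <#> a) = 4"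
      using eta_tau_compl[OF a] t2[OF dQ[OF a]] t2[OF dQ[OF dQ[OF a]]] h6 by linarith+
    then show "card ((S \<inter> s0) <#> (T \<inter> a)) = 4" "card ((S \<inter> s1) <#> (T \<inter> a)) = 4"
      using fibre_eq[OF a two[OF a]] eta_eq[OF Qmult[OF s01c(1) a]] eta_eq[OF Qmult[OF s01c(2) a]] by simp_all
  qed
  let ?A0 = "S \<inter> s0" and ?A1 = "S \<inter> s1"
  have A3: "card ?A0 = 3" "card ?A1 = 3" using s3 by (simp_all add: \<sigma>_def)
  define good where "good a t f \<longleftrightarrow> t \<in> carrier G \<and> f \<in> carrier G \<and> f \<noteq> \<one> \<and> f \<in> H \<and> T \<inter> a = {t, t \<otimes> f} \<and>
      card (?A0 \<inter> (?A0 #> f)) = 2 \<and> card (?A1 \<inter> (?A1 #> f)) = 2" for a t f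
  have gd: "\<exists>t f. good a t f" if a: "a \<in> carrier Q" for a
  proof -
    have "card (T \<inter> a) = 2" using t2[OF a] by (simp add: \<tau>_def)
    then obtain t f where tf: "t \<in> carrier G" "f \<in> carrier G" "f \<noteq> \<one>" "T \<inter> a = {t, t \<otimes> f}"
      by (rule pairE[OF fib_sub(2)])
    have "t \<in> a" "t \<otimes> f \<in> a" using tf(4) by auto
    then have "f \<in> H" by (rule coset_quotient_H[OF a _ _ tf(2)])
    moreover have "card (?A0 \<inter> (?A0 #> f)) = 2" "card (?A1 \<inter> (?A1 #> f)) = 2"
      using pair_overlap[OF fib_sub(1) fib_sub(4) tf(1,2), of s0] pair_overlap[OF fib_sub(1) fib_sub(4) tf(1,2), of s1]
        c4[OF a] A3 unfolding tf(4) by linarith+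
    ultimately show ?thesis using tf unfolding good_def by blast
  qed
  have cop: "\<exists>z\<in>?A1. z \<otimes> f \<in> ?A1" if "card (?A1 \<inter> (?A1 #> f)) = 2" for f
  proof -
    have "?A1 \<inter> (?A1 #> f) \<noteq> {}" using that by auto
    then show ?thesis by (auto simp: r_coset_iff)
  qed
  have Hmem: "\<And>x. x \<in> H \<Longrightarrow> x \<in> carrier G" using Hc by auto
  show False
  proof (cases "\<exists>a\<in>carrier Q. \<exists>t e. good a t e \<and> e \<otimes> e = \<one>")
    case True
    then obtain a t e where a: "a \<in> carrier Q" and ge: "good a t e" and e2: "e \<otimes> e = \<one>" by auto
    have e: "e \<in> carrier G" "e \<noteq> \<one>" "e \<in> H" and eA: "card (?A1 \<inter> (?A1 #> e)) = 2" using ge by (auto simp: good_def)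
    have "e \<in> stab G (T \<inter> b)" if b: "b \<in> carrier Q" for b
    proof -
      obtain t' d where gg: "good b t' d" using gd[OF b] by auto
      have d: "t' \<in> carrier G" "d \<in> carrier G" "d \<noteq> \<one>" "d \<in> H" "T \<inter> b = {t', t' \<otimes> d}" "card (?A1 \<inter> (?A1 #> d)) = 2"
        using gg by (auto simp: good_def)
      \<comment> \<open>If d also has order two, d and e span a subgroup of order 4. Otherwise the
        triple is a progression with difference d that has e as a difference; as e is its own
        inverse and differs from d, e = 2d and d has order 4. Both are impossible in order
        6.\<close>
      have "d = e"
      proof (rule ccontr)
        assume ne: "d \<noteq> e"
        have d2: "d \<otimes> d \<noteq> \<one>"
        proof
          assume "d \<otimes> d = \<one>"
          then show False using two_involutions[OF H(1,2) d(4) e(3) d(3) _ e(2) e2 ne] n4 by simp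
        qed
        have d2': "d [^] (2::nat) \<noteq> \<one>" using d2 d(2) by (simp add: numeral_2_eq_2)
        obtain x where x: "x \<in> carrier G" "?A1 = ap x d 3"
          by (rule three_set_cases[OF fib_sub(1) A3(2) d(2,3,6)]) (use d2' in auto)
        obtain z where z: "z \<in> ?A1" "z \<otimes> e \<in> ?A1" using cop[OF eA] by auto
        obtain k :: nat where k: "k < 3" "e = d [^] k \<or> d [^] k \<otimes> e = \<one>"
          by (rule ap_quotient[OF x(1) d(2) e(1) z[unfolded x(2)]])
        have dk: "d [^] k \<in> carrier G" using d(2) by simp
        have "d [^] k = e"
        proof (cases "e = d [^] k")
          case False
          then have "(d [^] k \<otimes> e) \<otimes> e = \<one> \<otimes> e" using k(2) by simp
          then show ?thesis using m_assoc[OF dk e(1,1)] e2 dk e(1) by simp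
        qed simp
        moreover have "k = 0 \<or> k = 1 \<or> k = 2" using k(1) by linarith
        ultimately have ee: "e = d [^] (2::nat)" using e(2) ne d(2) by auto
        have "d [^] (2 + 2::nat) = e \<otimes> e" unfolding ee using nat_pow_mult[OF d(2), of 2 2] by simp
        then have "d [^] (4::nat) = \<one>" using e2 by simp
        then show False using order_four[OF H(1,2) d(4) d2'] n4 by simp
      qed
      then have Tb: "T \<inter> b = {t', t' \<otimes> e}" using d(5) by simp
      have "(t' \<otimes> e) \<otimes> e = t'" using e2 m_assoc[OF d(1) e(1,1)] d(1) by simp
      then have "(T \<inter> b) #> e \<subseteq> T \<inter> b" unfolding Tb r_coset_image by simp
      then show ?thesis by (rule in_stabI[OF fib_sub(2,5) e(1)])
    qed
    then show False using T_fibres_aperiodic[OF two e(1,2)] by blast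
  next
    case False
    have sq: "e [^] (2::nat) \<noteq> \<one>" if "b \<in> carrier Q" "good b t e" for b t e
    proof -
      have "e \<otimes> e \<noteq> \<one>" "e \<in> carrier G" using False that by (auto simp: good_def)
      then show ?thesis by (simp add: numeral_2_eq_2)
    qed
    obtain t0 d where gg: "good s0 t0 d" using gd[OF s01c(1)] by auto
    have d: "d \<in> carrier G" "d \<noteq> \<one>" "d \<in> H" "card (?A0 \<inter> (?A0 #> d)) = 2" "card (?A1 \<inter> (?A1 #> d)) = 2"
      using gg by (auto simp: good_def)
    have d2: "d [^] (2::nat) \<noteq> \<one>" by (rule sq[OF s01c(1) gg])
    have d4: "d [^] (4::nat) \<noteq> \<one>" using order_four[OF H(1,2) d(3) d2] n4 by auto
    obtain x where x: "x \<in> carrier G" "?A1 = ap x d 3"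
      by (rule three_set_cases[OF fib_sub(1) A3(2) d(1,2,5)]) (use d2 in auto)
    obtain y where y: "y \<in> carrier G" "?A0 = ap y d 3"
      by (rule three_set_cases[OF fib_sub(1) A3(1) d(1,2,4)]) (use d2 in auto)
    have d3: "d [^] (3::nat) \<noteq> \<one>"
    proof
      assume e3: "d [^] (3::nat) = \<one>"
      have "?A1 #> d \<subseteq> ?A1"
      proof
        fix z assume "z \<in> ?A1 #> d"
        then obtain i :: nat where i: "i < 3" "z = (x \<otimes> d [^] i) \<otimes> d" unfolding x(2) by (auto simp: r_coset_iff)
        then have z: "z = x \<otimes> d [^] (Suc i)" using ap_shift[OF x(1) d(1)] by simp
        show "z \<in> ?A1"
        proof (cases "i = 2")
          case True
          then have "z = x \<otimes> d [^] (3::nat)" using z by (simp only: True) (simp add: numeral_3_eq_3 numeral_2_eq_2)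
          then have "z = x \<otimes> d [^] (0::nat)" using e3 by simp
          then show ?thesis unfolding x(2) by (rule image_eqI) simp
        next
          case False
          then show ?thesis unfolding x(2) using z i by (intro image_eqI[of _ _ "Suc i"]) auto
        qed
      qed
      moreover have "card (?A1 #> d) = 3" using card_r_coset[OF fib_sub(1) d(1)] A3 by simp
      ultimately have "?A1 #> d = ?A1" using A3 card_subset_eq[OF fib_sub(4)] by simp
      then show False using d(5) A3 by simp
    qed
    have o: "d [^] k \<noteq> \<one>" if k: "0 < k" "k \<le> 4" for k :: nat
    proof -
      have "k = 1 \<or> k = 2 \<or> k = 3 \<or> k = 4" using k by linarith
      then show ?thesis using d(1,2) d2 d3 d4 by auto
    qed
    have ex: "\<exists>t\<in>carrier G. T \<inter> b = {t, t \<otimes> d}" if b: "b \<in> carrier Q" for b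
    proof -
      obtain t f where gf: "good b t f" using gd[OF b] by auto
      have f: "t \<in> carrier G" "f \<in> carrier G" "f \<noteq> \<one>" "T \<inter> b = {t, t \<otimes> f}" "card (?A1 \<inter> (?A1 #> f)) = 2"
        using gf by (auto simp: good_def)
      obtain z where z: "z \<in> ?A1" "z \<otimes> f \<in> ?A1" using cop[OF f(5)] by auto
      obtain k :: nat where k: "k < 3" "f = d [^] k \<or> d [^] k \<otimes> f = \<one>"
        by (rule ap_quotient[OF x(1) d(1) f(2) z[unfolded x(2)]])
      have le1: "card (?A1 \<inter> (?A1 #> f)) \<le> 1" if "?A1 \<inter> (?A1 #> f) \<subseteq> {q}" for q
        using card_mono[OF _ that] by simp
      \<comment> \<open>With difference 2d a three-term progression would meet its translate in one
        point only.\<close>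
      have n2: "f \<noteq> d [^] (2::nat)"
      proof
        assume f2: "f = d [^] (2::nat)"
        have "?A1 \<inter> (?A1 #> f) \<subseteq> {x \<otimes> d [^] (2::nat)}"
        proof
          fix q assume "q \<in> ?A1 \<inter> (?A1 #> f)"
          then obtain i j :: nat where ij: "i < 3" "j < 3" "q = x \<otimes> d [^] i" "q = (x \<otimes> d [^] j) \<otimes> f"
            unfolding x(2) by (auto simp: r_coset_iff)
          have "x \<otimes> d [^] i = x \<otimes> d [^] (j + 2)" using ij(3,4) f2 ap_mult[OF x(1) d(1), of j 2] by simp
          then have "i = j + 2" by (intro ap_inj[OF x(1) d(1) o, where n = 4]) (use ij in auto)
          then have "i = 2" using ij by linarith
          then show "q \<in> {x \<otimes> d [^] (2::nat)}" using ij(3) by simp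
        qed
        then show False using le1 f(5) by fastforce
      qed
      have n2': "d [^] (2::nat) \<otimes> f \<noteq> \<one>"
      proof
        assume f2: "d [^] (2::nat) \<otimes> f = \<one>"
        have "?A1 \<inter> (?A1 #> f) \<subseteq> {x}"
        proof
          fix q assume "q \<in> ?A1 \<inter> (?A1 #> f)"
          then obtain i j :: nat where ij: "i < 3" "j < 3" "q = x \<otimes> d [^] i" "q = (x \<otimes> d [^] j) \<otimes> f"
            unfolding x(2) by (auto simp: r_coset_iff)
          have "x \<otimes> d [^] (i + 2) = ((x \<otimes> d [^] j) \<otimes> f) \<otimes> d [^] (2::nat)"
            using ij(3,4) ap_mult[OF x(1) d(1), of i 2] by simp
          also have "\<dots> = (x \<otimes> d [^] j) \<otimes> (f \<otimes> d [^] (2::nat))" using x(1) d(1) f(2) by (intro m_assoc) auto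
          also have "f \<otimes> d [^] (2::nat) = \<one>" using f2 m_comm[of f "d [^] (2::nat)"] f(2) d(1) by simp
          finally have "x \<otimes> d [^] (i + 2) = x \<otimes> d [^] j" using x(1) d(1) by simp
          then have "i + 2 = j" by (intro ap_inj[OF x(1) d(1) o, where n = 4]) (use ij in auto)
          then have "i = 0" using ij by linarith
          then show "q \<in> {x}" using ij(3) x(1) by simp
        qed
        then show False using le1 f(5) by fastforce
      qed
      have "k = 0 \<or> k = 1 \<or> k = 2" using k(1) by linarith
      then have "f = d \<or> d \<otimes> f = \<one>" using k(2) n2 n2' f(2,3) d(1) by auto
      then show ?thesis
      proof
        assume "f = d"
        then show ?thesis using f by auto
      next
        assume df: "d \<otimes> f = \<one>"
        have "(t \<otimes> f) \<otimes> d = t \<otimes> (d \<otimes> f)" using f(1,2) d(1) by (simp add: m_ac)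
        then have "(t \<otimes> f) \<otimes> d = t" using df f(1) by simp
        then have "T \<inter> b = {t \<otimes> f, (t \<otimes> f) \<otimes> d}" using f(4) by auto
        moreover have "t \<otimes> f \<in> carrier G" using f(1,2) by simp
        ultimately show ?thesis by blast
      qed
    qed
    \<comment> \<open>The shift from the triple over \<open>s0\<close> to the one over
      \<open>s1\<close>; it will take the pair in each coset to the pair in the next.\<close>
    define w where "w = x \<otimes> inv y"
    have wc: "w \<in> carrier G" using x(1) y(1) by (simp add: w_def)
    have xA: "x \<in> ?A1" unfolding x(2) by (rule image_eqI[of _ _ 0]) (use x(1) in auto)
    have yA: "y \<in> ?A0" unfolding y(2) by (rule image_eqI[of _ _ 0]) (use y(1) in auto)
    have w1: "w \<noteq> \<one>"
    proof
      assume "w = \<one>"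
      then have "w \<otimes> y = y" using y(1) by simp
      then have "x = y" using mult_inv_cancel(2)[OF y(1) x(1)] by (simp add: w_def)
      then show False using xA yA car_mem[OF s01c(1), of x] car_mem[OF s01c(2), of x] SS(2) by auto
    qed
    have Tw: "t \<otimes> w \<in> T" if t: "t \<in> T" for t
    proof -
      have tc: "t \<in> carrier G" using t T(1) by auto
      define b where "b = \<phi> t"
      have b: "b \<in> carrier Q" "t \<in> T \<inter> b" using phi_car[OF tc] phi_self[OF tc] t by (auto simp: b_def)
      obtain u where u: "u \<in> carrier G" "T \<inter> b = {u, u \<otimes> d}" using ex[OF b(1)] by auto
      obtain u' where u': "u' \<in> carrier G" "T \<inter> (b <#> V.d) = {u', u' \<otimes> d}" using ex[OF dQ[OF b(1)]] by auto
      have "?A0 <#> (T \<inter> (b <#> V.d)) = ?A1 <#> (T \<inter> b)"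
        using fibre_eq(1)[OF dQ[OF b(1)] two[OF dQ[OF b(1)]]] fibre_eq(2)[OF b(1) two[OF b(1)]] shiftQ[OF b(1)] by simp
      then have e: "ap (y \<otimes> u') d 4 = ap (x \<otimes> u) d 4"
        unfolding x(2) y(2) u(2) u'(2) using ap_pair[OF y(1) d(1) u'(1), of 3] ap_pair[OF x(1) d(1) u(1), of 3] by simp
      have "y \<otimes> u' = x \<otimes> u"
        by (rule ap_start[OF _ _ d(1) o _ e]) (use x(1) y(1) u(1) u'(1) in auto)
      moreover have "y \<otimes> (u \<otimes> w) = x \<otimes> u"
      proof -
        have "y \<otimes> (u \<otimes> w) = (y \<otimes> w) \<otimes> u" using y(1) u(1) wc by (simp add: m_ac)
        then show ?thesis using mult_inv_cancel(1)[OF y(1) x(1)] by (simp add: w_def)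
      qed
      ultimately have uu: "u' = u \<otimes> w" using cancel_left[OF y(1) u'(1), of "u \<otimes> w"] u(1) wc by simp
      have "t = u \<or> t = u \<otimes> d" using b(2) u(2) by auto
      then show "t \<otimes> w \<in> T"
      proof
        assume "t = u" then show ?thesis using uu u'(2) by auto
      next
        assume "t = u \<otimes> d"
        then have "t \<otimes> w = u' \<otimes> d" using uu u(1) d(1) wc by (simp add: m_ac)
        then show ?thesis using u'(2) by auto
      qed
    qed
    show False by (rule T_not_shift_closed[OF wc w1 Tw])
  qed
qed

text \<open>Let A = S \<inter> s1. Mann's theorem in H gives a subgroup P with |P + A| - |P| \<le>
  |X + A| - |X| for every fibre X of T, and complementation evaluates the right side as the size of
  another fibre of T. Summing the three bounds gives 3|P + A| \<le> h + 3|P|. With |P + A| = pm and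
  h = pq, and since |A| \<ge> h / 2, this leaves q = 2m \<le> 6 or q = 3, m = 2.\<close>

lemma exists_singleton_fibre: "\<exists>a\<in>carrier Q. \<tau> a = 1"
proof (rule ccontr)
  assume neg: "\<not> ?thesis"
  have two: "2 \<le> \<tau> a" if "a \<in> carrier Q" for a using neg tau_pos[OF that] that by (cases "\<tau> a = 1") auto
  let ?A = "S \<inter> s1"
  obtain x where x: "x \<in> ?A" using S_fib[OF s01(2)] by auto
  have xc: "x \<in> carrier G" using x S(1) by auto
  define B where "B = ?A #> inv x"
  have cB: "card B = \<sigma> s1" using card_r_coset[OF fib_sub(1)] xc by (simp add: B_def \<sigma>_def)
  have D: "\<sigma> s0 + \<sigma> s1 = h" using V.D_eq D_eq_h by simp
  have s1h: "\<sigma> s1 < h" using tau_le(2)[OF s01c(1)] tau_pos[OF s01c(1)] by linarith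
  have Aquot: "y \<otimes> inv x \<in> H" if y: "y \<in> ?A" for y
  proof -
    have yc: "y \<in> carrier G" using y S(1) by auto
    show ?thesis using coset_quotient_H[OF s01c(2), of x "y \<otimes> inv x"] mult_inv_cancel(1)[OF xc yc] x y xc yc by simp
  qed
  have BH: "B \<subseteq> H" using Aquot by (auto simp: B_def r_coset_iff)
  have fB: "finite B" using finite_r_coset fib_sub(4) by (simp add: B_def)
  have B0: "B \<noteq> {}" using x unfolding B_def r_coset_image by blast
  have BnH: "B \<noteq> H" using cB s1h by auto
  obtain P where P: "subgroup P G" "P \<subseteq> H" "finite P" "P <#> B \<noteq> H"
    and mn: "\<And>X. X \<subseteq> H \<Longrightarrow> finite X \<Longrightarrow> X \<noteq> {} \<Longrightarrow> X <#> B \<noteq> H \<Longrightarrow>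
        card (P <#> B) - card P \<le> card (X <#> B) - card X"
    by (rule mann[OF H(1) BH fB B0 BnH]) blast
  have Pc: "P \<subseteq> carrier G" by (rule subgroup.subset[OF P(1)])
  have P1: "\<one> \<in> P" by (rule subgroup.one_closed[OF P(1)])
  define p where "p = card P"
  define M where "M = card (P <#> ?A)"
  have p0: "0 < p" using P1 P(3) by (auto simp: p_def card_gt_0_iff)
  have cXB: "card (X <#> B) = card (X <#> ?A)" if "X \<subseteq> carrier G" for X
    unfolding B_def using set_mult_r_coset[OF that fib_sub(1), of "inv x"] card_r_coset[OF set_mult_closed[OF that fib_sub(1)]] xc by simp
  have MB: "card (P <#> B) = M" using cXB[OF Pc] by (simp add: M_def)
  have cT: "card (?A <#> (T \<inter> a)) = \<eta> (s1 <#> a)" if a: "a \<in> carrier Q" for a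
    using fibre_eq(2)[OF a two[OF a]] eta_eq[OF Qmult[OF s01c(2) a]] by simp
  have bound': "M \<le> \<tau> (a <#> V.d <#> V.d) + p" if a: "a \<in> carrier Q" for a
  proof -
    define b where "b = a <#> V.d"
    have b: "b \<in> carrier Q" using dQ[OF a] by (simp add: b_def)
    obtain t where t: "t \<in> T \<inter> b" using T_fib[OF aT[OF b]] by auto
    have tc: "t \<in> carrier G" using t T(1) by auto
    define X where "X = (T \<inter> b) #> inv t"
    have XH: "X \<subseteq> H"
    proof
      fix z assume "z \<in> X"
      then obtain y where y: "y \<in> T \<inter> b" "z = y \<otimes> inv t" by (auto simp: X_def r_coset_iff)
      have yc: "y \<in> carrier G" using y T(1) by auto
      show "z \<in> H" using coset_quotient_H[OF b, of t z] mult_inv_cancel(1)[OF tc yc] y t tc yc by simp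
    qed
    have Xc: "X \<subseteq> carrier G" using XH Hc by blast
    have cX: "card X = \<tau> b" using card_r_coset[OF fib_sub(2)] tc by (simp add: X_def \<tau>_def)
    have "X <#> ?A = ((T \<inter> b) <#> ?A) #> inv t" unfolding X_def by (rule r_coset_set_mult[OF fib_sub(2,1)]) (use tc in simp)
    then have "card (X <#> ?A) = card ((T \<inter> b) <#> ?A)"
      using card_r_coset[OF set_mult_closed[OF fib_sub(2) fib_sub(1)]] tc by simp
    also have "\<dots> = \<eta> (s1 <#> b)" using set_mult_comm[OF fib_sub(2) fib_sub(1)] cT[OF b] by simp
    finally have cXB': "card (X <#> B) = \<eta> (s1 <#> b)" using cXB[OF Xc] by simp
    have eb: "\<eta> (s1 <#> b) + \<tau> a = h" using eta_tau_compl(2)[OF b] three_back[OF a] by (simp add: b_def)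
    have X0: "X \<noteq> {}" using t unfolding X_def r_coset_image by blast
    have nXB: "X <#> B \<noteq> H"
    proof
      assume "X <#> B = H"
      then have "\<eta> (s1 <#> b) = h" using cXB' by simp
      then show False using eb tau_pos[OF a] by linarith
    qed
    then have "M - p \<le> \<eta> (s1 <#> b) - \<tau> b"
      using mn[OF XH finite_subset[OF XH H(2)] X0 nXB] unfolding MB cXB' cX p_def by simp
    then show ?thesis using eb three_tau[OF a] by (simp add: b_def)
  qed
  have bound: "M \<le> \<tau> a + p" if a: "a \<in> carrier Q" for a
    using bound'[OF dQ[OF a]] three_back[OF a] by simp
  have PBH: "P <#> B \<subseteq> H" by (rule set_mult_subgroup[OF H(1) P(2) BH])
  have Mh: "M < h" using psubset_card_mono[OF H(2), of "P <#> B"] PBH P(4) MB by auto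
  have AP: "?A \<subseteq> P <#> ?A"
  proof
    fix y assume y: "y \<in> ?A"
    have "\<one> \<otimes> y \<in> P <#> ?A" by (rule set_multI[OF P1 y])
    then show "y \<in> P <#> ?A" using y S(1) by auto
  qed
  have fPA: "finite (P <#> ?A)" by (rule finite_set_mult[OF P(3) fib_sub(4)])
  have sM: "\<sigma> s1 \<le> M" using card_mono[OF fPA AP] by (simp add: \<sigma>_def M_def)
  have h2M: "h \<le> 2 * M" using sM D SS(3) by linarith
  have "card P dvd card (P <#> ?A)"
  proof (rule card_dvd_of_stable[OF P(1) set_mult_closed[OF Pc fib_sub(1)] fPA])
    fix z assume "z \<in> P <#> ?A"
    then obtain k y where ky: "k \<in> P" "y \<in> ?A" "z = k \<otimes> y" by (auto simp: set_mult_iff)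
    show "P #> z \<subseteq> P <#> ?A"
    proof
      fix q assume "q \<in> P #> z"
      then obtain l where l: "l \<in> P" "q = l \<otimes> z" by (auto simp: r_coset_iff)
      have c: "k \<in> carrier G" "l \<in> carrier G" "y \<in> carrier G" using ky l Pc S(1) by auto
      have "q = (l \<otimes> k) \<otimes> y" using l ky m_assoc[OF c(2,1,3)] by simp
      then show "q \<in> P <#> ?A" using set_multI[OF subgroup.m_closed[OF P(1) l(1) ky(1)] ky(2)] by simp
    qed
  qed
  then obtain m where m: "M = p * m" by (auto simp: M_def p_def)
  obtain q where q: "h = p * q" using card_subgroup_dvd[OF P(1) H(1,2) P(2)] by (auto simp: p_def)
  have "3 * M \<le> h + 3 * p"
    using three_tau[OF s01c(1)] bound[OF s01c(1)] bound[OF dQ[OF s01c(1)]] bound[OF dQ[OF dQ[OF s01c(1)]]] by linarith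
  then have "p * (3 * m) \<le> p * (q + 3)" using m q by (simp add: algebra_simps)
  then have i1: "3 * m \<le> q + 3" using p0 by simp
  have "p * q \<le> p * (2 * m)" using h2M m q by (simp add: algebra_simps)
  then have i2: "q \<le> 2 * m" using p0 by simp
  have i3: "m < q" using Mh m q p0 by simp
  have h6: "6 \<le> h"
    using three_tau[OF s01c(1)] two[OF s01c(1)] two[OF dQ[OF s01c(1)]] two[OF dQ[OF dQ[OF s01c(1)]]] by linarith
  show False
  proof (cases "q = 2 * m")
    \<comment> \<open>Now A = P + A. A nontrivial \<open>P\<close> consists of periods of A; a
      trivial one leaves the case h = 6.\<close>
    case True
    then have hM: "h = 2 * M" using m q by simp
    have s1M: "\<sigma> s1 = M" "\<sigma> s0 = M" using sM hM D SS(3) by linarith+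
    have PA: "?A = P <#> ?A" using card_subset_eq[OF fPA AP] s1M(1) by (simp add: \<sigma>_def M_def)
    show False
    proof (cases "p = 1")
      case True
      then have hq: "M = m" "h = q" using m q by simp_all
      have "m = 3" using i1 \<open>q = 2 * m\<close> h6 hq by linarith
      then have "h = 6" "M = 3" using hM hq by simp_all
      moreover have "\<tau> a = 2" if a: "a \<in> carrier Q" for a
        using three_tau[OF a] two[OF a] two[OF dQ[OF a]] two[OF dQ[OF dQ[OF a]]] \<open>h = 6\<close> by linarith
      ultimately show False using no_six s1M by simp
    next
      case False
      have "\<exists>g\<in>P. g \<noteq> \<one>"
      proof (rule ccontr)
        assume "\<not> ?thesis"
        then have "P = {\<one>}" using P1 by blast
        then show False using False by (simp add: p_def)
      qed
      then obtain g where g: "g \<in> P" "g \<noteq> \<one>" by auto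
      have gc: "g \<in> carrier G" using g Pc by auto
      have "?A #> g \<subseteq> ?A"
      proof
        fix z assume "z \<in> ?A #> g"
        then obtain y where y: "y \<in> ?A" "z = y \<otimes> g" by (auto simp: r_coset_iff)
        then have "z = g \<otimes> y" using m_comm[of y g] gc S(1) by auto
        then have "z \<in> P <#> ?A" using set_multI[OF g(1) y(1)] by simp
        then show "z \<in> ?A" using PA by simp
      qed
      then have "g \<in> stab G ?A" by (rule in_stabI[OF fib_sub(1,4) gc])
      then show False by (intro T_fibres_aperiodic[OF two gc g(2)] disjI1)
    qed
  next
    case False
    then have mq: "q = 3" "m = 2" using i1 i2 i3 by linarith+
    have M2: "M = 2 * p" "h = 3 * p" using m q mq by simp_all
    have p2: "2 \<le> p" using M2 h6 by linarith
    have tp: "\<tau> a = p" if a: "a \<in> carrier Q" for a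
      using three_tau[OF a] bound[OF a] bound[OF dQ[OF a]] bound[OF dQ[OF dQ[OF a]]] M2 by linarith
    have e2p: "\<eta> (s1 <#> a) = 2 * p" if a: "a \<in> carrier Q" for a
      using eta_tau_compl(2)[OF a] tp[OF dQ[OF dQ[OF a]]] M2 by linarith
    show False
    proof (cases "\<forall>a\<in>carrier Q. \<forall>t\<in>T \<inter> a. \<forall>t'\<in>T \<inter> a. t' \<otimes> inv t \<in> P")
      case True
      have "\<exists>g\<in>P. g \<noteq> \<one>"
      proof (rule ccontr)
        assume "\<not> ?thesis"
        then have "P = {\<one>}" using P1 by blast
        then show False using p2 by (simp add: p_def)
      qed
      then obtain g where g: "g \<in> P" "g \<noteq> \<one>" by auto
      have gc: "g \<in> carrier G" using g Pc by auto
      have "g \<in> stab G (T \<inter> a)" if a: "a \<in> carrier Q" for a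
      proof -
        obtain t where t: "t \<in> T \<inter> a" using T_fib[OF aT[OF a]] by auto
        have tc: "t \<in> carrier G" using t T(1) by auto
        have "T \<inter> a \<subseteq> P #> t"
        proof
          fix y assume y: "y \<in> T \<inter> a"
          have yc: "y \<in> carrier G" using y T(1) by auto
          show "y \<in> P #> t" using True a t y mem_r_coset_iff[OF Pc tc yc] by blast
        qed
        moreover have "card (T \<inter> a) = card (P #> t)" using tp[OF a] card_r_coset[OF Pc tc] by (simp add: \<tau>_def p_def)
        ultimately have e: "T \<inter> a = P #> t" using card_subset_eq[OF finite_r_coset[OF P(3)]] by simp
        have "(T \<inter> a) #> g \<subseteq> T \<inter> a"
        proof
          fix z assume "z \<in> (T \<inter> a) #> g"
          then obtain k where k: "k \<in> P" "z = (k \<otimes> t) \<otimes> g" unfolding e by (auto simp: r_coset_iff)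
          have kc: "k \<in> carrier G" using k Pc by auto
          have "z = (k \<otimes> g) \<otimes> t" using k kc tc gc by (simp add: m_ac)
          then show "z \<in> T \<inter> a" unfolding e using subgroup.m_closed[OF P(1) k(1) g(1)] by (auto simp: r_coset_iff)
        qed
        then show ?thesis by (rule in_stabI[OF fib_sub(2,5) gc])
      qed
      then show False by (intro T_fibres_aperiodic[OF two gc g(2)] disjI2)
    next
      case False
      \<comment> \<open>Some fibre of T meets two cosets of \<open>P\<close>. Besides w, also 2w
        lies outside \<open>P\<close>: otherwise \<open>P\<close> and P + w would form a subgroup of
        order 2p in a group of order 3p.\<close>
      then obtain a t t' where a: "a \<in> carrier Q" and t: "t \<in> T \<inter> a" "t' \<in> T \<inter> a" "t' \<otimes> inv t \<notin> P" by blast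
      define w where "w = t' \<otimes> inv t"
      have tc: "t \<in> carrier G" "t' \<in> carrier G" using t T(1) by auto
      have wc: "w \<in> carrier G" using tc by (simp add: w_def)
      have tw: "t \<otimes> w = t'" using mult_inv_cancel(1)[OF tc] by (simp add: w_def)
      have wP: "w \<notin> P" using t(3) by (simp add: w_def)
      have wH: "w \<in> H" using coset_quotient_H[OF a _ _ wc, of t] tw t by simp
      have wwP: "w \<otimes> w \<notin> P"
      proof
        assume ww: "w \<otimes> w \<in> P"
        let ?F = "P \<union> (P #> w)"
        have Pw: "P #> w \<subseteq> H" by (rule r_coset_subgroup[OF H(1) P(2) wH])
        have sF: "subgroup ?F G"
        proof (rule subgroup_of_closed)
          show "?F \<subseteq> carrier G" using Pc Pw Hc by blast
          show "finite ?F" using P(3) finite_r_coset by simp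
          show "\<one> \<in> ?F" using P1 by simp
          fix u v assume "u \<in> ?F" "v \<in> ?F"
          then obtain k l where k: "k \<in> P" "u = k \<or> u = k \<otimes> w" and l: "l \<in> P" "v = l \<or> v = l \<otimes> w"
            by (auto simp: r_coset_iff)
          have c: "k \<in> carrier G" "l \<in> carrier G" using k l Pc by auto
          have kl: "k \<otimes> l \<in> P" "(k \<otimes> l) \<otimes> (w \<otimes> w) \<in> P" using subgroup.m_closed[OF P(1)] k l ww by auto
          have "u \<otimes> v = k \<otimes> l \<or> u \<otimes> v = (k \<otimes> l) \<otimes> w \<or> u \<otimes> v = (k \<otimes> l) \<otimes> (w \<otimes> w)"
            using k(2) l(2) c wc by (auto simp: m_ac)
          then show "u \<otimes> v \<in> ?F" using kl by (auto simp: r_coset_iff)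
        qed
        have "P \<inter> (P #> w) = {}"
        proof (rule ccontr)
          assume "P \<inter> (P #> w) \<noteq> {}"
          then obtain l where kl: "l \<otimes> w \<in> P" "l \<in> P" by (auto simp: r_coset_iff)
          have lc: "l \<in> carrier G" using kl Pc by auto
          have "inv l \<otimes> (l \<otimes> w) = w" using lc wc by (simp add: m_assoc[symmetric])
          then show False using subgroup.m_closed[OF P(1) subgroup.m_inv_closed[OF P(1) kl(2)] kl(1)] wP by simp
        qed
        then have "card ?F = p + p" using card_Un_disjoint[OF P(3) finite_r_coset[OF P(3)]] card_r_coset[OF Pc wc] by (simp add: p_def)
        moreover have "card ?F dvd h" by (rule card_subgroup_dvd[OF sF H(1,2)]) (use P(2) Pw in blast)
        ultimately obtain j where "3 * p = (p + p) * j" unfolding M2(2) by (metis dvdE)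
        then have "p * 3 = p * (2 * j)" by (simp add: algebra_simps)
        then have "3 = 2 * j" using p0 by simp
        then show False by presburger
      qed
      let ?I = "?A \<inter> (?A #> w)"
      have Ic: "?I \<subseteq> carrier G" using fib_sub(1) by blast
      have ov: "card (?A <#> {t, t \<otimes> w}) + card ?I = 2 * \<sigma> s1"
        using pair_overlap[OF fib_sub(1,4) tc(1) wc] by (simp add: \<sigma>_def)
      have "{t, t \<otimes> w} \<subseteq> T \<inter> a" using t tw by simp
      then have "?A <#> {t, t \<otimes> w} \<subseteq> ?A <#> (T \<inter> a)" unfolding set_mult_def by blast
      then have "card (?A <#> {t, t \<otimes> w}) \<le> card (?A <#> (T \<inter> a))"
        by (rule card_mono[OF finite_set_mult[OF fib_sub(4,5)]])
      then have "card (?A <#> {t, t \<otimes> w}) \<le> 2 * p" using cT[OF a] e2p[OF a] by linarith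
      then have b1: "2 * \<sigma> s1 \<le> card ?I + 2 * p" using ov by linarith
      let ?J = "?I #> inv w"
      have cJ: "card ?J = card ?I" using card_r_coset[OF Ic] wc by simp
      have JA: "?J \<subseteq> ?A"
      proof
        fix z assume "z \<in> ?J"
        then obtain y where y: "y \<in> ?A" "z = (y \<otimes> w) \<otimes> inv w" by (auto simp: r_coset_iff)
        have yc: "y \<in> carrier G" using y S(1) by auto
        show "z \<in> ?A" using y mult_inv_cancel(3)[OF wc yc] by simp
      qed
      \<comment> \<open>A common element would give three elements of A in distinct cosets of
        \<open>P\<close>, but |P + A| = 2p.\<close>
      have IJ: "?I \<inter> ?J = {}"
      proof (rule ccontr)
        assume "?I \<inter> ?J \<noteq> {}"
        then obtain z where z: "z \<in> ?I" "z \<in> ?J" by blast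
        from z(2) obtain y where y: "y \<in> ?I" "z = y \<otimes> inv w" unfolding r_coset_iff by blast
        have c: "z \<in> carrier G" "y \<in> carrier G" using z y Ic by auto
        have yz: "y = z \<otimes> w" using y(2) mult_inv_cancel(2)[OF wc c(2)] by simp
        obtain v where v: "v \<in> ?A" "z = v \<otimes> w" using z by (auto simp: r_coset_iff)
        have vc: "v \<in> carrier G" using v S(1) by auto
        have zA: "z \<in> ?A" "y \<in> ?A" using z y by auto
        have n1: "y \<otimes> inv z = w" using yz mult_inv_cancel(3)[OF c(1) wc] m_comm[OF c(1) wc] by simp
        have n2: "z \<otimes> inv v = w" using v(2) mult_inv_cancel(3)[OF vc wc] m_comm[OF vc wc] by simp
        have "y = (w \<otimes> w) \<otimes> v" using yz v(2) vc wc by (simp add: m_ac)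
        then have n3: "y \<otimes> inv v = w \<otimes> w" using mult_inv_cancel(3)[OF vc, of "w \<otimes> w"] wc by simp
        have "3 * card P \<le> card (P <#> ?A)"
          by (rule three_cosets[OF P(1,3) fib_sub(1,4) zA(2,1) v(1)]) (use n1 n2 n3 wP wwP in auto)
        then show False using M2 p0 by (simp add: M_def p_def)
      qed
      have "card (?I \<union> ?J) = card ?I + card ?J"
        by (rule card_Un_disjoint) (use fib_sub(4) IJ finite_r_coset in auto)
      moreover have "card (?I \<union> ?J) \<le> card ?A" by (rule card_mono[OF fib_sub(4)]) (use JA in blast)
      ultimately have "2 * card ?I \<le> \<sigma> s1" using cJ by (simp add: \<sigma>_def)
      \<comment> \<open>2|I| \<le> |A| and 2|A| \<le> |I| + 2p give |A| \<le> 4p / 3, less than h /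
        2 = 3p / 2.\<close>
      then show False using b1 D SS(3) M2 p0 by linarith
    qed
  qed
qed

end

section \<open>The connectivity of a four-term progression\<close>

context comm_group
begin

text \<open>A sumset that is not everything is not closed under adding \<open>w\<close>, so every
  further term of the progression contributes a new element.\<close>

lemma set_mult_ap_growth:
  assumes X: "X \<subseteq> carrier G" "finite X" "X \<noteq> {}" and w: "w \<in> carrier G"
    and gen: "\<And>Z. Z \<subseteq> carrier G \<Longrightarrow> finite Z \<Longrightarrow> Z \<noteq> {} \<Longrightarrow> Z #> w \<subseteq> Z \<Longrightarrow> Z = carrier G"
    and n: "1 \<le> n" and ne: "X <#> ap \<one> w n \<noteq> carrier G"
  shows "card X + n \<le> card (X <#> ap \<one> w n) + 1"
  using n ne
proof (induction n rule: dec_induct)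
  case base
  have "ap \<one> w 1 = {\<one>}" by auto
  then show ?case using X(1) by (simp add: set_mult_singleton)
next
  case (step n)
  let ?Z = "X <#> ap \<one> w n"
  have apc: "ap \<one> w n \<subseteq> carrier G" "{\<one>, w} \<subseteq> carrier G" using w by auto
  have "ap \<one> w (Suc n) = ap \<one> w n <#> {\<one>, w}" using ap_pair[OF one_closed w one_closed step.hyps(1)] w by simp
  then have e: "X <#> ap \<one> w (Suc n) = ?Z <#> {\<one>, w}" using set_mult_assoc[OF X(1) apc] by simp
  have Zc: "?Z \<subseteq> carrier G" by (rule set_mult_closed[OF X(1) apc(1)])
  have fZ: "finite ?Z" by (rule finite_set_mult[OF X(2)]) simp
  have Z1: "?Z <#> {\<one>, w} = ?Z \<union> (?Z #> w)" using r_coset_pair[of ?Z \<one> w] coset_mult_one[OF Zc] by simp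
  have Z1c: "?Z <#> {\<one>, w} \<subseteq> carrier G" by (rule set_mult_closed[OF Zc apc(2)])
  have nZ: "?Z \<noteq> carrier G"
  proof
    assume "?Z = carrier G"
    then have "?Z <#> {\<one>, w} = carrier G" using Z1 Z1c by blast
    then show False using step.prems e by simp
  qed
  have "\<one> \<otimes> w [^] (0::nat) \<in> ap \<one> w n" by (rule imageI) (use step.hyps(1) in simp)
  then have "?Z \<noteq> {}" using X(3) by (auto simp: set_mult_def)
  then have "\<not> ?Z #> w \<subseteq> ?Z" using gen[OF Zc fZ] nZ by blast
  then have "?Z \<subset> ?Z \<union> (?Z #> w)" by blast
  then have "card ?Z < card (?Z \<union> (?Z #> w))" using fZ finite_r_coset by (intro psubset_card_mono) auto
  then show ?case using step.IH[OF nZ] unfolding e Z1 by linarith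
qed

text \<open>As 0 lies in \<open>S\<close>, v = -jw for some j; so \<open>S\<close> lies in the
  cyclic subgroup of \<open>w\<close>, which is therefore the whole group.\<close>

lemma stable_under_step:
  assumes v: "v \<in> carrier G" and w: "w \<in> carrier G" and S: "\<one> \<in> S" "S \<subseteq> range (\<lambda>i::nat. v \<otimes> w [^] i)" "generate G S = carrier G"
    and Z: "Z \<subseteq> carrier G" "finite Z" "Z \<noteq> {}" "Z #> w \<subseteq> Z"
  shows "Z = carrier G"
proof -
  define K where "K = stab G Z"
  have K: "subgroup K G" using subgroup_stab[OF Z(1)] by (simp add: K_def)
  have wK: "w \<in> K" using in_stabI[OF Z(1,2) w Z(4)] by (simp add: K_def)
  have pK: "w [^] i \<in> K" for i :: nat
    by (induction i) (use subgroup.one_closed[OF K] subgroup.m_closed[OF K _ wK] in auto)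
  obtain j :: nat where j: "\<one> = v \<otimes> w [^] j" using S(1,2) by auto
  have "inv (w [^] j) = v" using j v w by (intro inv_equality) auto
  then have vK: "v \<in> K" using subgroup.m_inv_closed[OF K pK] by metis
  have "S \<subseteq> K" using S(2) subgroup.m_closed[OF K vK pK] by auto
  then have "carrier G \<subseteq> K" using generate_subgroup_incl[OF _ K] S(3) by blast
  show ?thesis
  proof
    show "carrier G \<subseteq> Z"
    proof
      fix g assume g: "g \<in> carrier G"
      obtain z where z: "z \<in> Z" using Z by auto
      have zc: "z \<in> carrier G" using z Z by auto
      have "g \<otimes> inv z \<in> stab G Z" using \<open>carrier G \<subseteq> K\<close> g zc by (auto simp: K_def)
      then have "z \<otimes> (g \<otimes> inv z) \<in> Z" by (rule stab_mult_mem[OF z])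
      then show "g \<in> Z" using mult_inv_cancel(1)[OF zc g] by simp
    qed
  qed (rule Z(1))
qed

text \<open>By \<open>set_mult_ap_growth\<close> every separable set has boundary at least 4 - 1.
  The pair {0, w} attains this: its sumset is a progression of at most five terms, leaving at least
  12 - 5 elements outside.\<close>

lemma kappa_of_four_term_progression:
  assumes v: "v \<in> carrier G" and w: "w \<in> carrier G" and r: "r \<in> carrier G"
    and S: "\<one> \<in> S" "S \<subseteq> range (\<lambda>i::nat. v \<otimes> w [^] i)" "generate G S = carrier G"
    and G12: "finite (carrier G)" "card (carrier G) = 12" and one: "\<one> \<in> ap r w 4"
  shows "kappa G 2 (ap r w 4) = 3"
proof -
  let ?T = "ap r w 4"
  note full = stable_under_step[OF v w S]
  have Tc: "?T \<subseteq> carrier G" "ap \<one> w 4 \<subseteq> carrier G" using r w by auto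
  have Tr: "?T = ap \<one> w 4 #> r" using ap_r_coset[OF one_closed w r, of 4] r by simp
  have cT: "card (X <#> ?T) = card (X <#> ap \<one> w 4)" if "X \<subseteq> carrier G" for X
    unfolding Tr set_mult_r_coset[OF that Tc(2) r] by (rule card_r_coset[OF set_mult_closed[OF that Tc(2)] r])
  have sub: "X \<subseteq> X <#> ?T" if X: "X \<subseteq> carrier G" for X
  proof
    fix x assume x: "x \<in> X"
    have "x \<otimes> \<one> \<in> X <#> ?T" by (rule set_multI[OF x one])
    then show "x \<in> X <#> ?T" using x X by auto
  qed
  have bd: "card (bdry G ?T X) + card X = card (X <#> ?T)" if X: "X \<subseteq> carrier G" "finite X" for X
    using card_Diff_subset[OF X(2) sub[OF X(1)]] card_mono[OF finite_set_mult[OF X(2)] sub[OF X(1)]] by (simp add: bdry_def)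
  have lower: "3 \<le> card (bdry G ?T X)" if X: "separable G 2 ?T X" for X
  proof -
    have Xc: "X \<subseteq> carrier G" "finite X" "2 \<le> card X" "exterior G ?T X \<noteq> {}"
      using X by (auto simp: separable_def)
    have XTc: "X <#> ?T \<subseteq> carrier G" by (rule set_mult_closed[OF Xc(1) Tc(1)])
    have ne: "X <#> ap \<one> w 4 \<noteq> carrier G"
    proof
      assume "X <#> ap \<one> w 4 = carrier G"
      then have "X <#> ?T = carrier G" using cT[OF Xc(1)] card_subset_eq[OF G12(1) XTc] by simp
      then show False using Xc(4) by (simp add: exterior_def)
    qed
    have "card X + 4 \<le> card (X <#> ap \<one> w 4) + 1"
      by (rule set_mult_ap_growth[OF Xc(1,2) _ w full _ ne]) (use Xc(3) in auto)
    then show ?thesis using bd[OF Xc(1,2)] cT[OF Xc(1)] by linarith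
  qed
  let ?X = "{\<one>, w}"
  have w1: "w \<noteq> \<one>"
  proof
    assume "w = \<one>"
    then have "{\<one>} #> w \<subseteq> {\<one>}" by (simp add: singleton_r_coset)
    then have "{\<one>} = carrier G" by (intro full) auto
    then have "card (carrier G) = card {\<one>}" by simp
    then show False using G12 by simp
  qed
  have Xc: "?X \<subseteq> carrier G" using w by auto
  have cX: "card ?X = 2" using w1 by auto
  have "?X <#> ?T = ap r w 5" using set_mult_comm[OF Xc Tc(1)] ap_pair[OF r w one_closed, of 4] r w by (simp add: eval_nat_numeral)
  then have c5: "card (?X <#> ?T) \<le> 5" using ap_card[of r w 5] by simp
  have "7 \<le> card (exterior G ?T ?X)"
    unfolding exterior_def using c5 card_Diff_subset[OF finite_subset[OF set_mult_closed[OF Xc Tc(1)] G12(1)] set_mult_closed[OF Xc Tc(1)]] G12 by linarith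
  then have sepX: "separable G 2 ?T ?X" using Xc cX by (simp add: separable_def)
  have b3: "card (bdry G ?T ?X) = 3" using lower[OF sepX] bd[OF Xc] c5 cX by simp
  have "(LEAST m. \<exists>X. separable G 2 ?T X \<and> m = card (bdry G ?T X)) = 3"
  proof (rule Least_equality)
    show "\<exists>X. separable G 2 ?T X \<and> 3 = card (bdry G ?T X)" using sepX b3 by metis
    fix m assume "\<exists>X. separable G 2 ?T X \<and> m = card (bdry G ?T X)"
    then show "3 \<le> m" using lower by blast
  qed
  then show ?thesis unfolding kappa_def using sepX by auto
qed

end

section \<open>The exceptional configuration of order twelve\<close>

context hyper_two
begin

text \<open>The fibres of T have sizes 2, 1, 1, and those of S are {u, u + e} and its translate by w
  = tc - tb. The one-point fibres contribute pairs that must fit into the three-term fibres of S +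
  T, which ties \<open>tb\<close> and \<open>tc\<close> to {t, t + e}. What results is e = 3w or e =
  -3w, so T is a progression with difference w.\<close>

lemma exceptional_sets:
  obtains v r w where "v \<in> carrier G" "r \<in> carrier G" "w \<in> carrier G"
    "S \<subseteq> range (\<lambda>i::nat. v \<otimes> w [^] i)" "T = ap r w 4"
    "card S = 4" "card T = 4" "finite (carrier G)" "card (carrier G) = 12"
proof -
  note goal = that
  obtain a0 where a0: "a0 \<in> carrier Q" "\<tau> a0 = 1" using exists_singleton_fibre by auto
  note sf = singleton_fibre[OF a0]
  have fG: "finite (carrier G)" using n_three finQ card_ge_0_finite[of "carrier Q"] by simp
  have cG: "card (carrier G) = 12" using ordQ[OF fG] n_three sf(1) by simp
  have cS: "card S = 4" using sum_sigma D_eq_h sf(1) by simp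
  obtain p where p: "p \<in> carrier Q" "\<tau> p = 2" "\<tau> (p <#> V.d) = 1" "\<tau> (p <#> V.d <#> V.d) = 1"
  proof -
    assume res: "\<And>p. p \<in> carrier Q \<Longrightarrow> \<tau> p = 2 \<Longrightarrow> \<tau> (p <#> V.d) = 1 \<Longrightarrow> \<tau> (p <#> V.d <#> V.d) = 1 \<Longrightarrow> thesis"
    note q = dQ[OF a0(1)] dQ[OF dQ[OF a0(1)]]
    have b: "1 \<le> \<tau> (a0 <#> V.d)" "1 \<le> \<tau> (a0 <#> V.d <#> V.d)" using tau_pos q by auto
    have "\<tau> (a0 <#> V.d) = 2 \<and> \<tau> (a0 <#> V.d <#> V.d) = 1 \<or> \<tau> (a0 <#> V.d) = 1 \<and> \<tau> (a0 <#> V.d <#> V.d) = 2"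
      using three_tau[OF a0(1)] a0(2) sf(1) b by linarith
    then show thesis
    proof
      assume "\<tau> (a0 <#> V.d) = 2 \<and> \<tau> (a0 <#> V.d <#> V.d) = 1"
      then show thesis using res[OF q(1)] three_back[OF a0(1)] a0(2) by simp
    next
      assume "\<tau> (a0 <#> V.d) = 1 \<and> \<tau> (a0 <#> V.d <#> V.d) = 2"
      then show thesis using res[OF q(2)] three_back[OF a0(1)] a0(2) by simp
    qed
  qed
  define b where "b = p <#> V.d"
  define c where "c = b <#> V.d"
  have bc: "b \<in> carrier Q" "c \<in> carrier Q" using dQ p(1) by (auto simp: b_def c_def)
  have tbc: "\<tau> b = 1" "\<tau> c = 1" using p(3,4) by (simp_all add: b_def c_def)
  have cd: "c <#> V.d = p" using three_back[OF p(1)] by (simp add: b_def c_def)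
  have sh: "s0 <#> b = s1 <#> p" "s0 <#> c = s1 <#> b" "s0 <#> p = s1 <#> c"
    using shiftQ[OF p(1)] shiftQ[OF bc(1)] shiftQ[OF bc(2)] cd by (simp_all add: b_def c_def)
  have e0p: "\<eta> (s0 <#> p) = 3" using eta_tau_compl(1)[OF p(1)] tbc(1) sf(1) by (simp add: b_def)
  have e1b: "\<eta> (s1 <#> b) = 2" using eta_tau_compl(2)[OF bc(1)] cd p(2) sf(1) by (simp add: c_def)
  have p2: "2 \<le> \<tau> p" using p(2) by simp
  have "card (S \<inter> s0) = 2" using sf(2) by (simp add: \<sigma>_def)
  then obtain u e where ue: "u \<in> carrier G" "e \<in> carrier G" "e \<noteq> \<one>" "S \<inter> s0 = {u, u \<otimes> e}"
    by (rule pairE[OF fib_sub(1)])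
  have eH: "e \<in> H" by (rule coset_quotient_H[OF s01c(1) _ _ ue(2), of u]) (use ue(4) in auto)
  have "card (T \<inter> b) = 1" "card (T \<inter> c) = 1" using tbc by (simp_all add: \<tau>_def)
  then obtain tb tc where tb: "T \<inter> b = {tb}" and tc: "T \<inter> c = {tc}" by (auto simp: card_1_singleton_iff)
  have tT: "tb \<in> T \<inter> b" "tc \<in> T \<inter> c" using tb tc by auto
  have tcar: "tb \<in> carrier G" "tc \<in> carrier G" using tT T(1) by auto
  define w where "w = tc \<otimes> inv tb"
  have wc: "w \<in> carrier G" using tcar by (simp add: w_def)
  have tcw: "tc = tb \<otimes> w" using mult_inv_cancel(1)[OF tcar] by (simp add: w_def)
  have A0: "S \<inter> s0 = ap u e 2" using ap_two[OF ue(1,2)] ue(4) by simp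
  have "(S \<inter> s1) #> tb = (S \<inter> s0) #> tc"
    using sum_fibre(1)[OF s01(2) aT[OF bc(1)] tT(1)] sum_fibre(1)[OF s01(1) aT[OF bc(2)] tT(2)] e1b sf sh(2) by simp
  then have "S \<inter> s1 = ((S \<inter> s0) #> tc) #> inv tb" using r_coset_mult_inv(1)[OF fib_sub(1) tcar(1), of s1] by simp
  also have "\<dots> = ap (u \<otimes> w) e 2"
    unfolding A0 using ap_r_coset[OF ue(1,2) tcar(2)] ap_r_coset[of "u \<otimes> tc" e "inv tb"] ue tcar by (simp add: w_def m_assoc)
  finally have A1: "S \<inter> s1 = ap (u \<otimes> w) e 2" .
  have uw: "u \<otimes> w \<in> carrier G" using ue(1) wc by simp
  have A1': "S \<inter> s1 = {u \<otimes> w, u \<otimes> w \<otimes> e}" using ap_two[OF uw ue(2)] A1 by simp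
  have cST: "card ((S \<inter> s0) <#> (T \<inter> p)) = 3"
    using fibre_eq(1)[OF p(1) p2] eta_eq[OF Qmult[OF s01c(1) p(1)]] e0p by simp
  have "card (T \<inter> p) = 2" using p(2) by (simp add: \<tau>_def)
  then obtain t0 f where tf: "t0 \<in> carrier G" "f \<in> carrier G" "f \<noteq> \<one>" "T \<inter> p = {t0, t0 \<otimes> f}"
    by (rule pairE[OF fib_sub(2)])
  have "card ((S \<inter> s0) \<inter> ((S \<inter> s0) #> f)) = 1"
    using pair_overlap[OF fib_sub(1,4) tf(1,2), of s0] cST sf(2) unfolding tf(4) \<sigma>_def by linarith
  then have "(S \<inter> s0) \<inter> ((S \<inter> s0) #> f) \<noteq> {}" by auto
  then obtain z' where z': "z' \<in> S \<inter> s0" "z' \<in> (S \<inter> s0) #> f" by blast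
  from z'(2) obtain z where zf: "z \<in> S \<inter> s0" "z' = z \<otimes> f" unfolding r_coset_iff by blast
  have z: "z \<in> ap u e 2" "z \<otimes> f \<in> ap u e 2" using z'(1) zf unfolding A0 by simp_all
  obtain k :: nat where k: "k < 2" "f = e [^] k \<or> e [^] k \<otimes> f = \<one>"
    by (rule ap_quotient[OF ue(1,2) tf(2) z])
  have "k = 0 \<or> k = 1" using k(1) by linarith
  then have fe: "f = e \<or> e \<otimes> f = \<one>" using k(2) tf(2,3) ue(2) by auto
  obtain t where t: "t \<in> carrier G" "T \<inter> p = {t, t \<otimes> e}"
  proof -
    assume res: "\<And>t. t \<in> carrier G \<Longrightarrow> T \<inter> p = {t, t \<otimes> e} \<Longrightarrow> thesis"
    from fe show thesis
    proof
      assume "f = e" then show thesis using res[OF tf(1)] tf(4) by simp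
    next
      assume ef: "e \<otimes> f = \<one>"
      have "(t0 \<otimes> f) \<otimes> e = t0 \<otimes> (e \<otimes> f)" using tf(1,2) ue(2) by (simp add: m_ac)
      then have "(t0 \<otimes> f) \<otimes> e = t0" using ef tf(1) by simp
      then show thesis using res[of "t0 \<otimes> f"] tf by auto
    qed
  qed
  have ut: "u \<otimes> t \<in> carrier G" "u \<otimes> w \<otimes> t \<in> carrier G" using ue(1) wc t(1) by auto
  have S0T: "(S \<inter> s0) <#> (T \<inter> p) = ap (u \<otimes> t) e 3" unfolding A0 t(2) using ap_pair[OF ue(1,2) t(1), of 2] by simp
  have S1T: "(S \<inter> s1) <#> (T \<inter> p) = ap (u \<otimes> w \<otimes> t) e 3" unfolding A1 t(2) using ap_pair[OF uw ue(2) t(1), of 2] by simp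
  have e2: "e [^] (2::nat) \<noteq> \<one>"
  proof
    assume e2: "e [^] (2::nat) = \<one>"
    have "(u \<otimes> t) \<otimes> e [^] (0::nat) \<in> ap (u \<otimes> t) e 2" by (rule imageI) simp
    then have "ap (u \<otimes> t) e (Suc 2) = ap (u \<otimes> t) e 2" unfolding ap_Suc e2 by auto
    then have "card (ap (u \<otimes> t) e 3) \<le> 2" using ap_card[of "u \<otimes> t" e 2] by simp
    then show False using cST S0T by simp
  qed
  have e3: "e [^] (3::nat) \<noteq> \<one>" using order_three[OF H(1,2) eH ue(3)] sf(1) by auto
  have o: "e [^] k \<noteq> \<one>" if k: "0 < k" "k \<le> 3" for k :: nat
  proof -
    have "k = 1 \<or> k = 2 \<or> k = 3" using k by linarith
    then show ?thesis using ue(2,3) e2 e3 by auto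
  qed
  have f0p: "ST \<inter> (s0 <#> p) = ap (u \<otimes> t) e 3" using fibre_eq(1)[OF p(1) p2] S0T by simp
  have f1p: "ST \<inter> (s1 <#> p) = ap (u \<otimes> w \<otimes> t) e 3" using fibre_eq(2)[OF p(1) p2] S1T by simp
  have cl: "u \<otimes> w \<otimes> tc \<in> carrier G" "u \<otimes> tb \<in> carrier G" using uw ue(1) tcar by auto
  have "(S \<inter> s1) <#> (T \<inter> c) \<subseteq> ap (u \<otimes> t) e 3" using fibre_mult[OF s01c(2) bc(2)] unfolding sh(3)[symmetric] f0p .
  moreover have "(S \<inter> s1) <#> (T \<inter> c) = {u \<otimes> w \<otimes> tc, u \<otimes> w \<otimes> tc \<otimes> e}"
    unfolding tc set_mult_singleton A1' using uw ue(2) tcar by (auto simp: r_coset_image m_ac)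
  ultimately have "u \<otimes> w \<otimes> tc = u \<otimes> t \<or> u \<otimes> w \<otimes> tc = u \<otimes> t \<otimes> e"
    by (intro ap_three_pair[OF cl(1) ut(1) ue(2) o]) auto
  then have "u \<otimes> (w \<otimes> tc) = u \<otimes> t \<or> u \<otimes> (w \<otimes> tc) = u \<otimes> (t \<otimes> e)" using ue(1,2) wc tcar t(1) by (simp add: m_assoc)
  then have wtc: "w \<otimes> tc = t \<or> w \<otimes> tc = t \<otimes> e" using cancel_left[OF ue(1)] wc tcar t(1) ue(2) by simp
  have "(S \<inter> s0) <#> (T \<inter> b) \<subseteq> ap (u \<otimes> w \<otimes> t) e 3" using fibre_mult[OF s01c(1) bc(1)] unfolding sh(1) f1p .
  moreover have "(S \<inter> s0) <#> (T \<inter> b) = {u \<otimes> tb, u \<otimes> tb \<otimes> e}"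
    unfolding tb set_mult_singleton ue(4) using ue(1,2) tcar by (auto simp: r_coset_image m_ac)
  ultimately have "u \<otimes> tb = u \<otimes> w \<otimes> t \<or> u \<otimes> tb = u \<otimes> w \<otimes> t \<otimes> e"
    by (intro ap_three_pair[OF cl(2) ut(2) ue(2) o]) auto
  then have "u \<otimes> tb = u \<otimes> (t \<otimes> w) \<or> u \<otimes> tb = u \<otimes> (t \<otimes> (e \<otimes> w))" using ue(1,2) wc t(1) by (simp add: m_ac)
  then have tbw: "tb = t \<otimes> w \<or> tb = t \<otimes> (e \<otimes> w)" using cancel_left[OF ue(1)] wc tcar t(1) ue(2) by simp
  have S_eq: "S = {u, u \<otimes> e, u \<otimes> w, u \<otimes> w \<otimes> e}"
  proof -
    have "S = (S \<inter> s0) \<union> (S \<inter> s1)"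
    proof
      show "S \<subseteq> (S \<inter> s0) \<union> (S \<inter> s1)"
      proof
        fix x assume x: "x \<in> S"
        then have "\<phi> x \<in> {s0, s1}" using SS by auto
        moreover have "x \<in> \<phi> x" using x S(1) phi_self by auto
        ultimately show "x \<in> (S \<inter> s0) \<union> (S \<inter> s1)" using x by auto
      qed
    qed blast
    then show ?thesis using ue(4) A1' by auto
  qed
  \<comment> \<open>If 3w = 0, then X = {0, w, 2w} has |X + S| \<le> 6, while the 2-fragment
    inequality demands 3 + 8 \<le> |X + S| + 4.\<close>
  have w3: "w [^] (3::nat) \<noteq> \<one>"
  proof
    assume w3: "w [^] (3::nat) = \<one>"
    have us: "u \<in> S \<inter> s0" "u \<otimes> w \<in> S \<inter> s1" using ue(4) A1' by auto
    have w1: "w \<noteq> \<one>"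
    proof
      assume "w = \<one>"
      then have "u \<in> s0" "u \<in> s1" using us ue(1) by auto
      then show False using car_mem[OF s01c(1), of u] car_mem[OF s01c(2), of u] SS(2) by auto
    qed
    have w2: "w [^] (2::nat) \<noteq> \<one>"
    proof
      assume "w [^] (2::nat) = \<one>"
      then have "w [^] (Suc 2) = w" unfolding nat_pow_Suc using wc by simp
      then show False using w3 w1 by simp
    qed
    have ow: "w [^] k \<noteq> \<one>" if k: "0 < k" "k \<le> 2" for k :: nat
    proof -
      have "k = 1 \<or> k = 2" using k by linarith
      then show ?thesis using wc w1 w2 by auto
    qed
    have "inj_on (\<lambda>i::nat. \<one> \<otimes> w [^] i) {..<3}"
      by (rule inj_onI) (rule ap_inj[OF one_closed wc ow, where n = 2], auto)
    then have cX: "card (ap \<one> w 3) = 3" by (simp add: card_image)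
    have Xc: "ap \<one> w 3 \<subseteq> carrier G" using wc by auto
    define Z where "Z = ap u w 3 \<union> ap (u \<otimes> e) w 3"
    have ap0: "x \<in> ap x w 3" "x \<otimes> w \<in> ap x w 3" if "x \<in> carrier G" for x
      using that wc by (auto intro: image_eqI[of _ _ 0] image_eqI[of _ _ 1])
    have uec: "u \<otimes> e \<in> carrier G" using ue by simp
    have uwe: "u \<otimes> w \<otimes> e = u \<otimes> e \<otimes> w" using ue wc by (simp add: m_ac)
    have SZ: "S \<subseteq> Z" unfolding S_eq Z_def uwe using ap0[OF ue(1)] ap0[OF uec] by auto
    have apw: "z \<otimes> w \<in> ap x w 3" if x: "x \<in> carrier G" and z: "z \<in> ap x w 3" for x z
    proof -
      obtain i :: nat where i: "i < 3" "z = x \<otimes> w [^] i" using z by auto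
      have e: "z \<otimes> w = x \<otimes> w [^] (Suc i)" using i(2) ap_shift[OF x wc] by simp
      show ?thesis
      proof (cases "Suc i = 3")
        case True
        then have "z \<otimes> w = x" using e w3 x by simp
        then show ?thesis using ap0[OF x] by simp
      next
        case False
        then show ?thesis using e i(1) by (intro image_eqI[of _ _ "Suc i"]) auto
      qed
    qed
    have Zw: "z \<otimes> w [^] i \<in> Z" if "z \<in> Z" for z and i :: nat
    proof (induction i)
      case 0
      have "z \<in> carrier G" using that ue(1) uec wc by (auto simp: Z_def)
      then show ?case using that by simp
    next
      case (Suc i)
      have "z \<in> carrier G" using that ue(1) uec wc by (auto simp: Z_def)
      then have "z \<otimes> w [^] (Suc i) = (z \<otimes> w [^] i) \<otimes> w" using wc by (simp add: m_assoc)
      then show ?case using Suc apw[OF ue(1)] apw[OF uec] by (auto simp: Z_def)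
    qed
    have XS: "ap \<one> w 3 <#> S \<subseteq> Z"
    proof
      fix y assume "y \<in> ap \<one> w 3 <#> S"
      then obtain x s where xs: "x \<in> ap \<one> w 3" "s \<in> S" "y = x \<otimes> s" by (auto simp: set_mult_iff)
      then obtain i :: nat where i: "x = w [^] i" using wc by auto
      have sc: "s \<in> carrier G" using xs S(1) by auto
      have "y = s \<otimes> w [^] i" using xs(3) i sc wc by (simp add: m_comm)
      then show "y \<in> Z" using Zw SZ xs(2) by auto
    qed
    have fZ: "finite Z" by (simp add: Z_def)
    have "card Z \<le> 6" using card_Un_le[of "ap u w 3" "ap (u \<otimes> e) w 3"] ap_card[of u w 3] ap_card[of "u \<otimes> e" w 3]
      unfolding Z_def by linarith
    then have c6: "card (ap \<one> w 3 <#> S) \<le> 6" using card_mono[OF fZ XS] by linarith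
    have "card (carrier G) - card (ap \<one> w 3 <#> S) \<le> card (carrier G - (ap \<one> w 3 <#> S))"
      by (rule diff_card_le_card_Diff[OF finite_subset[OF XS fZ]])
    then have ext: "infinite (carrier G) \<or> 2 \<le> card (carrier G - (ap \<one> w 3 <#> S))" using c6 cG by linarith
    have "card (ap \<one> w 3) + card (H <#> S) \<le> card (ap \<one> w 3 <#> S) + h"
      by (rule frag[OF Xc _ _ ext]) (use cX in auto)
    moreover have "card (\<phi> ` S) = 2" using SS by simp
    ultimately show False using HS_card cX c6 sf(1) by simp
  qed
  have TU: "T \<subseteq> {t, t \<otimes> e, tb, tc}"
  proof
    fix x assume x: "x \<in> T"
    then have xc: "x \<in> carrier G" using T(1) by auto
    have fx: "\<phi> x \<in> carrier Q" by (rule phi_car[OF xc])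
    have "s0 <#> \<phi> x = s0 <#> p \<or> s0 <#> \<phi> x = s1 <#> p \<or> s0 <#> \<phi> x = s1 <#> (p <#> V.d)"
      using c3(7)[OF p(1), of "s0 <#> \<phi> x"] Qmult[OF s01c(1) fx] by simp
    then have "s0 <#> \<phi> x = s0 <#> p \<or> s0 <#> \<phi> x = s0 <#> b \<or> s0 <#> \<phi> x = s0 <#> c" using sh by (simp add: b_def)
    then have "\<phi> x = p \<or> \<phi> x = b \<or> \<phi> x = c"
      using W.cancel_left[OF s01c(1) fx] p(1) bc by simp
    then have "x \<in> T \<inter> p \<or> x \<in> T \<inter> b \<or> x \<in> T \<inter> c" using phi_self[OF xc] x by auto
    then show "x \<in> {t, t \<otimes> e, tb, tc}" using t(2) tb tc by auto
  qed
  have pw: "w [^] (2::nat) = w \<otimes> w" "w [^] (3::nat) = w \<otimes> (w \<otimes> w)" "w [^] (4::nat) = w \<otimes> (w \<otimes> (w \<otimes> w))"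
    using wc by (simp_all add: eval_nat_numeral m_assoc)
  have ap4: "ap y w 4 = {y, y \<otimes> w, y \<otimes> w [^] (2::nat), y \<otimes> w [^] (3::nat)}" if "y \<in> carrier G" for y
    using that wc by (auto simp: eval_nat_numeral lessThan_Suc)
  have fin: thesis if y: "v \<in> carrier G" "r \<in> carrier G" and S4: "S \<subseteq> range (\<lambda>i::nat. v \<otimes> w [^] i)" and T4: "T \<subseteq> ap r w 4" for v r
  proof -
    have "card T \<le> card (ap r w 4)" by (rule card_mono[OF _ T4]) simp
    then have cT: "card T = 4" "card (ap r w 4) = 4" using ap_card[of r w 4] sizes(3) cS by linarith+
    have "T = ap r w 4" by (rule card_subset_eq[OF _ T4]) (use cT in auto)
    then show thesis using goal[OF y wc S4 _ cS cT(1) fG cG] by simp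
  qed
  have rg: "x \<in> range (\<lambda>i::nat. v \<otimes> w [^] i)" if "x = v \<otimes> w [^] (j::nat)" for x v j using that by auto
  from tbw show thesis
  proof
    assume A: "tb = t \<otimes> w"
    have "w \<otimes> tc = t \<otimes> w [^] (3::nat)" using tcw A t(1) wc pw by (simp add: m_ac)
    then have "t \<otimes> w [^] (3::nat) = t \<otimes> \<one> \<or> t \<otimes> w [^] (3::nat) = t \<otimes> e" using wtc t(1) by simp
    then have ew: "e = w [^] (3::nat)" using w3 cancel_left[OF t(1)] wc ue(2) by auto
    have "tc = t \<otimes> w [^] (2::nat)" using tcw A t(1) wc pw by (simp add: m_assoc)
    then have "T \<subseteq> ap t w 4" using TU A ew ap4[OF t(1)] by auto
    moreover have "S \<subseteq> range (\<lambda>i::nat. u \<otimes> w [^] i)"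
    proof -
      have "u = u \<otimes> w [^] (0::nat)" "u \<otimes> e = u \<otimes> w [^] (3::nat)" "u \<otimes> w = u \<otimes> w [^] (1::nat)"
        using ue(1) wc ew by simp_all
      moreover have "u \<otimes> w \<otimes> e = u \<otimes> w [^] (4::nat)" using ue(1) wc ew pw by (simp add: m_assoc)
      ultimately show ?thesis unfolding S_eq using rg by (metis insert_subset empty_subsetI)
    qed
    ultimately show thesis using fin[OF ue(1) t(1)] by simp
  next
    \<comment> \<open>The mirror image: here e = -3w, so the progressions start from t + e and u +
      e.\<close>
    assume A: "tb = t \<otimes> (e \<otimes> w)"
    define r where "r = t \<otimes> e"
    define v where "v = u \<otimes> e"
    have rv: "r \<in> carrier G" "v \<in> carrier G" using t ue by (simp_all add: r_def v_def)
    have "w \<otimes> tc = t \<otimes> (e \<otimes> w [^] (3::nat))" using tcw A t(1) ue(2) wc pw by (simp add: m_ac)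
    then have "t \<otimes> (e \<otimes> w [^] (3::nat)) = t \<otimes> \<one> \<or> t \<otimes> (e \<otimes> w [^] (3::nat)) = t \<otimes> (e \<otimes> \<one>)" using wtc t(1) ue(2) by simp
    then have "e \<otimes> w [^] (3::nat) = \<one> \<or> e \<otimes> w [^] (3::nat) = e \<otimes> \<one>"
      using cancel_left[OF t(1), of "e \<otimes> w [^] (3::nat)"] wc ue(2) by auto
    then have ew: "e \<otimes> w [^] (3::nat) = \<one>" using w3 cancel_left[OF ue(2), of "w [^] (3::nat)" \<one>] wc by auto
    have tr: "t = r \<otimes> w [^] (3::nat)" using ew t(1) ue(2) wc by (simp add: r_def m_assoc)
    have ur: "u = v \<otimes> w [^] (3::nat)" using ew ue(1,2) wc by (simp add: v_def m_assoc)
    have tb2: "tb = r \<otimes> w" "tc = r \<otimes> w [^] (2::nat)" using A tcw t(1) ue(2) wc pw by (simp_all add: r_def m_assoc)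
    have "T \<subseteq> {r \<otimes> w [^] (3::nat), r, r \<otimes> w, r \<otimes> w [^] (2::nat)}" using TU unfolding tr[symmetric] tb2[symmetric] r_def[symmetric] .
    then have "T \<subseteq> ap r w 4" unfolding ap4[OF rv(1)] by auto
    moreover have "S \<subseteq> range (\<lambda>i::nat. v \<otimes> w [^] i)"
    proof -
      have "u \<otimes> e = v \<otimes> w [^] (0::nat)" "u \<otimes> w \<otimes> e = v \<otimes> w [^] (1::nat)"
        using ue(1,2) wc by (simp_all add: v_def m_ac)
      moreover have "u \<otimes> w = v \<otimes> w [^] (4::nat)"
        using arg_cong[OF ur, of "\<lambda>z. z \<otimes> w"] rv wc ap_shift[OF rv(2) wc, of 3] by (simp add: eval_nat_numeral)
      ultimately show ?thesis unfolding S_eq using rg ur by (metis insert_subset empty_subsetI)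
    qed
    ultimately show thesis using fin[OF rv(2,1)] by simp
  qed
qed

lemma exceptional:
  "\<mu> = 0" "finite (carrier G)" "card (carrier G) = 12" "card S = 4" "card T = 4"
  "g \<in> carrier G \<Longrightarrow> \<one> \<in> T #> g \<Longrightarrow> kappa G 2 (T #> g) = 3"
proof -
  obtain v r w where v: "v \<in> carrier G" "r \<in> carrier G" "w \<in> carrier G"
    and st: "S \<subseteq> range (\<lambda>i::nat. v \<otimes> w [^] i)" "T = ap r w 4"
    and c: "card S = 4" "card T = 4" "finite (carrier G)" "card (carrier G) = 12"
    by (rule exceptional_sets)
  show "\<mu> = 0" by (rule c3(2))
  show "finite (carrier G)" "card (carrier G) = 12" "card S = 4" "card T = 4" by (rule c)+
  assume g: "g \<in> carrier G" "\<one> \<in> T #> g"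
  have "T #> g = ap (r \<otimes> g) w 4" using ap_r_coset[OF v(2,3) g(1)] st(2) by simp
  then show "kappa G 2 (T #> g) = 3"
    using kappa_of_four_term_progression[OF v(1,3) _ S(3) st(1) S(4) c(3,4), of "r \<otimes> g"] v(2) g by simp
qed

end

text \<open>For a nonempty proper d-periodic set R the Cauchy-Davenport bound would read |R| + 2
  \<le> |R| + 1. So the periodic part of \<open>T\<close> is empty and only the progression
  remains.\<close>

lemma (in cauchy_set) progression_of_two:
  assumes S2: "card S = 2" and T: "T \<subseteq> carrier G" "finite T" "T \<noteq> {}" "T \<noteq> carrier G"
    and c: "card (T <#> S) \<le> card T + 1"
  shows "\<exists>d. progression G d S \<and> progression G d T"
proof -
  obtain d where d: "S = {\<one>, d}" "d \<noteq> \<one>" using S2 S(3) by (auto simp: card_2_iff)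
  have dc: "d \<in> carrier G" using d S(1) by auto
  have pS: "progression G d S"
    by (rule progressionI[OF one_closed dc, of 2]) (use ap_two[OF one_closed dc] d dc in auto)
  have stable: False if R: "R \<subseteq> carrier G" "finite R" "R \<noteq> {}" "R \<noteq> carrier G" "R #> d = R" for R
  proof -
    have "R <#> S = R" using r_coset_pair[of R \<one> d] coset_mult_one[OF R(1)] R(5) d(1) by simp
    then show False using cauchy[OF R(1-3)] R(4) S2 by simp
  qed
  have c': "card (T <#> {\<one>, d}) \<le> card T + 1" using c d(1) by simp
  have "progression G d T"
  proof (rule pair_growth_cases[OF T(1,2) dc c'])
    assume "T #> d = T"
    then show ?thesis using stable[OF T] by simp
  next
    fix a assume a: "T - (T #> d) = {a}"
    obtain l R where l: "l \<ge> 1" "T = (\<lambda>i::nat. a \<otimes> d [^] i) ` {..<l} \<union> R" "R \<subseteq> T" "R #> d = R" "a \<notin> R"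
      by (rule progression_structure[OF T(1,2) dc a])
    have ac: "a \<in> carrier G" using a T(1) by auto
    have "R = {}"
    proof (rule ccontr)
      assume "R \<noteq> {}"
      then show False using stable[OF _ finite_subset[OF l(3) T(2)] _ _ l(4)] l(3,5) T(1) ac by blast
    qed
    then show ?thesis using progressionI[OF ac dc l(1)] l(2) by simp
  qed
  then show ?thesis using pS by blast
qed

text \<open>The first alternative cannot be decided by weights and is left to the study of fibres in
  \<open>hyper_two\<close>. \<open>nocw\<close> stands for \<open>constant_weights\<close>, which
  also needs the actual fibres; \<open>t1\<close> ensures that \<open>T\<close> has two elements
  when it has to serve as a separable set.\<close>

lemma (in weighted) progressions_or_covering:
  assumes small: "card Y + 1 \<le> card S + card T" and t1: "card T = 1 \<Longrightarrow> card S = 2"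
    and nocw: "\<And>s0 s1 c. s0 \<in> S \<Longrightarrow> s1 \<in> S \<Longrightarrow> s0 \<noteq> s1 \<Longrightarrow> \<sigma> s0 = c \<Longrightarrow> \<sigma> s1 = c \<Longrightarrow>
      (\<And>y. y \<in> carrier G \<Longrightarrow> \<eta> y = c) \<Longrightarrow> T = carrier G \<Longrightarrow> False"
  shows "T = carrier G \<and> card S = 2 \<or>
    card Y = card S + card T - 1 \<and> (\<exists>d. progression G d S \<and> progression G d T)"
proof -
  have YTS: "T <#> S = Y" by (rule set_mult_comm[OF T(1) S(1)])
  have tY: "card T \<le> card Y" using card_le_set_mult[OF T(1) S(1) T(2) S(2)] S(3) YTS by auto
  have t0: "1 \<le> card T" using T(2,3) by (simp add: Suc_le_eq card_gt_0_iff)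
  have two: ?thesis if u: "card S = 2" and nT: "T \<noteq> carrier G" and y: "card Y = card S + card T - 1"
    using progression_of_two[OF u T nT] YTS y u by simp
  show ?thesis
  proof (cases "Y = carrier G")
    case True
    show ?thesis
    proof (cases "3 \<le> card S")
      case u: True
      show ?thesis by (rule covering[OF True small u]) (use nocw in blast)
    next
      case False
      then have u: "card S = 2" using S(5) by linarith
      show ?thesis
      proof (cases "T = carrier G")
        case nT: False
        then have "card T < card Y" using True psubset_card_mono[of "carrier G" T] Y(2) T(1) by auto
        then have "card Y = card S + card T - 1" using small u by linarith
        then show ?thesis by (rule two[OF u nT])
      qed (use u in simp)
    qed
  next
    case False
    have y: "card Y = card S + card T - 1" using cauchy[OF T] YTS False small by simp
    have nT: "T \<noteq> carrier G"
    proof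
      assume "T = carrier G"
      then have "card (carrier G) \<le> card Y" "finite (carrier G)" using tY T(2) by auto
      then show False using card_seteq[of "carrier G" Y] Y(1) False by simp
    qed
    show ?thesis
    proof (cases "card S = 2")
      case True
      then show ?thesis using two nT y by blast
    next
      case u2: False
      then have u: "3 \<le> card S" using S(5) by linarith
      have t2: "2 \<le> card T" using t1 u2 t0 by (cases "card T = 1") auto
      show ?thesis
      proof (cases "\<exists>z\<in>carrier G. z \<noteq> \<one> \<and> card (S <#> {\<one>, z}) \<le> card S + 1")
        case True
        then obtain z where z: "z \<in> carrier G" "z \<noteq> \<one>" "card (S <#> {\<one>, z}) \<le> card S + 1" by auto
        have p: "progression G z S" by (rule progression_of_pair[OF z])
        have "progression G z T"
          by (rule progression_partner[OF p T]) (use YTS False small in auto)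
        then show ?thesis using p y by blast
      next
        \<comment> \<open>Then \<open>S\<close> meets each nonzero translate in at most |S| - 2
          points. \<open>near_covering\<close> excludes a single missing element; with more missing,
          \<open>T\<close> itself is a set of small excess, and \<open>pair_of_fragment\<close>
          produces the pair assumed not to exist.\<close>
        case noz: False
        have ov: "card (S \<inter> (S #> z)) + 2 \<le> card S" if z: "z \<in> carrier G" "z \<noteq> \<one>" for z
        proof -
          have "card S + 2 \<le> card (S <#> {\<one>, z})" using noz z by force
          then show ?thesis using card_mult_pair[OF S(1,2) z(1)] by linarith
        qed
        show ?thesis
        proof (cases "finite (carrier G) \<and> card Y + 1 = card (carrier G)")
          case True
          have "card Y + 1 = card S + card T" using y t0 by simp
          then show ?thesis using near_covering[OF _ _ _ u ov] True by blast
        next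
          case nn: False
          have "infinite (carrier G) \<or> 2 \<le> card (carrier G - Y)"
          proof (cases "finite (carrier G)")
            case True
            have "card Y < card (carrier G)" using psubset_card_mono[OF True, of Y] Y(1) False by blast
            then show ?thesis using nn True card_Diff_subset[OF Y(2,1)] by linarith
          qed simp
          then have sep: "sep_in G (carrier G) 2 S T" using T t2 YTS by (simp add: sep_in_def)
          obtain d where "d \<in> carrier G" "d \<noteq> \<one>" "card (S <#> {\<one>, d}) \<le> card S + 1"
            by (rule pair_of_fragment[OF sep]) (use YTS small in auto)
          then show ?thesis using noz by blast
        qed
      qed
    qed
  qed
qed

lemma (in hyper) outcome:
  "\<mu> = 0 \<and> finite (carrier G) \<and> card (carrier G) = 12 \<and> card S = 4 \<and> card T = 4 \<and>
     (\<forall>g \<in> carrier G. \<one> \<in> T #> g \<longrightarrow> kappa G 2 (T #> g) = 3) \<or>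
   card (\<phi> ` ST) = card (\<phi> ` S) + card (\<phi> ` T) - 1 \<and>
     (\<exists>d. progression Q d (\<phi> ` S) \<and> progression Q d (\<phi> ` T))"
proof -
  have small: "card W.Y + 1 \<le> card (\<phi> ` S) + card (\<phi> ` T)" using not_large by linarith
  \<comment> \<open>A single coset for T gives |S| \<le> |T| \<le> h, so by \<open>holesG\<close>
    the image of S has at most two elements.\<close>
  have t1: "card (\<phi> ` S) = 2" if one: "card (\<phi> ` T) = 1"
  proof -
    obtain a where a: "\<phi> ` T = {a}" using one by (auto simp: card_1_singleton_iff)
    have "card T \<le> h" using sum_tau W.tau[of a] a by simp
    then have "card (\<phi> ` S) * h \<le> 2 * h" using holesG sizes(3) by linarith
    then show ?thesis using u2 H(3) by simp
  qed
  have "\<phi> ` T = carrier Q \<and> card (\<phi> ` S) = 2 \<or>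
      card W.Y = card (\<phi> ` S) + card (\<phi> ` T) - 1 \<and> (\<exists>d. progression Q d (\<phi> ` S) \<and> progression Q d (\<phi> ` T))"
    by (rule W.progressions_or_covering[OF small t1 constant_weights])
  then show ?thesis
  proof
    assume A: "\<phi> ` T = carrier Q \<and> card (\<phi> ` S) = 2"
    then obtain a b where ab: "\<phi> ` S = {a, b}" "a \<noteq> b" by (auto simp: card_2_iff)
    have "\<exists>s0 s1. \<phi> ` S = {s0, s1} \<and> s0 \<noteq> s1 \<and> \<sigma> s0 \<le> \<sigma> s1"
    proof (cases "\<sigma> a \<le> \<sigma> b")
      case True
      then show ?thesis using ab by blast
    next
      case False
      then have "\<phi> ` S = {b, a} \<and> b \<noteq> a \<and> \<sigma> b \<le> \<sigma> a" using ab by auto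
      then show ?thesis by blast
    qed
    then obtain s0 s1 where s: "\<phi> ` S = {s0, s1}" "s0 \<noteq> s1" "\<sigma> s0 \<le> \<sigma> s1" by blast
    interpret X: hyper_two G S T H \<mu> s0 s1
      by unfold_locales (use s A in auto)
    show ?thesis using X.exceptional by blast
  next
    assume "card W.Y = card (\<phi> ` S) + card (\<phi> ` T) - 1 \<and> (\<exists>d. progression Q d (\<phi> ` S) \<and> progression Q d (\<phi> ` T))"
    then show ?thesis unfolding phi_ST by blast
  qed
qed

section \<open>From the definition of a hyper-atom to sumset inequalities\<close>

lemma kappa_le: "separable G k S X \<Longrightarrow> kappa G k S \<le> card (bdry G S X)"
  unfolding kappa_def by (auto intro!: Least_le)

lemma (in comm_group) card_bdry:
  assumes "S \<subseteq> carrier G" "finite S" "\<one> \<in> S" "X \<subseteq> carrier G" "finite X"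
  shows "card (bdry G S X) + card X = card (X <#> S)"
proof -
  have sub: "X \<subseteq> X <#> S"
  proof
    fix x assume x: "x \<in> X"
    have "x \<otimes> \<one> \<in> X <#> S" by (rule set_multI[OF x assms(3)])
    then show "x \<in> X <#> S" using x assms(4) by auto
  qed
  show ?thesis
    using card_Diff_subset[OF assms(5) sub] card_mono[OF finite_set_mult[OF assms(5,2)] sub] by (simp add: bdry_def)
qed

lemma (in comm_group) hyper_of_hyper_atom:
  assumes S: "finite S" "S \<subseteq> carrier G" "\<one> \<in> S" "generate G S = carrier G"
    and HA: "hyper_atom G S H"
    and T: "finite T" "T \<subseteq> carrier G" "T \<noteq> {}"
    and mu: "\<mu> \<le> 1" and sizes: "3 \<le> card S + \<mu>" "4 \<le> card T + 2 * \<mu>" "card S \<le> card T"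
    and aper: "\<not> periodic G (S <#> T)" and tot: "card (S <#> T) + \<mu> = card S + card T"
    and ub: "finite (carrier G) \<Longrightarrow> 3 * card (S <#> T) \<le> 2 * card (carrier G) + 2 * \<mu>"
  shows "hyper G S T H \<mu>"
proof -
  have H: "subgroup H G" "separable G 2 S H" "card (bdry G S H) = kappa G 2 S"
    and mx: "\<And>K. subgroup K G \<Longrightarrow> fragment G 2 S K \<Longrightarrow> H \<subseteq> K \<Longrightarrow> K = H"
    using HA by (auto simp: hyper_atom_def fragment_def)
  have Hs: "H \<subseteq> carrier G" "finite H" "2 \<le> card H" "exterior G S H \<noteq> {}"
    using H(2) by (auto simp: separable_def)
  have bd: "card (bdry G S X) + card X = card (X <#> S)" if "X \<subseteq> carrier G" "finite X" for X
    by (rule card_bdry[OF S(2,1,3) that])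
  have sep: "separable G 2 S X"
    if X: "X \<subseteq> carrier G" "finite X" "2 \<le> card X" "infinite (carrier G) \<or> 2 \<le> card (carrier G - (X <#> S))" for X
  proof -
    have "infinite (carrier G) \<Longrightarrow> infinite (carrier G - (X <#> S))"
      by (rule Diff_infinite_finite[OF finite_set_mult[OF X(2) S(1)]])
    then show ?thesis using X by (auto simp: separable_def exterior_def)
  qed
  show ?thesis
  proof (intro hyper.intro hyper_axioms.intro)
    show "comm_group G" by (rule comm_group_axioms)
    show "S \<subseteq> carrier G" "finite S" "\<one> \<in> S" "generate G S = carrier G" by (rule S)+
    show "T \<subseteq> carrier G" "finite T" "T \<noteq> {}" by (rule T)+
    show "subgroup H G" "finite H" "2 \<le> card H" by (rule H(1), rule Hs, rule Hs)
    show "H <#> S \<noteq> carrier G" using Hs(4) by (auto simp: exterior_def)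
    show "card X + card (H <#> S) \<le> card (X <#> S) + card H"
      if X: "X \<subseteq> carrier G" "finite X" "2 \<le> card X" "infinite (carrier G) \<or> 2 \<le> card (carrier G - (X <#> S))" for X
      using kappa_le[OF sep[OF X]] H(3) bd[OF X(1,2)] bd[OF Hs(1,2)] by linarith
    show "K = H" if K: "subgroup K G" "finite K" "H \<subseteq> K"
      "infinite (carrier G) \<or> 2 \<le> card (carrier G - (K <#> S))" "card (K <#> S) + card H \<le> card K + card (H <#> S)" for K
    proof -
      have Kc: "K \<subseteq> carrier G" by (rule subgroup.subset[OF K(1)])
      have "2 \<le> card K" using card_mono[OF K(2,3)] Hs(3) by linarith
      then have sK: "separable G 2 S K" by (rule sep[OF Kc K(2) _ K(4)])
      have "card (bdry G S K) = kappa G 2 S"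
        using kappa_le[OF sK] H(3) bd[OF Kc K(2)] bd[OF Hs(1,2)] K(5) by linarith
      then show ?thesis using mx[OF K(1) _ K(3)] sK by (simp add: fragment_def)
    qed
    show "\<mu> \<le> 1" "3 \<le> card S + \<mu>" "4 \<le> card T + 2 * \<mu>" "card S \<le> card T" by (rule mu, rule sizes, rule sizes, rule sizes)
    show "\<not> periodic G (S <#> T)" by (rule aper)
    show "card (S <#> T) + \<mu> = card S + card T" by (rule tot)
    show "3 * card (S <#> T) \<le> 2 * card (carrier G) + 2 * \<mu>" if "finite (carrier G)" by (rule ub[OF that])
  qed
qed

theorem theorem14:
  fixes G :: "('a, 'b) monoid_scheme" (structure)
    and S T H :: "'a set" and \<mu> :: nat and \<phi> :: "'a \<Rightarrow> 'a set"
  assumes "\<mu> \<in> {0, 1}"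
    and "comm_group G"
    and "finite S" "S \<subseteq> carrier G" "\<one> \<in> S" "generate G S = carrier G"
    and "degenerate G S"
    and "hyper_atom G S H"
    and \<phi>: "\<phi> = (\<lambda>x. H #> x)"
    and "finite T" "T \<subseteq> carrier G"
    and "3 - \<mu> \<le> card S" "card S \<le> max (4 - 2 * \<mu>) (card S)" "max (4 - 2 * \<mu>) (card S) \<le> card T"
    and "\<not> periodic G (S <#> T)"
    and "card (S <#> T) = card S + card T - \<mu>"
    and "finite (carrier G) \<longrightarrow> real (card (S <#> T)) \<le> (2 * real (order G) + 2 * real \<mu>) / 3"
  shows "(\<mu> = 0 \<and> finite (carrier G) \<and> order G = 3 * card S \<and> 3 * card S = 3 * card T \<and>
            (\<forall>g \<in> carrier G. \<one> \<in> T #> g \<longrightarrow>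
               3 * card T = 4 * kappa G 2 (T #> g) \<and> 4 * kappa G 2 (T #> g) = 12)) \<or>
         (card (\<phi> ` (S <#> T)) = card (\<phi> ` S) + card (\<phi> ` T) - 1 \<and>
            (\<exists>d. progression (G Mod H) d (\<phi> ` S) \<and> progression (G Mod H) d (\<phi> ` T)))"
proof -
  interpret comm_group G by (rule assms(2))
  have mu: "\<mu> \<le> 1" using assms(1) by auto
  have sz: "3 \<le> card S + \<mu>" "4 \<le> card T + 2 * \<mu>" "card S \<le> card T" using assms(12,14) by linarith+
  have T0: "T \<noteq> {}" using sz mu by auto
  \<comment> \<open>Since |S| + |T| \<ge> \<mu>, the truncated subtraction in the hypothesis is
    exact.\<close>
  have tot: "card (S <#> T) + \<mu> = card S + card T" using assms(16) sz mu by linarith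
  have ub: "3 * card (S <#> T) \<le> 2 * card (carrier G) + 2 * \<mu>" if "finite (carrier G)"
  proof -
    have "real (3 * card (S <#> T)) \<le> real (2 * card (carrier G) + 2 * \<mu>)"
      using assms(17) that by (simp add: order_def)
    then show ?thesis by (simp only: of_nat_le_iff)
  qed
  interpret Y: hyper G S T H \<mu>
    by (rule hyper_of_hyper_atom[OF assms(3-6,8,10,11) T0 mu sz assms(15) tot ub])
  have "Y.\<phi> = \<phi>" unfolding \<phi> by (rule ext) (simp add: Y.\<phi>_def)
  then show ?thesis using Y.outcome by (auto simp: order_def)
qed

end
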